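(* Let $\rho>0$, let $A=(A_1,\ldots,A_n)$ and $B=(B_1,\ldots,B_n)$ in $B(\mathcal H)^n$ be in the class $\mathcal C_\rho$, and let $c>0$. The following statements are equivalent: (i) $A\overset{H}{\underset{c}\prec}B$; (ii) $P_\rho(rA,R)\le c^2P_\rho(rB,R)$ for any $r\in[0,1)$; (iii) $u(rA_1,\ldots,rA_n)+(\rho-1)u(0)\le c^2\left[u(rB_1,\ldots,rB_n)+(\rho-1)u(0)\right]$ for any positive free pluriharmonic function $u$ with operator-valued coefficients and any $r\in[0,1)$; (iv) $K_{\rho,A}\le c^2K_{\rho,B}$, where $K_{\rho,X}$ is the multi-Toeplitz kernel associated with $X\in\mathcal C_\rho$; (v) $c^2\varphi_B-\varphi_A$ is a completely positive linear map on the operator space $\overline{\mathcal A_n^*+\mathcal A_n}^{\|\cdot\|}$, where $\varphi_A,\varphi_B$ are the completely positive maps associated with $A$ and $B$; (vi) there is an operator $L_{B,A}\in B(\mathcal K_B,\mathcal K_A)$ with $\|L_{B,A}\|\le c$ such that $L_{B,A}|_{\mathcal H}=I_{\mathcal H}$ and $L_{B,A}W_i=V_iL_{B,A}$ for $i=1,\ldots,n$, where $(V_1,\ldots,V_n)$ on $\mathcal K_A\supset\mathcal H$ and $(W_1,\ldots,W_n)$ on $\mathcal K_B\supset\mathcal H$ are the minimal isometric dilations of $A$ and $B$, respectively.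
   Context: Let $n\ge1$, $\mathcal H$ a complex Hilbert space, $\mathcal K$ a separable infinite-dimensional Hilbert space, and $\mathcal E$ separable Hilbert spaces. $\mathbb F_n^+$ is the unital free semigroup on generators $g_1,\ldots,g_n$ with identity $g_0$; $|\alpha|$ is the length and $\tilde\alpha$ the reverse word of $\alpha$. $T_\alpha:=T_{i_1}\cdots T_{i_k}$ if $\alpha=g_{i_1}\cdots g_{i_k}$, $T_{g_0}:=I$. Write $\omega>_l\gamma$ if $\omega=\gamma\sigma$ for some $\sigma\ne g_0$, and then $\omega\backslash_l\gamma:=\sigma$. Class $\mathcal C_\rho$: $T\in B(\mathcal H)^n$ is in $\mathcal C_\rho$ if there are a Hilbert space $\mathcal G\supseteq\mathcal H$ and isometries $V_i\in B(\mathcal G)$ with orthogonal ranges such that $T_\alpha=\rho P_{\mathcal H}V_\alpha|_{\mathcal H}$ for all $\alpha\neq g_0$. If $\mathcal G=\mathcal K_T:=\bigvee_{\alpha}V_\alpha\mathcal H$, $(V_1,\ldots,V_n)$ is the minimal isometric dilation of $T$ (unique up to isomorphism). $F^2(H_n)=\mathbb C1\oplus\bigoplus_{k\ge1}H_n^{\otimes k}$ is the full Fock space over an $n$-dimensional Hilbert space with orthonormal basis $e_1,\ldots,e_n$; $S_i\varphi=e_i\otimes\varphi$ and $R_i\varphi=\varphi\otimes e_i$ are the left and right creation operators, $R=(R_1,\ldots,R_n)$; $\mathcal A_n$ is the norm closed algebra generated by $S_1,\ldots,S_n,I$. For $X\in\mathcal C_\rho$ and $r\in[0,1)$, $$P_\rho(rX,R):=\sum_{k=1}^\infty\sum_{|\alpha|=k}r^kX_\alpha\otimes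 R_{\tilde\alpha}^*+\rho I\otimes I+\sum_{k=1}^\infty\sum_{|\alpha|=k}r^kX_\alpha^*\otimes R_{\tilde\alpha}$$ (norm convergent in $k$). The multi-Toeplitz kernel $K_{\rho,X}:\mathbb F_n^+\times\mathbb F_n^+\to B(\mathcal H)$ is: $K_{\rho,X}(\alpha,\beta)=\frac1\rho X_{\beta\backslash_l\alpha}$ if $\beta>_l\alpha$; $=I$ if $\alpha=\beta$; $=\frac1\rho(X_{\alpha\backslash_l\beta})^*$ if $\alpha>_l\beta$; $=0$ otherwise. $K_{\rho,A}\le c^2K_{\rho,B}$ means that $K=c^2K_{\rho,B}-K_{\rho,A}$ is positive semidefinite: $\sum_{i,j}\langle K(\sigma_i,\sigma_j)h_j,h_i\rangle\ge0$ for all finite families $h_i\in\mathcal H$, $\sigma_i\in\mathbb F_n^+$. For $T\in\mathcal C_\rho$, $\varphi_T:\overline{\mathcal A_n^*+\mathcal A_n}^{\|\cdot\|}\to B(\mathcal H)$ is the completely positive map $\varphi_T(g):=\frac1\rho g(T)+(1-\frac1\rho)g(0)$, where $g(T)$ is the functional calculus; it is the continuous linear extension of $q(S)^*+p(S)\mapsto\frac1\rho(q(T)^*+p(T))+(1-\frac1\rho)(\overline{q(0)}+p(0))I$ for noncommutative polynomials $p,q$. $[B(\mathcal K)^n]_1:=\{X\in B(\mathcal K)^n:\|\sum_iX_iX_i^*\|<1\}$. A free holomorphic function with coefficients in $B(\mathcal E)$ is $F(X)=\sum_k\sum_{|\alpha|=k}X_\alpha\otimes A_{(\alpha)}$ with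 $A_{(\alpha)}\in B(\mathcal E)$ and $\limsup_k\|\sum_{|\alpha|=k}A_{(\alpha)}^*A_{(\alpha)}\|^{1/2k}\le1$. A positive free pluriharmonic function is $u=\Re F=\frac12(F^*+F)$, $F$ free holomorphic, with $u(X)\ge0$ for all $X\in[B(\mathcal K)^n]_1$. For $T\in\mathcal C_\rho$ and $r\in[0,1)$, $u(rT)$ is given by the corresponding norm-convergent series; $u(0)$ is the constant term $I\otimes A$. Harnack domination: for $A,B\in\mathcal C_\rho$, $A\overset{H}{\underset{c}\prec}B$ means $$\Re p(A)+(\rho-1)\Re p(0)\le c^2[\Re p(B)+(\rho-1)\Re p(0)]$$ for every noncommutative polynomial $p\in\mathbb C[X_1,\ldots,X_n]\otimes M_m$, $m\in\mathbb N$, with $\Re p(X)=\frac12(p(X)^*+p(X))\ge0$ for all $X\in[B(\mathcal K)^n]_1$. Here $p(A)=\sum A_\alpha\otimes M_\alpha$ for $p=\sum X_\alpha\otimes M_\alpha$. *)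

theory Defs
  imports "HOL-Analysis.Analysis" "HOL-Library.Sublist"
begin

section \<open>Complex Hilbert spaces\<close>

text \<open>The sesquilinear form is linear in its first argument.  The real inner product of
  \<^class>\<open>real_inner\<close> is its real part, so norm, topology and completeness are those of the library.\<close>

class chilbert_space = real_inner + banach +
  fixes scaleC :: "complex \<Rightarrow> 'a \<Rightarrow> 'a" (infixr \<open>*\<^sub>C\<close> 75)
    and cinner :: "'a \<Rightarrow> 'a \<Rightarrow> complex"
  assumes scaleC_add_right: "c *\<^sub>C (x + y) = c *\<^sub>C x + c *\<^sub>C y"
    and scaleC_add_left: "(c + d) *\<^sub>C x = c *\<^sub>C x + d *\<^sub>C x"
    and scaleC_scaleC: "c *\<^sub>C (d *\<^sub>C x) = (c * d) *\<^sub>C x"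
    and scaleR_scaleC: "r *\<^sub>R x = complex_of_real r *\<^sub>C x"
    and cinner_commute: "cinner x y = cnj (cinner y x)"
    and cinner_add_left: "cinner (x + y) z = cinner x z + cinner y z"
    and cinner_scaleC_left: "cinner (c *\<^sub>C x) y = c * cinner x y"
    and inner_eq_Re_cinner: "inner x y = Re (cinner x y)"

instantiation complex :: chilbert_space
begin
definition scaleC_complex :: "complex \<Rightarrow> complex \<Rightarrow> complex" where "scaleC_complex c x = c * x"
definition cinner_complex :: "complex \<Rightarrow> complex \<Rightarrow> complex" where "cinner_complex x y = x * cnj y"
instance
  by standard
    (auto simp: scaleC_complex_def cinner_complex_def algebra_simps inner_complex_def scaleR_conv_of_real)
end

lemma cinner_self: "cinner x x = complex_of_real ((norm (x :: 'a :: chilbert_space))\<^sup>2)"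
proof -
  have "Im (cinner x x) = 0"
    using cinner_commute[of x x] by (metis Reals_cnj_iff complex_is_Real_iff)
  moreover have "Re (cinner x x) = (norm x)\<^sup>2"
    by (metis dot_square_norm inner_eq_Re_cinner)
  ultimately show ?thesis by (simp add: complex_eq_iff)
qed

lemma norm_scaleC: "norm (c *\<^sub>C (x :: 'a :: chilbert_space)) = cmod c * norm x"
proof -
  have "complex_of_real ((norm (c *\<^sub>C x))\<^sup>2) = c * cnj (c * cinner x x)"
    by (metis cinner_commute cinner_scaleC_left cinner_self)
  also have "\<dots> = complex_of_real ((cmod c * norm x)\<^sup>2)"
    by (simp add: cinner_self power_mult_distrib complex_norm_square[symmetric] mult.assoc[symmetric]
        flip: of_real_power)
  finally show ?thesis
    by (metis (mono_tags) of_real_eq_iff power2_eq_imp_eq norm_ge_zero zero_le_mult_iff)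
qed

lemma norm_cinner_le: "cmod (cinner x y) \<le> norm x * norm (y :: 'a :: chilbert_space)"
proof (cases "cinner x y = 0")
  case False
  define c where "c = cnj (cinner x y) / cmod (cinner x y)"
  have [simp]: "cmod c = 1" using False by (simp add: c_def norm_divide)
  have "cmod (cinner x y) = Re (c * cinner x y)"
    using False
    by (simp add: c_def complex_norm_square[symmetric] mult.commute power2_eq_square
        flip: of_real_power of_real_divide of_real_mult)
  also have "\<dots> = inner (c *\<^sub>C x) y" by (simp add: inner_eq_Re_cinner cinner_scaleC_left)
  also have "\<dots> \<le> norm (c *\<^sub>C x) * norm y" by (rule norm_cauchy_schwarz)
  finally show ?thesis by (simp add: norm_scaleC)
qed simp

section \<open>Square summable families and Hilbert space tensor products\<close>

lemma norm_square_add_le: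
  "(norm (x + y :: 'a :: real_inner))\<^sup>2 \<le> 2 * (norm x)\<^sup>2 + 2 * (norm y)\<^sup>2"
proof -
  have "(norm (x + y))\<^sup>2 + (norm (x - y))\<^sup>2 = 2 * (norm x)\<^sup>2 + 2 * (norm y)\<^sup>2"
    by (simp add: power2_norm_eq_inner inner_diff inner_add inner_commute)
  then show ?thesis using zero_le_power2[of "norm (x - y)"] by linarith
qed

typedef (overloaded) ('i, 'h :: chilbert_space) ell2 =
  "{f :: 'i \<Rightarrow> 'h. (\<lambda>i. (norm (f i))\<^sup>2) summable_on UNIV}"
  morphisms ell2_nth Abs_ell2
  by (rule exI[of _ "\<lambda>_. 0"]) simp

setup_lifting type_definition_ell2

lemma ell2_summable: "(\<lambda>i. (norm (ell2_nth f i))\<^sup>2) summable_on UNIV"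
  using ell2_nth[of f] by simp

lemma ell2_add_summable:
  fixes f g :: "'i \<Rightarrow> 'h :: real_inner"
  assumes "(\<lambda>i. (norm (f i))\<^sup>2) summable_on A" "(\<lambda>i. (norm (g i))\<^sup>2) summable_on A"
  shows "(\<lambda>i. (norm (f i + g i))\<^sup>2) summable_on A"
proof (rule summable_on_comparison_test)
  show "(\<lambda>i. 2 * (norm (f i))\<^sup>2 + 2 * (norm (g i))\<^sup>2) summable_on A"
    by (intro summable_on_add summable_on_cmult_right assms)
qed (auto intro: norm_square_add_le)

lemma ell2_cinner_summable:
  "(\<lambda>i. cinner (ell2_nth f i) (ell2_nth g i)) summable_on UNIV"
proof (rule abs_summable_summable, rule summable_on_comparison_test)
  show "(\<lambda>i. (norm (ell2_nth f i))\<^sup>2 + (norm (ell2_nth g i))\<^sup>2) summable_on UNIV"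
    by (intro summable_on_add ell2_summable)
  fix i
  have "2 * (norm (ell2_nth f i) * norm (ell2_nth g i))
      \<le> (norm (ell2_nth f i))\<^sup>2 + (norm (ell2_nth g i))\<^sup>2"
    using sum_squares_bound[of "norm (ell2_nth f i)" "norm (ell2_nth g i)"] by simp
  then show "norm (cinner (ell2_nth f i) (ell2_nth g i))
      \<le> (norm (ell2_nth f i))\<^sup>2 + (norm (ell2_nth g i))\<^sup>2"
    using norm_cinner_le[of "ell2_nth f i" "ell2_nth g i"]
      mult_nonneg_nonneg[of "norm (ell2_nth f i)" "norm (ell2_nth g i)"]
    by (auto simp del: mult_nonneg_nonneg)
qed auto

instantiation ell2 :: (type, chilbert_space) real_vector
begin
lift_definition zero_ell2 :: "('a, 'b) ell2" is "\<lambda>_. 0" by simp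
lift_definition plus_ell2 :: "('a, 'b) ell2 \<Rightarrow> ('a, 'b) ell2 \<Rightarrow> ('a, 'b) ell2" is "\<lambda>f g i. f i + g i"
  by (rule ell2_add_summable)
lift_definition uminus_ell2 :: "('a, 'b) ell2 \<Rightarrow> ('a, 'b) ell2" is "\<lambda>f i. - f i" by simp
lift_definition minus_ell2 :: "('a, 'b) ell2 \<Rightarrow> ('a, 'b) ell2 \<Rightarrow> ('a, 'b) ell2" is "\<lambda>f g i. f i - g i"
  by (simp add: ell2_add_summable[where g = "\<lambda>i. - _ i", simplified])
lift_definition scaleR_ell2 :: "real \<Rightarrow> ('a, 'b) ell2 \<Rightarrow> ('a, 'b) ell2" is "\<lambda>r f i. r *\<^sub>R f i"
  by (auto simp: power_mult_distrib intro: summable_on_cmult_right)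
instance
  by standard (transfer; auto simp: algebra_simps fun_eq_iff)+
end

instantiation ell2 :: (type, chilbert_space) real_inner
begin
definition inner_ell2 :: "('a, 'b) ell2 \<Rightarrow> ('a, 'b) ell2 \<Rightarrow> real" where
  "inner_ell2 f g = Re (\<Sum>\<^sub>\<infinity>i. cinner (ell2_nth f i) (ell2_nth g i))"
definition norm_ell2 :: "('a, 'b) ell2 \<Rightarrow> real" where "norm_ell2 f = sqrt (inner f f)"
definition sgn_ell2 :: "('a, 'b) ell2 \<Rightarrow> ('a, 'b) ell2" where "sgn_ell2 f = f /\<^sub>R norm f"
definition dist_ell2 :: "('a, 'b) ell2 \<Rightarrow> ('a, 'b) ell2 \<Rightarrow> real" where "dist_ell2 f g = norm (f - g)"
definition uniformity_ell2 :: "(('a, 'b) ell2 \<times> ('a, 'b) ell2) filter" where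
  "uniformity_ell2 = (INF e\<in>{0<..}. principal {(x, y). dist x y < e})"
definition open_ell2 :: "('a, 'b) ell2 set \<Rightarrow> bool" where
  "open_ell2 U \<longleftrightarrow> (\<forall>x\<in>U. eventually (\<lambda>(x', y). x' = x \<longrightarrow> y \<in> U) uniformity)"

lemma inner_ell2_eq: "inner f g = (\<Sum>\<^sub>\<infinity>i. inner (ell2_nth f i) (ell2_nth g i))"
  for f g :: "('a, 'b) ell2"
  unfolding inner_ell2_def inner_eq_Re_cinner by (simp add: infsum_Re ell2_cinner_summable)

lemma ell2_inner_summable: "(\<lambda>i. inner (ell2_nth f i) (ell2_nth g i)) summable_on UNIV"
  for f g :: "('a, 'b) ell2"
  unfolding inner_eq_Re_cinner by (rule summable_on_Re) (rule ell2_cinner_summable)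

instance
proof
  fix x y z :: "('a, 'b) ell2" and r :: real
  show "inner x y = inner y x" by (simp add: inner_ell2_eq inner_commute)
  show "inner (x + y) z = inner x z + inner y z"
    by (simp add: inner_ell2_eq plus_ell2.rep_eq inner_add_left infsum_add ell2_inner_summable)
  show "inner (r *\<^sub>R x) y = r * inner x y"
    by (simp add: inner_ell2_eq scaleR_ell2.rep_eq infsum_cmult_right')
  show "0 \<le> inner x x" by (auto simp: inner_ell2_eq intro: infsum_nonneg)
  show "inner x x = 0 \<longleftrightarrow> x = 0"
  proof
    assume "inner x x = 0"
    then have "inner (ell2_nth x i) (ell2_nth x i) = 0" for i
      unfolding inner_ell2_eq
      by (rule nonneg_infsum_le_0D[OF eq_refl]) (auto intro: ell2_inner_summable)
    then show "x = 0" by (simp add: ell2_nth_inject[symmetric] zero_ell2.rep_eq fun_eq_iff)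
  qed (simp add: inner_ell2_eq zero_ell2.rep_eq)
qed (rule norm_ell2_def sgn_ell2_def dist_ell2_def uniformity_ell2_def open_ell2_def)+
end

lemma norm_ell2_square: "(norm f)\<^sup>2 = (\<Sum>\<^sub>\<infinity>i. (norm (ell2_nth f i))\<^sup>2)"
  by (simp add: power2_norm_eq_inner inner_ell2_eq)

lemma sum_le_norm_ell2_square:
  assumes "finite F"
  shows "(\<Sum>i\<in>F. (norm (ell2_nth f i))\<^sup>2) \<le> (norm f)\<^sup>2"
  unfolding norm_ell2_square by (rule finite_sum_le_infsum) (use assms in \<open>auto intro: ell2_summable\<close>)

lemma norm_ell2_nth_le: "norm (ell2_nth f i) \<le> norm f"
  by (rule power2_le_imp_le) (use sum_le_norm_ell2_square[of "{i}" f] in simp_all)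

instance ell2 :: (type, chilbert_space) banach
proof
  fix X :: "nat \<Rightarrow> ('a, 'b) ell2"
  assume X: "Cauchy X"
  have "Cauchy (\<lambda>n. ell2_nth (X n) i)" for i
  proof (rule CauchyI)
    fix e :: real assume "e > 0"
    then obtain N where N: "\<And>m n. m \<ge> N \<Longrightarrow> n \<ge> N \<Longrightarrow> norm (X m - X n) < e"
      using CauchyD[OF X] by blast
    have "norm (ell2_nth (X m) i - ell2_nth (X n) i) < e" if "m \<ge> N" "n \<ge> N" for m n
      using N[OF that] norm_ell2_nth_le[of "X m - X n" i] by (simp add: minus_ell2.rep_eq)
    then show "\<exists>N. \<forall>m\<ge>N. \<forall>n\<ge>N. norm (ell2_nth (X m) i - ell2_nth (X n) i) < e"
      by blast
  qed
  then have "\<exists>l. (\<lambda>n. ell2_nth (X n) i) \<longlonglongrightarrow> l" for i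
    by (simp add: Cauchy_convergent_iff convergent_def)
  then obtain L where L: "\<And>i. (\<lambda>n. ell2_nth (X n) i) \<longlonglongrightarrow> L i" by metis
  have tail: "\<exists>N. \<forall>m\<ge>N. \<forall>F. finite F \<longrightarrow> (\<Sum>i\<in>F. (norm (ell2_nth (X m) i - L i))\<^sup>2) \<le> e\<^sup>2"
    if e: "e > 0" for e :: real
  proof -
    obtain N where N: "\<And>m n. m \<ge> N \<Longrightarrow> n \<ge> N \<Longrightarrow> norm (X m - X n) < e"
      using CauchyD[OF X e] by blast
    have "(\<Sum>i\<in>F. (norm (ell2_nth (X m) i - L i))\<^sup>2) \<le> e\<^sup>2" if m: "m \<ge> N" and F: "finite F" for m F
    proof (rule tendsto_upperbound)
      show "(\<lambda>n. \<Sum>i\<in>F. (norm (ell2_nth (X m) i - ell2_nth (X n) i))\<^sup>2)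
          \<longlonglongrightarrow> (\<Sum>i\<in>F. (norm (ell2_nth (X m) i - L i))\<^sup>2)"
        by (intro tendsto_intros L)
      show "\<forall>\<^sub>F n in sequentially. (\<Sum>i\<in>F. (norm (ell2_nth (X m) i - ell2_nth (X n) i))\<^sup>2) \<le> e\<^sup>2"
        using eventually_ge_at_top[of N]
      proof eventually_elim
        case (elim n)
        have "(\<Sum>i\<in>F. (norm (ell2_nth (X m - X n) i))\<^sup>2) \<le> (norm (X m - X n))\<^sup>2"
          by (rule sum_le_norm_ell2_square[OF F])
        also have "\<dots> \<le> e\<^sup>2" using N[OF m elim] e by (simp add: power_mono)
        finally show ?case by (simp add: minus_ell2.rep_eq)
      qed
    qed simp
    then show ?thesis by blast
  qed
  have summ: "(\<lambda>i. (norm (ell2_nth (X m) i - L i))\<^sup>2) summable_on UNIV"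
    if "\<forall>F. finite F \<longrightarrow> (\<Sum>i\<in>F. (norm (ell2_nth (X m) i - L i))\<^sup>2) \<le> e\<^sup>2" for m e
    by (rule nonneg_bounded_partial_sums_imp_summable_on[where C = "e\<^sup>2"])
      (use that in \<open>simp_all add: eventually_finite_subsets_at_top_weakI\<close>)
  obtain m where m: "\<forall>F. finite F \<longrightarrow> (\<Sum>i\<in>F. (norm (ell2_nth (X m) i - L i))\<^sup>2) \<le> 1\<^sup>2"
    using tail[of 1] zero_less_one by blast
  have "(\<lambda>i. (norm (ell2_nth (X m) i + - (ell2_nth (X m) i - L i)))\<^sup>2) summable_on UNIV"
    by (intro ell2_add_summable ell2_summable) (use summ[OF m] in \<open>simp add: norm_minus_commute\<close>)
  then have "(\<lambda>i. (norm (L i))\<^sup>2) summable_on UNIV" by simp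
  then obtain l where l: "ell2_nth l = L" using Abs_ell2_inverse[of L] by auto
  have "X \<longlonglongrightarrow> l"
  proof (rule LIMSEQ_I)
    fix r :: real assume r: "r > 0"
    obtain N where N: "\<forall>m\<ge>N. \<forall>F. finite F \<longrightarrow> (\<Sum>i\<in>F. (norm (ell2_nth (X m) i - L i))\<^sup>2) \<le> (r / 2)\<^sup>2"
      using tail[of "r / 2"] r half_gt_zero by blast
    have "norm (X m - l) < r" if "m \<ge> N" for m
    proof -
      have Nm: "\<forall>F. finite F \<longrightarrow> (\<Sum>i\<in>F. (norm (ell2_nth (X m) i - L i))\<^sup>2) \<le> (r / 2)\<^sup>2"
        using N that by blast
      have "(norm (X m - l))\<^sup>2 \<le> (r / 2)\<^sup>2"
        unfolding norm_ell2_square minus_ell2.rep_eq l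
        by (rule infsum_le_finite_sums[OF summ[OF Nm]]) (use Nm in simp)
      then show ?thesis using r power2_le_imp_le[of "norm (X m - l)" "r / 2"] by simp
    qed
    then show "\<exists>N. \<forall>m\<ge>N. norm (X m - l) < r" by blast
  qed
  then show "convergent X" by (auto simp: convergent_def)
qed

instantiation ell2 :: (type, chilbert_space) chilbert_space
begin
lift_definition scaleC_ell2 :: "complex \<Rightarrow> ('a, 'b) ell2 \<Rightarrow> ('a, 'b) ell2" is "\<lambda>c f i. c *\<^sub>C f i"
  by (auto simp: norm_scaleC power_mult_distrib intro: summable_on_cmult_right)
definition cinner_ell2 :: "('a, 'b) ell2 \<Rightarrow> ('a, 'b) ell2 \<Rightarrow> complex" where
  "cinner_ell2 f g = (\<Sum>\<^sub>\<infinity>i. cinner (ell2_nth f i) (ell2_nth g i))"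
instance
proof
  fix x y z :: "('a, 'b) ell2" and c d :: complex and r :: real
  show "c *\<^sub>C (x + y) = c *\<^sub>C x + c *\<^sub>C y" by transfer (simp add: scaleC_add_right)
  show "(c + d) *\<^sub>C x = c *\<^sub>C x + d *\<^sub>C x" by transfer (simp add: scaleC_add_left)
  show "c *\<^sub>C (d *\<^sub>C x) = (c * d) *\<^sub>C x" by transfer (simp add: scaleC_scaleC)
  show "r *\<^sub>R x = complex_of_real r *\<^sub>C x" by transfer (simp add: scaleR_scaleC)
  show "cinner x y = cnj (cinner y x)"
    unfolding cinner_ell2_def by (subst infsum_cnj[symmetric]) (simp flip: cinner_commute)
  show "cinner (x + y) z = cinner x z + cinner y z"
    by (simp add: cinner_ell2_def plus_ell2.rep_eq cinner_add_left infsum_add ell2_cinner_summable)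
  show "cinner (c *\<^sub>C x) y = c * cinner x y"
    by (simp add: cinner_ell2_def scaleC_ell2.rep_eq cinner_scaleC_left infsum_cmult_right')
  show "inner x y = Re (cinner x y)" by (simp add: inner_ell2_def cinner_ell2_def)
qed
end

text \<open>\<^typ>\<open>('i, 'h) ell2\<close> is the Hilbert space tensor product of \<open>'h\<close> with
  \<^typ>\<open>('i, complex) ell2\<close>; the elementary tensor of \<open>x\<close> and \<open>e\<close> is the family \<open>i \<mapsto> e(i) x\<close>.
  Subsets \<open>J\<close> of \<open>'i\<close> give the closed subspaces \<open>'h \<otimes> ell2(J)\<close>.\<close>

lift_definition tensor_vec :: "'h :: chilbert_space \<Rightarrow> ('i, complex) ell2 \<Rightarrow> ('i, 'h) ell2"
  is "\<lambda>x e i. e i *\<^sub>C x"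
  by (auto simp: norm_scaleC power_mult_distrib intro: summable_on_cmult_left)

definition ell2_on :: "'i set \<Rightarrow> ('i, 'h :: chilbert_space) ell2 set" where
  "ell2_on J = {f. \<forall>i. i \<notin> J \<longrightarrow> ell2_nth f i = 0}"

section \<open>Bounded operators\<close>

text \<open>Elements of \<open>B(H)\<close> are the complex linear elements of the library type of bounded real
  linear maps; norm, convergence and composition are those of that type.\<close>

definition cbounded :: "('a :: chilbert_space \<Rightarrow>\<^sub>L 'b :: chilbert_space) \<Rightarrow> bool" where
  "cbounded T \<longleftrightarrow> (\<forall>c x. T (c *\<^sub>C x) = c *\<^sub>C T x)"

text \<open>The adjoint exists, by the Riesz representation theorem, for complex linear \<open>T\<close>.\<close>

definition adj :: "('a :: chilbert_space \<Rightarrow>\<^sub>L 'b :: chilbert_space) \<Rightarrow> ('b \<Rightarrow>\<^sub>L 'a)" where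
  "adj T = (THE S :: 'b \<Rightarrow>\<^sub>L 'a. \<forall>x y. cinner (T x) y = cinner x (S y))"

definition re_op :: "('a :: chilbert_space \<Rightarrow>\<^sub>L 'a) \<Rightarrow> ('a \<Rightarrow>\<^sub>L 'a)" where
  "re_op T = (1 / 2) *\<^sub>R (adj T + T)"

lift_definition scalar_op :: "complex \<Rightarrow> ('a :: chilbert_space \<Rightarrow>\<^sub>L 'a)" is "\<lambda>c x. c *\<^sub>C x"
proof (rule bounded_linear_intro)
  fix c :: complex and x y :: 'a and r :: real
  show "c *\<^sub>C (x + y) = c *\<^sub>C x + c *\<^sub>C y" by (rule scaleC_add_right)
  show "c *\<^sub>C (r *\<^sub>R x) = r *\<^sub>R (c *\<^sub>C x)" by (simp add: scaleR_scaleC scaleC_scaleC mult.commute)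
  show "norm (c *\<^sub>C x) \<le> norm x * cmod c" by (simp add: norm_scaleC)
qed

text \<open>For a closed subspace \<open>M\<close> reduced by \<open>T\<close> this is positivity of the restriction of \<open>T\<close> to \<open>M\<close>.\<close>

definition op_positive_on :: "'a :: chilbert_space set \<Rightarrow> ('a \<Rightarrow>\<^sub>L 'a) \<Rightarrow> bool" where
  "op_positive_on M T \<longleftrightarrow> (\<forall>x\<in>M. cinner (T x) x \<in> \<real>\<^sub>\<ge>\<^sub>0)"

definition op_le_on :: "'a :: chilbert_space set \<Rightarrow> ('a \<Rightarrow>\<^sub>L 'a) \<Rightarrow> ('a \<Rightarrow>\<^sub>L 'a) \<Rightarrow> bool" where
  "op_le_on M S T \<longleftrightarrow> op_positive_on M (T - S)"

text \<open>Elementary tensors span a dense subspace, so \<open>X \<otimes> M\<close> is the only bounded operator with these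
  values; it exists for complex linear \<open>X\<close> and \<open>M\<close>.\<close>

definition tensor_op ::
  "('h :: chilbert_space \<Rightarrow>\<^sub>L 'h) \<Rightarrow> (('i, complex) ell2 \<Rightarrow>\<^sub>L ('i, complex) ell2)
    \<Rightarrow> (('i, 'h) ell2 \<Rightarrow>\<^sub>L ('i, 'h) ell2)" where
  "tensor_op X M =
    (THE T :: ('i, 'h) ell2 \<Rightarrow>\<^sub>L ('i, 'h) ell2. cbounded T \<and> (\<forall>x e. T (tensor_vec x e) = tensor_vec (X x) (M e)))"

text \<open>Words are lists; the free semigroup has \<^term>\<open>[]\<close> as unit and \<^term>\<open>(@)\<close> as product.
  The index type \<open>'n\<close> of the generators is nonempty, so \<open>n \<ge> 1\<close>.\<close>

definition wprod :: "('n \<Rightarrow> ('a :: chilbert_space \<Rightarrow>\<^sub>L 'a)) \<Rightarrow> 'n list \<Rightarrow> ('a \<Rightarrow>\<^sub>L 'a)" where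
  "wprod T \<alpha> = foldr (\<lambda>i X. T i o\<^sub>L X) \<alpha> id_blinfun"

section \<open>Full Fock space\<close>

text \<open>The words, standing for \<open>e\<^sub>\<alpha> = e\<^sub>i\<^sub>1 \<otimes> \<cdots> \<otimes> e\<^sub>i\<^sub>k\<close>, index an orthonormal basis of the full Fock space.\<close>

type_synonym 'n fock = "('n list, complex) ell2"

text \<open>For injective \<open>s\<close> this is the isometry \<open>e\<^sub>\<alpha> \<mapsto> e\<^sub>s\<^sub>(\<^sub>\<alpha>\<^sub>)\<close>.\<close>

lift_definition ell2_push :: "('a \<Rightarrow> 'b) \<Rightarrow> ('a, complex) ell2 \<Rightarrow> ('b, complex) ell2"
  is "\<lambda>s f w. if w \<in> range s then f (inv s w) else 0"
proof -
  fix s :: "'a \<Rightarrow> 'b" and f :: "'a \<Rightarrow> complex"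
  assume "(\<lambda>i. (norm (f i))\<^sup>2) summable_on UNIV"
  then have "(\<lambda>i. (norm (f i))\<^sup>2) summable_on (inv s ` range s)"
    by (rule summable_on_subset_banach) simp
  then have "((\<lambda>i. (norm (f i))\<^sup>2) \<circ> inv s) summable_on range s"
    by (subst summable_on_reindex[symmetric]) (auto intro: inj_on_inv_into)
  then show "(\<lambda>w. (norm (if w \<in> range s then f (inv s w) else 0))\<^sup>2) summable_on UNIV"
    by (rule summable_on_cong_neutral[THEN iffD1, rotated -1]) auto
qed

lemma norm_ell2_push_le: "norm (ell2_push s f) \<le> norm f"
proof (rule power2_le_imp_le)
  have "(norm (ell2_push s f))\<^sup>2 = (\<Sum>\<^sub>\<infinity>w\<in>range s. (norm (ell2_nth f (inv s w)))\<^sup>2)"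
    unfolding norm_ell2_square ell2_push.rep_eq by (rule infsum_cong_neutral) auto
  also have "\<dots> = (\<Sum>\<^sub>\<infinity>i\<in>inv s ` range s. (norm (ell2_nth f i))\<^sup>2)"
    by (subst infsum_reindex) (auto intro: inj_on_inv_into simp: o_def)
  also have "\<dots> \<le> (norm f)\<^sup>2"
    unfolding norm_ell2_square
    by (rule infsum_mono_neutral)
      (auto intro: ell2_summable summable_on_subset_banach[OF ell2_summable])
  finally show "(norm (ell2_push s f))\<^sup>2 \<le> (norm f)\<^sup>2" .
qed simp

lift_definition push_op :: "('a \<Rightarrow> 'b) \<Rightarrow> (('a, complex) ell2 \<Rightarrow>\<^sub>L ('b, complex) ell2)" is ell2_push
proof (rule bounded_linear_intro)
  fix s :: "'a \<Rightarrow> 'b" and x y :: "('a, complex) ell2" and r :: real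
  show "ell2_push s (x + y) = ell2_push s x + ell2_push s y"
    by transfer (simp add: fun_eq_iff)
  show "ell2_push s (r *\<^sub>R x) = r *\<^sub>R ell2_push s x"
    by transfer (simp add: fun_eq_iff)
  show "norm (ell2_push s x) \<le> norm x * 1" by (simp add: norm_ell2_push_le)
qed

definition left_creation :: "'n \<Rightarrow> ('n fock \<Rightarrow>\<^sub>L 'n fock)" where
  "left_creation i = push_op (\<lambda>\<alpha>. i # \<alpha>)"

definition right_creation :: "'n \<Rightarrow> ('n fock \<Rightarrow>\<^sub>L 'n fock)" where
  "right_creation i = push_op (\<lambda>\<alpha>. \<alpha> @ [i])"

section \<open>Isometric dilations and the class \<open>C\<^sub>\<rho>\<close>\<close>

definition csubspace :: "'a :: chilbert_space set \<Rightarrow> bool" where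
  "csubspace M \<longleftrightarrow> 0 \<in> M \<and> (\<forall>x\<in>M. \<forall>y\<in>M. x + y \<in> M) \<and> (\<forall>c. \<forall>x\<in>M. c *\<^sub>C x \<in> M)"

definition closed_cspan :: "'a :: chilbert_space set \<Rightarrow> 'a set" where
  "closed_cspan S = \<Inter>{M. csubspace M \<and> closed M \<and> S \<subseteq> M}"

definition orth_proj :: "'a :: chilbert_space set \<Rightarrow> 'a \<Rightarrow> 'a" where
  "orth_proj M x = (THE y. y \<in> M \<and> (\<forall>z\<in>M. cinner (x - y) z = 0))"

definition clinear_on :: "'a :: chilbert_space set \<Rightarrow> ('a \<Rightarrow> 'b :: chilbert_space) \<Rightarrow> bool" where
  "clinear_on M f \<longleftrightarrow> (\<forall>x\<in>M. \<forall>y\<in>M. f (x + y) = f x + f y) \<and> (\<forall>c. \<forall>x\<in>M. f (c *\<^sub>C x) = c *\<^sub>C f x)"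

definition word_map :: "('n \<Rightarrow> 'g \<Rightarrow> 'g) \<Rightarrow> 'n list \<Rightarrow> 'g \<Rightarrow> 'g" where
  "word_map V \<alpha> = foldr (\<lambda>i f. V i \<circ> f) \<alpha> id"

text \<open>The dilation space is the closed subspace \<open>G\<close> of the Hilbert space \<open>'g\<close>, and the inclusion of
  the Hilbert space \<open>'h\<close> into it is the isometry \<open>J\<close>.  The maps \<open>V i\<close> matter only on \<open>G\<close>.\<close>

definition isometric_dilation ::
  "real \<Rightarrow> ('n \<Rightarrow> ('h :: chilbert_space \<Rightarrow>\<^sub>L 'h)) \<Rightarrow> 'g :: chilbert_space set
    \<Rightarrow> ('h \<Rightarrow> 'g) \<Rightarrow> ('n \<Rightarrow> 'g \<Rightarrow> 'g) \<Rightarrow> bool" where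
  "isometric_dilation \<rho> T G J V \<longleftrightarrow>
    csubspace G \<and> closed G \<and>
    clinear_on UNIV J \<and> (\<forall>h. norm (J h) = norm h) \<and> range J \<subseteq> G \<and>
    (\<forall>i. clinear_on G (V i) \<and> V i ` G \<subseteq> G \<and> (\<forall>x\<in>G. norm (V i x) = norm x)) \<and>
    (\<forall>i j. i \<noteq> j \<longrightarrow> (\<forall>x\<in>G. \<forall>y\<in>G. cinner (V i x) (V j y) = 0)) \<and>
    (\<forall>\<alpha> h. \<alpha> \<noteq> [] \<longrightarrow> J (wprod T \<alpha> h) = \<rho> *\<^sub>R orth_proj (range J) (word_map V \<alpha> (J h)))"

definition minimal_isometric_dilation ::
  "real \<Rightarrow> ('n \<Rightarrow> ('h :: chilbert_space \<Rightarrow>\<^sub>L 'h)) \<Rightarrow> 'g :: chilbert_space set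
    \<Rightarrow> ('h \<Rightarrow> 'g) \<Rightarrow> ('n \<Rightarrow> 'g \<Rightarrow> 'g) \<Rightarrow> bool" where
  "minimal_isometric_dilation \<rho> T G J V \<longleftrightarrow>
    isometric_dilation \<rho> T G J V \<and> G = closed_cspan {word_map V \<alpha> (J h) | \<alpha> h. True}"

text \<open>One cannot quantify over types, so the existentially quantified dilation space is a closed
  subspace of one fixed Hilbert space.  This is no restriction: any dilation may be cut down to the
  closed span of the vectors \<open>V\<^sub>\<alpha> h\<close>, which are indexed by \<^typ>\<open>'n list \<times> 'h\<close>, so its Hilbert
  dimension is at most the cardinality of that type.\<close>

definition class_C :: "real \<Rightarrow> ('n \<Rightarrow> ('h :: chilbert_space \<Rightarrow>\<^sub>L 'h)) \<Rightarrow> bool" where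
  "class_C \<rho> T \<longleftrightarrow> (\<forall>i. cbounded (T i)) \<and>
    (\<exists>(G :: ('n list \<times> 'h, complex) ell2 set) J V. isometric_dilation \<rho> T G J V)"

lemma closed_cspan_closed: "closed (closed_cspan S)"
  and closed_cspan_csubspace: "csubspace (closed_cspan S)"
  and closed_cspan_superset: "S \<subseteq> closed_cspan S"
  by (auto simp: closed_cspan_def csubspace_def)

lemma closed_cspan_least: "S \<subseteq> M \<Longrightarrow> csubspace M \<Longrightarrow> closed M \<Longrightarrow> closed_cspan S \<subseteq> M"
  by (auto simp: closed_cspan_def)

lemma class_C_imp_minimal_isometric_dilation:
  fixes T :: "'n \<Rightarrow> ('h :: chilbert_space \<Rightarrow>\<^sub>L 'h)"
  assumes "class_C \<rho> T"
  shows "\<exists>(K :: ('n list \<times> 'h, complex) ell2 set) J V. minimal_isometric_dilation \<rho> T K J V"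
proof -
  obtain G :: "('n list \<times> 'h, complex) ell2 set" and J V
    where dil: "isometric_dilation \<rho> T G J V"
    using assms by (auto simp: class_C_def)
  define S where "S = {word_map V \<alpha> (J h) | \<alpha> h. True}"
  define K where "K = closed_cspan S"
  have G: "csubspace G" "closed G" and JG: "range J \<subseteq> G"
    and V: "\<And>i. clinear_on G (V i)" "\<And>i x. x \<in> G \<Longrightarrow> V i x \<in> G"
      "\<And>i x. x \<in> G \<Longrightarrow> norm (V i x) = norm x"
    using dil by (simp_all add: isometric_dilation_def image_subset_iff)
  have "word_map V \<alpha> (J h) \<in> G" for \<alpha> h
    by (induction \<alpha>) (use JG V in \<open>auto simp: word_map_def\<close>)
  then have KG: "K \<subseteq> G" unfolding K_def S_def by (intro closed_cspan_least G) auto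
  have minus: "x - y \<in> G" if "x \<in> G" "y \<in> G" for x y
  proof -
    have "- 1 *\<^sub>C y = - y" using scaleR_scaleC[of "-1" y] by simp
    moreover have "x + - 1 *\<^sub>C y \<in> G" using that G(1) unfolding csubspace_def by blast
    ultimately show ?thesis by simp
  qed
  have Vdiff: "V i x - V i y = V i (x - y)" if "x \<in> G" "y \<in> G" for i x y
  proof -
    have "V i ((x - y) + y) = V i (x - y) + V i y"
      using V(1)[of i] minus[OF that] that unfolding clinear_on_def by blast
    then show ?thesis by simp
  qed
  have VK: "V i x \<in> K" if "x \<in> K" for i x
  proof -
    define M where "M = {x \<in> G. V i x \<in> K}"
    have "continuous_on G (V i)"
      unfolding continuous_on_iff dist_norm
    proof (intro ballI allI impI)
      fix x e assume "x \<in> G" "(0 :: real) < e"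
      then show "\<exists>d>0. \<forall>x'\<in>G. norm (x' - x) < d \<longrightarrow> norm (V i x' - V i x) < e"
        by (intro exI[of _ e]) (simp add: Vdiff minus V)
    qed
    then have "closed M"
      using continuous_closed_preimage[of G "V i" K] G(2) closed_cspan_closed[of S]
      by (simp add: M_def K_def vimage_def Int_def)
    moreover have "V i 0 = 0"
      using V(3)[of 0 i] G(1) by (simp add: csubspace_def)
    then have "csubspace M"
      using G(1) V(1)[of i] closed_cspan_csubspace[of S]
      by (auto simp: csubspace_def M_def K_def clinear_on_def)
    moreover have "S \<subseteq> M"
    proof
      fix x assume x: "x \<in> S"
      then obtain \<alpha> h where "x = word_map V \<alpha> (J h)" by (auto simp: S_def)
      then have "V i x = word_map V (i # \<alpha>) (J h)" by (simp add: word_map_def)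
      then have "V i x \<in> S" unfolding S_def by blast
      then show "x \<in> M" using x KG closed_cspan_superset[of S] by (auto simp: M_def K_def)
    qed
    ultimately have "K \<subseteq> M" unfolding K_def by (intro closed_cspan_least)
    then show ?thesis using that by (auto simp: M_def)
  qed
  have JK: "range J \<subseteq> K"
  proof
    fix x assume "x \<in> range J"
    then obtain h where "x = word_map V [] (J h)" by (auto simp: word_map_def)
    then have "x \<in> S" unfolding S_def by blast
    then show "x \<in> K" using closed_cspan_superset[of S] by (auto simp: K_def)
  qed
  have "isometric_dilation \<rho> T K J V"
    unfolding isometric_dilation_def
  proof (intro conjI allI impI ballI)
    show "csubspace K" "closed K"
      unfolding K_def by (rule closed_cspan_csubspace closed_cspan_closed)+
    show "clinear_on K (V i)" for i
      using V(1)[of i] KG unfolding clinear_on_def by blast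
    show "V i ` K \<subseteq> K" for i using VK by auto
    show "norm (V i x) = norm x" if "x \<in> K" for i x using V(3) KG that by auto
    show "cinner (V i x) (V j y) = 0" if "i \<noteq> j" "x \<in> K" "y \<in> K" for i j x y
    proof -
      have "x \<in> G" "y \<in> G" using that KG by auto
      then show ?thesis using dil that(1) by (simp add: isometric_dilation_def)
    qed
  qed (use dil JK in \<open>simp_all add: isometric_dilation_def\<close>)
  then show ?thesis unfolding minimal_isometric_dilation_def K_def S_def by blast
qed

section \<open>The objects attached to an \<open>n\<close>-tuple\<close>

definition words :: "nat \<Rightarrow> 'n list set" where
  "words k = {\<alpha>. length \<alpha> = k}"

definition P_rho :: "real \<Rightarrow> ('n \<Rightarrow> ('h :: chilbert_space \<Rightarrow>\<^sub>L 'h)) \<Rightarrow> real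
    \<Rightarrow> (('n list, 'h) ell2 \<Rightarrow>\<^sub>L ('n list, 'h) ell2)" where
  "P_rho \<rho> X r =
    (\<Sum>k. \<Sum>\<alpha>\<in>words (Suc k).
      r ^ Suc k *\<^sub>R tensor_op (wprod X \<alpha>) (adj (wprod right_creation (rev \<alpha>)))) +
    \<rho> *\<^sub>R tensor_op id_blinfun id_blinfun +
    (\<Sum>k. \<Sum>\<alpha>\<in>words (Suc k).
      r ^ Suc k *\<^sub>R tensor_op (adj (wprod X \<alpha>)) (wprod right_creation (rev \<alpha>)))"

definition mt_kernel :: "real \<Rightarrow> ('n \<Rightarrow> ('h :: chilbert_space \<Rightarrow>\<^sub>L 'h))
    \<Rightarrow> 'n list \<Rightarrow> 'n list \<Rightarrow> ('h \<Rightarrow>\<^sub>L 'h)" where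
  "mt_kernel \<rho> X \<alpha> \<beta> =
    (if strict_prefix \<alpha> \<beta> then (1 / \<rho>) *\<^sub>R wprod X (drop (length \<alpha>) \<beta>)
     else if \<alpha> = \<beta> then id_blinfun
     else if strict_prefix \<beta> \<alpha> then (1 / \<rho>) *\<^sub>R adj (wprod X (drop (length \<beta>) \<alpha>))
     else 0)"

definition kernel_positive ::
  "('n list \<Rightarrow> 'n list \<Rightarrow> ('h :: chilbert_space \<Rightarrow>\<^sub>L 'h)) \<Rightarrow> bool" where
  "kernel_positive K \<longleftrightarrow>
    (\<forall>(N :: nat) \<sigma> h. (\<Sum>i<N. \<Sum>j<N. cinner (K (\<sigma> i) (\<sigma> j) (h j)) (h i)) \<in> \<real>\<^sub>\<ge>\<^sub>0)"

subsection \<open>Noncommutative polynomials and the map \<open>\<phi>\<^sub>T\<close>\<close>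

definition is_poly :: "('n list \<Rightarrow> 'c :: zero) \<Rightarrow> bool" where
  "is_poly p \<longleftrightarrow> finite {\<alpha>. p \<alpha> \<noteq> 0}"

definition poly_op ::
  "('n list \<Rightarrow> complex) \<Rightarrow> ('n \<Rightarrow> ('h :: chilbert_space \<Rightarrow>\<^sub>L 'h)) \<Rightarrow> ('h \<Rightarrow>\<^sub>L 'h)" where
  "poly_op p T = (\<Sum>\<alpha> | p \<alpha> \<noteq> 0. scalar_op (p \<alpha>) o\<^sub>L wprod T \<alpha>)"

definition disc_algebra :: "('n fock \<Rightarrow>\<^sub>L 'n fock) set" where
  "disc_algebra = closure {poly_op p left_creation | p. is_poly p}"

definition disc_opspace :: "('n fock \<Rightarrow>\<^sub>L 'n fock) set" where
  "disc_opspace = closure {adj f + g | f g. f \<in> disc_algebra \<and> g \<in> disc_algebra}"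

text \<open>The elements \<open>q(S)\<^sup>* + p(S)\<close> are dense in \<^term>\<open>disc_opspace\<close>, which makes the continuous
  extension unique; the value outside that space is a mere convention.\<close>

definition phi_map :: "real \<Rightarrow> ('n \<Rightarrow> ('h :: chilbert_space \<Rightarrow>\<^sub>L 'h))
    \<Rightarrow> ('n fock \<Rightarrow>\<^sub>L 'n fock) \<Rightarrow> ('h \<Rightarrow>\<^sub>L 'h)" where
  "phi_map \<rho> T = (THE \<phi>.
    continuous_on disc_opspace \<phi> \<and>
    (\<forall>p q. is_poly p \<longrightarrow> is_poly q \<longrightarrow>
      \<phi> (adj (poly_op q left_creation) + poly_op p left_creation) =
        (1 / \<rho>) *\<^sub>R (adj (poly_op q T) + poly_op p T) +
        (1 - 1 / \<rho>) *\<^sub>R scalar_op (cnj (q []) + p [])) \<and>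
    (\<forall>g. g \<notin> disc_opspace \<longrightarrow> \<phi> g = 0))"

definition op_matrix_positive ::
  "nat \<Rightarrow> (nat \<Rightarrow> nat \<Rightarrow> ('a :: chilbert_space \<Rightarrow>\<^sub>L 'a)) \<Rightarrow> bool" where
  "op_matrix_positive m G \<longleftrightarrow> (\<forall>f. (\<Sum>i<m. \<Sum>j<m. cinner (G i j (f j)) (f i)) \<in> \<real>\<^sub>\<ge>\<^sub>0)"

definition completely_positive_on :: "('a :: chilbert_space \<Rightarrow>\<^sub>L 'a) set
    \<Rightarrow> (('a \<Rightarrow>\<^sub>L 'a) \<Rightarrow> ('b :: chilbert_space \<Rightarrow>\<^sub>L 'b)) \<Rightarrow> bool" where
  "completely_positive_on M \<phi> \<longleftrightarrow>
    (\<forall>f\<in>M. \<forall>g\<in>M. \<phi> (f + g) = \<phi> f + \<phi> g) \<and>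
    (\<forall>c. \<forall>f\<in>M. \<phi> (scalar_op c o\<^sub>L f) = scalar_op c o\<^sub>L \<phi> f) \<and>
    (\<forall>m G. (\<forall>i<m. \<forall>j<m. G i j \<in> M) \<longrightarrow> op_matrix_positive m G \<longrightarrow>
      op_matrix_positive m (\<lambda>i j. \<phi> (G i j)))"

subsection \<open>Operator-valued polynomials and free holomorphic functions\<close>

text \<open>Every separable Hilbert space is \<open>ell2(J)\<close> for some set \<open>J\<close> of natural numbers, and
  \<open>B(ell2(J))\<close> consists of the operators on \<open>ell2(\<nat>)\<close> that map into \<open>ell2(J)\<close> and vanish on its
  orthogonal complement.  In particular \<^term>\<open>coeff_ops {..<m}\<close> is the algebra of complex
  \<open>m \<times> m\<close> matrices.\<close>

type_synonym seq_space = "(nat, complex) ell2"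

definition coeff_ops :: "nat set \<Rightarrow> (seq_space \<Rightarrow>\<^sub>L seq_space) set" where
  "coeff_ops J = {M. cbounded M \<and> (\<forall>e. M e \<in> ell2_on J) \<and> (\<forall>e\<in>ell2_on (- J). M e = 0)}"

definition row_ball :: "('n :: finite \<Rightarrow> (seq_space \<Rightarrow>\<^sub>L seq_space)) set" where
  "row_ball = {X. (\<forall>i. cbounded (X i)) \<and> norm (\<Sum>i\<in>UNIV. X i o\<^sub>L adj (X i)) < 1}"

definition opoly :: "('n list \<Rightarrow> (seq_space \<Rightarrow>\<^sub>L seq_space))
    \<Rightarrow> ('n \<Rightarrow> ('h :: chilbert_space \<Rightarrow>\<^sub>L 'h)) \<Rightarrow> ((nat, 'h) ell2 \<Rightarrow>\<^sub>L (nat, 'h) ell2)" where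
  "opoly p X = (\<Sum>\<alpha> | p \<alpha> \<noteq> 0. tensor_op (wprod X \<alpha>) (p \<alpha>))"

definition harnack_dominated :: "real \<Rightarrow> real \<Rightarrow> ('n :: finite \<Rightarrow> ('h :: chilbert_space \<Rightarrow>\<^sub>L 'h))
    \<Rightarrow> ('n \<Rightarrow> ('h \<Rightarrow>\<^sub>L 'h)) \<Rightarrow> bool" where
  "harnack_dominated \<rho> c A B \<longleftrightarrow>
    (\<forall>(m :: nat) p. is_poly p \<and> (\<forall>\<alpha>. p \<alpha> \<in> coeff_ops {..<m}) \<and>
        (\<forall>X\<in>row_ball. op_positive_on (ell2_on {..<m}) (re_op (opoly p X))) \<longrightarrow>
      op_le_on (ell2_on {..<m})
        (re_op (opoly p A) + (\<rho> - 1) *\<^sub>R re_op (opoly p (\<lambda>_. 0)))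
        (c\<^sup>2 *\<^sub>R (re_op (opoly p B) + (\<rho> - 1) *\<^sub>R re_op (opoly p (\<lambda>_. 0)))))"

definition free_holomorphic :: "nat set \<Rightarrow> ('n list \<Rightarrow> (seq_space \<Rightarrow>\<^sub>L seq_space)) \<Rightarrow> bool" where
  "free_holomorphic J F \<longleftrightarrow> (\<forall>\<alpha>. F \<alpha> \<in> coeff_ops J) \<and>
    limsup (\<lambda>k. ereal (norm (\<Sum>\<alpha>\<in>words k. adj (F \<alpha>) o\<^sub>L F \<alpha>) powr (1 / (2 * real k)))) \<le> 1"

definition holo_eval :: "('n list \<Rightarrow> (seq_space \<Rightarrow>\<^sub>L seq_space))
    \<Rightarrow> ('n \<Rightarrow> ('h :: chilbert_space \<Rightarrow>\<^sub>L 'h)) \<Rightarrow> ((nat, 'h) ell2 \<Rightarrow>\<^sub>L (nat, 'h) ell2)" where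
  "holo_eval F X = (\<Sum>k. \<Sum>\<alpha>\<in>words k. tensor_op (wprod X \<alpha>) (F \<alpha>))"

text \<open>A pluriharmonic function \<open>u = Re F\<close> is represented by the coefficients of \<open>F\<close>.\<close>

definition pluriharmonic_eval :: "('n list \<Rightarrow> (seq_space \<Rightarrow>\<^sub>L seq_space))
    \<Rightarrow> ('n \<Rightarrow> ('h :: chilbert_space \<Rightarrow>\<^sub>L 'h)) \<Rightarrow> ((nat, 'h) ell2 \<Rightarrow>\<^sub>L (nat, 'h) ell2)" where
  "pluriharmonic_eval F X = re_op (holo_eval F X)"

definition positive_pluriharmonic ::
  "nat set \<Rightarrow> ('n :: finite list \<Rightarrow> (seq_space \<Rightarrow>\<^sub>L seq_space)) \<Rightarrow> bool" where
  "positive_pluriharmonic J F \<longleftrightarrow> free_holomorphic J F \<and>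
    (\<forall>X\<in>row_ball. op_positive_on (ell2_on J) (pluriharmonic_eval F X))"

end

theory Submission
  imports Defs
begin

text \<open>
  Each condition is compared with positivity of the multi-Toeplitz kernel \<open>K = c\<^sup>2 K\<^sub>B - K\<^sub>A\<close>.
  The quadratic form of \<open>P\<^sub>\<rho>(rX, R)\<close> on the Fock space is \<open>\<rho>\<close> times that of the kernel of \<open>rX\<close>, which gives (ii).
  If \<open>K\<close> is positive, a Kolmogorov decomposition provides a row contraction \<open>Z\<close> on the
  sequence space and vectors \<open>u\<^sub>j\<close> with \<open>\<langle>K([], \<alpha>) h\<^sub>j, h\<^sub>i\<rangle> = \<langle>Z\<^sub>\<alpha> u\<^sub>j, u\<^sub>i\<rangle>\<close>. Evaluating a
  positivity hypothesis on the open row ball at \<open>rZ\<close> gives (i) and (iii); for (v), a Poisson transform carries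
  positivity from the left creation operators to the row ball. Conversely, the matrix \<open>(K\<^sub>1\<^sub>,\<^sub>X(\<sigma>\<^sub>i, \<sigma>\<^sub>j))\<close> is the
  real part of a polynomial in \<open>X\<close> that is positive on the row ball, and testing (i), (iii) or (v) with it recovers
  \<open>K \<ge> 0\<close>. Condition (vi) is a comparison of Gram matrices, since
  \<open>\<langle>W\<^sub>\<beta> h, W\<^sub>\<alpha> h'\<rangle> = \<langle>K\<^sub>B(\<alpha>, \<beta>) h, h'\<rangle>\<close> for the minimal isometric dilation \<open>W\<close> of \<open>B\<close>.
\<close>

section \<open>Hilbert space basics\<close>

text \<open>Every condition tests one linear map, which sends a word \<alpha> to K([], \<alpha>): on
  a polynomial p its value is c^2 \<phi>_B(p) - \<phi>_A(p), and \<rho> times this value is c^2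
  [p(B) + (\<rho> - 1) p(0)] - [p(A) + (\<rho> - 1) p(0)], which explains the summands with \<rho> -
  1. The obstacle is the place where positivity is known: the open row ball of one separable space,
  while H may be nonseparable and K is not normalised, its value at a pair of empty words being (c^2
  - 1) I. A single test involves only finitely many vectors of H, so the Gram kernel to be realised
  is indexed by the countable set of pairs of a word and a number, and its vectors fit into the
  sequence space; the missing normalisation is absorbed by the vectors u_j. The model is only a row
  contraction, so it is scaled by r < 1 to enter the open ball. Kernel sums and polynomials are
  finite expressions in r, so letting r tend to 1 loses nothing.\<close>

lemma bounded_bilinear_cinner:
  "bounded_bilinear (cinner :: 'a :: chilbert_space \<Rightarrow> 'a \<Rightarrow> complex)"
proof
  fix a a' b b' :: 'a and r :: real
  show add: "cinner (a + a') b = cinner a b + cinner a' b" for a a' b :: 'a by (rule cinner_add_left)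
  show "cinner a (b + b') = cinner a b + cinner a b'"
    by (metis cinner_commute cinner_add_left complex_cnj_add)
  show scale: "cinner (r *\<^sub>R a) b = r *\<^sub>R cinner a b" for a b :: 'a
    by (simp add: scaleR_scaleC cinner_scaleC_left scaleC_complex_def)
  show "cinner a (r *\<^sub>R b) = r *\<^sub>R cinner a b"
    by (metis cinner_commute scale complex_cnj_scaleR)
  show "\<exists>K. \<forall>a b :: 'a. norm (cinner a b) \<le> norm a * norm b * K"
    by (rule exI[of _ 1]) (simp add: norm_cinner_le)
qed

lemmas cinner_add_right = bounded_bilinear.add_right[OF bounded_bilinear_cinner]
lemmas cinner_diff_left = bounded_bilinear.diff_left[OF bounded_bilinear_cinner]
lemmas cinner_diff_right = bounded_bilinear.diff_right[OF bounded_bilinear_cinner]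
lemmas cinner_zero_left [simp] = bounded_bilinear.zero_left[OF bounded_bilinear_cinner]
lemmas cinner_zero_right [simp] = bounded_bilinear.zero_right[OF bounded_bilinear_cinner]
lemmas cinner_minus_left = bounded_bilinear.minus_left[OF bounded_bilinear_cinner]
lemmas cinner_scaleR_left = bounded_bilinear.scaleR_left[OF bounded_bilinear_cinner]
lemmas cinner_scaleR_right = bounded_bilinear.scaleR_right[OF bounded_bilinear_cinner]
lemmas cinner_sum_left = bounded_bilinear.sum_left[OF bounded_bilinear_cinner]
lemmas cinner_sum_right = bounded_bilinear.sum_right[OF bounded_bilinear_cinner]
lemmas tendsto_cinner = bounded_bilinear.tendsto[OF bounded_bilinear_cinner]

lemma cinner_scaleC_right: "cinner x (c *\<^sub>C y) = cnj c * cinner x y"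
  by (metis cinner_commute cinner_scaleC_left complex_cnj_mult)

lemma bounded_bilinear_scaleC:
  "bounded_bilinear (scaleC :: complex \<Rightarrow> 'a :: chilbert_space \<Rightarrow> 'a)"
proof
  fix a a' :: complex and b b' :: 'a and r :: real
  show "(a + a') *\<^sub>C b = a *\<^sub>C b + a' *\<^sub>C b" by (rule scaleC_add_left)
  show "a *\<^sub>C (b + b') = a *\<^sub>C b + a *\<^sub>C b'" by (rule scaleC_add_right)
  show "(r *\<^sub>R a) *\<^sub>C b = r *\<^sub>R a *\<^sub>C b" by (simp add: scaleR_scaleC scaleC_scaleC scaleC_complex_def)
  show "a *\<^sub>C r *\<^sub>R b = r *\<^sub>R a *\<^sub>C b" by (simp add: scaleR_scaleC scaleC_scaleC mult.commute)
  show "\<exists>K. \<forall>a (b :: 'a). norm (a *\<^sub>C b) \<le> norm a * norm b * K"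
    by (rule exI[of _ 1]) (simp add: norm_scaleC)
qed

lemmas scaleC_zero_left [simp] = bounded_bilinear.zero_left[OF bounded_bilinear_scaleC]
lemmas scaleC_zero_right [simp] = bounded_bilinear.zero_right[OF bounded_bilinear_scaleC]
lemmas scaleC_minus_left = bounded_bilinear.minus_left[OF bounded_bilinear_scaleC]
lemmas scaleC_diff_right = bounded_bilinear.diff_right[OF bounded_bilinear_scaleC]
lemmas scaleC_sum_right = bounded_bilinear.sum_right[OF bounded_bilinear_scaleC]
lemmas tendsto_scaleC = bounded_bilinear.tendsto[OF bounded_bilinear_scaleC]

lemma scaleC_one [simp]: "1 *\<^sub>C (x :: 'a :: chilbert_space) = x"
  using scaleR_scaleC[of 1 x] by simp

lemma cinner_eq_zero_iff [simp]: "cinner x x = 0 \<longleftrightarrow> x = (0 :: 'a :: chilbert_space)"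
  by (simp add: cinner_self)

lemma cinner_ext: "(\<And>z. cinner x z = cinner y z) \<Longrightarrow> x = (y :: 'a :: chilbert_space)"
  using cinner_eq_zero_iff[of "x - y"] by (simp add: cinner_diff_left cinner_diff_right)

lemma norm_add_square: "(norm (x + y))\<^sup>2 = (norm x)\<^sup>2 + (norm y)\<^sup>2 + 2 * Re (cinner x y)"
  for x y :: "'a :: chilbert_space"
  by (simp add: power2_norm_eq_inner inner_add inner_commute flip: inner_eq_Re_cinner)

lemma norm_sum_square:
  "complex_of_real ((norm (\<Sum>i\<in>I. x i))\<^sup>2) = (\<Sum>i\<in>I. \<Sum>j\<in>I. cinner (x j) (x i))"
  for x :: "'i \<Rightarrow> 'a :: chilbert_space"
  unfolding cinner_self[symmetric] cinner_sum_right unfolding cinner_sum_left ..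

section \<open>Complex subspaces and orthogonal projections\<close>

lemma csubspace_subspace: "csubspace M \<Longrightarrow> subspace M"
  by (simp add: csubspace_def subspace_def scaleR_scaleC)

lemma csubspace_sum: "csubspace M \<Longrightarrow> (\<And>i. i \<in> I \<Longrightarrow> f i \<in> M) \<Longrightarrow> sum f I \<in> M"
  by (rule subspace_sum[OF csubspace_subspace])

lemma csubspace_diff: "csubspace M \<Longrightarrow> x \<in> M \<Longrightarrow> y \<in> M \<Longrightarrow> x - y \<in> M"
  by (rule subspace_diff[OF csubspace_subspace])

lemma csubspace_scaleC: "csubspace M \<Longrightarrow> x \<in> M \<Longrightarrow> c *\<^sub>C x \<in> M"
  by (simp add: csubspace_def)

lemma csubspace_add: "csubspace M \<Longrightarrow> x \<in> M \<Longrightarrow> y \<in> M \<Longrightarrow> x + y \<in> M"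
  by (simp add: csubspace_def)

lemma csubspace_orthogonal: "csubspace {x :: 'a :: chilbert_space. \<forall>z\<in>S. cinner z x = 0}"
  by (auto simp: csubspace_def cinner_add_right cinner_scaleC_right)

lemma closed_orthogonal: "closed {x :: 'a :: chilbert_space. \<forall>z\<in>S. cinner z x = 0}"
proof -
  have "continuous_on UNIV (\<lambda>x. cinner z x)" for z :: 'a
    by (rule linear_continuous_on[OF bounded_bilinear.bounded_linear_right[OF bounded_bilinear_cinner]])
  then have "closed {x. cinner z x = 0}" for z :: 'a
    using continuous_closed_preimage_constant[of UNIV "\<lambda>x. cinner z x" 0] by simp
  then have "closed (\<Inter>z\<in>S. {x. cinner z x = 0})" by blast
  moreover have "{x. \<forall>z\<in>S. cinner z x = 0} = (\<Inter>z\<in>S. {x. cinner z x = 0})" by blast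
  ultimately show ?thesis by simp
qed

lemma closed_cspan_orthogonal:
  assumes "\<And>x. x \<in> S \<Longrightarrow> cinner z x = 0" "u \<in> closed_cspan S"
  shows "cinner z u = 0"
proof -
  have "closed_cspan S \<subseteq> {x. \<forall>z'\<in>{z}. cinner z' x = 0}"
    using assms(1) csubspace_orthogonal closed_orthogonal by (intro closed_cspan_least) blast+
  then show ?thesis using assms by blast
qed

text \<open>By the parallelogram law a minimising sequence for the distance is Cauchy, and at the
  minimiser the first variation vanishes in every direction of \<open>M\<close>.\<close>

lemma projection_exists:
  fixes M :: "'a :: chilbert_space set"
  assumes M: "csubspace M" "closed M"
  shows "\<exists>y\<in>M. \<forall>z\<in>M. cinner (x - y) z = 0"
proof -
  define d where "d = infdist x M"
  have ne: "M \<noteq> {}" using M by (auto simp: csubspace_def)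
  have d0: "d \<ge> 0" by (simp add: d_def infdist_nonneg)
  have low: "d \<le> norm (x - y)" if "y \<in> M" for y
    using infdist_le[OF that, of x] by (simp add: d_def dist_norm)
  have "\<exists>y\<in>M. (norm (x - y))\<^sup>2 < d\<^sup>2 + e" if "e > 0" for e
  proof -
    have "d < sqrt (d\<^sup>2 + e)" using that d0 by (simp add: real_less_rsqrt)
    then have "(INF a\<in>M. dist x a) < sqrt (d\<^sup>2 + e)" using ne by (simp add: d_def infdist_notempty)
    then obtain y where y: "y \<in> M" "dist x y < sqrt (d\<^sup>2 + e)"
      using cInf_lessD[of "dist x ` M"] ne by auto
    then have "(norm (x - y))\<^sup>2 < (sqrt (d\<^sup>2 + e))\<^sup>2"
      by (intro power_strict_mono) (auto simp: dist_norm)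
    then show ?thesis using y that d0 by auto
  qed
  then have "\<forall>n. \<exists>y\<in>M. (norm (x - y))\<^sup>2 < d\<^sup>2 + 1 / real (Suc n)" by auto
  then obtain Y where Y: "\<And>n. Y n \<in> M" "\<And>n. (norm (x - Y n))\<^sup>2 < d\<^sup>2 + 1 / real (Suc n)" by metis
  have par: "(norm (Y m - Y n))\<^sup>2 \<le> 2 / real (Suc m) + 2 / real (Suc n)" for m n
  proof -
    have mid: "(1/2) *\<^sub>R (Y m + Y n) \<in> M"
      using Y(1) csubspace_subspace[OF M(1)] by (simp add: subspace_add subspace_scale)
    have eq: "(x - Y m) + (x - Y n) = 2 *\<^sub>R (x - (1/2) *\<^sub>R (Y m + Y n))"
      by (simp add: algebra_simps scaleR_2)
    have "(norm ((x - Y m) + (x - Y n)))\<^sup>2 = 4 * (norm (x - (1/2) *\<^sub>R (Y m + Y n)))\<^sup>2"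
      unfolding eq by (simp add: power_mult_distrib)
    moreover have "d\<^sup>2 \<le> (norm (x - (1/2) *\<^sub>R (Y m + Y n)))\<^sup>2"
      using low[OF mid] d0 by (simp add: power_mono)
    moreover have "(norm ((x - Y m) + (x - Y n)))\<^sup>2 + (norm ((x - Y m) - (x - Y n)))\<^sup>2
        = 2 * (norm (x - Y m))\<^sup>2 + 2 * (norm (x - Y n))\<^sup>2"
      by (simp add: power2_norm_eq_inner inner_diff inner_add inner_commute)
    moreover have "norm ((x - Y m) - (x - Y n)) = norm (Y m - Y n)"
      by (simp add: norm_minus_commute)
    ultimately show ?thesis using Y(2)[of m] Y(2)[of n] by simp
  qed
  have "Cauchy Y"
  proof (rule CauchyI)
    fix e :: real assume e: "e > 0"
    obtain N where N: "4 / e\<^sup>2 < real N" using reals_Archimedean2 by blast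
    have "norm (Y m - Y n) < e" if mn: "m \<ge> N" "n \<ge> N" for m n
    proof -
      have "0 < 4 / e\<^sup>2" using e by simp
      then have "N > 0" using N by (cases N) auto
      then have "2 / real (Suc m) \<le> 2 / real N" "2 / real (Suc n) \<le> 2 / real N"
        using mn by (auto intro!: divide_left_mono)
      then have "(norm (Y m - Y n))\<^sup>2 \<le> 4 / real N" using par[of m n] by simp
      also have "4 / real N < e\<^sup>2" using N e \<open>N > 0\<close> by (simp add: field_simps)
      finally show ?thesis using e by (simp add: power2_less_imp_less)
    qed
    then show "\<exists>M. \<forall>m\<ge>M. \<forall>n\<ge>M. norm (Y m - Y n) < e" by blast
  qed
  then obtain y where y: "Y \<longlonglongrightarrow> y" using Cauchy_convergent_iff convergent_def by blast
  have yM: "y \<in> M" using M(2) Y(1) y closed_sequentially by blast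
  have "(\<lambda>n. (norm (x - Y n))\<^sup>2) \<longlonglongrightarrow> (norm (x - y))\<^sup>2" by (intro tendsto_intros y)
  moreover have "(\<lambda>n. d\<^sup>2 + 1 / real (Suc n)) \<longlonglongrightarrow> d\<^sup>2 + 0"
    by (intro tendsto_intros LIMSEQ_Suc[OF lim_1_over_n])
  ultimately have nd: "(norm (x - y))\<^sup>2 \<le> d\<^sup>2"
    using Y(2) by (intro LIMSEQ_le) (auto intro: less_imp_le)
  have inner0: "inner (x - y) z = 0" if z: "z \<in> M" for z
  proof (cases "z = 0")
    case False
    \<comment> \<open>This \<open>t\<close> minimises the quadratic polynomial
      \<open>(norm ((x - y) - t *\<^sub>R z))\<^sup>2\<close>; a nonzero inner product would push
      the distance below \<open>d\<close>.\<close>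
    define t where "t = inner (x - y) z / (norm z)\<^sup>2"
    have "y + t *\<^sub>R z \<in> M"
      using yM z csubspace_subspace[OF M(1)] by (simp add: subspace_add subspace_scale)
    then have "d\<^sup>2 \<le> (norm (x - (y + t *\<^sub>R z)))\<^sup>2" using low d0 by (simp add: power_mono)
    also have "x - (y + t *\<^sub>R z) = (x - y) - t *\<^sub>R z" by simp
    also have "(norm ((x - y) - t *\<^sub>R z))\<^sup>2
        = (norm (x - y))\<^sup>2 - 2 * t * inner (x - y) z + t\<^sup>2 * (norm z)\<^sup>2"
      unfolding power2_norm_eq_inner inner_diff_left inner_diff_right
      by (simp add: inner_commute algebra_simps power2_eq_square)
    also have "\<dots> = (norm (x - y))\<^sup>2 - (inner (x - y) z)\<^sup>2 / (norm z)\<^sup>2"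
      using False by (simp add: t_def power2_eq_square field_simps)
    finally have "(inner (x - y) z)\<^sup>2 / (norm z)\<^sup>2 \<le> 0" using nd by linarith
    then show ?thesis using False by (simp add: divide_le_0_iff)
  qed simp
  have "cinner (x - y) z = 0" if "z \<in> M" for z
  proof (rule complex_eqI)
    show "Re (cinner (x - y) z) = Re 0" using inner0[OF that] by (simp add: inner_eq_Re_cinner)
    \<comment> \<open>The subspace is complex, so \<open>\<i> *\<^sub>C z\<close> is an admissible
      direction as well and yields the imaginary part.\<close>
    have "inner (x - y) (\<i> *\<^sub>C z) = 0" using inner0 csubspace_scaleC[OF M(1) that] by blast
    then show "Im (cinner (x - y) z) = Im 0" by (simp add: inner_eq_Re_cinner cinner_scaleC_right)
  qed
  then show ?thesis using yM by blast
qed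

lemma projection_unique:
  assumes M: "csubspace M" and "y \<in> M" "y' \<in> M"
    and "\<forall>z\<in>M. cinner (x - y) z = 0" "\<forall>z\<in>M. cinner (x - y') z = 0"
  shows "y = (y' :: 'a :: chilbert_space)"
proof -
  have m: "y - y' \<in> M" using assms csubspace_diff by blast
  have "cinner (y - y') (y - y') = cinner (x - y') (y - y') - cinner (x - y) (y - y')"
    by (simp add: cinner_diff_left)
  also have "\<dots> = 0" using assms m by simp
  finally show ?thesis by simp
qed

lemma orth_proj:
  fixes M :: "'a :: chilbert_space set"
  assumes M: "csubspace M" "closed M"
  shows "orth_proj M x \<in> M" "z \<in> M \<Longrightarrow> cinner (x - orth_proj M x) z = 0"
proof -
  have "\<exists>!y. y \<in> M \<and> (\<forall>z\<in>M. cinner (x - y) z = 0)"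
    using projection_exists[OF M, of x] projection_unique[OF M(1)] by blast
  from theI'[OF this] show "orth_proj M x \<in> M" "z \<in> M \<Longrightarrow> cinner (x - orth_proj M x) z = 0"
    unfolding orth_proj_def by auto
qed

lemma orth_proj_eqI:
  assumes M: "csubspace M" "closed M" and "y \<in> M" "\<And>z. z \<in> M \<Longrightarrow> cinner (x - y) z = 0"
  shows "orth_proj M x = y"
  using projection_unique[OF M(1) orth_proj(1)[OF M, of x] assms(3)] orth_proj(2)[OF M] assms(4) by blast

lemma norm_orth_proj_le:
  assumes M: "csubspace M" "closed M"
  shows "norm (orth_proj M x) \<le> norm x"
proof -
  have "(norm ((x - orth_proj M x) + orth_proj M x))\<^sup>2
      = (norm (x - orth_proj M x))\<^sup>2 + (norm (orth_proj M x))\<^sup>2"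
    unfolding norm_add_square using orth_proj[OF M] by simp
  then show ?thesis by (simp add: power2_le_imp_le)
qed

section \<open>The Riesz representation and adjoints\<close>

lemma cbounded_scaleC: "cbounded T \<Longrightarrow> T (c *\<^sub>C x) = c *\<^sub>C T x"
  by (simp add: cbounded_def)

text \<open>The kernel of a nonzero functional is a closed subspace of codimension one, so the
  functional is determined by its value at a vector \<open>w\<close> orthogonal to the
  kernel.\<close>

lemma riesz:
  fixes T :: "'a :: chilbert_space \<Rightarrow>\<^sub>L complex"
  assumes T: "\<And>c x. T (c *\<^sub>C x) = c * T x"
  obtains p where "\<And>x. T x = cinner x p"
proof -
  define M where "M = {x. T x = 0}"
  have "continuous_on UNIV (blinfun_apply T)"
    by (rule linear_continuous_on[OF blinfun.bounded_linear_right])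
  then have "closed M"
    using continuous_closed_preimage_constant[of UNIV "blinfun_apply T" 0] by (simp add: M_def)
  moreover have "csubspace M" by (simp add: M_def csubspace_def blinfun.add_right T)
  ultimately have M: "csubspace M" "closed M" by blast+
  show thesis
  proof (cases "\<forall>x. T x = 0")
    case True
    then show thesis using that[of 0] by simp
  next
    case False
    then obtain x0 where x0: "T x0 \<noteq> 0" by blast
    define w where "w = x0 - orth_proj M x0"
    have Tw: "T w \<noteq> 0" using x0 orth_proj(1)[OF M, of x0] by (simp add: w_def M_def blinfun.diff_right)
    have wM: "cinner w z = 0" if "z \<in> M" for z using orth_proj(2)[OF M that] by (simp add: w_def)
    have wn: "norm w \<noteq> 0" using Tw by (auto simp: blinfun.zero_right)
    have "T x = cinner x ((cnj (T w) / complex_of_real ((norm w)\<^sup>2)) *\<^sub>C w)" for x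
    proof -
      have "x - (T x / T w) *\<^sub>C w \<in> M" using Tw by (simp add: M_def blinfun.diff_right T)
      then have "cinner w (x - (T x / T w) *\<^sub>C w) = 0" by (rule wM)
      then have "cinner (x - (T x / T w) *\<^sub>C w) w = 0" by (metis cinner_commute complex_cnj_zero)
      then have "cinner x w = (T x / T w) * complex_of_real ((norm w)\<^sup>2)"
        by (simp add: cinner_diff_left cinner_scaleC_left cinner_self)
      then show ?thesis using Tw wn by (simp add: cinner_scaleC_right)
    qed
    then show thesis using that by blast
  qed
qed

lemma adj_eqI:
  fixes T :: "'a :: chilbert_space \<Rightarrow>\<^sub>L 'b :: chilbert_space" and S :: "'b \<Rightarrow>\<^sub>L 'a"
  shows "(\<And>x y. cinner (T x) y = cinner x (S y)) \<Longrightarrow> adj T = S"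
proof -
  assume S: "\<And>x y. cinner (T x) y = cinner x (S y)"
  have "S' = S" if S': "\<forall>x y. cinner (T x) y = cinner x (S' y)" for S' :: "'b \<Rightarrow>\<^sub>L 'a"
  proof (rule blinfun_eqI, rule cinner_ext)
    fix y x
    have "cinner x (S' y) = cinner x (S y)" using S' S by simp
    then show "cinner (S' y) x = cinner (S y) x" by (metis cinner_commute)
  qed
  with S show "adj T = S" unfolding adj_def by (intro the_equality) auto
qed

text \<open>Riesz gives the adjoint pointwise as \<open>p\<close>; linearity and the bound follow by
  testing against vectors, and \<open>adj_eqI\<close> identifies \<open>p\<close> with the definite
  description.\<close>

lemma cinner_adj:
  assumes T: "cbounded T"
  shows "cinner (T x) y = cinner x (adj T y)"
proof -
  have "\<exists>p. \<forall>x. cinner (T x) y = cinner x p" for y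
  proof -
    define f where "f x = cinner (T x) y" for x
    have f: "bounded_linear f"
    proof (rule bounded_linear_intro)
      show "f (x + x') = f x + f x'" for x x' by (simp add: f_def blinfun.add_right cinner_add_left)
      show "f (r *\<^sub>R x) = r *\<^sub>R f x" for r x by (simp add: f_def blinfun.scaleR_right cinner_scaleR_left)
      show "norm (f x) \<le> norm x * (norm T * norm y)" for x
      proof -
        have "norm (f x) \<le> norm (T x) * norm y" by (simp add: f_def norm_cinner_le)
        also have "\<dots> \<le> (norm T * norm x) * norm y" by (intro mult_right_mono norm_blinfun) simp
        finally show ?thesis by (simp add: ac_simps)
      qed
    qed
    obtain p where "\<And>x. Blinfun f x = cinner x p"
      by (rule riesz[of "Blinfun f"])
        (simp_all add: bounded_linear_Blinfun_apply[OF f], simp add: f_def cbounded_scaleC[OF T] cinner_scaleC_left)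
    then show ?thesis by (auto simp: bounded_linear_Blinfun_apply[OF f] f_def)
  qed
  then obtain p where p: "\<And>x y. cinner (T x) y = cinner x (p y)" by metis
  have p_linear: "bounded_linear p"
  proof (rule bounded_linear_intro)
    have p': "cinner (p y) x = cinner y (T x)" for x y using p[of x y] by (metis cinner_commute)
    show "p (x + y) = p x + p y" for x y by (rule cinner_ext) (simp add: p' cinner_add_left)
    show "p (r *\<^sub>R x) = r *\<^sub>R p x" for r x by (rule cinner_ext) (simp add: p' cinner_scaleR_left)
    show "norm (p x) \<le> norm x * norm T" for x
    proof -
      have "(norm (p x))\<^sup>2 = Re (cinner (T (p x)) x)" by (simp add: p cinner_self)
      also have "\<dots> \<le> norm (T (p x)) * norm x"
        using norm_cinner_le complex_Re_le_cmod order_trans by blast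
      also have "\<dots> \<le> norm T * norm (p x) * norm x" by (intro mult_right_mono norm_blinfun) simp
      finally have "norm (p x) * norm (p x) \<le> (norm x * norm T) * norm (p x)"
        by (simp add: power2_eq_square mult.commute mult.left_commute)
      then show ?thesis by (cases "norm (p x) = 0") (auto simp: mult_le_cancel_right)
    qed
  qed
  have "adj T = Blinfun p" by (rule adj_eqI) (simp add: p bounded_linear_Blinfun_apply[OF p_linear])
  then show ?thesis by (simp add: p bounded_linear_Blinfun_apply[OF p_linear])
qed

lemma cinner_adj': "cbounded T \<Longrightarrow> cinner (adj T y) x = cinner y (T x)"
  using cinner_commute[of "adj T y" x] cinner_adj[of T x y] cinner_commute[of y "T x"] by simp

lemma cbounded_adj [simp]: "cbounded T \<Longrightarrow> cbounded (adj T)"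
  unfolding cbounded_def[of "adj T"]
  by (rule allI, rule allI, rule cinner_ext) (simp add: cinner_adj' cinner_scaleC_left)

lemma adj_adj [simp]: "cbounded T \<Longrightarrow> adj (adj T) = T"
  by (rule adj_eqI) (simp add: cinner_adj')

lemma cbounded_add [simp]: "cbounded S \<Longrightarrow> cbounded T \<Longrightarrow> cbounded (S + T)"
  by (simp add: cbounded_def blinfun.add_left scaleC_add_right)

lemma cbounded_diff [simp]: "cbounded S \<Longrightarrow> cbounded T \<Longrightarrow> cbounded (S - T)"
  by (simp add: cbounded_def blinfun.diff_left scaleC_diff_right)

lemma cbounded_compose [simp]: "cbounded S \<Longrightarrow> cbounded T \<Longrightarrow> cbounded (S o\<^sub>L T)"
  by (simp add: cbounded_def)

lemma cbounded_id [simp]: "cbounded id_blinfun"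
  by (simp add: cbounded_def)

lemma cbounded_zero [simp]: "cbounded 0"
  by (simp add: cbounded_def)

lemma cbounded_scaleR [simp]: "cbounded T \<Longrightarrow> cbounded (r *\<^sub>R T)"
  by (simp add: cbounded_def blinfun.scaleR_left scaleR_scaleC scaleC_scaleC mult.commute)

lemma cbounded_scalar_op [simp]: "cbounded (scalar_op c)"
  by (simp add: cbounded_def scalar_op.rep_eq scaleC_scaleC mult.commute)

lemma cbounded_sum [simp]: "(\<And>i. i \<in> I \<Longrightarrow> cbounded (f i)) \<Longrightarrow> cbounded (sum f I)"
  by (induction I rule: infinite_finite_induct) auto

lemma adj_id [simp]: "adj id_blinfun = id_blinfun"
  by (rule adj_eqI) simp

lemma adj_zero [simp]: "adj 0 = 0"
  by (rule adj_eqI) simp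

lemma adj_compose: "cbounded S \<Longrightarrow> cbounded T \<Longrightarrow> adj (S o\<^sub>L T) = adj T o\<^sub>L adj S"
  by (rule adj_eqI) (simp add: cinner_adj)

lemma adj_add: "cbounded S \<Longrightarrow> cbounded T \<Longrightarrow> adj (S + T) = adj S + adj T"
  by (rule adj_eqI) (simp add: blinfun.add_left cinner_add_left cinner_add_right cinner_adj)

lemma adj_diff: "cbounded S \<Longrightarrow> cbounded T \<Longrightarrow> adj (S - T) = adj S - adj T"
  by (rule adj_eqI) (simp add: blinfun.diff_left cinner_diff_left cinner_diff_right cinner_adj)

lemma adj_sum: "(\<And>i. i \<in> I \<Longrightarrow> cbounded (f i)) \<Longrightarrow> adj (sum f I) = (\<Sum>i\<in>I. adj (f i))"
  by (rule adj_eqI) (simp add: blinfun.sum_left cinner_sum_left cinner_sum_right cinner_adj)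

lemma adj_scaleR: "cbounded T \<Longrightarrow> adj (r *\<^sub>R T) = r *\<^sub>R adj T"
  by (rule adj_eqI) (simp add: blinfun.scaleR_left cinner_scaleR_left cinner_scaleR_right cinner_adj)

lemma adj_scalar_op: "adj (scalar_op c) = scalar_op (cnj c)"
  by (rule adj_eqI) (simp add: scalar_op.rep_eq cinner_scaleC_left cinner_scaleC_right)

lemma norm_le_cinnerI:
  assumes "\<And>y. cmod (cinner x y) \<le> C * norm y" "C \<ge> 0"
  shows "norm (x :: 'a :: chilbert_space) \<le> C"
proof (cases "norm x = 0")
  case False
  have "norm x * norm x \<le> C * norm x"
    using assms(1)[of x] by (simp add: cinner_self norm_power norm_mult power2_eq_square)
  then show ?thesis using False by (simp add: mult_le_cancel_right)
qed (use assms in simp)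

lemma norm_adj_le: "cbounded T \<Longrightarrow> norm (adj T) \<le> norm T"
proof (rule norm_blinfun_bound)
  fix y assume T: "cbounded T"
  show "norm (adj T y) \<le> norm T * norm y"
  proof (rule norm_le_cinnerI)
    fix x
    have "cmod (cinner (adj T y) x) \<le> norm y * norm (T x)" by (simp add: T cinner_adj' norm_cinner_le)
    also have "\<dots> \<le> norm y * (norm T * norm x)" by (intro mult_left_mono norm_blinfun) simp
    finally show "cmod (cinner (adj T y) x) \<le> norm T * norm y * norm x" by (simp add: ac_simps)
  qed simp
qed simp

lemma cinner_re_op: "cbounded T \<Longrightarrow> cinner (re_op T x) x = complex_of_real (Re (cinner (T x) x))"
proof -
  assume T: "cbounded T"
  have "cinner (re_op T x) x = (1 / 2) *\<^sub>R (cinner x (T x) + cinner (T x) x)"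
    by (simp add: re_op_def T blinfun.scaleR_left blinfun.add_left cinner_scaleR_left cinner_add_left cinner_adj')
  also have "cinner x (T x) = cnj (cinner (T x) x)" by (rule cinner_commute)
  finally show ?thesis by (simp add: complex_eq_iff)
qed

lemma tendsto_blinfun_apply: "S \<longlonglongrightarrow> T \<Longrightarrow> (\<lambda>n. blinfun_apply (S n) x) \<longlonglongrightarrow> T x"
  by (rule bounded_linear.tendsto[OF blinfun.bounded_linear_left])

lemma cbounded_limit:
  assumes "\<And>n. cbounded (S n)" "S \<longlonglongrightarrow> T"
  shows "cbounded T"
  unfolding cbounded_def
proof (intro allI)
  fix c x
  have "(\<lambda>n. S n (c *\<^sub>C x)) \<longlonglongrightarrow> c *\<^sub>C T x"
    unfolding cbounded_scaleC[OF assms(1)]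
    by (intro tendsto_scaleC tendsto_const tendsto_blinfun_apply assms(2))
  moreover have "(\<lambda>n. S n (c *\<^sub>C x)) \<longlonglongrightarrow> T (c *\<^sub>C x)" by (intro tendsto_blinfun_apply assms(2))
  ultimately show "T (c *\<^sub>C x) = c *\<^sub>C T x" by (rule LIMSEQ_unique[symmetric])
qed

subsection \<open>Extending a bounded map from a family of vectors\<close>

lemma csubspace_closure:
  assumes "csubspace (M :: 'a :: chilbert_space set)" shows "csubspace (closure M)"
proof -
  have "c *\<^sub>C x \<in> closure M" if x: "x \<in> closure M" for c x
  proof -
    obtain s where s: "\<And>n. s n \<in> M" "s \<longlonglongrightarrow> x"
      using x closure_sequential[of x M] by blast
    have "(\<lambda>n. c *\<^sub>C s n) \<longlonglongrightarrow> c *\<^sub>C x" by (intro tendsto_scaleC tendsto_const s)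
    moreover have "\<forall>n. c *\<^sub>C s n \<in> M" using assms s(1) by (simp add: csubspace_scaleC)
    ultimately show ?thesis
      unfolding closure_sequential by (intro exI[of _ "\<lambda>n. c *\<^sub>C s n"] conjI)
  qed
  moreover have "x + y \<in> closure M" if x: "x \<in> closure M" and y: "y \<in> closure M" for x y
  proof -
    obtain s where s: "\<And>n. s n \<in> M" "s \<longlonglongrightarrow> x"
      using x closure_sequential[of x M] by blast
    obtain t where t: "\<And>n. t n \<in> M" "t \<longlonglongrightarrow> y"
      using y closure_sequential[of y M] by blast
    have "\<forall>n. s n + t n \<in> M" using assms s(1) t(1) by (simp add: csubspace_add)
    moreover have "(\<lambda>n. s n + t n) \<longlonglongrightarrow> x + y" by (intro tendsto_add s t)
    ultimately show ?thesis
      unfolding closure_sequential by (intro exI[of _ "\<lambda>n. s n + t n"] conjI)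
  qed
  moreover have "0 \<in> closure M" using assms closure_subset by (auto simp: csubspace_def)
  ultimately show ?thesis by (auto simp: csubspace_def)
qed

lemma sum_scaleC_union:
  fixes x :: "'i \<Rightarrow> 'a :: chilbert_space"
  assumes "finite F" "finite G"
  shows "(\<Sum>i\<in>F. c i *\<^sub>C x i) + (\<Sum>i\<in>G. d i *\<^sub>C x i)
    = (\<Sum>i\<in>F\<union>G. ((if i \<in> F then c i else 0) + (if i \<in> G then d i else 0)) *\<^sub>C x i)"
proof -
  have "(\<Sum>i\<in>F. c i *\<^sub>C x i) = (\<Sum>i\<in>F\<union>G. (if i \<in> F then c i else 0) *\<^sub>C x i)"
    by (rule sum.mono_neutral_cong_left) (auto simp: assms)
  moreover have "(\<Sum>i\<in>G. d i *\<^sub>C x i) = (\<Sum>i\<in>F\<union>G. (if i \<in> G then d i else 0) *\<^sub>C x i)"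
    by (rule sum.mono_neutral_cong_left) (auto simp: assms)
  ultimately show ?thesis by (simp only: scaleC_add_left sum.distrib)
qed

text \<open>The closed span is defined from above, as an intersection; this inclusion presents its
  elements as limits of finite combinations.\<close>

lemma closed_cspan_range_closure:
  fixes x :: "'i \<Rightarrow> 'a :: chilbert_space"
  shows "closed_cspan (range x) \<subseteq> closure {\<Sum>i\<in>F. c i *\<^sub>C x i | F c. finite F}"
proof (rule closed_cspan_least)
  let ?S = "{\<Sum>i\<in>F. c i *\<^sub>C x i | F c. finite F}"
  have memI: "finite F \<Longrightarrow> (\<Sum>i\<in>F. c i *\<^sub>C x i) \<in> ?S" for F c by blast
  have "csubspace ?S"
    unfolding csubspace_def
  proof (intro conjI ballI allI)
    show "0 \<in> ?S" by (rule CollectI, rule exI[of _ "{}"]) simp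
  next
    fix u v assume "u \<in> ?S" "v \<in> ?S"
    then obtain F c G d where u: "u = (\<Sum>i\<in>F. c i *\<^sub>C x i)" "finite F"
      and v: "v = (\<Sum>i\<in>G. d i *\<^sub>C x i)" "finite G" by blast
    have "u + v = (\<Sum>i\<in>F\<union>G. ((if i \<in> F then c i else 0) + (if i \<in> G then d i else 0)) *\<^sub>C x i)"
      unfolding u(1) v(1) by (rule sum_scaleC_union) (rule u(2) v(2))+
    moreover have "finite (F \<union> G)" using u(2) v(2) by simp
    ultimately show "u + v \<in> ?S" by (simp only: memI)
  next
    fix u and a :: complex assume "u \<in> ?S"
    then obtain F c where u: "u = (\<Sum>i\<in>F. c i *\<^sub>C x i)" "finite F" by blast
    then have "a *\<^sub>C u = (\<Sum>i\<in>F. (a * c i) *\<^sub>C x i)" by (simp add: scaleC_sum_right scaleC_scaleC)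
    then show "a *\<^sub>C u \<in> ?S" using memI[of F "\<lambda>i. a * c i"] u(2) by simp
  qed
  then show "csubspace (closure ?S)" by (rule csubspace_closure)
  have "x i \<in> ?S" for i by (rule CollectI, rule exI[of _ "{i}"], rule exI[of _ "\<lambda>_. 1"]) simp
  then show "range x \<subseteq> closure ?S" using closure_subset by blast
qed simp

text \<open>One extension principle serves for functionals, tensor products of operators, shifts and
  intertwiners. The inequality makes \<open>x i \<mapsto> y i\<close> well defined and bounded on
  finite combinations, so it extends to the closed span, and by zero to the orthogonal complement.
  The last two conclusions are kept because they later give orthogonality of ranges and control of
  supports.\<close>

lemma ext_family:
  fixes x :: "'i \<Rightarrow> 'a :: chilbert_space" and y :: "'i \<Rightarrow> 'b :: chilbert_space"
  assumes le: "\<And>F c. finite F \<Longrightarrow> norm (\<Sum>i\<in>F. c i *\<^sub>C y i) \<le> C * norm (\<Sum>i\<in>F. c i *\<^sub>C x i)" and C: "C \<ge> 0"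
  shows "\<exists>T :: 'a \<Rightarrow>\<^sub>L 'b. cbounded T \<and> (\<forall>i. T (x i) = y i) \<and> (\<forall>z. norm (T z) \<le> C * norm z) \<and>
    (\<forall>z. T z \<in> closed_cspan (range y)) \<and> (\<forall>z. (\<forall>i. cinner z (x i) = 0) \<longrightarrow> T z = 0)"
proof -
  define G where "G = {(\<Sum>i\<in>F. c i *\<^sub>C x i, \<Sum>i\<in>F. c i *\<^sub>C y i) | F c. finite F}"
  define M where "M = closed_cspan (range x)"
  \<comment> \<open>\<open>R\<close> is the closure of the graph \<open>G\<close>: the norm
    inequality makes it single valued, and completeness of the target defines it on all of
    \<open>M\<close>.\<close>
  define R where "R u w \<longleftrightarrow> (\<exists>s t. (\<forall>n. (s n, t n) \<in> G) \<and> s \<longlonglongrightarrow> u \<and> t \<longlonglongrightarrow> w)" for u w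
  have GI: "finite F \<Longrightarrow> s = (\<Sum>i\<in>F. c i *\<^sub>C x i) \<Longrightarrow> t = (\<Sum>i\<in>F. c i *\<^sub>C y i) \<Longrightarrow> (s, t) \<in> G" for F c s t
    unfolding G_def by blast
  have Gle: "norm t \<le> C * norm s" if "(s, t) \<in> G" for s t using that le by (auto simp: G_def)
  have Gadd: "(s + s', t + t') \<in> G" if "(s, t) \<in> G" "(s', t') \<in> G" for s t s' t'
  proof -
    obtain F c F' c' where F: "finite F" "finite F'" and
      st: "s = (\<Sum>i\<in>F. c i *\<^sub>C x i)" "t = (\<Sum>i\<in>F. c i *\<^sub>C y i)"
        "s' = (\<Sum>i\<in>F'. c' i *\<^sub>C x i)" "t' = (\<Sum>i\<in>F'. c' i *\<^sub>C y i)"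
      using \<open>(s, t) \<in> G\<close> \<open>(s', t') \<in> G\<close> unfolding G_def by blast
    show ?thesis unfolding st
      by (rule GI[OF _ sum_scaleC_union[OF F] sum_scaleC_union[OF F]]) (use F in simp)
  qed
  have Gscale: "(a *\<^sub>C s, a *\<^sub>C t) \<in> G" if st: "(s, t) \<in> G" for a s t
  proof -
    obtain F c where F: "finite F" and st: "s = (\<Sum>i\<in>F. c i *\<^sub>C x i)" "t = (\<Sum>i\<in>F. c i *\<^sub>C y i)"
      using st unfolding G_def by blast
    have "a *\<^sub>C s = (\<Sum>i\<in>F. (a * c i) *\<^sub>C x i)" "a *\<^sub>C t = (\<Sum>i\<in>F. (a * c i) *\<^sub>C y i)"
      unfolding st by (simp_all add: scaleC_sum_right scaleC_scaleC)
    then show ?thesis by (rule GI[rotated]) (use F in simp)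
  qed
  have Gdiff: "(s - s', t - t') \<in> G" if "(s, t) \<in> G" "(s', t') \<in> G" for s t s' t'
    using Gadd[OF that(1) Gscale[OF that(2), of "-1"]] by (simp add: scaleC_minus_left)
  have Gx: "(x i, y i) \<in> G" for i
    unfolding G_def by (rule CollectI, rule exI[of _ "{i}"], rule exI[of _ "\<lambda>_. 1"]) simp
  have Gspan: "t \<in> closed_cspan (range y)" if st: "(s, t) \<in> G" for s t
  proof -
    have "y i \<in> closed_cspan (range y)" for i by (rule subsetD[OF closed_cspan_superset]) simp
    then show ?thesis using st unfolding G_def
      by (auto intro!: csubspace_sum csubspace_scaleC closed_cspan_csubspace)
  qed
  have Rx: "R (x i) (y i)" for i
    unfolding R_def using Gx by (intro exI[of _ "\<lambda>_. x i"] exI[of _ "\<lambda>_. y i"]) auto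
  have R0: "R 0 0" unfolding R_def using Gscale[OF Gx, of 0]
    by (intro exI[of _ "\<lambda>_. 0"]) auto
  have Rle: "norm w \<le> C * norm u" if uw: "R u w" for u w
  proof -
    obtain s t where st: "\<And>n. (s n, t n) \<in> G" "s \<longlonglongrightarrow> u" "t \<longlonglongrightarrow> w" using uw unfolding R_def by blast
    show ?thesis
      by (rule LIMSEQ_le[OF tendsto_norm[OF st(3)] tendsto_mult[OF tendsto_const tendsto_norm[OF st(2)]]])
        (use Gle[OF st(1)] in blast)
  qed
  have Radd: "R (u + u') (w + w')" if uw: "R u w" "R u' w'" for u w u' w'
  proof -
    obtain s t s' t' where st: "\<And>n. (s n, t n) \<in> G" "s \<longlonglongrightarrow> u" "t \<longlonglongrightarrow> w"
      "\<And>n. (s' n, t' n) \<in> G" "s' \<longlonglongrightarrow> u'" "t' \<longlonglongrightarrow> w'" using uw unfolding R_def by blast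
    show ?thesis unfolding R_def
      by (rule exI[of _ "\<lambda>n. s n + s' n"], rule exI[of _ "\<lambda>n. t n + t' n"])
        (use Gadd[OF st(1,4)] st in \<open>auto intro: tendsto_add\<close>)
  qed
  have Rscale: "R (a *\<^sub>C u) (a *\<^sub>C w)" if uw: "R u w" for a u w
  proof -
    obtain s t where st: "\<And>n. (s n, t n) \<in> G" "s \<longlonglongrightarrow> u" "t \<longlonglongrightarrow> w" using uw unfolding R_def by blast
    show ?thesis unfolding R_def
      by (rule exI[of _ "\<lambda>n. a *\<^sub>C s n"], rule exI[of _ "\<lambda>n. a *\<^sub>C t n"])
        (use Gscale[OF st(1)] st in \<open>auto intro: tendsto_scaleC\<close>)
  qed
  have Runique: "w = w'" if "R u w" "R u w'" for u w w'
  proof -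
    have "R (u + (-1) *\<^sub>C u) (w + (-1) *\<^sub>C w')" using Radd[OF that(1) Rscale[OF that(2)]] .
    from Rle[OF this] show ?thesis by (simp add: scaleC_minus_left)
  qed
  have Rex: "\<exists>w. R u w" if u: "u \<in> M" for u
  proof -
    obtain s where s: "\<And>n. s n \<in> {\<Sum>i\<in>F. c i *\<^sub>C x i | F c. finite F}" "s \<longlonglongrightarrow> u"
      using subsetD[OF closed_cspan_range_closure[of x] u[unfolded M_def]]
      unfolding closure_sequential by blast
    have "\<exists>w. (s n, w) \<in> G" for n using s(1)[of n] by (auto simp: G_def)
    then obtain t where t: "\<And>n. (s n, t n) \<in> G" by metis
    have "Cauchy t"
    proof (rule CauchyI)
      fix e :: real assume e: "e > 0"
      have "Cauchy s" using s(2) by (rule LIMSEQ_imp_Cauchy)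
      \<comment> \<open>The denominator is \<open>C + 1\<close> because \<open>C\<close> may be
        0.\<close>
      then obtain N where N: "\<And>m n. m \<ge> N \<Longrightarrow> n \<ge> N \<Longrightarrow> norm (s m - s n) < e / (C + 1)"
        using CauchyD[of s "e / (C + 1)"] e C by auto
      have "norm (t m - t n) < e" if "m \<ge> N" "n \<ge> N" for m n
      proof -
        have "norm (t m - t n) \<le> C * norm (s m - s n)" by (rule Gle[OF Gdiff[OF t t]])
        also have "\<dots> \<le> C * (e / (C + 1))" using N[OF that] C by (intro mult_left_mono) auto
        also have "\<dots> < e" using e C by (simp add: field_simps)
        finally show ?thesis .
      qed
      then show "\<exists>M. \<forall>m\<ge>M. \<forall>n\<ge>M. norm (t m - t n) < e" by blast
    qed
    then obtain w where "t \<longlonglongrightarrow> w" using Cauchy_convergent_iff convergent_def by blast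
    then show ?thesis unfolding R_def using t s(2) by blast
  qed
  have Mc: "csubspace M" "closed M" unfolding M_def by (rule closed_cspan_csubspace closed_cspan_closed)+
  have xM: "x i \<in> M" for i using closed_cspan_superset[of "range x"] by (auto simp: M_def)
  \<comment> \<open>Composing with the projection makes the map total without enlarging its
    bound.\<close>
  define P where "P = orth_proj M"
  have PM: "P z \<in> M" for z unfolding P_def by (rule orth_proj(1)[OF Mc])
  have Padd: "P (z + z') = P z + P z'" for z z'
    unfolding P_def using orth_proj[OF Mc] 
    by (intro orth_proj_eqI[OF Mc] csubspace_add[OF Mc(1)]) (auto simp: add_diff_add cinner_add_left)
  have Pscale: "P (a *\<^sub>C z) = a *\<^sub>C P z" for a z
    unfolding P_def using orth_proj[OF Mc]
    by (intro orth_proj_eqI[OF Mc] csubspace_scaleC[OF Mc(1)])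
      (auto simp: scaleC_diff_right[symmetric] cinner_scaleC_left)
  have Px: "P (x i) = x i" for i unfolding P_def by (rule orth_proj_eqI[OF Mc]) (simp_all add: xM)
  define f where "f z = (THE w. R (P z) w)" for z
  have f: "R (P z) (f z)" for z
    unfolding f_def by (rule theI') (use Rex[OF PM] Runique in blast)
  have feq: "f z = w" if "R (P z) w" for z w using Runique[OF f that] .
  have fle: "norm (f z) \<le> C * norm z" for z
  proof -
    have "C * norm (P z) \<le> C * norm z" unfolding P_def by (intro mult_left_mono norm_orth_proj_le Mc C)
    then show ?thesis using Rle[OF f[of z]] by linarith
  qed
  have fscale: "f (a *\<^sub>C z) = a *\<^sub>C f z" for a z by (rule feq) (use Rscale[OF f] in \<open>simp add: Pscale\<close>)
  have fb: "bounded_linear f"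
  proof (rule bounded_linear_intro)
    show "f (z + z') = f z + f z'" for z z' by (rule feq) (use Radd[OF f f] in \<open>simp add: Padd\<close>)
    show "f (r *\<^sub>R z) = r *\<^sub>R f z" for r z by (simp add: scaleR_scaleC fscale)
    show "norm (f z) \<le> norm z * C" for z using fle by (simp add: mult.commute)
  qed
  show ?thesis
  proof (intro exI[of _ "Blinfun f"] conjI allI impI)
    show "cbounded (Blinfun f)" by (simp add: cbounded_def bounded_linear_Blinfun_apply[OF fb] fscale)
    show "Blinfun f (x i) = y i" for i
      by (simp add: bounded_linear_Blinfun_apply[OF fb]) (rule feq, simp add: Px Rx)
    show "norm (Blinfun f z) \<le> C * norm z" for z by (simp add: bounded_linear_Blinfun_apply[OF fb] fle)
    show "Blinfun f z \<in> closed_cspan (range y)" for z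
    proof -
      obtain s t where st: "\<And>n. (s n, t n) \<in> G" "t \<longlonglongrightarrow> f z" using f[of z] unfolding R_def by blast
      then have "f z \<in> closed_cspan (range y)"
        using closed_sequentially[OF closed_cspan_closed] Gspan by blast
      then show ?thesis by (simp add: bounded_linear_Blinfun_apply[OF fb])
    qed
    show "Blinfun f z = 0" if z: "\<forall>i. cinner z (x i) = 0" for z
    proof -
      have "cinner z u = 0" if "u \<in> M" for u
        using closed_cspan_orthogonal[of "range x" z u] that z by (auto simp: M_def)
      then have "P z = 0"
        unfolding P_def using Mc(1) by (intro orth_proj_eqI[OF Mc]) (auto simp: csubspace_def)
      then show ?thesis by (simp add: bounded_linear_Blinfun_apply[OF fb]) (rule feq, simp add: R0)
    qed
  qed
qed

section \<open>Square summable families\<close>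

lemma ell2_eqI: "(\<And>i. ell2_nth f i = ell2_nth g i) \<Longrightarrow> f = g"
  by (simp add: ell2_nth_inject[symmetric] fun_eq_iff)

lift_definition ket :: "'i \<Rightarrow> ('i, complex) ell2" is "\<lambda>j i. if i = j then 1 else 0"
proof -
  fix j :: 'i
  have "{i \<in> UNIV. (norm (if i = j then 1 else 0 :: complex))\<^sup>2 \<noteq> 0} \<subseteq> {j}" by auto
  then show "(\<lambda>i. (norm (if i = j then 1 else 0 :: complex))\<^sup>2) summable_on UNIV"
    by (intro finite_nonzero_values_imp_summable_on) (rule finite_subset, auto)
qed

lemma cinner_ell2: "((\<lambda>i. cinner (ell2_nth f i) (ell2_nth g i)) has_sum cinner f g) UNIV"
  unfolding cinner_ell2_def by (rule has_sum_infsum) (rule ell2_cinner_summable)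

lemma cinner_ell2_eqI:
  "((\<lambda>i. cinner (ell2_nth f i) (ell2_nth g i)) has_sum s) UNIV \<Longrightarrow> cinner f g = s"
  using has_sum_unique[OF cinner_ell2] .

lemma bounded_linear_ell2_nth: "bounded_linear (\<lambda>f. ell2_nth f i)"
  by (rule bounded_linear_intro[where K = 1])
    (simp_all add: plus_ell2.rep_eq scaleR_ell2.rep_eq norm_ell2_nth_le)

lemmas ell2_nth_sum = linear_sum[OF bounded_linear.linear[OF bounded_linear_ell2_nth]]
  and ell2_nth_zero [simp] = linear_0[OF bounded_linear.linear[OF bounded_linear_ell2_nth]]
  and ell2_nth_add = linear_add[OF bounded_linear.linear[OF bounded_linear_ell2_nth]]
  and ell2_nth_diff = linear_diff[OF bounded_linear.linear[OF bounded_linear_ell2_nth]]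
  and tendsto_ell2_nth = bounded_linear.tendsto[OF bounded_linear_ell2_nth]

lemma ell2_nth_tensor_ket: "ell2_nth (tensor_vec x (ket i)) j = (if j = i then x else 0)"
  by (simp add: tensor_vec.rep_eq ket.rep_eq)

lemma cinner_tensor_ket: "cinner f (tensor_vec x (ket i)) = cinner (ell2_nth f i) x"
  by (rule cinner_ell2_eqI, rule has_sum_finite_neutralI[of "{i}"]) (auto simp: ell2_nth_tensor_ket)

lemma cinner_ket: "cinner f (ket i) = ell2_nth f i"
  by (rule cinner_ell2_eqI, rule has_sum_finite_neutralI[of "{i}"])
    (auto simp: ket.rep_eq cinner_complex_def)

lemma cinner_tensor_vec: "cinner (tensor_vec x e) (tensor_vec y g) = cinner x y * cinner e g"
proof (rule cinner_ell2_eqI)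
  have "((\<lambda>i. cinner x y * cinner (ell2_nth e i) (ell2_nth g i)) has_sum cinner x y * cinner e g) UNIV"
    by (rule has_sum_cmult_right) (rule cinner_ell2)
  then show "((\<lambda>i. cinner (ell2_nth (tensor_vec x e) i) (ell2_nth (tensor_vec y g) i)) has_sum
      cinner x y * cinner e g) UNIV"
    by (simp add: tensor_vec.rep_eq cinner_scaleC_left cinner_scaleC_right cinner_complex_def ac_simps)
qed

lemma norm_tensor_vec: "norm (tensor_vec x e) = norm x * norm e"
proof -
  have "complex_of_real ((norm (tensor_vec x e))\<^sup>2) = complex_of_real ((norm x * norm e)\<^sup>2)"
    unfolding cinner_self[symmetric] cinner_tensor_vec power_mult_distrib by (simp add: cinner_self)
  then have "(norm (tensor_vec x e))\<^sup>2 = (norm x * norm e)\<^sup>2" using of_real_eq_iff by blast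
  then show ?thesis by (simp add: power2_eq_iff_nonneg)
qed

lemma bounded_bilinear_tensor_vec:
  "bounded_bilinear (tensor_vec :: 'h :: chilbert_space \<Rightarrow> ('i, complex) ell2 \<Rightarrow> ('i, 'h) ell2)"
proof
  show "tensor_vec (x + x') e = tensor_vec x e + tensor_vec x' e" for x x' :: 'h and e :: "('i, complex) ell2"
    by (rule ell2_eqI) (simp add: tensor_vec.rep_eq plus_ell2.rep_eq scaleC_add_right)
  show "tensor_vec x (e + e') = tensor_vec x e + tensor_vec x e'" for x :: 'h and e e' :: "('i, complex) ell2"
    by (rule ell2_eqI) (simp add: tensor_vec.rep_eq plus_ell2.rep_eq scaleC_add_left)
  show "tensor_vec (r *\<^sub>R x) e = r *\<^sub>R tensor_vec x e" for r and x :: 'h and e :: "('i, complex) ell2"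
    by (rule ell2_eqI)
      (simp add: tensor_vec.rep_eq scaleR_ell2.rep_eq
        bounded_bilinear.scaleR_right[OF bounded_bilinear_scaleC])
  show "tensor_vec x (r *\<^sub>R e) = r *\<^sub>R tensor_vec x e" for r and x :: 'h and e :: "('i, complex) ell2"
    by (rule ell2_eqI)
      (simp add: tensor_vec.rep_eq scaleR_ell2.rep_eq
        bounded_bilinear.scaleR_left[OF bounded_bilinear_scaleC])
  show "\<exists>K. \<forall>(x :: 'h) (e :: ('i, complex) ell2). norm (tensor_vec x e) \<le> norm x * norm e * K"
    by (rule exI[of _ 1]) (simp add: norm_tensor_vec)
qed

lemmas tensor_vec_zero_left [simp] = bounded_bilinear.zero_left[OF bounded_bilinear_tensor_vec]
  and tensor_vec_zero_right [simp] = bounded_bilinear.zero_right[OF bounded_bilinear_tensor_vec]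
  and tensor_vec_sum_right = bounded_bilinear.sum_right[OF bounded_bilinear_tensor_vec]

lemma tensor_vec_scaleC_left: "tensor_vec (c *\<^sub>C x) e = c *\<^sub>C tensor_vec x e"
  by (rule ell2_eqI) (simp add: tensor_vec.rep_eq scaleC_ell2.rep_eq scaleC_scaleC mult.commute)

text \<open>Truncation to \<open>F\<close> is an orthogonal projection, so the squared error is the
  tail of a convergent sum.\<close>

lemma ell2_truncation_tendsto:
  "((\<lambda>F. \<Sum>i\<in>F. tensor_vec (ell2_nth f i) (ket i)) \<longlongrightarrow> f) (finite_subsets_at_top UNIV)"
proof -
  have eq: "(norm (f - (\<Sum>i\<in>F. tensor_vec (ell2_nth f i) (ket i))))\<^sup>2
      = (norm f)\<^sup>2 - (\<Sum>i\<in>F. (norm (ell2_nth f i))\<^sup>2)" if "finite F" for F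
  proof -
    let ?g = "\<Sum>i\<in>F. tensor_vec (ell2_nth f i) (ket i)"
    have nth: "ell2_nth ?g j = (if j \<in> F then ell2_nth f j else 0)" for j
      using that by (simp add: ell2_nth_sum ell2_nth_tensor_ket)
    have "cinner f ?g = (\<Sum>i\<in>F. cinner (ell2_nth f i) (ell2_nth f i))"
      by (simp add: cinner_sum_right cinner_tensor_ket)
    moreover have "cinner ?g ?g = (\<Sum>i\<in>F. cinner (ell2_nth f i) (ell2_nth f i))"
      by (subst (2) sum.cong[OF refl refl], simp only: cinner_sum_right cinner_tensor_ket nth)
        (simp add: cinner_sum_right cinner_tensor_ket nth)
    ultimately have "inner f ?g = (\<Sum>i\<in>F. (norm (ell2_nth f i))\<^sup>2)"
      "inner ?g ?g = (\<Sum>i\<in>F. (norm (ell2_nth f i))\<^sup>2)"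
      by (simp_all add: inner_eq_Re_cinner cinner_self)
    then show ?thesis
      by (simp add: power2_norm_eq_inner inner_diff_left inner_diff_right inner_commute)
  qed
  have "((\<lambda>F. \<Sum>i\<in>F. (norm (ell2_nth f i))\<^sup>2) \<longlongrightarrow> (norm f)\<^sup>2) (finite_subsets_at_top UNIV)"
    unfolding norm_ell2_square has_sum_def[symmetric] by (rule has_sum_infsum) (rule ell2_summable)
  then have "((\<lambda>F. (norm f)\<^sup>2 - (\<Sum>i\<in>F. (norm (ell2_nth f i))\<^sup>2)) \<longlongrightarrow> (norm f)\<^sup>2 - (norm f)\<^sup>2)
      (finite_subsets_at_top UNIV)"
    by (intro tendsto_diff tendsto_const)
  then have "((\<lambda>F. sqrt ((norm f)\<^sup>2 - (\<Sum>i\<in>F. (norm (ell2_nth f i))\<^sup>2))) \<longlongrightarrow> sqrt 0)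
      (finite_subsets_at_top UNIV)"
    by (intro tendsto_real_sqrt) simp
  moreover have "\<forall>\<^sub>F F in finite_subsets_at_top UNIV.
      sqrt ((norm f)\<^sup>2 - (\<Sum>i\<in>F. (norm (ell2_nth f i))\<^sup>2))
        = norm (f - (\<Sum>i\<in>F. tensor_vec (ell2_nth f i) (ket i)))"
    by (intro eventually_finite_subsets_at_top_weakI) (simp add: eq[symmetric])
  ultimately have "((\<lambda>F. norm (f - (\<Sum>i\<in>F. tensor_vec (ell2_nth f i) (ket i)))) \<longlongrightarrow> 0)
      (finite_subsets_at_top UNIV)"
    unfolding real_sqrt_zero by (rule Lim_transform_eventually)
  then have "((\<lambda>F. f - (\<Sum>i\<in>F. tensor_vec (ell2_nth f i) (ket i))) \<longlongrightarrow> 0) (finite_subsets_at_top UNIV)"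
    by (rule tendsto_norm_zero_cancel)
  from tendsto_diff[OF tendsto_const[of f] this] show ?thesis by simp
qed

text \<open>Truncations of an element supported in \<open>J\<close> only involve indices from
  \<open>J\<close>. Hence closed conditions, such as equality or positivity of operators, need only
  be checked on finite sums of elementary tensors.\<close>

lemma ell2_on_dense:
  assumes C: "closed C" and f: "f \<in> ell2_on J"
    and fin: "\<And>F x. finite F \<Longrightarrow> F \<subseteq> J \<Longrightarrow> (\<Sum>i\<in>F. tensor_vec (x i) (ket i)) \<in> C"
  shows "f \<in> C"
proof (rule Lim_in_closed_set[OF C _ _ ell2_truncation_tendsto])
  have "(\<Sum>i\<in>F. tensor_vec (ell2_nth f i) (ket i)) \<in> C" if "finite F" for F
  proof -
    have "(\<Sum>i\<in>F. tensor_vec (ell2_nth f i) (ket i)) = (\<Sum>i\<in>F \<inter> J. tensor_vec (ell2_nth f i) (ket i))"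
      using that f by (intro sum.mono_neutral_right) (auto simp: ell2_on_def)
    then show ?thesis using fin[of "F \<inter> J" "ell2_nth f"] that by simp
  qed
  then show "\<forall>\<^sub>F F in finite_subsets_at_top UNIV. (\<Sum>i\<in>F. tensor_vec (ell2_nth f i) (ket i)) \<in> C"
    by (intro eventually_finite_subsets_at_top_weakI)
qed simp

lemma ell2_on_UNIV [simp]: "ell2_on UNIV = UNIV"
  by (simp add: ell2_on_def)

lemma ell2_dense:
  assumes "closed C" "\<And>F x. finite F \<Longrightarrow> (\<Sum>i\<in>F. tensor_vec (x i) (ket i)) \<in> C"
  shows "f \<in> C"
  by (rule ell2_on_dense[OF assms(1), of f UNIV]) (simp_all add: assms(2))

section \<open>Positive semidefinite kernels\<close>

text \<open>The conjugate belongs to the second index, so Gram kernels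
  \<open>cinner (u i) (u j)\<close> fit as they stand. In \<open>kernel_positive\<close> the vector
  of the second argument comes first in the inner product, so a passage between the two notions
  exchanges the arguments.\<close>

definition psd_kernel :: "('i \<Rightarrow> 'i \<Rightarrow> complex) \<Rightarrow> bool" where
  "psd_kernel k \<longleftrightarrow>
    (\<forall>(N :: nat) \<sigma> c. (\<Sum>i<N. \<Sum>j<N. c i * cnj (c j) * k (\<sigma> i) (\<sigma> j)) \<in> \<real>\<^sub>\<ge>\<^sub>0)"

lemma psd_kernel_pullback:
  assumes "psd_kernel k" shows "psd_kernel (\<lambda>i j. k (f i) (f j))"
  unfolding psd_kernel_def
proof (intro allI)
  fix N :: nat and \<sigma> c
  show "(\<Sum>i<N. \<Sum>j<N. c i * cnj (c j) * k (f (\<sigma> i)) (f (\<sigma> j))) \<in> \<real>\<^sub>\<ge>\<^sub>0"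
    using assms[unfolded psd_kernel_def, rule_format, where N = N and c = c and \<sigma> = "\<lambda>i. f (\<sigma> i)"] .
qed

lemma sum_sum_reindex_nat:
  assumes "finite I"
  obtains e :: "nat \<Rightarrow> 'a" where "bij_betw e {..<card I} I"
    "\<And>f :: 'a \<Rightarrow> 'a \<Rightarrow> 'b :: comm_monoid_add.
      (\<Sum>i\<in>I. \<Sum>j\<in>I. f i j) = (\<Sum>i<card I. \<Sum>j<card I. f (e i) (e j))"
proof -
  obtain e where e: "bij_betw e {..<card I} I"
    using ex_bij_betw_nat_finite[OF assms] by (auto simp: atLeast0LessThan)
  have "(\<Sum>i\<in>I. \<Sum>j\<in>I. f i j) = (\<Sum>i<card I. \<Sum>j<card I. f (e i) (e j))"
    for f :: "'a \<Rightarrow> 'a \<Rightarrow> 'b"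
    by (simp add: sum.reindex_bij_betw[OF e, symmetric])
  with e show thesis by (rule that)
qed

lemma psd_kernelD:
  assumes "psd_kernel k" "finite I"
  shows "(\<Sum>i\<in>I. \<Sum>j\<in>I. c i * cnj (c j) * k (\<sigma> i) (\<sigma> j)) \<in> \<real>\<^sub>\<ge>\<^sub>0"
proof -
  obtain e where "\<And>f :: _ \<Rightarrow> _ \<Rightarrow> complex.
      (\<Sum>i\<in>I. \<Sum>j\<in>I. f i j) = (\<Sum>i<card I. \<Sum>j<card I. f (e i) (e j))"
    using sum_sum_reindex_nat[OF assms(2)] by blast
  then show ?thesis
    using assms(1)[unfolded psd_kernel_def, rule_format, where N = "card I" and c = "\<lambda>i. c (e i)"
        and \<sigma> = "\<lambda>i. \<sigma> (e i)"] by simp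
qed

lemma psd_kernel_diag: "psd_kernel k \<Longrightarrow> k i i \<in> \<real>\<^sub>\<ge>\<^sub>0"
  using psd_kernelD[where k = k and I = "{()}" and c = "\<lambda>_. 1" and \<sigma> = "\<lambda>_. i"] by simp

text \<open>The form is real at the coefficient pairs \<open>(1, 1)\<close> and
  \<open>(1, \<i>)\<close>; the first gives the imaginary part, the second the real part.\<close>

lemma psd_kernel_hermitian:
  assumes k: "psd_kernel k" shows "k j i = cnj (k i j)"
proof -
  define \<sigma> where "\<sigma> b = (if b then i else j)" for b
  have ii: "Im (k i i) = 0" "Im (k j j) = 0"
    using psd_kernel_diag[OF k] by (auto simp: complex_nonneg_Reals_iff)
  have "Im (k i j) + Im (k j i) = 0"
    using psd_kernelD[OF k finite, where I = UNIV and c = "\<lambda>_. 1" and \<sigma> = \<sigma>] ii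
    by (simp add: UNIV_bool \<sigma>_def complex_nonneg_Reals_iff)
  moreover have "Re (k j i) - Re (k i j) = 0"
    using psd_kernelD[OF k finite, where I = UNIV and c = "\<lambda>b. if b then 1 else \<i>" and \<sigma> = \<sigma>] ii
    by (simp add: UNIV_bool \<sigma>_def complex_nonneg_Reals_iff)
  ultimately show ?thesis by (simp add: complex_eq_iff)
qed

text \<open>Cauchy-Schwarz for the semi-inner product of \<open>k\<close>, available before any Gram
  vectors exist: subtracting \<open>t * a\<close> times the point \<open>i\<close> from the
  combination leaves a nonnegative quadratic polynomial in \<open>t\<close>.\<close>

lemma psd_kernel_cauchy_schwarz:
  fixes c :: "'i \<Rightarrow> complex"
  assumes k: "psd_kernel k" and F: "finite F"
  shows "(cmod (\<Sum>j\<in>F. c j * k j i))\<^sup>2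
    \<le> Re (\<Sum>a\<in>F. \<Sum>b\<in>F. c a * cnj (c b) * k a b) * Re (k i i)"
proof -
  define a where "a = (\<Sum>j\<in>F. c j * k j i)"
  define q where "q = Re (\<Sum>a\<in>F. \<Sum>b\<in>F. c a * cnj (c b) * k a b)"
  define b where "b = Re (k i i)"
  have b: "b \<ge> 0" "k i i = complex_of_real b"
    using psd_kernel_diag[OF k, of i] by (auto simp: complex_nonneg_Reals_iff b_def complex_eq_iff)
  have caa: "cnj a * a = complex_of_real ((cmod a)\<^sup>2)" by (metis complex_norm_square mult.commute)
  have Q: "0 \<le> q - 2 * t * (cmod a)\<^sup>2 + t\<^sup>2 * (cmod a)\<^sup>2 * b" for t :: real
  proof -
    define s where "s = - (complex_of_real t * a)"
    \<comment> \<open>\<open>None\<close> stands for an additional copy of the point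
      \<open>i\<close>, which may also occur in \<open>F\<close>.\<close>
    define d where "d m = (case m of None \<Rightarrow> s | Some j \<Rightarrow> c j)" for m
    define \<sigma> where "\<sigma> m = (case m of None \<Rightarrow> i | Some j \<Rightarrow> j)" for m
    have sumI: "(\<Sum>m\<in>insert None (Some ` F). f m) = f None + (\<Sum>j\<in>F. f (Some j))" for f :: "_ \<Rightarrow> complex"
      using F by (subst sum.insert) (auto simp: sum.reindex)
    have "0 \<le> Re (\<Sum>m\<in>insert None (Some ` F). \<Sum>m'\<in>insert None (Some ` F).
        d m * cnj (d m') * k (\<sigma> m) (\<sigma> m'))"
      using psd_kernelD[OF k, where I = "insert None (Some ` F)" and c = d and \<sigma> = \<sigma>] F by (simp add: complex_nonneg_Reals_iff)
    also have "(\<Sum>m\<in>insert None (Some ` F). \<Sum>m'\<in>insert None (Some ` F). d m * cnj (d m') * k (\<sigma> m) (\<sigma> m'))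
        = s * cnj s * k i i + s * (\<Sum>j\<in>F. cnj (c j) * k i j) + cnj s * a
          + (\<Sum>a\<in>F. \<Sum>b\<in>F. c a * cnj (c b) * k a b)"
      unfolding sumI d_def \<sigma>_def
      by (simp add: sum.distrib sum_distrib_left a_def ac_simps)
    also have "(\<Sum>j\<in>F. cnj (c j) * k i j) = cnj a"
      by (simp add: a_def psd_kernel_hermitian[OF k, of i])
    also have "s * cnj s = complex_of_real (t\<^sup>2 * (cmod a)\<^sup>2)"
      using caa by (simp add: s_def power2_eq_square) (metis mult.assoc mult.commute mult.left_commute)
    also have "s * cnj a = - complex_of_real (t * (cmod a)\<^sup>2)"
      using caa by (simp add: s_def) (metis mult.assoc mult.commute)
    also have "cnj s * a = - complex_of_real (t * (cmod a)\<^sup>2)"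
      using caa by (simp add: s_def)
    finally show ?thesis by (simp add: q_def b(2))
  qed
  have "(cmod a)\<^sup>2 \<le> q * b"
  proof (cases "b = 0")
    case True
    have "cmod a = 0"
    proof (rule ccontr)
      assume "cmod a \<noteq> 0"
      \<comment> \<open>If \<open>b = 0\<close> the polynomial is linear in \<open>t\<close>, and
        this \<open>t\<close> gives it the value -1.\<close>
      then show False using Q[of "(q + 1) / (2 * (cmod a)\<^sup>2)"] True by simp
    qed
    then show ?thesis using True by simp
  next
    case False
    then have "0 \<le> q - (cmod a)\<^sup>2 / b" using Q[of "1 / b"] by (simp add: field_simps power2_eq_square)
    then show ?thesis using False b(1) by (simp add: field_simps)
  qed
  then show ?thesis by (simp add: a_def q_def b_def)
qed

lemma ell2_on_mono: "I \<subseteq> J \<Longrightarrow> ell2_on I \<subseteq> ell2_on J"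
  by (auto simp: ell2_on_def)

lemma ell2_on_add: "f \<in> ell2_on J \<Longrightarrow> g \<in> ell2_on J \<Longrightarrow> f + g \<in> ell2_on J"
  by (simp add: ell2_on_def ell2_nth_add)

text \<open>One step of the factorisation. The required values \<open>k j n\<close> define a
  functional on the span of the vectors found so far, bounded by the square root of
  \<open>k n n\<close> by Cauchy-Schwarz, and Riesz represents it by \<open>p\<close>. The norm
  still missing is put on the fresh basis vector \<open>ket n\<close>, which is orthogonal to
  \<open>p\<close> and to all earlier vectors.\<close>

lemma psd_kernel_extend:
  fixes v :: "nat \<Rightarrow> seq_space"
  assumes k: "psd_kernel k"
    and v: "\<And>i j. i < n \<Longrightarrow> j < n \<Longrightarrow> cinner (v i) (v j) = k i j" "\<And>i. i < n \<Longrightarrow> v i \<in> ell2_on {..<n}"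
  obtains w where "w \<in> ell2_on {..n}" "\<And>j. j < n \<Longrightarrow> cinner (v j) w = k j n" "cinner w w = k n n"
proof -
  define x where "x i = (if i < n then v i else 0)" for i
  define y where "y i = (if i < n then k i n else 0)" for i
  define C where "C = sqrt (Re (k n n))"
  have knn: "Re (k n n) \<ge> 0" "k n n = complex_of_real (Re (k n n))"
    using psd_kernel_diag[OF k, of n] by (auto simp: complex_nonneg_Reals_iff complex_eq_iff)
  have C: "C \<ge> 0" "C\<^sup>2 = Re (k n n)" using knn by (simp_all add: C_def)
  have le: "norm (\<Sum>i\<in>F. c i *\<^sub>C y i) \<le> C * norm (\<Sum>i\<in>F. c i *\<^sub>C x i)" if F: "finite F" for F c
  proof (rule power2_le_imp_le)
    define G where "G = F \<inter> {..<n}"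
    have G: "finite G" using F by (simp add: G_def)
    have "(\<Sum>i\<in>F. c i *\<^sub>C y i) = (\<Sum>i\<in>G. c i * k i n)"
      unfolding G_def using F by (intro sum.mono_neutral_cong_right) (auto simp: y_def scaleC_complex_def)
    moreover have "(\<Sum>i\<in>F. c i *\<^sub>C x i) = (\<Sum>i\<in>G. c i *\<^sub>C v i)"
      unfolding G_def using F by (intro sum.mono_neutral_cong_right) (auto simp: x_def)
    moreover have "complex_of_real ((norm (\<Sum>i\<in>G. c i *\<^sub>C v i))\<^sup>2) = (\<Sum>a\<in>G. \<Sum>b\<in>G. c a * cnj (c b) * k a b)"
      unfolding norm_sum_square
      by (subst sum.swap, intro sum.cong refl)
        (simp add: cinner_scaleC_left cinner_scaleC_right v(1) G_def)
    then have "(norm (\<Sum>i\<in>G. c i *\<^sub>C v i))\<^sup>2 = Re (\<Sum>a\<in>G. \<Sum>b\<in>G. c a * cnj (c b) * k a b)"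
      by (metis Re_complex_of_real)
    ultimately show "(norm (\<Sum>i\<in>F. c i *\<^sub>C y i))\<^sup>2 \<le> (C * norm (\<Sum>i\<in>F. c i *\<^sub>C x i))\<^sup>2"
      using psd_kernel_cauchy_schwarz[OF k G, of c n] by (simp add: power_mult_distrib C(2) mult.commute)
  qed (simp add: C)
  obtain T :: "seq_space \<Rightarrow>\<^sub>L complex" where T: "cbounded T" "\<And>i. T (x i) = y i"
      "\<And>z. norm (T z) \<le> C * norm z" "\<And>z. T z \<in> closed_cspan (range y)"
      "\<And>z. (\<And>i. cinner z (x i) = 0) \<Longrightarrow> T z = 0"
    using ext_family[OF le C(1)] by meson
  obtain p where p: "\<And>z. T z = cinner z p"
    using riesz[of T] T(1) by (auto simp: cbounded_def scaleC_complex_def)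
  have np: "norm p \<le> C"
  proof (rule norm_le_cinnerI[OF _ C(1)])
    show "cmod (cinner p z) \<le> C * norm z" for z
      using T(3)[of z] by (metis p cinner_commute complex_mod_cnj)
  qed
  \<comment> \<open>The functional vanishes on the orthogonal complement of the earlier vectors, and
    every \<open>ket m\<close> with \<open>m \<ge> n\<close> lies there.\<close>
  have pn: "p \<in> ell2_on {..<n}"
    unfolding ell2_on_def
  proof (intro CollectI allI impI)
    fix m assume m: "m \<notin> {..<n}"
    have "cinner (x i) (ket m) = 0" for i
      using v(2)[of i] m by (simp add: cinner_ket x_def ell2_on_def)
    then have "cinner (ket m) (x i) = 0" for i by (metis cinner_commute complex_cnj_zero)
    then have "cinner (ket m) p = 0" using T(5) p by metis
    then have "cinner p (ket m) = 0" by (metis cinner_commute complex_cnj_zero)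
    then show "ell2_nth p m = 0" by (simp add: cinner_ket)
  qed
  define r where "r = sqrt (C\<^sup>2 - (norm p)\<^sup>2)"
  have r: "r\<^sup>2 = C\<^sup>2 - (norm p)\<^sup>2" unfolding r_def using np by (simp add: power_mono)
  have ketn: "ket n \<in> ell2_on {..n}" by (auto simp: ell2_on_def ket.rep_eq)
  have "cinner (ket n) (ket n) = 1" by (simp add: cinner_ket ket.rep_eq)
  then have "(norm (ket n))\<^sup>2 = 1" unfolding cinner_self using of_real_eq_1_iff by blast
  moreover have "cinner p (ket n) = 0" using pn by (simp add: cinner_ket ell2_on_def)
  ultimately have "(norm (p + r *\<^sub>R ket n))\<^sup>2 = (norm p)\<^sup>2 + r\<^sup>2"
    by (simp add: norm_add_square cinner_scaleR_right power_mult_distrib)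
  then have "cinner (p + r *\<^sub>R ket n) (p + r *\<^sub>R ket n) = k n n"
    unfolding cinner_self using r C(2) knn(2) by simp
  moreover have "cinner (v j) (p + r *\<^sub>R ket n) = k j n" if "j < n" for j
  proof -
    have "cinner (v j) (ket n) = 0" using v(2)[OF that] by (simp add: cinner_ket ell2_on_def)
    moreover have "cinner (v j) p = k j n" using T(2)[of j] that p by (simp add: x_def y_def)
    ultimately show ?thesis by (simp add: cinner_add_right cinner_scaleR_right)
  qed
  moreover have "p + r *\<^sub>R ket n \<in> ell2_on {..n}"
    using pn ketn by (auto simp: ell2_on_def ell2_nth_add scaleR_ell2.rep_eq)
  ultimately show thesis using that by blast
qed

text \<open>The construction is the Cholesky factorisation: the \<open>n\<close>-th vector has support in \<open>{..n}\<close>.\<close>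

lemma psd_kernel_vectors_nat:
  fixes k :: "nat \<Rightarrow> nat \<Rightarrow> complex"
  assumes k: "psd_kernel k"
  shows "\<exists>v :: nat \<Rightarrow> seq_space. \<forall>i j. cinner (v i) (v j) = k i j"
proof -
  define P where "P n v \<longleftrightarrow> (\<forall>i<n. \<forall>j<n. cinner (v i) (v j) = k i j) \<and> (\<forall>i<n. v i \<in> ell2_on {..<n})"
    for n and v :: "nat \<Rightarrow> seq_space"
  define Q where "Q n v w \<longleftrightarrow> (\<forall>i<n. w i = v i)" for n :: nat and v w :: "nat \<Rightarrow> seq_space"
  have "\<exists>f. \<forall>n. P n (f n) \<and> Q n (f n) (f (Suc n))"
  proof (rule dependent_nat_choice)
    show "\<exists>v. P 0 v" by (simp add: P_def)
    fix v n assume v: "P n v"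
    then obtain w where w: "w \<in> ell2_on {..n}" "\<And>j. j < n \<Longrightarrow> cinner (v j) w = k j n" "cinner w w = k n n"
      using psd_kernel_extend[OF k, of n v] unfolding P_def by blast
    have w': "cinner w (v j) = k n j" if "j < n" for j
      using w(2)[OF that] psd_kernel_hermitian[OF k, of n j] by (metis cinner_commute)
    have "P (Suc n) (v(n := w))"
      unfolding P_def
    proof (intro conjI allI impI)
      fix i j assume "i < Suc n" "j < Suc n"
      then show "cinner ((v(n := w)) i) ((v(n := w)) j) = k i j"
        using v w w' by (auto simp: P_def less_Suc_eq)
    next
      fix i assume "i < Suc n"
      moreover have "ell2_on {..<n} \<subseteq> ell2_on {..<Suc n}" by (rule ell2_on_mono) auto
      ultimately show "(v(n := w)) i \<in> ell2_on {..<Suc n}"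
        using v w by (auto simp: P_def less_Suc_eq lessThan_Suc_atMost)
    qed
    then show "\<exists>w. P (Suc n) w \<and> Q n v w" by (intro exI[of _ "v(n := w)"]) (simp add: Q_def)
  qed
  then obtain f where f: "\<And>n. P n (f n)" "\<And>n. Q n (f n) (f (Suc n))" by blast
  have stable: "f m i = f (Suc i) i" if "Suc i \<le> m" for i m
    using that by (induction m rule: dec_induct) (use f(2) in \<open>auto simp: Q_def\<close>)
  have "cinner (f (Suc i) i) (f (Suc j) j) = k i j" for i j
  proof -
    define m where "m = Suc (max i j)"
    have "cinner (f m i) (f m j) = k i j" using f(1)[of m] by (auto simp: P_def m_def)
    then show ?thesis using stable[of i m] stable[of j m] by (simp add: m_def)
  qed
  then show ?thesis by (intro exI[of _ "\<lambda>i. f (Suc i) i"]) blast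
qed

lemma psd_kernel_vectors:
  fixes k :: "'i :: countable \<Rightarrow> 'i \<Rightarrow> complex"
  assumes k: "psd_kernel k"
  obtains u :: "'i \<Rightarrow> seq_space" where "\<And>i j. cinner (u i) (u j) = k i j"
proof -
  obtain v :: "nat \<Rightarrow> seq_space" where "\<And>i j. cinner (v i) (v j) = k (from_nat i) (from_nat j)"
    using psd_kernel_vectors_nat[OF psd_kernel_pullback[OF k, of from_nat]] by blast
  then show thesis using that[of "\<lambda>i. v (to_nat i)"] by simp
qed

lemma psd_kernel_cinner: "psd_kernel (\<lambda>i j. cinner (x i) (x j :: 'a :: chilbert_space))"
  unfolding psd_kernel_def
proof (intro allI)
  fix N :: nat and \<sigma> c
  have "(\<Sum>i<N. \<Sum>j<N. c i * cnj (c j) * cinner (x (\<sigma> i)) (x (\<sigma> j)))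
      = complex_of_real ((norm (\<Sum>i<N. c i *\<^sub>C x (\<sigma> i)))\<^sup>2)"
    unfolding norm_sum_square
    by (subst sum.swap) (simp add: cinner_scaleC_left cinner_scaleC_right ac_simps)
  then show "(\<Sum>i<N. \<Sum>j<N. c i * cnj (c j) * cinner (x (\<sigma> i)) (x (\<sigma> j))) \<in> \<real>\<^sub>\<ge>\<^sub>0"
    by (simp add: complex_nonneg_Reals_iff)
qed

lemma has_sum_sum:
  fixes f :: "'a \<Rightarrow> 'b \<Rightarrow> 'c :: {topological_comm_monoid_add}"
  assumes "\<And>a. a \<in> I \<Longrightarrow> (f a has_sum s a) A"
  shows "((\<lambda>x. \<Sum>a\<in>I. f a x) has_sum (\<Sum>a\<in>I. s a)) A"
  using assms by (induction I rule: infinite_finite_induct) (auto intro: has_sum_add)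

text \<open>In coordinates the Gram matrix is a sum of matrices of rank one, and pairing
  \<open>M\<close> with one of them is a value of the form of \<open>M\<close>. The hypothesis
  speaks of the real part because \<open>M\<close> will be a compression of an analytic polynomial,
  which is not Hermitian.\<close>

lemma psd_pairing_seq_space:
  fixes u :: "'a \<Rightarrow> seq_space"
  assumes M: "\<And>c. 0 \<le> Re (\<Sum>a\<in>I. \<Sum>b\<in>I. M a b * c b * cnj (c a))"
  shows "0 \<le> Re (\<Sum>a\<in>I. \<Sum>b\<in>I. M a b * cinner (u b) (u a))"
proof -
  have "((\<lambda>k. \<Sum>a\<in>I. \<Sum>b\<in>I. M a b * cinner (ell2_nth (u b) k) (ell2_nth (u a) k)) has_sum
      (\<Sum>a\<in>I. \<Sum>b\<in>I. M a b * cinner (u b) (u a))) UNIV"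
    by (intro has_sum_sum has_sum_cmult_right cinner_ell2)
  then have "((\<lambda>k. Re (\<Sum>a\<in>I. \<Sum>b\<in>I. M a b * cinner (ell2_nth (u b) k) (ell2_nth (u a) k))) has_sum
      Re (\<Sum>a\<in>I. \<Sum>b\<in>I. M a b * cinner (u b) (u a))) UNIV"
    by (rule has_sum_Re)
  then show ?thesis
    by (rule has_sum_nonneg) (use M in \<open>simp add: cinner_complex_def mult.assoc\<close>)
qed

text \<open>On a finite set every positive kernel is the Gram matrix of vectors in the sequence
  space, wherever it came from, so the previous pairing applies.\<close>

lemma psd_pairing:
  assumes I: "finite I" and M: "\<And>c. 0 \<le> Re (\<Sum>a\<in>I. \<Sum>b\<in>I. M a b * c b * cnj (c a))"
    and k: "psd_kernel k"
  shows "0 \<le> Re (\<Sum>a\<in>I. \<Sum>b\<in>I. M a b * k b a)"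
proof -
  obtain e where e: "bij_betw e {..<card I} I" and sum: "\<And>f :: _ \<Rightarrow> _ \<Rightarrow> complex.
      (\<Sum>i\<in>I. \<Sum>j\<in>I. f i j) = (\<Sum>i<card I. \<Sum>j<card I. f (e i) (e j))"
    using sum_sum_reindex_nat[OF I] by blast
  obtain v :: "nat \<Rightarrow> seq_space" where v: "\<And>i j. cinner (v i) (v j) = k (e i) (e j)"
    using psd_kernel_vectors[OF psd_kernel_pullback[OF k, of e]] by blast
  have "0 \<le> Re (\<Sum>i<card I. \<Sum>j<card I. M (e i) (e j) * cinner (v j) (v i))"
  proof (rule psd_pairing_seq_space)
    fix c :: "nat \<Rightarrow> complex"
    have "0 \<le> Re (\<Sum>a\<in>I. \<Sum>b\<in>I. M a b * c (the_inv_into {..<card I} e b) * cnj (c (the_inv_into {..<card I} e a)))"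
      by (rule M)
    also have "(\<Sum>a\<in>I. \<Sum>b\<in>I. M a b * c (the_inv_into {..<card I} e b) * cnj (c (the_inv_into {..<card I} e a)))
        = (\<Sum>i<card I. \<Sum>j<card I. M (e i) (e j) * c j * cnj (c i))"
      unfolding sum using e by (intro sum.cong refl) (simp add: bij_betw_def the_inv_into_f_f)
    finally show "0 \<le> Re (\<Sum>i<card I. \<Sum>j<card I. M (e i) (e j) * c j * cnj (c i))" .
  qed
  then show ?thesis by (simp add: sum v)
qed

section \<open>Tensor products of operators\<close>

lemma norm_ell2_has_sum: "((\<lambda>i. (norm (ell2_nth f i))\<^sup>2) has_sum (norm f)\<^sup>2) UNIV"
  unfolding norm_ell2_square by (rule has_sum_infsum) (rule ell2_summable)

text \<open>A row of operators \<open>X\<close> against a column of operators \<open>M\<close>: after splitting off the row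
  componentwise, the column estimate for vector coefficients is the pairing of two positive
  semidefinite matrices.\<close>

lemma tensor_row_column_bound:
  fixes X :: "'a \<Rightarrow> ('h :: chilbert_space \<Rightarrow>\<^sub>L 'h)"
    and M :: "'a \<Rightarrow> (('i, complex) ell2 \<Rightarrow>\<^sub>L ('i, complex) ell2)"
  assumes cb: "\<And>a. a \<in> A \<Longrightarrow> cbounded (X a)" "\<And>a. a \<in> A \<Longrightarrow> cbounded (M a)"
    and row: "\<And>g. (norm (\<Sum>a\<in>A. X a (g a)))\<^sup>2 \<le> C * (\<Sum>a\<in>A. (norm (g a))\<^sup>2)" and C: "0 \<le> C"
    and col: "\<And>e. (\<Sum>a\<in>A. (norm (M a e))\<^sup>2) \<le> D * (norm e)\<^sup>2"
    and F: "finite F"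
  shows "(norm (\<Sum>k\<in>F. \<Sum>a\<in>A. tensor_vec (X a (x k)) (M a (e k))))\<^sup>2
    \<le> C * D * (norm (\<Sum>k\<in>F. tensor_vec (x k) (e k)))\<^sup>2"
proof -
  define g where "g a = (\<Sum>k\<in>F. tensor_vec (x k) (M a (e k)))" for a
  let ?L = "\<Sum>k\<in>F. \<Sum>a\<in>A. tensor_vec (X a (x k)) (M a (e k))"
  have nth: "ell2_nth ?L i = (\<Sum>a\<in>A. X a (ell2_nth (g a) i))" for i
  proof -
    have "ell2_nth ?L i = (\<Sum>k\<in>F. \<Sum>a\<in>A. X a (ell2_nth (M a (e k)) i *\<^sub>C x k))"
      unfolding ell2_nth_sum tensor_vec.rep_eq by (intro sum.cong refl) (simp add: cb cbounded_scaleC)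
    also have "\<dots> = (\<Sum>a\<in>A. X a (ell2_nth (g a) i))"
      unfolding g_def ell2_nth_sum tensor_vec.rep_eq blinfun.sum_right by (rule sum.swap)
    finally show ?thesis .
  qed
  have "(norm ?L)\<^sup>2 \<le> C * (\<Sum>a\<in>A. (norm (g a))\<^sup>2)"
  proof (rule has_sum_mono[OF norm_ell2_has_sum])
    show "((\<lambda>i. C * (\<Sum>a\<in>A. (norm (ell2_nth (g a) i))\<^sup>2)) has_sum C * (\<Sum>a\<in>A. (norm (g a))\<^sup>2)) UNIV"
      by (intro has_sum_cmult_right has_sum_sum norm_ell2_has_sum)
  qed (simp only: nth row)
  moreover have "(\<Sum>a\<in>A. (norm (g a))\<^sup>2) \<le> D * (norm (\<Sum>k\<in>F. tensor_vec (x k) (e k)))\<^sup>2"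
  proof -
    \<comment> \<open>The column estimate at the vector \<open>w\<close> below says that this matrix
      is positive; pairing it with the Gram matrix of the vectors \<open>x k\<close> turns scalar
      coefficients into vector coefficients.\<close>
    define m where "m k l = complex_of_real D * cinner (e l) (e k) - (\<Sum>a\<in>A. cinner (M a (e l)) (M a (e k)))" for k l
    have "0 \<le> Re (\<Sum>k\<in>F. \<Sum>l\<in>F. m k l * cinner (x l) (x k))"
    proof (rule psd_pairing[OF F _ psd_kernel_cinner])
      fix c :: "_ \<Rightarrow> complex"
      define w where "w = (\<Sum>k\<in>F. c k *\<^sub>C e k)"
      have w2: "complex_of_real ((norm w)\<^sup>2) = (\<Sum>k\<in>F. \<Sum>l\<in>F. cinner (e l) (e k) * c l * cnj (c k))"
        unfolding w_def norm_sum_square by (simp add: cinner_scaleC_left cinner_scaleC_right ac_simps)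
      have "complex_of_real ((norm (M a w))\<^sup>2)
          = (\<Sum>k\<in>F. \<Sum>l\<in>F. cinner (M a (e l)) (M a (e k)) * c l * cnj (c k))" if a: "a \<in> A" for a
      proof -
        have "M a w = (\<Sum>k\<in>F. c k *\<^sub>C M a (e k))"
          by (simp add: w_def blinfun.sum_right cbounded_scaleC[OF cb(2)[OF a]])
        then show ?thesis
          by (simp only: norm_sum_square) (simp add: cinner_scaleC_left cinner_scaleC_right ac_simps)
      qed
      then have "complex_of_real (\<Sum>a\<in>A. (norm (M a w))\<^sup>2)
          = (\<Sum>a\<in>A. \<Sum>k\<in>F. \<Sum>l\<in>F. cinner (M a (e l)) (M a (e k)) * c l * cnj (c k))"
        by (simp del: of_real_power)
      also have "\<dots> = (\<Sum>k\<in>F. \<Sum>a\<in>A. \<Sum>l\<in>F. cinner (M a (e l)) (M a (e k)) * c l * cnj (c k))"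
        by (rule sum.swap)
      also have "\<dots> = (\<Sum>k\<in>F. \<Sum>l\<in>F. \<Sum>a\<in>A. cinner (M a (e l)) (M a (e k)) * c l * cnj (c k))"
        by (intro sum.cong refl sum.swap)
      finally have "(\<Sum>k\<in>F. \<Sum>l\<in>F. m k l * c l * cnj (c k))
          = complex_of_real D * complex_of_real ((norm w)\<^sup>2) - complex_of_real (\<Sum>a\<in>A. (norm (M a w))\<^sup>2)"
        unfolding w2
        by (simp add: m_def left_diff_distrib sum_subtractf sum_distrib_left sum_distrib_right mult.assoc)
      also have "Re \<dots> = D * (norm w)\<^sup>2 - (\<Sum>a\<in>A. (norm (M a w))\<^sup>2)"
        by (simp only: minus_complex.sel Re_complex_of_real flip: of_real_mult)
      finally show "0 \<le> Re (\<Sum>k\<in>F. \<Sum>l\<in>F. m k l * c l * cnj (c k))" using col[of w] by simp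
    qed
    also have "(\<Sum>k\<in>F. \<Sum>l\<in>F. m k l * cinner (x l) (x k))
        = complex_of_real D * complex_of_real ((norm (\<Sum>k\<in>F. tensor_vec (x k) (e k)))\<^sup>2)
          - (\<Sum>a\<in>A. complex_of_real ((norm (g a))\<^sup>2))"
    proof -
      have "(\<Sum>k\<in>F. \<Sum>l\<in>F. m k l * cinner (x l) (x k))
          = complex_of_real D * complex_of_real ((norm (\<Sum>k\<in>F. tensor_vec (x k) (e k)))\<^sup>2)
            - (\<Sum>k\<in>F. \<Sum>l\<in>F. \<Sum>a\<in>A. cinner (x l) (x k) * cinner (M a (e l)) (M a (e k)))"
        unfolding norm_sum_square cinner_tensor_vec
        by (simp add: m_def left_diff_distrib right_diff_distrib sum_subtractf sum_distrib_left
            sum_distrib_right ac_simps)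
      also have "(\<Sum>k\<in>F. \<Sum>l\<in>F. \<Sum>a\<in>A. cinner (x l) (x k) * cinner (M a (e l)) (M a (e k)))
          = (\<Sum>k\<in>F. \<Sum>a\<in>A. \<Sum>l\<in>F. cinner (x l) (x k) * cinner (M a (e l)) (M a (e k)))"
        by (intro sum.cong refl sum.swap)
      also have "\<dots> = (\<Sum>a\<in>A. \<Sum>k\<in>F. \<Sum>l\<in>F. cinner (x l) (x k) * cinner (M a (e l)) (M a (e k)))"
        by (rule sum.swap)
      also have "\<dots> = (\<Sum>a\<in>A. complex_of_real ((norm (g a))\<^sup>2))"
        unfolding g_def norm_sum_square cinner_tensor_vec ..
      finally show ?thesis .
    qed
    also have "Re \<dots> = D * (norm (\<Sum>k\<in>F. tensor_vec (x k) (e k)))\<^sup>2 - (\<Sum>a\<in>A. (norm (g a))\<^sup>2)"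
      by (simp only: minus_complex.sel Re_complex_of_real flip: of_real_mult of_real_sum)
    finally show ?thesis by simp
  qed
  then have "C * (\<Sum>a\<in>A. (norm (g a))\<^sup>2) \<le> C * (D * (norm (\<Sum>k\<in>F. tensor_vec (x k) (e k)))\<^sup>2)"
    using C by (rule mult_left_mono)
  ultimately show ?thesis by (simp add: mult.assoc)
qed

lemma norm_blinfun_square_le: "(norm (blinfun_apply T x))\<^sup>2 \<le> (norm T)\<^sup>2 * (norm x)\<^sup>2"
  by (metis norm_blinfun norm_ge_zero power_mono power_mult_distrib)

lemma tensor_op_exists:
  fixes X :: "'h :: chilbert_space \<Rightarrow>\<^sub>L 'h" and M :: "('i, complex) ell2 \<Rightarrow>\<^sub>L ('i, complex) ell2"
  assumes X: "cbounded X" and M: "cbounded M"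
  shows "\<exists>T. cbounded T \<and> (\<forall>x e. T (tensor_vec x e) = tensor_vec (X x) (M e))"
proof -
  have "norm (\<Sum>p\<in>F. c p *\<^sub>C tensor_vec (X (fst p)) (M (snd p)))
      \<le> (norm X * norm M) * norm (\<Sum>p\<in>F. c p *\<^sub>C tensor_vec (fst p) (snd p))"
    if F: "finite F" for F and c :: "'h \<times> ('i, complex) ell2 \<Rightarrow> complex"
  proof (rule power2_le_imp_le)
    \<comment> \<open>A row and a column of length one; the scalars \<open>c p\<close> are moved
      into the first tensor factor.\<close>
    have "(norm (\<Sum>p\<in>F. \<Sum>a\<in>{()}. tensor_vec (X (c p *\<^sub>C fst p)) (M (snd p))))\<^sup>2
      \<le> (norm X)\<^sup>2 * (norm M)\<^sup>2 * (norm (\<Sum>p\<in>F. tensor_vec (c p *\<^sub>C fst p) (snd p)))\<^sup>2"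
      by (rule tensor_row_column_bound[where A = "{()}" and X = "\<lambda>_. X" and M = "\<lambda>_. M"])
        (simp_all add: X M F norm_blinfun_square_le)
    then show "(norm (\<Sum>p\<in>F. c p *\<^sub>C tensor_vec (X (fst p)) (M (snd p))))\<^sup>2
      \<le> ((norm X * norm M) * norm (\<Sum>p\<in>F. c p *\<^sub>C tensor_vec (fst p) (snd p)))\<^sup>2"
      by (simp add: cbounded_scaleC[OF X] tensor_vec_scaleC_left power_mult_distrib)
  qed simp
  from ext_family[OF this] obtain T where "cbounded T"
    "\<forall>p. T (tensor_vec (fst p) (snd p)) = tensor_vec (X (fst p)) (M (snd p))" by auto
  then show ?thesis by (intro exI[of _ T]) auto
qed

lemma closed_blinfun_eq: "closed {f. blinfun_apply S f = blinfun_apply T f}"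
  by (intro closed_Collect_eq linear_continuous_on blinfun.bounded_linear_right)

lemma tensor_op_eqI:
  fixes X :: "'h :: chilbert_space \<Rightarrow>\<^sub>L 'h" and M :: "('i, complex) ell2 \<Rightarrow>\<^sub>L ('i, complex) ell2"
  assumes S: "cbounded S" "\<And>x e. S (tensor_vec x e) = tensor_vec (X x) (M e)"
  shows "tensor_op X M = S"
  unfolding tensor_op_def
proof (rule the_equality)
  fix T assume T: "cbounded T \<and> (\<forall>x e. T (tensor_vec x e) = tensor_vec (X x) (M e))"
  have "f \<in> {f. blinfun_apply T f = blinfun_apply S f}" for f
    by (rule ell2_dense[OF closed_blinfun_eq]) (simp add: S T blinfun.sum_right)
  then show "T = S" by (intro blinfun_eqI) blast
qed (simp add: S)

lemma tensor_op:
  assumes "cbounded X" "cbounded M"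
  shows cbounded_tensor_op: "cbounded (tensor_op X M)"
    and tensor_op_tensor_vec: "tensor_op X M (tensor_vec x e) = tensor_vec (X x) (M e)"
proof -
  obtain T where T: "cbounded T" "\<And>x e. T (tensor_vec x e) = tensor_vec (X x) (M e)"
    using tensor_op_exists[OF assms] by blast
  with tensor_op_eqI[of T X M] show "cbounded (tensor_op X M)"
    "tensor_op X M (tensor_vec x e) = tensor_vec (X x) (M e)" by simp_all
qed

lemma tensor_op_zero_right [simp]: "tensor_op X 0 = 0"
  by (rule tensor_op_eqI) simp_all

lemma tensor_op_id [simp]: "tensor_op id_blinfun id_blinfun = id_blinfun"
  by (rule tensor_op_eqI) simp_all

lemma tensor_op_scaleR_left:
  "cbounded X \<Longrightarrow> cbounded M \<Longrightarrow> tensor_op (r *\<^sub>R X) M = r *\<^sub>R tensor_op X M"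
  by (rule tensor_op_eqI)
    (simp_all add: cbounded_tensor_op tensor_op_tensor_vec blinfun.scaleR_left
      bounded_bilinear.scaleR_left[OF bounded_bilinear_tensor_vec])

lemma adj_tensor_op:
  assumes X: "cbounded X" and M: "cbounded M"
  shows "adj (tensor_op X M) = tensor_op (adj X) (adj M)"
proof (rule tensor_op_eqI[symmetric])
  fix y g
  have T: "cbounded (tensor_op X M)" using X M by (rule cbounded_tensor_op)
  \<comment> \<open>\<open>blinfun_inner_left\<close> turns both sides into bounded functionals of
    \<open>z\<close>, so their equality is a closed condition that can be tested on elementary
    tensors.\<close>
  have "z \<in> {z. blinfun_apply (blinfun_inner_left (adj (tensor_op X M) (tensor_vec y g))) z
      = blinfun_apply (blinfun_inner_left (tensor_vec (adj X y) (adj M g))) z}" for z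
    by (rule ell2_dense[OF closed_blinfun_eq])
      (simp add: inner_eq_Re_cinner inner_commute[of _ "sum _ _"] cinner_sum_left cinner_sum_right blinfun.sum_right
        cinner_adj[OF T, symmetric] tensor_op_tensor_vec[OF X M] cinner_tensor_vec cinner_adj[OF X] cinner_adj[OF M])
  then have "inner (adj (tensor_op X M) (tensor_vec y g) - tensor_vec (adj X y) (adj M g)) z = 0" for z
    by (simp add: inner_diff_right inner_commute)
  then show "adj (tensor_op X M) (tensor_vec y g) = tensor_vec (adj X y) (adj M g)"
    by (metis inner_eq_zero_iff eq_iff_diff_eq_0)
qed (simp add: cbounded_tensor_op X M)

text \<open>The row bound and the column bound control a whole homogeneous level at once; a triangle
  inequality over the words would cost a factor that grows exponentially with the level and spoil
  the convergence of the series.\<close>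

lemma norm_sum_tensor_op_le:
  fixes X :: "'a \<Rightarrow> ('h :: chilbert_space \<Rightarrow>\<^sub>L 'h)"
    and M :: "'a \<Rightarrow> (('i, complex) ell2 \<Rightarrow>\<^sub>L ('i, complex) ell2)"
  assumes cb: "\<And>a. a \<in> A \<Longrightarrow> cbounded (X a)" "\<And>a. a \<in> A \<Longrightarrow> cbounded (M a)"
    and row: "\<And>g. (norm (\<Sum>a\<in>A. X a (g a)))\<^sup>2 \<le> C * (\<Sum>a\<in>A. (norm (g a))\<^sup>2)" and C: "0 \<le> C"
    and col: "\<And>e. (\<Sum>a\<in>A. (norm (M a e))\<^sup>2) \<le> D * (norm e)\<^sup>2" and D: "0 \<le> D"
  shows "norm (\<Sum>a\<in>A. tensor_op (X a) (M a)) \<le> sqrt (C * D)"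
proof (rule norm_blinfun_bound)
  fix f :: "('i, 'h) ell2"
  let ?T = "\<Sum>a\<in>A. tensor_op (X a) (M a)"
  have "f \<in> {f. norm (?T f) \<le> sqrt (C * D) * norm f}"
  proof (rule ell2_dense)
    show "closed {f. norm (?T f) \<le> sqrt (C * D) * norm f}"
      by (intro closed_Collect_le continuous_intros linear_continuous_on blinfun.bounded_linear_right)
    fix F :: "'i set" and x :: "'i \<Rightarrow> 'h" assume F: "finite F"
    have "?T (\<Sum>i\<in>F. tensor_vec (x i) (ket i)) = (\<Sum>i\<in>F. \<Sum>a\<in>A. tensor_vec (X a (x i)) (M a (ket i)))"
      by (simp add: blinfun.sum_left blinfun.sum_right tensor_op_tensor_vec cb)
    moreover have "(norm (\<Sum>i\<in>F. \<Sum>a\<in>A. tensor_vec (X a (x i)) (M a (ket i))))\<^sup>2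
        \<le> (sqrt (C * D) * norm (\<Sum>i\<in>F. tensor_vec (x i) (ket i)))\<^sup>2"
      using tensor_row_column_bound[OF cb row C col F] C D by (simp add: power_mult_distrib)
    ultimately show "(\<Sum>i\<in>F. tensor_vec (x i) (ket i)) \<in> {f. norm (?T f) \<le> sqrt (C * D) * norm f}"
      using C D by (auto intro: power2_le_imp_le)
  qed
  then show "norm (?T f) \<le> sqrt (C * D) * norm f" by simp
qed (use C D in simp)

lemma cinner_tensor_op_finite:
  assumes "cbounded X" "cbounded M"
  shows "cinner (tensor_op X M (\<Sum>i\<in>F. tensor_vec (x i) (ket i))) (\<Sum>i\<in>F. tensor_vec (x i) (ket i))
    = (\<Sum>i\<in>F. \<Sum>j\<in>F. cinner (X (x j)) (x i) * cinner (M (ket j)) (ket i))"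
  by (simp add: blinfun.sum_right tensor_op_tensor_vec assms cinner_sum_left cinner_sum_right cinner_tensor_vec)

lemma op_positive_on_denseI:
  fixes T :: "('i, 'h :: chilbert_space) ell2 \<Rightarrow>\<^sub>L ('i, 'h) ell2"
  assumes "\<And>F x. finite F \<Longrightarrow> F \<subseteq> J \<Longrightarrow>
    cinner (blinfun_apply T (\<Sum>i\<in>F. tensor_vec (x i) (ket i))) (\<Sum>i\<in>F. tensor_vec (x i) (ket i)) \<in> \<real>\<^sub>\<ge>\<^sub>0"
  shows "op_positive_on (ell2_on J) T"
  unfolding op_positive_on_def
proof
  fix f :: "('i, 'h) ell2" assume f: "f \<in> ell2_on J"
  have "continuous_on UNIV (\<lambda>f. cinner (T f) f)"
    by (intro bounded_bilinear.continuous_on[OF bounded_bilinear_cinner] continuous_on_id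
        linear_continuous_on blinfun.bounded_linear_right)
  then have "closed {f. cinner (T f) f \<in> \<real>\<^sub>\<ge>\<^sub>0}"
    using continuous_closed_vimage[of "\<real>\<^sub>\<ge>\<^sub>0 :: complex set" "\<lambda>f. cinner (T f) f"]
    by (simp add: continuous_on_eq_continuous_at vimage_def)
  from ell2_on_dense[OF this f] show "cinner (T f) f \<in> \<real>\<^sub>\<ge>\<^sub>0" using assms by blast
qed

section \<open>Words and creation operators\<close>

lemma wprod_Nil [simp]: "wprod T [] = id_blinfun"
  and wprod_Cons [simp]: "wprod T (i # \<alpha>) = T i o\<^sub>L wprod T \<alpha>"
  by (simp_all add: wprod_def)

lemma wprod_append: "wprod T (\<alpha> @ \<beta>) = wprod T \<alpha> o\<^sub>L wprod T \<beta>"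
  by (induction \<alpha>) (auto intro: blinfun_eqI)

lemma cbounded_wprod: "(\<And>i. cbounded (T i)) \<Longrightarrow> cbounded (wprod T \<alpha>)"
  by (induction \<alpha>) simp_all

lemma wprod_scaleR: "wprod (\<lambda>i. r *\<^sub>R T i) \<alpha> = r ^ length \<alpha> *\<^sub>R wprod T \<alpha>"
  by (induction \<alpha>) (auto intro!: blinfun_eqI simp: blinfun.scaleR_left blinfun.scaleR_right)

lemma wprod_zero: "wprod (\<lambda>_. 0) \<alpha> = (if \<alpha> = [] then id_blinfun else 0)"
  by (cases \<alpha>) (auto intro!: blinfun_eqI)

lemma finite_words [simp]: "finite (words k :: 'n :: finite list set)"
  using finite_lists_length_eq[of "UNIV :: 'n set" k] by (simp add: words_def)

lemma words_0 [simp]: "words 0 = {[]}"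
  by (auto simp: words_def)

lemma sum_words_Suc:
  "(\<Sum>\<alpha>\<in>words (Suc k). f \<alpha>) = (\<Sum>i\<in>UNIV. \<Sum>\<alpha>\<in>words k. f ((i :: 'n :: finite) # \<alpha>))"
proof -
  have "(\<Sum>i\<in>UNIV. \<Sum>\<alpha>\<in>words k. f (i # \<alpha>)) = (\<Sum>p\<in>UNIV \<times> words k. f (fst p # snd p))"
    by (simp add: sum.cartesian_product case_prod_beta)
  also have "\<dots> = (\<Sum>\<alpha>\<in>words (Suc k). f \<alpha>)"
    by (rule sum.reindex_bij_witness[of _ "\<lambda>\<alpha>. (hd \<alpha>, tl \<alpha>)" "\<lambda>p. fst p # snd p"])
      (auto simp: words_def length_Suc_conv)
  finally show ?thesis by simp
qed

lemma sum_words_rev: "(\<Sum>\<alpha>\<in>words k. f (rev \<alpha>)) = (\<Sum>\<alpha>\<in>words k. f \<alpha>)"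
  by (rule sum.reindex_bij_witness[of _ rev rev]) (auto simp: words_def)

text \<open>This is \<open>\<Sum>X_i X_i^* \<le> I\<close>, that is, contractivity of the row
  operator, written without adjoints. In this form the estimate can be iterated over the letters of
  a word.\<close>

definition row_contraction :: "('n :: finite \<Rightarrow> ('a :: chilbert_space \<Rightarrow>\<^sub>L 'a)) \<Rightarrow> bool" where
  "row_contraction X \<longleftrightarrow> (\<forall>i. cbounded (X i)) \<and>
    (\<forall>g. (norm (\<Sum>i\<in>UNIV. X i (g i)))\<^sup>2 \<le> (\<Sum>i\<in>UNIV. (norm (g i))\<^sup>2))"

lemma row_contraction_words:
  assumes X: "row_contraction X"
  shows "(norm (\<Sum>\<alpha>\<in>words k. wprod X \<alpha> (g \<alpha>)))\<^sup>2 \<le> (\<Sum>\<alpha>\<in>words k. (norm (g \<alpha>))\<^sup>2)"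
proof (induction k arbitrary: g)
  case (Suc k)
  have "(norm (\<Sum>\<alpha>\<in>words (Suc k). wprod X \<alpha> (g \<alpha>)))\<^sup>2
      = (norm (\<Sum>i\<in>UNIV. X i (\<Sum>\<alpha>\<in>words k. wprod X \<alpha> (g (i # \<alpha>)))))\<^sup>2"
    by (simp add: sum_words_Suc blinfun.sum_right)
  also have "\<dots> \<le> (\<Sum>i\<in>UNIV. (norm (\<Sum>\<alpha>\<in>words k. wprod X \<alpha> (g (i # \<alpha>))))\<^sup>2)"
    using X by (simp add: row_contraction_def)
  also have "\<dots> \<le> (\<Sum>i\<in>UNIV. \<Sum>\<alpha>\<in>words k. (norm (g (i # \<alpha>)))\<^sup>2)" by (intro sum_mono Suc.IH)
  finally show ?case by (simp add: sum_words_Suc)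
qed simp

text \<open>The column of adjoints is the adjoint of the row operator and inherits its bound: with
  \<open>s\<close> the left-hand side and \<open>u\<close> the row applied to the column,
  \<open>s\<close> equals \<open>cinner u e\<close>, and the row estimate gives
  \<open>s\<^sup>2 \<le> s * (norm e)\<^sup>2\<close>.\<close>

lemma column_from_row:
  assumes W: "\<And>a. a \<in> A \<Longrightarrow> cbounded (W a)"
    and row: "\<And>g. (norm (\<Sum>a\<in>A. W a (g a)))\<^sup>2 \<le> (\<Sum>a\<in>A. (norm (g a))\<^sup>2)"
  shows "(\<Sum>a\<in>A. (norm (adj (W a) e))\<^sup>2) \<le> (norm e)\<^sup>2"
proof -
  define s where "s = (\<Sum>a\<in>A. (norm (adj (W a) e))\<^sup>2)"
  define u where "u = (\<Sum>a\<in>A. W a (adj (W a) e))"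
  have s0: "s \<ge> 0" by (simp add: s_def sum_nonneg)
  have "complex_of_real s = (\<Sum>a\<in>A. cinner (adj (W a) e) (adj (W a) e))"
    by (simp add: s_def cinner_self)
  also have "\<dots> = cinner u e" by (simp add: u_def cinner_sum_left cinner_adj W)
  finally have "s \<le> norm u * norm e"
    using norm_cinner_le[of u e] s0 by (metis abs_of_nonneg norm_of_real)
  then have "s\<^sup>2 \<le> (norm u)\<^sup>2 * (norm e)\<^sup>2" using s0 by (metis power_mono power_mult_distrib)
  also have "\<dots> \<le> s * (norm e)\<^sup>2" unfolding u_def s_def by (intro mult_right_mono row) simp
  finally show ?thesis using s0 unfolding s_def[symmetric]
    by (cases "s = 0") (simp_all add: power2_eq_square mult_le_cancel_left)
qed

lemma norm_sum_orthogonal: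
  fixes x :: "'i \<Rightarrow> 'a :: chilbert_space"
  assumes "finite I" "\<And>i j. i \<in> I \<Longrightarrow> j \<in> I \<Longrightarrow> i \<noteq> j \<Longrightarrow> cinner (x i) (x j) = 0"
  shows "(norm (\<Sum>i\<in>I. x i))\<^sup>2 = (\<Sum>i\<in>I. (norm (x i))\<^sup>2)"
proof -
  have "complex_of_real ((norm (\<Sum>i\<in>I. x i))\<^sup>2) = (\<Sum>i\<in>I. \<Sum>j\<in>I. if j = i then cinner (x i) (x i) else 0)"
    unfolding norm_sum_square using assms by (intro sum.cong refl) auto
  also have "\<dots> = complex_of_real (\<Sum>i\<in>I. (norm (x i))\<^sup>2)" using assms(1) by (simp add: cinner_self)
  finally show ?thesis using of_real_eq_iff by blast
qed

lemma row_contractionI: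
  assumes "\<And>i. cbounded (X i)" "\<And>i x. norm (X i x) \<le> norm x"
    "\<And>i j x y. i \<noteq> j \<Longrightarrow> cinner (X i x) (X j y) = 0"
  shows "row_contraction X"
  unfolding row_contraction_def
proof (intro conjI allI)
  fix g
  have "(norm (\<Sum>i\<in>UNIV. X i (g i)))\<^sup>2 = (\<Sum>i\<in>UNIV. (norm (X i (g i)))\<^sup>2)"
    by (rule norm_sum_orthogonal) (simp_all add: assms)
  also have "\<dots> \<le> (\<Sum>i\<in>UNIV. (norm (g i))\<^sup>2)" by (intro sum_mono power_mono assms) simp
  finally show "(norm (\<Sum>i\<in>UNIV. X i (g i)))\<^sup>2 \<le> (\<Sum>i\<in>UNIV. (norm (g i))\<^sup>2)" .
qed (rule assms)

section \<open>Creation operators as row contractions\<close>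

lemma cbounded_push_op [simp]: "cbounded (push_op s)"
  unfolding cbounded_def
  by (intro allI ell2_eqI) (simp add: push_op.rep_eq ell2_push.rep_eq scaleC_ell2.rep_eq)

lemma cinner_push_op_disjoint:
  "range s \<inter> range t = {} \<Longrightarrow> cinner (push_op s x) (push_op t y) = 0"
  by (rule cinner_ell2_eqI, rule has_sum_0) (auto simp: push_op.rep_eq ell2_push.rep_eq)

lemma push_op_ket: "inj s \<Longrightarrow> push_op s (ket i) = ket (s i)"
  by (rule ell2_eqI) (auto simp: push_op.rep_eq ell2_push.rep_eq ket.rep_eq)

lemma norm_push_op_le: "norm (push_op s x) \<le> norm x"
  by (simp add: push_op.rep_eq norm_ell2_push_le)

lemma inj_Cons [simp]: "inj (\<lambda>\<alpha>. i # \<alpha>)" and inj_snoc [simp]: "inj (\<lambda>\<alpha>. \<alpha> @ [i])"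
  by (auto intro: injI)

lemma row_contraction_left_creation: "row_contraction left_creation"
  unfolding left_creation_def
  by (rule row_contractionI) (auto simp: norm_push_op_le intro!: cinner_push_op_disjoint)

lemma row_contraction_right_creation: "row_contraction right_creation"
  unfolding right_creation_def
  by (rule row_contractionI) (auto simp: norm_push_op_le intro!: cinner_push_op_disjoint)

lemma cbounded_left_creation [simp]: "cbounded (left_creation i)"
  and cbounded_right_creation [simp]: "cbounded (right_creation i)"
  by (simp_all add: left_creation_def right_creation_def)

lemma wprod_left_creation_ket: "wprod left_creation \<alpha> (ket \<gamma>) = ket (\<alpha> @ \<gamma>)"
  by (induction \<alpha>) (simp_all add: left_creation_def push_op_ket)

text \<open>The operator nearest to the vector acts first, so the product over the reversed word
  appends the letters of \<open>\<alpha>\<close> in their proper order.\<close>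

lemma wprod_right_creation_ket: "wprod right_creation (rev \<alpha>) (ket \<gamma>) = ket (\<gamma> @ \<alpha>)"
  by (induction \<alpha> arbitrary: \<gamma>) (simp_all add: right_creation_def push_op_ket wprod_append)

lemma cinner_ket_ket: "cinner (ket i) (ket j) = (if i = j then 1 else 0)"
  by (simp add: cinner_ket ket.rep_eq)

lemma cinner_adj_wprod_right_creation_ket:
  "cinner (adj (wprod right_creation (rev \<alpha>)) (ket \<beta>)) (ket \<gamma>) = (if \<beta> = \<gamma> @ \<alpha> then 1 else 0)"
  by (simp add: cinner_adj' cbounded_wprod wprod_right_creation_ket cinner_ket_ket)

lemma column_right_creation:
  fixes e :: "'n :: finite fock"
  shows "(\<Sum>\<alpha>\<in>words k. (norm (adj (wprod right_creation (rev \<alpha>)) e))\<^sup>2) \<le> (norm e)\<^sup>2"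
proof (rule column_from_row)
  fix g :: "'n list \<Rightarrow> 'n fock"
  have "(norm (\<Sum>\<alpha>\<in>words k. wprod right_creation \<alpha> (g (rev \<alpha>))))\<^sup>2 \<le> (\<Sum>\<alpha>\<in>words k. (norm (g (rev \<alpha>)))\<^sup>2)"
    by (rule row_contraction_words[OF row_contraction_right_creation])
  then show "(norm (\<Sum>\<alpha>\<in>words k. wprod right_creation (rev \<alpha>) (g \<alpha>)))\<^sup>2 \<le> (\<Sum>\<alpha>\<in>words k. (norm (g \<alpha>))\<^sup>2)"
    using sum_words_rev[of "\<lambda>\<alpha>. wprod right_creation \<alpha> (g (rev \<alpha>))" k]
      sum_words_rev[of "\<lambda>\<alpha>. (norm (g \<alpha>))\<^sup>2" k] by simp
qed (simp add: cbounded_wprod)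

section \<open>Multi-Toeplitz kernels\<close>

text \<open>This recursion is the multi-Toeplitz property. With the two cases of an empty word it
  replaces the comparison of prefixes by induction, and it is the form in which the property is
  assumed of abstract kernels later.\<close>

lemma mt_kernel_Cons: "mt_kernel \<rho> X (i # \<alpha>) (j # \<beta>) = (if i = j then mt_kernel \<rho> X \<alpha> \<beta> else 0)"
  by (auto simp: mt_kernel_def)

lemma mt_kernel_Nil_left: "mt_kernel \<rho> X [] \<beta> = (if \<beta> = [] then id_blinfun else (1 / \<rho>) *\<^sub>R wprod X \<beta>)"
  by (cases \<beta>) (auto simp: mt_kernel_def)

lemma mt_kernel_Nil_right:
  "mt_kernel \<rho> X \<alpha> [] = (if \<alpha> = [] then id_blinfun else (1 / \<rho>) *\<^sub>R adj (wprod X \<alpha>))"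
  by (cases \<alpha>) (auto simp: mt_kernel_def)

lemma cbounded_mt_kernel: "(\<And>i. cbounded (X i)) \<Longrightarrow> cbounded (mt_kernel \<rho> X \<alpha> \<beta>)"
  by (auto simp: mt_kernel_def cbounded_wprod)

lemma adj_mt_kernel:
  assumes "\<And>i. cbounded (X i)"
  shows "adj (mt_kernel \<rho> X \<alpha> \<beta>) = mt_kernel \<rho> X \<beta> \<alpha>"
proof (induction \<alpha> arbitrary: \<beta>)
  case Nil
  then show ?case
    by (auto simp: mt_kernel_Nil_left mt_kernel_Nil_right adj_scaleR cbounded_wprod assms)
next
  case (Cons i \<alpha>)
  then show ?case
    by (cases \<beta>) (auto simp: mt_kernel_Cons mt_kernel_Nil_left mt_kernel_Nil_right adj_scaleR
        cbounded_wprod assms adj_compose)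
qed

lemma mt_kernel_same_length:
  "length \<alpha> = length \<beta> \<Longrightarrow> mt_kernel \<rho> X \<alpha> \<beta> = (if \<alpha> = \<beta> then id_blinfun else 0)"
  by (auto simp: mt_kernel_def dest: prefix_length_less)

lemma Im_hermitian_sum:
  assumes "\<And>i j. f j i = cnj (f i j)"
  shows "Im (\<Sum>i\<in>I. \<Sum>j\<in>I. f i j) = 0"
proof -
  have "cnj (\<Sum>i\<in>I. \<Sum>j\<in>I. f i j) = (\<Sum>i\<in>I. \<Sum>j\<in>I. f j i)"
    unfolding cnj_sum by (intro sum.cong refl assms[symmetric])
  also have "\<dots> = (\<Sum>i\<in>I. \<Sum>j\<in>I. f i j)" by (rule sum.swap)
  finally show ?thesis by (simp add: complex_eq_iff sum_negf)
qed

lemma kernel_positiveI: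
  assumes "\<And>\<alpha> \<beta>. cbounded (K \<alpha> \<beta>)" "\<And>\<alpha> \<beta>. adj (K \<alpha> \<beta>) = K \<beta> \<alpha>"
    and "\<And>(N :: nat) \<sigma> h. 0 \<le> Re (\<Sum>i<N. \<Sum>j<N. cinner (K (\<sigma> i) (\<sigma> j) (h j)) (h i))"
  shows "kernel_positive K"
proof -
  have "Im (\<Sum>i<N. \<Sum>j<N. cinner (K (\<sigma> i) (\<sigma> j) (h j)) (h i)) = 0" for N :: nat and \<sigma> h
  proof (rule Im_hermitian_sum)
    fix i j
    have "cinner (K (\<sigma> j) (\<sigma> i) (h i)) (h j) = cinner (h i) (K (\<sigma> i) (\<sigma> j) (h j))"
      using cinner_adj[OF assms(1)] assms(2) by metis
    then show "cinner (K (\<sigma> j) (\<sigma> i) (h i)) (h j) = cnj (cinner (K (\<sigma> i) (\<sigma> j) (h j)) (h i))"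
      by (metis cinner_commute)
  qed
  then show ?thesis unfolding kernel_positive_def complex_nonneg_Reals_iff using assms(3) by blast
qed

lemma kernel_positiveD:
  assumes "kernel_positive K" "finite I"
  shows "(\<Sum>i\<in>I. \<Sum>j\<in>I. cinner (K (\<sigma> i) (\<sigma> j) (h j)) (h i)) \<in> \<real>\<^sub>\<ge>\<^sub>0"
proof -
  obtain e where "\<And>f :: _ \<Rightarrow> _ \<Rightarrow> complex.
      (\<Sum>i\<in>I. \<Sum>j\<in>I. f i j) = (\<Sum>i<card I. \<Sum>j<card I. f (e i) (e j))"
    using sum_sum_reindex_nat[OF assms(2)] by blast
  then show ?thesis
    using assms(1)[unfolded kernel_positive_def, rule_format, where N = "card I" and \<sigma> = "\<lambda>i. \<sigma> (e i)"
        and h = "\<lambda>i. h (e i)"] by simp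
qed

subsection \<open>Kernels of row contractions\<close>

text \<open>The condition \<open>\<sigma> i = a # tl (\<sigma> i)\<close> expresses that the first
  letter is \<open>a\<close> and at the same time excludes the empty word.\<close>

lemma sum_split_head:
  fixes f :: "'i \<Rightarrow> 'b :: comm_monoid_add" and \<sigma> :: "'i \<Rightarrow> 'n :: finite list"
  assumes "finite I"
  shows "(\<Sum>i\<in>I. f i) = (\<Sum>i\<in>{i\<in>I. \<sigma> i = []}. f i) + (\<Sum>a\<in>UNIV. \<Sum>i\<in>{i\<in>I. \<sigma> i = a # tl (\<sigma> i)}. f i)"
proof -
  have head: "(\<sigma> i \<noteq> [] \<and> hd (\<sigma> i) = a) \<longleftrightarrow> \<sigma> i = a # tl (\<sigma> i)" for i a
    by (cases "\<sigma> i") auto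
  have "(\<Sum>i\<in>{i\<in>I. \<sigma> i \<noteq> []}. f i) = (\<Sum>a\<in>UNIV. \<Sum>i\<in>{i\<in>{i\<in>I. \<sigma> i \<noteq> []}. hd (\<sigma> i) = a}. f i)"
    by (rule sum.group[symmetric]) (use assms in auto)
  also have "\<dots> = (\<Sum>a\<in>UNIV. \<Sum>i\<in>{i\<in>I. \<sigma> i = a # tl (\<sigma> i)}. f i)"
    using head by (intro sum.cong refl arg_cong[where f = "sum f"]) blast
  finally have *: "(\<Sum>i\<in>{i\<in>I. \<sigma> i \<noteq> []}. f i) = (\<Sum>a\<in>UNIV. \<Sum>i\<in>{i\<in>I. \<sigma> i = a # tl (\<sigma> i)}. f i)" .
  have "I = {i\<in>I. \<sigma> i = []} \<union> {i\<in>I. \<sigma> i \<noteq> []}" by auto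
  then have "(\<Sum>i\<in>I. f i) = (\<Sum>i\<in>{i\<in>I. \<sigma> i = []} \<union> {i\<in>I. \<sigma> i \<noteq> []}. f i)" by simp
  also have "\<dots> = (\<Sum>i\<in>{i\<in>I. \<sigma> i = []}. f i) + (\<Sum>i\<in>{i\<in>I. \<sigma> i \<noteq> []}. f i)"
    by (rule sum.union_disjoint) (use assms in auto)
  finally show ?thesis using * by simp
qed

text \<open>A lower bound by a square, instead of 0, is what makes the induction over first letters
  work. The empty words contribute \<open>u\<close>, the words beginning with \<open>a\<close>
  contribute \<open>X a (y a)\<close>; the cross terms on both sides agree, and the diagonal blocks
  are forms in the tails. The induction hypothesis bounds the blocks below by the squares of the
  norms of \<open>y a\<close>, and the row estimate returns to \<open>w\<close>.\<close>

lemma mt_kernel_row_contraction_ge: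
  fixes X :: "'n :: finite \<Rightarrow> ('a :: chilbert_space \<Rightarrow>\<^sub>L 'a)"
  assumes X: "row_contraction X" and I: "finite I" and "\<And>i. i \<in> I \<Longrightarrow> length (\<sigma> i) < N"
  shows "(norm (\<Sum>i\<in>I. wprod X (\<sigma> i) (h i)))\<^sup>2
    \<le> Re (\<Sum>i\<in>I. \<Sum>j\<in>I. cinner (mt_kernel 1 X (\<sigma> i) (\<sigma> j) (h j)) (h i))"
  using I assms(3)
proof (induction N arbitrary: I \<sigma>)
  case 0
  then have "I = {}" by auto
  then show ?case by simp
next
  case (Suc N)
  have cb: "cbounded (X i)" for i using X by (simp add: row_contraction_def)
  define E where "E = {i\<in>I. \<sigma> i = []}"
  define H where "H a = {i\<in>I. \<sigma> i = a # tl (\<sigma> i)}" for a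
  define \<tau> where "\<tau> i = tl (\<sigma> i)" for i
  define u where "u = (\<Sum>i\<in>E. h i)"
  define y where "y a = (\<Sum>i\<in>H a. wprod X (\<tau> i) (h i))" for a
  define k where "k i j = cinner (mt_kernel 1 X (\<sigma> i) (\<sigma> j) (h j)) (h i)" for i j
  define q where "q a = (\<Sum>i\<in>H a. \<Sum>j\<in>H a. cinner (mt_kernel 1 X (\<tau> i) (\<tau> j) (h j)) (h i))" for a
  have split: "(\<Sum>i\<in>I. f i) = (\<Sum>i\<in>E. f i) + (\<Sum>a\<in>UNIV. \<Sum>i\<in>H a. f i)" for f :: "'b \<Rightarrow> 'c :: comm_monoid_add"
    unfolding E_def H_def by (rule sum_split_head[OF Suc.prems(1)])
  have E: "\<sigma> i = []" if "i \<in> E" for i using that by (simp add: E_def)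
  have H: "\<sigma> i = a # \<tau> i" if "i \<in> H a" for a i using that by (simp add: H_def \<tau>_def)
  have IH: "(norm (y a))\<^sup>2 \<le> Re (q a)" for a
    unfolding y_def q_def
  proof (rule Suc.IH)
    fix i assume "i \<in> H a"
    moreover from this have "length (\<sigma> i) < Suc N" using Suc.prems(2) by (simp add: H_def)
    ultimately show "length (\<tau> i) < N" using H[of i a] by simp
  qed (use Suc.prems(1) in \<open>simp add: H_def\<close>)
  define w where "w = (\<Sum>a\<in>UNIV. X a (y a))"
  have wH: "w = (\<Sum>a\<in>UNIV. \<Sum>i\<in>H a. wprod X (\<sigma> i) (h i))"
    unfolding w_def y_def blinfun.sum_right by (intro sum.cong refl) (simp add: H)
  have "(\<Sum>i\<in>I. wprod X (\<sigma> i) (h i)) = u + w"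
    unfolding split wH u_def by (simp add: E)
  then have lhs: "(norm (\<Sum>i\<in>I. wprod X (\<sigma> i) (h i)))\<^sup>2 = (norm u)\<^sup>2 + (norm w)\<^sup>2 + 2 * Re (cinner u w)"
    by (simp add: norm_add_square)
  have ee: "(\<Sum>i\<in>E. \<Sum>j\<in>E. k i j) = complex_of_real ((norm u)\<^sup>2)"
    unfolding u_def norm_sum_square k_def by (intro sum.cong refl) (simp add: E mt_kernel_Nil_left)
  have eh: "(\<Sum>i\<in>E. \<Sum>a\<in>UNIV. \<Sum>j\<in>H a. k i j) = cinner w u"
    unfolding u_def wH cinner_sum_left cinner_sum_right k_def
    by (intro sum.cong refl) (auto simp: E H mt_kernel_Nil_left)
  have he: "(\<Sum>a\<in>UNIV. \<Sum>i\<in>H a. \<Sum>j\<in>E. k i j) = cinner u w"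
    unfolding u_def wH cinner_sum_right unfolding cinner_sum_left k_def
    by (intro sum.cong refl) (auto simp: E H mt_kernel_Nil_right cinner_adj' cbounded_wprod cb adj_compose)
  \<comment> \<open>Blocks with different first letters vanish, and a common first letter
    cancels.\<close>
  have hh: "(\<Sum>a\<in>UNIV. \<Sum>i\<in>H a. \<Sum>b\<in>UNIV. \<Sum>j\<in>H b. k i j) = (\<Sum>a\<in>UNIV. q a)"
  proof (intro sum.cong refl)
    fix a
    have "(\<Sum>b\<in>UNIV. \<Sum>j\<in>H b. k i j) = (\<Sum>j\<in>H a. cinner (mt_kernel 1 X (\<tau> i) (\<tau> j) (h j)) (h i))"
      if i: "i \<in> H a" for i
    proof -
      have "(\<Sum>b\<in>UNIV. \<Sum>j\<in>H b. k i j)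
          = (\<Sum>b\<in>UNIV. if b = a then \<Sum>j\<in>H b. cinner (mt_kernel 1 X (\<tau> i) (\<tau> j) (h j)) (h i) else 0)"
        by (intro sum.cong refl) (auto simp: k_def H[OF i] H mt_kernel_Cons intro!: sum.neutral)
      then show ?thesis by simp
    qed
    then show "(\<Sum>i\<in>H a. \<Sum>b\<in>UNIV. \<Sum>j\<in>H b. k i j) = q a" unfolding q_def by (intro sum.cong refl)
  qed
  have "(\<Sum>i\<in>I. \<Sum>j\<in>I. k i j)
      = complex_of_real ((norm u)\<^sup>2) + cinner w u + cinner u w + (\<Sum>a\<in>UNIV. q a)"
    unfolding split sum.distrib ee eh he hh by simp
  then have "Re (\<Sum>i\<in>I. \<Sum>j\<in>I. k i j) = (norm u)\<^sup>2 + 2 * Re (cinner u w) + (\<Sum>a\<in>UNIV. Re (q a))"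
    using cinner_commute[of w u] by simp
  moreover have "(norm w)\<^sup>2 \<le> (\<Sum>a\<in>UNIV. (norm (y a))\<^sup>2)"
    using X by (simp add: row_contraction_def w_def)
  moreover have "(\<Sum>a\<in>UNIV. (norm (y a))\<^sup>2) \<le> (\<Sum>a\<in>UNIV. Re (q a))" by (intro sum_mono IH)
  ultimately show ?case using lhs by (simp add: k_def)
qed

lemma kernel_positive_row_contraction:
  fixes X :: "'n :: finite \<Rightarrow> ('a :: chilbert_space \<Rightarrow>\<^sub>L 'a)"
  assumes X: "row_contraction X"
  shows "kernel_positive (mt_kernel 1 X)"
proof (rule kernel_positiveI)
  have cb: "cbounded (X i)" for i using X by (simp add: row_contraction_def)
  show "cbounded (mt_kernel 1 X \<alpha> \<beta>)" for \<alpha> \<beta> by (rule cbounded_mt_kernel[OF cb])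
  show "adj (mt_kernel 1 X \<alpha> \<beta>) = mt_kernel 1 X \<beta> \<alpha>" for \<alpha> \<beta> by (rule adj_mt_kernel[OF cb])
  fix N :: nat and \<sigma> :: "nat \<Rightarrow> 'n list" and h
  define m where "m = Suc (\<Sum>i<N. length (\<sigma> i))"
  have "length (\<sigma> i) < m" if "i \<in> {..<N}" for i
    using member_le_sum[of i "{..<N}" "\<lambda>i. length (\<sigma> i)"] that by (simp add: m_def)
  from mt_kernel_row_contraction_ge[where I = "{..<N}" and \<sigma> = \<sigma> and h = h and N = m, OF X finite_lessThan this]
  show "0 \<le> Re (\<Sum>i<N. \<Sum>j<N. cinner (mt_kernel 1 X (\<sigma> i) (\<sigma> j) (h j)) (h i))"
    by (rule order_trans[OF zero_le_power2])
qed

lemma row_contraction_row_ball: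
  fixes Z :: "'n :: finite \<Rightarrow> (seq_space \<Rightarrow>\<^sub>L seq_space)"
  assumes Z: "row_contraction Z" and t: "0 \<le> t" "t < 1"
  shows "(\<lambda>i. t *\<^sub>R Z i) \<in> row_ball"
proof -
  have cb: "cbounded (Z i)" for i using Z by (simp add: row_contraction_def)
  define S where "S = (\<Sum>i\<in>UNIV. Z i o\<^sub>L adj (Z i))"
  have "norm S \<le> 1"
  proof (rule norm_blinfun_bound)
    fix e
    have "(norm (S e))\<^sup>2 \<le> (\<Sum>i\<in>UNIV. (norm (adj (Z i) e))\<^sup>2)"
      using Z by (simp add: S_def row_contraction_def blinfun.sum_left)
    also have "\<dots> \<le> (norm e)\<^sup>2"
      by (rule column_from_row) (use Z in \<open>auto simp: row_contraction_def\<close>)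
    finally have "norm (S e) \<le> norm e" by (rule power2_le_imp_le) simp
    then show "norm (S e) \<le> 1 * norm e" by simp
  qed simp
  moreover have "(\<Sum>i\<in>UNIV. (t *\<^sub>R Z i) o\<^sub>L adj (t *\<^sub>R Z i)) = t\<^sup>2 *\<^sub>R S"
    unfolding S_def scaleR_sum_right
    by (intro sum.cong refl blinfun_eqI) (simp add: adj_scaleR cb blinfun.scaleR_left blinfun.scaleR_right power2_eq_square)
  moreover have "t\<^sup>2 < 1" using t by (simp add: power_less_one_iff abs_square_less_1)
  ultimately have "norm (\<Sum>i\<in>UNIV. (t *\<^sub>R Z i) o\<^sub>L adj (t *\<^sub>R Z i)) < 1"
    using mult_left_mono[of "norm S" 1 "t\<^sup>2"] by simp
  then show ?thesis by (simp add: row_ball_def cb)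
qed

text \<open>The constant is the norm of \<open>\<Sum>X_i X_i^*\<close> itself, since the fact that
  it is less than 1 is what later gives geometric decay over long words.\<close>

lemma row_ball_column:
  assumes X: "X \<in> row_ball"
  shows "(\<Sum>i\<in>UNIV. (norm (adj (X i) e))\<^sup>2) \<le> norm (\<Sum>i\<in>UNIV. X i o\<^sub>L adj (X i)) * (norm e)\<^sup>2"
proof -
  have cb: "cbounded (X i)" for i using X by (simp add: row_ball_def)
  define S where "S = (\<Sum>i\<in>UNIV. X i o\<^sub>L adj (X i))"
  have "complex_of_real (\<Sum>i\<in>UNIV. (norm (adj (X i) e))\<^sup>2) = (\<Sum>i\<in>UNIV. cinner (adj (X i) e) (adj (X i) e))"
    by (simp add: cinner_self)
  also have "\<dots> = cinner (S e) e" by (simp add: S_def blinfun.sum_left cinner_sum_left cinner_adj cb)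
  finally have "Re (complex_of_real (\<Sum>i\<in>UNIV. (norm (adj (X i) e))\<^sup>2)) = Re (cinner (S e) e)"
    by (rule arg_cong)
  then have "(\<Sum>i\<in>UNIV. (norm (adj (X i) e))\<^sup>2) \<le> norm (S e) * norm e"
    using norm_cinner_le[of "S e" e] complex_Re_le_cmod[of "cinner (S e) e"] by (simp only: Re_complex_of_real)
  also have "\<dots> \<le> (norm S * norm e) * norm e" by (intro mult_right_mono norm_blinfun) simp
  finally show ?thesis by (simp add: S_def power2_eq_square)
qed

text \<open>Row and column estimates are adjoint to each other: the squared norm of \<open>w\<close>
  is the sum of the inner products of \<open>g i\<close> with \<open>adj (X i) w\<close>, to which
  Cauchy-Schwarz and the column estimate apply.\<close>

lemma row_ball_row_contraction:
  assumes X: "X \<in> row_ball"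
  shows "row_contraction X"
  unfolding row_contraction_def
proof (intro conjI allI)
  show cb: "cbounded (X i)" for i using X by (simp add: row_ball_def)
  fix g
  define w where "w = (\<Sum>i\<in>UNIV. X i (g i))"
  have "complex_of_real ((norm w)\<^sup>2) = (\<Sum>i\<in>UNIV. cinner (g i) (adj (X i) w))"
    by (simp add: cinner_self[symmetric] cinner_sum_left cinner_adj[OF cb, symmetric] flip: w_def of_real_power)
      (simp add: w_def cinner_sum_left)
  then have "(norm w)\<^sup>2 = cmod (\<Sum>i\<in>UNIV. cinner (g i) (adj (X i) w))"
    by (metis abs_of_nonneg norm_of_real zero_le_power2)
  also have "\<dots> \<le> (\<Sum>i\<in>UNIV. norm (g i) * norm (adj (X i) w))"
    by (rule sum_norm_le) (simp add: norm_cinner_le)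
  finally have "((norm w)\<^sup>2)\<^sup>2 \<le> (\<Sum>i\<in>UNIV. norm (g i) * norm (adj (X i) w))\<^sup>2" by (intro power_mono) auto
  also have "\<dots> \<le> (\<Sum>i\<in>UNIV. (norm (g i))\<^sup>2) * (\<Sum>i\<in>UNIV. (norm (adj (X i) w))\<^sup>2)"
    by (rule Cauchy_Schwarz_ineq_sum)
  also have "(\<Sum>i\<in>UNIV. (norm (adj (X i) w))\<^sup>2) \<le> 1 * (norm w)\<^sup>2"
    using X by (intro order_trans[OF row_ball_column[OF X]] mult_right_mono) (auto simp: row_ball_def)
  finally have "(norm w)\<^sup>2 * (norm w)\<^sup>2 \<le> (\<Sum>i\<in>UNIV. (norm (g i))\<^sup>2) * (norm w)\<^sup>2"
    by (simp add: power2_eq_square mult_left_mono sum_nonneg)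
  then show "(norm (\<Sum>i\<in>UNIV. X i (g i)))\<^sup>2 \<le> (\<Sum>i\<in>UNIV. (norm (g i))\<^sup>2)"
    unfolding w_def[symmetric] using mult_right_le_imp_le[of "(norm w)\<^sup>2" "(norm w)\<^sup>2"]
    by (cases "w = 0") (simp_all only: zero_less_norm_iff zero_less_power norm_zero sum_nonneg
        zero_power2 zero_le_power2 not_False_eq_True)
qed

subsection \<open>Realising a positive multi-Toeplitz kernel by a row contraction on the sequence space\<close>

text \<open>The Gram vectors \<open>u(\<beta>, j)\<close> of \<open>\<langle>K(\<alpha>, \<beta>) z\<^sub>j, z\<^sub>i\<rangle>\<close> satisfy the relations of \<open>W\<^sub>\<beta> z\<^sub>j\<close> for a row
  isometry \<open>W\<close>; \<open>Z\<^sub>i\<close> is \<open>W\<^sub>i\<close> extended by zero to the orthogonal complement of their span.\<close>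

lemma multi_toeplitz_model:
  fixes K :: "'n :: finite list \<Rightarrow> 'n list \<Rightarrow> ('h :: chilbert_space \<Rightarrow>\<^sub>L 'h)" and z :: "nat \<Rightarrow> 'h"
  assumes pos: "kernel_positive K" and cb: "\<And>\<alpha> \<beta>. cbounded (K \<alpha> \<beta>)"
    and shift: "\<And>i j \<alpha> \<beta>. K (i # \<alpha>) (j # \<beta>) = (if i = j then K \<alpha> \<beta> else 0)"
  shows "\<exists>(v :: nat \<Rightarrow> seq_space) (Z :: 'n \<Rightarrow> (seq_space \<Rightarrow>\<^sub>L seq_space)). row_contraction Z \<and>
    (\<forall>\<alpha> i j. cinner (wprod Z \<alpha> (v j)) (v i) = cinner (K [] \<alpha> (z j)) (z i))"
proof -
  \<comment> \<open>The two words change places here to match the index convention of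
    \<open>psd_kernel\<close>.\<close>
  define k where "k p q = cinner (K (fst q) (fst p) (z (snd p))) (z (snd q))" for p q :: "'n list \<times> nat"
  have "psd_kernel k"
    unfolding psd_kernel_def
  proof (intro allI)
    fix N :: nat and \<sigma> :: "nat \<Rightarrow> 'n list \<times> nat" and c
    have "(\<Sum>i<N. \<Sum>j<N. cinner (K (fst (\<sigma> i)) (fst (\<sigma> j)) (c j *\<^sub>C z (snd (\<sigma> j)))) (c i *\<^sub>C z (snd (\<sigma> i)))) \<in> \<real>\<^sub>\<ge>\<^sub>0"
      by (rule kernel_positiveD[OF pos finite_lessThan])
    also have "(\<Sum>i<N. \<Sum>j<N. cinner (K (fst (\<sigma> i)) (fst (\<sigma> j)) (c j *\<^sub>C z (snd (\<sigma> j)))) (c i *\<^sub>C z (snd (\<sigma> i))))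
        = (\<Sum>i<N. \<Sum>j<N. c j * cnj (c i) * k (\<sigma> j) (\<sigma> i))"
      by (simp add: k_def cbounded_scaleC[OF cb] cinner_scaleC_left cinner_scaleC_right ac_simps)
    also have "\<dots> = (\<Sum>i<N. \<Sum>j<N. c i * cnj (c j) * k (\<sigma> i) (\<sigma> j))" by (rule sum.swap)
    finally show "(\<Sum>i<N. \<Sum>j<N. c i * cnj (c j) * k (\<sigma> i) (\<sigma> j)) \<in> \<real>\<^sub>\<ge>\<^sub>0" .
  qed
  then obtain u :: "'n list \<times> nat \<Rightarrow> seq_space" where u: "\<And>p q. cinner (u p) (u q) = k p q"
    using psd_kernel_vectors by blast
  define y where "y i p = u (i # fst p, snd p)" for i p
  have yy: "cinner (y i p) (y j q) = (if i = j then cinner (u p) (u q) else 0)" for i j p q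
    by (simp add: y_def u k_def shift)
  have "norm (\<Sum>p\<in>F. c p *\<^sub>C y i p) \<le> 1 * norm (\<Sum>p\<in>F. c p *\<^sub>C u p)" for i F c
  proof -
    have "complex_of_real ((norm (\<Sum>p\<in>F. c p *\<^sub>C y i p))\<^sup>2) = complex_of_real ((norm (\<Sum>p\<in>F. c p *\<^sub>C u p))\<^sup>2)"
      unfolding norm_sum_square by (simp add: cinner_scaleC_left cinner_scaleC_right yy)
    then have "(norm (\<Sum>p\<in>F. c p *\<^sub>C y i p))\<^sup>2 = (norm (\<Sum>p\<in>F. c p *\<^sub>C u p))\<^sup>2"
      using of_real_eq_iff by blast
    then show ?thesis by (simp add: power2_eq_iff_nonneg)
  qed
  from ext_family[OF this] have "\<exists>T :: seq_space \<Rightarrow>\<^sub>L seq_space. cbounded T \<and> (\<forall>p. T (u p) = y i p) \<and>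
      (\<forall>x. norm (T x) \<le> norm x) \<and> (\<forall>x. T x \<in> closed_cspan (range (y i)))" for i
    by (simp only: mult_1 zero_le_one) blast
  then obtain Z :: "'n \<Rightarrow> (seq_space \<Rightarrow>\<^sub>L seq_space)" where Z: "\<And>i. cbounded (Z i)" "\<And>i p. Z i (u p) = y i p"
    "\<And>i x. norm (Z i x) \<le> norm x" "\<And>i x. Z i x \<in> closed_cspan (range (y i))" by metis
  have "row_contraction Z"
  proof (rule row_contractionI)
    fix i j :: 'n and a b assume ij: "i \<noteq> j"
    \<comment> \<open>The ranges lie in the closed spans of the families \<open>y i\<close> and
      \<open>y j\<close>, so orthogonality has only to be checked on these families.\<close>
    have "cinner (y j q) (Z i a) = 0" for q
      by (rule closed_cspan_orthogonal[OF _ Z(4)]) (use ij in \<open>auto simp: yy\<close>)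
    then have "cinner (Z i a) x = 0" if "x \<in> range (y j)" for x
      using that by (metis cinner_commute complex_cnj_zero rangeE)
    then show "cinner (Z i a) (Z j b) = 0" by (rule closed_cspan_orthogonal[OF _ Z(4)])
  qed (rule Z)+
  moreover have "wprod Z \<alpha> (u ([], j)) = u (\<alpha>, j)" for \<alpha> j
    by (induction \<alpha>) (simp_all add: Z y_def)
  then have "cinner (wprod Z \<alpha> (u ([], j))) (u ([], i)) = cinner (K [] \<alpha> (z j)) (z i)" for \<alpha> i j
    by (simp add: u k_def)
  ultimately show ?thesis by (intro exI[of _ "\<lambda>j. u ([], j)"] exI[of _ Z]) blast
qed

subsection \<open>Kernels of isometric dilations\<close>

lemma isometry_cinner:
  fixes f :: "'a :: chilbert_space \<Rightarrow> 'b :: chilbert_space"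
  assumes M: "csubspace M" and f: "clinear_on M f" "\<And>x. x \<in> M \<Longrightarrow> norm (f x) = norm x"
    and xy: "x \<in> M" "y \<in> M"
  shows "cinner (f x) (f y) = cinner x y"
proof -
  have Re: "Re (cinner (f x) (f y)) = Re (cinner x y)" if "x \<in> M" "y \<in> M" for x y
  proof -
    have "f (x + y) = f x + f y" using f(1) that by (simp add: clinear_on_def)
    then have "(norm (f x + f y))\<^sup>2 = (norm (x + y))\<^sup>2" using f(2)[of "x + y"] csubspace_add[OF M that] by simp
    then show ?thesis by (simp add: norm_add_square f(2) that)
  qed
  have "f (\<i> *\<^sub>C y) = \<i> *\<^sub>C f y" using f(1) xy by (simp add: clinear_on_def)
  then have "Im (cinner (f x) (f y)) = Im (cinner x y)"
    using Re[OF xy(1) csubspace_scaleC[OF M xy(2)], of \<i>] by (simp add: cinner_scaleC_right)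
  then show ?thesis using Re[OF xy] by (simp add: complex_eq_iff)
qed

lemma word_map_Nil [simp]: "word_map V [] = id"
  and word_map_Cons [simp]: "word_map V (i # \<alpha>) = V i \<circ> word_map V \<alpha>"
  by (simp_all add: word_map_def)

lemma isometric_range:
  fixes J :: "'h :: chilbert_space \<Rightarrow> 'g :: chilbert_space"
  assumes J: "clinear_on UNIV J" "\<And>h. norm (J h) = norm h"
  shows "csubspace (range J)" "closed (range J)"
proof -
  have add: "J (x + y) = J x + J y" and scale: "J (c *\<^sub>C x) = c *\<^sub>C J x" for x y c
    using J(1) by (simp_all add: clinear_on_def)
  have bl: "bounded_linear J"
    by (rule bounded_linear_intro[where K = 1]) (simp_all add: add scale scaleR_scaleC J)
  show "csubspace (range J)"
    unfolding csubspace_def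
    by (auto simp: image_iff intro: add[symmetric] scale[symmetric])
      (metis J(2) norm_eq_zero norm_zero)
  have "complete (range J)"
    by (rule complete_isometric_image[OF _ _ bl, of 1 UNIV]) (simp_all add: J(2) complete_UNIV)
  then show "closed (range J)" by (rule complete_imp_closed)
qed

context
  fixes \<rho> :: real and T :: "'n :: finite \<Rightarrow> ('h :: chilbert_space \<Rightarrow>\<^sub>L 'h)"
    and G :: "'g :: chilbert_space set" and J V
  assumes \<rho>: "\<rho> > 0" and T: "\<And>i. cbounded (T i)" and dil: "isometric_dilation \<rho> T G J V"
begin

lemma dilation_space: "csubspace G" "closed G"
  and dilation_incl: "clinear_on UNIV J" "norm (J h) = norm h" "J h \<in> G"
  and dilation_shift: "clinear_on G (V i)" "x \<in> G \<Longrightarrow> V i x \<in> G" "x \<in> G \<Longrightarrow> norm (V i x) = norm x"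
    "i \<noteq> j \<Longrightarrow> x \<in> G \<Longrightarrow> y \<in> G \<Longrightarrow> cinner (V i x) (V j y) = 0"
  and dilation_compress: "\<alpha> \<noteq> [] \<Longrightarrow> J (wprod T \<alpha> h) = \<rho> *\<^sub>R orth_proj (range J) (word_map V \<alpha> (J h))"
  using dil by (auto simp: isometric_dilation_def image_subset_iff)

lemma dilation_word_in: "x \<in> G \<Longrightarrow> word_map V \<alpha> x \<in> G"
  by (induction \<alpha>) (simp_all add: dilation_shift)

lemma dilation_incl_cinner: "cinner (J h) (J h') = cinner h h'"
  by (rule isometry_cinner[of UNIV]) (simp_all add: csubspace_def dilation_incl)

lemma dilation_word_cinner:
  assumes "\<alpha> \<noteq> []"
  shows "cinner (word_map V \<alpha> (J h)) (J h') = (1 / \<rho>) *\<^sub>R cinner (wprod T \<alpha> h) h'"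
proof -
  have P: "csubspace (range J)" "closed (range J)" by (rule isometric_range; rule dilation_incl)+
  have "cinner (wprod T \<alpha> h) h' = cinner (J (wprod T \<alpha> h)) (J h')" by (simp add: dilation_incl_cinner)
  also have "\<dots> = \<rho> *\<^sub>R cinner (orth_proj (range J) (word_map V \<alpha> (J h))) (J h')"
    by (simp add: dilation_compress[OF assms] cinner_scaleR_left)
  also have "cinner (orth_proj (range J) (word_map V \<alpha> (J h))) (J h') = cinner (word_map V \<alpha> (J h)) (J h')"
    using orth_proj(2)[OF P, of "J h'" "word_map V \<alpha> (J h)"] by (simp add: cinner_diff_left)
  finally show ?thesis using \<rho> by simp
qed

text \<open>Equal first letters cancel because \<open>V i\<close> is isometric, and different ones
  give orthogonal vectors. Once one word is exhausted, the compression formula supplies the factor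
  \<open>1 / \<rho>\<close> for a nonempty remainder.\<close>

lemma dilation_gram:
  "cinner (word_map V \<beta> (J h)) (word_map V \<alpha> (J h')) = cinner (mt_kernel \<rho> T \<alpha> \<beta> h) h'"
proof (induction \<alpha> arbitrary: \<beta>)
  case Nil
  show ?case
    by (cases "\<beta> = []")
      (simp_all add: mt_kernel_Nil_left dilation_incl_cinner dilation_word_cinner blinfun.scaleR_left cinner_scaleR_left)
next
  case (Cons i \<alpha>)
  show ?case
  proof (cases \<beta>)
    case Nil
    have "cinner (J h) (word_map V (i # \<alpha>) (J h')) = cnj (cinner (word_map V (i # \<alpha>) (J h')) (J h))"
      by (rule cinner_commute)
    also have "\<dots> = (1 / \<rho>) *\<^sub>R cnj (cinner (wprod T (i # \<alpha>) h') h)"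
      by (subst dilation_word_cinner) simp_all
    also have "cnj (cinner (wprod T (i # \<alpha>) h') h) = cinner (adj (wprod T (i # \<alpha>)) h) h'"
      by (subst cinner_commute, subst cinner_adj'[OF cbounded_wprod[OF T]]) simp
    finally show ?thesis
      unfolding Nil mt_kernel_Nil_right by (simp add: blinfun.scaleR_left cinner_scaleR_left)
  next
    case (Cons j \<beta>')
    have G: "word_map V \<gamma> (J h) \<in> G" for \<gamma> h by (simp add: dilation_word_in dilation_incl)
    have "cinner (V j (word_map V \<beta>' (J h))) (V i (word_map V \<alpha> (J h')))
        = (if i = j then cinner (word_map V \<beta>' (J h)) (word_map V \<alpha> (J h')) else 0)"
      using isometry_cinner[OF dilation_space(1) dilation_shift(1,3) G G] dilation_shift(4)[of j i] G by auto
    then show ?thesis using Cons.IH[of \<beta>'] unfolding \<open>\<beta> = j # \<beta>'\<close> by (simp add: mt_kernel_Cons)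
  qed
qed

lemma dilation_sum:
  "(\<Sum>i\<in>I. \<Sum>j\<in>I. cinner (mt_kernel \<rho> T (\<sigma> i) (\<sigma> j) (h j)) (h i))
    = complex_of_real ((norm (\<Sum>i\<in>I. word_map V (\<sigma> i) (J (h i))))\<^sup>2)"
  unfolding norm_sum_square by (simp add: dilation_gram)

lemma dilation_kernel_positive: "kernel_positive (mt_kernel \<rho> T)"
  by (simp add: kernel_positive_def dilation_sum complex_nonneg_Reals_iff)

text \<open>For \<open>k > 0\<close> the vectors \<open>word_map V \<alpha> (J (g \<alpha>))\<close>
  are mutually orthogonal and the compression costs a factor \<rho>; for \<open>k = 0\<close> the
  bound is 1. The constant \<open>1 + \<rho>\<^sup>2\<close> covers both cases.\<close>

lemma dilation_row_bound:
  "(norm (\<Sum>\<alpha>\<in>words k. wprod T \<alpha> (g \<alpha>)))\<^sup>2 \<le> (1 + \<rho>\<^sup>2) * (\<Sum>\<alpha>\<in>words k. (norm (g \<alpha>))\<^sup>2)"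
proof (cases k)
  case 0
  then show ?thesis by (simp add: algebra_simps)
next
  case (Suc m)
  define s where "s = (\<Sum>\<alpha>\<in>words k. (norm (g \<alpha>))\<^sup>2)"
  have s: "s \<ge> 0" by (simp add: s_def sum_nonneg)
  define w where "w = (\<Sum>\<alpha>\<in>words k. word_map V \<alpha> (J (g \<alpha>)))"
  have "(norm w)\<^sup>2 = (\<Sum>\<alpha>\<in>words k. (norm (word_map V \<alpha> (J (g \<alpha>))))\<^sup>2)"
    unfolding w_def
    by (rule norm_sum_orthogonal[OF finite_words])
      (auto simp: dilation_gram mt_kernel_same_length words_def)
  also have "\<dots> = s"
  proof -
    have "complex_of_real ((norm (word_map V \<alpha> (J (g \<alpha>))))\<^sup>2) = complex_of_real ((norm (g \<alpha>))\<^sup>2)" for \<alpha>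
      unfolding cinner_self[symmetric] dilation_gram by (simp add: mt_kernel_same_length)
    then show ?thesis unfolding s_def using of_real_eq_iff by (intro sum.cong refl) blast
  qed
  finally have w: "norm w = sqrt s" by (metis norm_ge_zero real_sqrt_unique)
  have "norm (\<Sum>\<alpha>\<in>words k. wprod T \<alpha> (g \<alpha>)) \<le> \<rho> * sqrt s"
  proof (rule norm_le_cinnerI)
    fix y
    have "cinner (wprod T \<alpha> (g \<alpha>)) y = \<rho> *\<^sub>R cinner (word_map V \<alpha> (J (g \<alpha>))) (J y)" if "\<alpha> \<in> words k" for \<alpha>
    proof -
      have "\<alpha> \<noteq> []" using that Suc by (auto simp: words_def)
      then show ?thesis using \<rho> by (simp add: dilation_word_cinner)
    qed
    then have "cinner (\<Sum>\<alpha>\<in>words k. wprod T \<alpha> (g \<alpha>)) y = \<rho> *\<^sub>R cinner w (J y)"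
      by (simp add: w_def cinner_sum_left scaleR_sum_right)
    moreover have "cmod (cinner w (J y)) \<le> sqrt s * norm y"
      using norm_cinner_le[of w "J y"] by (simp add: w dilation_incl)
    ultimately show "cmod (cinner (\<Sum>\<alpha>\<in>words k. wprod T \<alpha> (g \<alpha>)) y) \<le> \<rho> * sqrt s * norm y"
      using \<rho> by (simp add: mult.assoc mult_left_mono)
  qed (use \<rho> s in simp)
  then have "(norm (\<Sum>\<alpha>\<in>words k. wprod T \<alpha> (g \<alpha>)))\<^sup>2 \<le> (\<rho> * sqrt s)\<^sup>2" by (intro power_mono norm_ge_zero)
  also have "\<dots> \<le> (1 + \<rho>\<^sup>2) * s" using s by (simp add: power_mult_distrib algebra_simps)
  finally show ?thesis by (simp add: s_def)
qed

end

section \<open>Norm convergent series\<close>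

text \<open>A tuple in the class for \<rho> is in general not a row contraction. A bound that is
  uniform in the level \<open>k\<close> is what it has in common with row contractions, and it
  suffices for the series at \<open>r\<close> times the tuple.\<close>

definition row_bounded :: "real \<Rightarrow> ('n :: finite \<Rightarrow> ('a :: chilbert_space \<Rightarrow>\<^sub>L 'a)) \<Rightarrow> bool" where
  "row_bounded C X \<longleftrightarrow> 0 \<le> C \<and> (\<forall>i. cbounded (X i)) \<and>
    (\<forall>k g. (norm (\<Sum>\<alpha>\<in>words k. wprod X \<alpha> (g \<alpha>)))\<^sup>2 \<le> C * (\<Sum>\<alpha>\<in>words k. (norm (g \<alpha>))\<^sup>2))"

lemma row_contraction_row_bounded: "row_contraction X \<Longrightarrow> row_bounded 1 X"
  using row_contraction_words[of X] by (simp add: row_bounded_def row_contraction_def)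

lemma cbounded_coeff_ops: "M \<in> coeff_ops J \<Longrightarrow> cbounded M"
  by (simp add: coeff_ops_def)

lemma bounded_linear_quadratic_form:
  fixes f :: "'a :: chilbert_space" and g :: "'b :: chilbert_space"
  shows "bounded_linear (\<lambda>T. cinner (blinfun_apply T f) g)"
proof (rule bounded_linear_intro[where K = "norm f * norm g"])
  show "cmod (cinner (T f) g) \<le> norm T * (norm f * norm g)" for T :: "'a \<Rightarrow>\<^sub>L 'b"
  proof -
    have "cmod (cinner (T f) g) \<le> norm (T f) * norm g" by (rule norm_cinner_le)
    also have "\<dots> \<le> (norm T * norm f) * norm g" by (intro mult_right_mono norm_blinfun) simp
    finally show ?thesis by (simp add: mult.assoc)
  qed
qed (simp_all add: blinfun.add_left blinfun.scaleR_left cinner_add_left cinner_scaleR_left)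

text \<open>Level \<open>k\<close> is at most \<open>r ^ k * sqrt (C * D k)\<close> in norm, and the
  growth condition on the coefficients bounds the k-th root of \<open>sqrt (D k)\<close>, so the
  root test applies.\<close>

lemma holo_eval_summable:
  fixes X :: "'n :: finite \<Rightarrow> ('h :: chilbert_space \<Rightarrow>\<^sub>L 'h)"
  assumes F: "free_holomorphic J F" and X: "row_bounded C X" and r: "0 \<le> r" "r < 1"
  shows "summable (\<lambda>k. \<Sum>\<alpha>\<in>words k. tensor_op (wprod (\<lambda>i. r *\<^sub>R X i) \<alpha>) (F \<alpha>))"
proof -
  have cF: "cbounded (F \<alpha>)" for \<alpha> using F by (auto simp: free_holomorphic_def intro: cbounded_coeff_ops)
  have cX: "cbounded (X i)" for i using X by (simp add: row_bounded_def)
  have C: "C \<ge> 0" using X by (simp add: row_bounded_def)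
  define D where "D k = norm (\<Sum>\<alpha>\<in>words k. adj (F \<alpha>) o\<^sub>L F \<alpha>)" for k
  \<comment> \<open>Any number strictly between \<open>r\<close> and 1 serves: eventually
    \<open>sqrt (D k) \<le> (1 / s) ^ k\<close>, which leaves the geometric majorant
    \<open>(r / s) ^ k\<close>.\<close>
  define s where "s = (1 + r) / 2"
  have s: "0 < s" "s < 1" "r < s" using r by (simp_all add: s_def)
  have col: "(\<Sum>\<alpha>\<in>words k. (norm (F \<alpha> e))\<^sup>2) \<le> D k * (norm e)\<^sup>2" for k e
  proof -
    let ?S = "\<Sum>\<alpha>\<in>words k. adj (F \<alpha>) o\<^sub>L F \<alpha>"
    have "complex_of_real (\<Sum>\<alpha>\<in>words k. (norm (F \<alpha> e))\<^sup>2) = cinner (?S e) e"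
      by (simp add: blinfun.sum_left cinner_sum_left cinner_adj'[OF cF] cinner_self)
    then have "Re (complex_of_real (\<Sum>\<alpha>\<in>words k. (norm (F \<alpha> e))\<^sup>2)) = Re (cinner (?S e) e)"
      by (rule arg_cong)
    then have "(\<Sum>\<alpha>\<in>words k. (norm (F \<alpha> e))\<^sup>2) \<le> norm (?S e) * norm e"
      using norm_cinner_le[of "?S e" e] complex_Re_le_cmod[of "cinner (?S e) e"] by (simp only: Re_complex_of_real)
    also have "\<dots> \<le> (D k * norm e) * norm e" unfolding D_def by (intro mult_right_mono norm_blinfun) simp
    finally show ?thesis by (simp add: power2_eq_square)
  qed
  have bound: "norm (\<Sum>\<alpha>\<in>words k. tensor_op (wprod (\<lambda>i. r *\<^sub>R X i) \<alpha>) (F \<alpha>)) \<le> r ^ k * sqrt (C * D k)" for k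
  proof -
    have "(\<Sum>\<alpha>\<in>words k. tensor_op (wprod (\<lambda>i. r *\<^sub>R X i) \<alpha>) (F \<alpha>))
        = r ^ k *\<^sub>R (\<Sum>\<alpha>\<in>words k. tensor_op (wprod X \<alpha>) (F \<alpha>))"
      unfolding scaleR_sum_right
      by (intro sum.cong refl) (auto simp: wprod_scaleR tensor_op_scaleR_left cbounded_wprod cX cF words_def)
    moreover have "norm (\<Sum>\<alpha>\<in>words k. tensor_op (wprod X \<alpha>) (F \<alpha>)) \<le> sqrt (C * D k)"
      by (rule norm_sum_tensor_op_le[OF _ _ _ _ col])
        (use X in \<open>auto simp: row_bounded_def cbounded_wprod cF D_def\<close>)
    ultimately show ?thesis using r by (simp add: mult_left_mono)
  qed
  have "limsup (\<lambda>k. ereal (D k powr (1 / (2 * real k)))) < ereal (1 / s)"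
  proof (rule le_less_trans)
    show "limsup (\<lambda>k. ereal (D k powr (1 / (2 * real k)))) \<le> 1"
      using F by (simp add: free_holomorphic_def D_def)
    show "1 < ereal (1 / s)" using s by (simp add: one_ereal_def)
  qed
  then have "\<forall>\<^sub>F k in sequentially. ereal (D k powr (1 / (2 * real k))) < ereal (1 / s)"
    by (rule Limsup_lessD)
  then have "\<forall>\<^sub>F k in sequentially.
      norm (\<Sum>\<alpha>\<in>words k. tensor_op (wprod (\<lambda>i. r *\<^sub>R X i) \<alpha>) (F \<alpha>)) \<le> sqrt C * (r / s) ^ k"
    using eventually_gt_at_top[of 0]
  proof eventually_elim
    case (elim k)
    have "sqrt (D k) \<le> (1 / s) ^ k"
    proof (cases "D k = 0")
      case False
      then have D: "D k > 0" by (simp add: D_def)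
      have "sqrt (D k) = (D k powr (1 / (2 * real k))) powr real k"
        using elim D by (simp add: powr_powr powr_half_sqrt)
      also have "\<dots> \<le> (1 / s) powr real k"
        using elim s by (intro powr_mono2) auto
      also have "\<dots> = (1 / s) ^ k" using s by (simp add: powr_realpow)
      finally show ?thesis .
    qed (use s in simp)
    then have "r ^ k * (sqrt C * sqrt (D k)) \<le> r ^ k * (sqrt C * (1 / s) ^ k)"
      using r C by (intro mult_left_mono) auto
    then show ?case using bound[of k] by (simp add: real_sqrt_mult power_divide field_simps)
  qed
  moreover have "summable (\<lambda>k. sqrt C * (r / s) ^ k)"
    using s r by (intro summable_mult summable_geometric) simp
  ultimately show ?thesis by (rule summable_comparison_test_ev)
qed

lemma cbounded_suminf:
  assumes "summable f" "\<And>k. cbounded (f k)" shows "cbounded (suminf f)"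
  by (rule cbounded_limit[OF _ summable_LIMSEQ[OF assms(1)]]) (simp add: assms(2))

text \<open>The form is a power series in \<open>r\<close> whose k-th coefficient sees only words of
  length \<open>k\<close>. This allows the values at \<open>A\<close>, at \<open>B\<close> and at
  the model tuple to be compared coefficient by coefficient.\<close>

lemma holo_eval_form:
  fixes X :: "'n :: finite \<Rightarrow> ('h :: chilbert_space \<Rightarrow>\<^sub>L 'h)" and I :: "nat set" and x :: "nat \<Rightarrow> 'h"
  assumes F: "free_holomorphic J F" and X: "row_bounded C X" and r: "0 \<le> r" "r < 1"
  defines "f \<equiv> \<Sum>i\<in>I. tensor_vec (x i) (ket i)"
  shows "cbounded (holo_eval F (\<lambda>i. r *\<^sub>R X i))"
    and "(\<lambda>k. (\<Sum>\<alpha>\<in>words k. \<Sum>i\<in>I. \<Sum>j\<in>I. cinner (wprod X \<alpha> (x j)) (x i) * cinner (F \<alpha> (ket j)) (ket i))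
      * complex_of_real r ^ k) sums cinner (holo_eval F (\<lambda>i. r *\<^sub>R X i) f) f"
proof -
  have cF: "cbounded (F \<alpha>)" for \<alpha> using F by (auto simp: free_holomorphic_def intro: cbounded_coeff_ops)
  have cX: "cbounded (X i)" for i using X by (simp add: row_bounded_def)
  note s = holo_eval_summable[OF F X r]
  show "cbounded (holo_eval F (\<lambda>i. r *\<^sub>R X i))"
    unfolding holo_eval_def by (rule cbounded_suminf[OF s]) (simp add: cbounded_tensor_op cbounded_wprod cX cF)
  have "(\<lambda>k. cinner ((\<Sum>\<alpha>\<in>words k. tensor_op (wprod (\<lambda>i. r *\<^sub>R X i) \<alpha>) (F \<alpha>)) f) f) sums
      cinner (holo_eval F (\<lambda>i. r *\<^sub>R X i) f) f"
    unfolding holo_eval_def by (rule bounded_linear.sums[OF bounded_linear_quadratic_form summable_sums[OF s]])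
  also have "(\<lambda>k. cinner ((\<Sum>\<alpha>\<in>words k. tensor_op (wprod (\<lambda>i. r *\<^sub>R X i) \<alpha>) (F \<alpha>)) f) f)
      = (\<lambda>k. (\<Sum>\<alpha>\<in>words k. \<Sum>i\<in>I. \<Sum>j\<in>I. cinner (wprod X \<alpha> (x j)) (x i) * cinner (F \<alpha> (ket j)) (ket i))
        * complex_of_real r ^ k)"
  proof
    fix k
    have "cinner (tensor_op (wprod (\<lambda>i. r *\<^sub>R X i) \<alpha>) (F \<alpha>) f) f
        = (\<Sum>i\<in>I. \<Sum>j\<in>I. cinner (wprod X \<alpha> (x j)) (x i) * cinner (F \<alpha> (ket j)) (ket i)) * complex_of_real r ^ k"
      if "\<alpha> \<in> words k" for \<alpha>
    proof -
      have "cinner (tensor_op (wprod (\<lambda>i. r *\<^sub>R X i) \<alpha>) (F \<alpha>) f) f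
          = r ^ k *\<^sub>R cinner (tensor_op (wprod X \<alpha>) (F \<alpha>) f) f"
        using that by (simp add: wprod_scaleR tensor_op_scaleR_left cbounded_wprod cX cF words_def
            blinfun.scaleR_left cinner_scaleR_left)
      then show ?thesis unfolding f_def cinner_tensor_op_finite[OF cbounded_wprod[OF cX] cF]
        by (simp add: scaleR_conv_of_real mult.commute)
    qed
    then show "cinner ((\<Sum>\<alpha>\<in>words k. tensor_op (wprod (\<lambda>i. r *\<^sub>R X i) \<alpha>) (F \<alpha>)) f) f
      = (\<Sum>\<alpha>\<in>words k. \<Sum>i\<in>I. \<Sum>j\<in>I. cinner (wprod X \<alpha> (x j)) (x i) * cinner (F \<alpha> (ket j)) (ket i))
        * complex_of_real r ^ k"
      by (simp add: blinfun.sum_left cinner_sum_left sum_distrib_right)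
  qed
  finally show "(\<lambda>k. (\<Sum>\<alpha>\<in>words k. \<Sum>i\<in>I. \<Sum>j\<in>I. cinner (wprod X \<alpha> (x j)) (x i) * cinner (F \<alpha> (ket j)) (ket i))
      * complex_of_real r ^ k) sums cinner (holo_eval F (\<lambda>i. r *\<^sub>R X i) f) f" .
qed

lemma holo_eval_zero_form:
  fixes X :: "'n :: finite \<Rightarrow> ('h :: chilbert_space \<Rightarrow>\<^sub>L 'h)" and I :: "nat set" and x :: "nat \<Rightarrow> 'h"
  assumes F: "free_holomorphic J F" and X: "row_bounded C X"
  defines "f \<equiv> \<Sum>i\<in>I. tensor_vec (x i) (ket i)"
  shows "cbounded (holo_eval F (\<lambda>_ :: 'n. 0 :: 'h \<Rightarrow>\<^sub>L 'h))"
    and "cinner (holo_eval F (\<lambda>_ :: 'n. 0) f) f = (\<Sum>i\<in>I. \<Sum>j\<in>I. cinner (x j) (x i) * cinner (F [] (ket j)) (ket i))"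
proof -
  \<comment> \<open>Evaluation at the zero tuple is the case \<open>r = 0\<close>.\<close>
  note h = holo_eval_form(1)[OF F X order_refl zero_less_one, simplified]
    holo_eval_form(2)[OF F X order_refl zero_less_one, where I = I and x = x, simplified]
  show "cbounded (holo_eval F (\<lambda>_ :: 'n. 0 :: 'h \<Rightarrow>\<^sub>L 'h))" by (rule h(1))
  show "cinner (holo_eval F (\<lambda>_ :: 'n. 0) f) f = (\<Sum>i\<in>I. \<Sum>j\<in>I. cinner (x j) (x i) * cinner (F [] (ket j)) (ket i))"
    using h(2) unfolding f_def by simp
qed

section \<open>The difference of two kernels\<close>

definition kernel_diff :: "real \<Rightarrow> real \<Rightarrow> ('n \<Rightarrow> ('h :: chilbert_space \<Rightarrow>\<^sub>L 'h)) \<Rightarrow> ('n \<Rightarrow> ('h \<Rightarrow>\<^sub>L 'h))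
    \<Rightarrow> 'n list \<Rightarrow> 'n list \<Rightarrow> ('h \<Rightarrow>\<^sub>L 'h)" where
  "kernel_diff \<rho> c A B \<alpha> \<beta> = c\<^sup>2 *\<^sub>R mt_kernel \<rho> B \<alpha> \<beta> - mt_kernel \<rho> A \<alpha> \<beta>"

lemma kernel_diff_Cons:
  "kernel_diff \<rho> c A B (i # \<alpha>) (j # \<beta>) = (if i = j then kernel_diff \<rho> c A B \<alpha> \<beta> else 0)"
  by (simp add: kernel_diff_def mt_kernel_Cons)

lemma cinner_kernel_diff:
  "cinner (kernel_diff \<rho> c A B \<alpha> \<beta> h) h'
    = c\<^sup>2 *\<^sub>R cinner (mt_kernel \<rho> B \<alpha> \<beta> h) h' - cinner (mt_kernel \<rho> A \<alpha> \<beta> h) h'"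
  by (simp add: kernel_diff_def blinfun.diff_left blinfun.scaleR_left cinner_diff_left cinner_scaleR_left)

lemma cbounded_kernel_diff:
  "(\<And>i. cbounded (A i)) \<Longrightarrow> (\<And>i. cbounded (B i)) \<Longrightarrow> cbounded (kernel_diff \<rho> c A B \<alpha> \<beta>)"
  by (simp add: kernel_diff_def cbounded_mt_kernel)

lemma adj_kernel_diff:
  "(\<And>i. cbounded (A i)) \<Longrightarrow> (\<And>i. cbounded (B i)) \<Longrightarrow>
    adj (kernel_diff \<rho> c A B \<alpha> \<beta>) = kernel_diff \<rho> c A B \<beta> \<alpha>"
  by (simp add: kernel_diff_def adj_diff adj_scaleR cbounded_mt_kernel adj_mt_kernel)

text \<open>One of the two truncated differences is 0, so the exponent is the absolute difference of
  the lengths.\<close>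

lemma mt_kernel_scaleR:
  assumes "\<And>i. cbounded (X i)"
  shows "mt_kernel \<rho> (\<lambda>i. r *\<^sub>R X i) \<alpha> \<beta>
    = r ^ ((length \<beta> - length \<alpha>) + (length \<alpha> - length \<beta>)) *\<^sub>R mt_kernel \<rho> X \<alpha> \<beta>"
  by (auto simp: mt_kernel_def wprod_scaleR adj_scaleR cbounded_wprod assms dest: prefix_length_less)

text \<open>The shift relation and Hermitian symmetry determine such a kernel from its first row, so
  the agreement on words paired with the empty word propagates to all pairs.\<close>

lemma model_kernel:
  assumes Z: "row_contraction Z" and cK: "\<And>\<alpha> \<beta>. cbounded (K \<alpha> \<beta>)" and adjK: "\<And>\<alpha> \<beta>. adj (K \<alpha> \<beta>) = K \<beta> \<alpha>"
    and shift: "\<And>i j \<alpha> \<beta>. K (i # \<alpha>) (j # \<beta>) = (if i = j then K \<alpha> \<beta> else 0)"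
    and v: "\<And>\<alpha> i j. cinner (wprod Z \<alpha> (v j)) (v i) = cinner (K [] \<alpha> (z j)) (z i)"
  shows "cinner (mt_kernel 1 Z \<alpha> \<beta> (v j)) (v i) = cinner (K \<alpha> \<beta> (z j)) (z i)"
proof (induction \<alpha> arbitrary: \<beta>)
  case Nil
  then show ?case using v[of "[]"] v[of \<beta>] by (simp add: mt_kernel_Nil_left)
next
  case (Cons a \<alpha>)
  have cZ: "cbounded (wprod Z \<alpha>)" for \<alpha> using Z by (simp add: row_contraction_def cbounded_wprod)
  show ?case
  proof (cases \<beta>)
    case Nil
    have "cinner (adj (wprod Z (a # \<alpha>)) (v j)) (v i) = cnj (cinner (wprod Z (a # \<alpha>) (v i)) (v j))"
      by (subst cinner_adj'[OF cZ]) (rule cinner_commute)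
    also have "\<dots> = cnj (cinner (K [] (a # \<alpha>) (z i)) (z j))" by (simp only: v)
    also have "\<dots> = cinner (adj (K [] (a # \<alpha>)) (z j)) (z i)"
      by (subst cinner_adj'[OF cK]) (rule cinner_commute[symmetric])
    finally show ?thesis by (simp add: Nil mt_kernel_Nil_right adjK)
  next
    case (Cons b \<beta>')
    then show ?thesis using Cons.IH by (simp add: mt_kernel_Cons shift)
  qed
qed

subsection \<open>Kernels and the operators \<open>P\<^sub>\<rho>(rX, R)\<close>\<close>

text \<open>The strictly upper part of the kernel form without its factor \<open>1 / \<rho>\<close>.
  It carries the whole dependence on the tuple; the lower part is its conjugate transpose.\<close>

definition upper_entry :: "('n \<Rightarrow> ('h :: chilbert_space \<Rightarrow>\<^sub>L 'h)) \<Rightarrow> 'n list \<Rightarrow> 'n list \<Rightarrow> 'h \<Rightarrow> 'h \<Rightarrow> complex" where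
  "upper_entry X \<alpha> \<beta> h h' =
    (if strict_prefix \<alpha> \<beta> then cinner (wprod X (drop (length \<alpha>) \<beta>) h) h' else 0)"

lemma cinner_mt_kernel:
  assumes "\<And>i. cbounded (X i)"
  shows "cinner (mt_kernel \<rho> X \<alpha> \<beta> h) h'
    = (1 / \<rho>) *\<^sub>R (upper_entry X \<alpha> \<beta> h h' + cnj (upper_entry X \<beta> \<alpha> h' h)) + (if \<alpha> = \<beta> then cinner h h' else 0)"
proof -
  have "cinner (adj (wprod X \<gamma>) h) h' = cnj (cinner (wprod X \<gamma> h') h)" for \<gamma>
    by (subst cinner_adj'[OF cbounded_wprod[OF assms]]) (rule cinner_commute)
  then show ?thesis
    by (auto simp: mt_kernel_def upper_entry_def blinfun.scaleR_left cinner_scaleR_left)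
qed

text \<open>In the basis of words, the adjoint of the right creation operators of \<delta> has the
  entry 1 exactly where \<open>\<beta> = \<alpha> @ \<delta>\<close>. Each pair of words therefore
  meets one homogeneous part only, and on finite combinations the operator series becomes a finite
  sum.\<close>

lemma P_rho_form:
  fixes X :: "'n :: finite \<Rightarrow> ('h :: chilbert_space \<Rightarrow>\<^sub>L 'h)" and x :: "'n list \<Rightarrow> 'h"
  assumes X: "row_bounded C X" and r: "0 \<le> r" "r < 1" and F: "finite F" and \<rho>: "\<rho> > 0"
  defines "f \<equiv> \<Sum>\<gamma>\<in>F. tensor_vec (x \<gamma>) (ket \<gamma>)"
  shows "cinner (P_rho \<rho> X r f) f
    = \<rho> *\<^sub>R (\<Sum>\<alpha>\<in>F. \<Sum>\<beta>\<in>F. cinner (mt_kernel \<rho> (\<lambda>i. r *\<^sub>R X i) \<alpha> \<beta> (x \<beta>)) (x \<alpha>))"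
proof -
  have cX: "cbounded (X i)" for i using X by (simp add: row_bounded_def)
  have cW: "cbounded (wprod X \<alpha>)" for \<alpha> by (rule cbounded_wprod[OF cX])
  have cR: "cbounded (wprod right_creation \<alpha>)" for \<alpha> :: "'n list" by (simp add: cbounded_wprod)
  define S where "S k = (\<Sum>\<alpha>\<in>words (Suc k).
      r ^ Suc k *\<^sub>R tensor_op (wprod X \<alpha>) (adj (wprod right_creation (rev \<alpha>))))" for k
  have cS: "cbounded (S k)" for k by (simp add: S_def cbounded_tensor_op cW cR)
  have bound: "norm (S k) \<le> sqrt C * r ^ Suc k" for k
  proof -
    have b: "norm (\<Sum>\<alpha>\<in>words (Suc k). tensor_op (wprod X \<alpha>) (adj (wprod right_creation (rev \<alpha>)))) \<le> sqrt (C * 1)"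
      by (rule norm_sum_tensor_op_le) (use X column_right_creation in \<open>auto simp: row_bounded_def cW cR\<close>)
    show ?thesis
      unfolding S_def scaleR_sum_right[symmetric]
      using mult_left_mono[OF b, of "r ^ Suc k"] r by (simp add: ac_simps)
  qed
  have geom: "summable (\<lambda>k. sqrt C * r ^ Suc k)"
    using r by (intro summable_mult summable_Suc_iff[THEN iffD2] summable_geometric) simp
  have sS: "summable S" by (rule summable_comparison_test'[OF geom, of 0]) (rule bound)
  have sS': "summable (\<lambda>k. adj (S k))"
    by (rule summable_comparison_test'[OF geom, of 0]) (rule order_trans[OF norm_adj_le[OF cS] bound])
  have adjS: "adj (S k) = (\<Sum>\<alpha>\<in>words (Suc k). r ^ Suc k *\<^sub>R tensor_op (adj (wprod X \<alpha>)) (wprod right_creation (rev \<alpha>)))" for k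
    unfolding S_def by (simp add: adj_sum adj_scaleR cbounded_tensor_op cW cR adj_tensor_op)
  have P: "P_rho \<rho> X r = suminf S + \<rho> *\<^sub>R id_blinfun + (\<Sum>k. adj (S k))"
    unfolding P_rho_def tensor_op_id adjS[symmetric] S_def[symmetric] ..
  define g where "g = (\<Sum>\<alpha>\<in>F. \<Sum>\<beta>\<in>F. upper_entry (\<lambda>i. r *\<^sub>R X i) \<alpha> \<beta> (x \<beta>) (x \<alpha>))"
  \<comment> \<open>\<open>S k\<close> has degree \<open>Suc k\<close>, hence the
    \<open>- 1\<close>. Truncated subtraction does no harm, as \<open>upper_entry\<close> vanishes
    unless \<alpha> is a strict prefix of \<beta>.\<close>
  have form: "cinner (S k f) f = (\<Sum>\<alpha>\<in>F. \<Sum>\<beta>\<in>F. if k = length \<beta> - length \<alpha> - 1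
      then upper_entry (\<lambda>i. r *\<^sub>R X i) \<alpha> \<beta> (x \<beta>) (x \<alpha>) else 0)" for k
  proof -
    have "cinner (S k f) f = (\<Sum>\<delta>\<in>words (Suc k). \<Sum>\<alpha>\<in>F. \<Sum>\<beta>\<in>F.
        if \<beta> = \<alpha> @ \<delta> then cinner (wprod (\<lambda>i. r *\<^sub>R X i) \<delta> (x \<beta>)) (x \<alpha>) else 0)"
      unfolding S_def blinfun.sum_left cinner_sum_left blinfun.scaleR_left cinner_scaleR_left f_def
        cinner_tensor_op_finite[OF cW cbounded_adj[OF cR]] cinner_adj_wprod_right_creation_ket
      by (intro sum.cong refl) (simp add: scaleR_sum_right words_def wprod_scaleR blinfun.scaleR_left
          cinner_scaleR_left if_distrib cong: if_cong)
    also have "\<dots> = (\<Sum>\<alpha>\<in>F. \<Sum>\<beta>\<in>F. \<Sum>\<delta>\<in>words (Suc k).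
        if \<beta> = \<alpha> @ \<delta> then cinner (wprod (\<lambda>i. r *\<^sub>R X i) \<delta> (x \<beta>)) (x \<alpha>) else 0)"
      by (rule trans[OF sum.swap], rule sum.cong[OF refl], rule sum.swap)
    also have "\<dots> = (\<Sum>\<alpha>\<in>F. \<Sum>\<beta>\<in>F. if k = length \<beta> - length \<alpha> - 1
        then upper_entry (\<lambda>i. r *\<^sub>R X i) \<alpha> \<beta> (x \<beta>) (x \<alpha>) else 0)"
    proof (intro sum.cong refl)
      fix \<alpha> \<beta>
      show "(\<Sum>\<delta>\<in>words (Suc k). if \<beta> = \<alpha> @ \<delta> then cinner (wprod (\<lambda>i. r *\<^sub>R X i) \<delta> (x \<beta>)) (x \<alpha>) else 0)
          = (if k = length \<beta> - length \<alpha> - 1 then upper_entry (\<lambda>i. r *\<^sub>R X i) \<alpha> \<beta> (x \<beta>) (x \<alpha>) else 0)"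
      proof (cases "strict_prefix \<alpha> \<beta>")
        case True
        then obtain \<gamma> where \<gamma>: "\<beta> = \<alpha> @ \<gamma>" "\<gamma> \<noteq> []" by (auto simp: strict_prefix_def prefix_def)
        have "(\<Sum>\<delta>\<in>words (Suc k). if \<beta> = \<alpha> @ \<delta> then cinner (wprod (\<lambda>i. r *\<^sub>R X i) \<delta> (x \<beta>)) (x \<alpha>) else 0)
            = (\<Sum>\<delta>\<in>words (Suc k). if \<delta> = \<gamma> then cinner (wprod (\<lambda>i. r *\<^sub>R X i) \<gamma> (x \<beta>)) (x \<alpha>) else 0)"
          by (intro sum.cong refl) (auto simp: \<gamma>)
        also have "\<dots> = (if \<gamma> \<in> words (Suc k) then cinner (wprod (\<lambda>i. r *\<^sub>R X i) \<gamma> (x \<beta>)) (x \<alpha>) else 0)"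
          by simp
        also have "\<gamma> \<in> words (Suc k) \<longleftrightarrow> k = length \<beta> - length \<alpha> - 1"
          using \<gamma> by (cases \<gamma>) (auto simp: words_def)
        finally show ?thesis using True by (simp add: upper_entry_def \<gamma>(1))
      next
        case False
        have "\<beta> \<noteq> \<alpha> @ \<delta>" if "\<delta> \<in> words (Suc k)" for \<delta>
          using False that by (auto simp: words_def strict_prefix_def)
        then show ?thesis using False by (simp add: upper_entry_def)
      qed
    qed
    finally show ?thesis .
  qed
  have "(\<lambda>k. cinner (S k f) f) sums g"
    unfolding form g_def by (intro sums_sum sums_single)
  moreover have "(\<lambda>k. cinner (S k f) f) sums cinner (suminf S f) f"
    by (rule bounded_linear.sums[OF bounded_linear_quadratic_form summable_sums[OF sS]])
  ultimately have 1: "cinner (suminf S f) f = g" by (rule sums_unique2[symmetric])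
  have adj: "cinner (adj (S k) f) f = cnj (cinner (S k f) f)" for k
    by (subst cinner_adj'[OF cS]) (rule cinner_commute)
  have "(\<lambda>k. cinner (adj (S k) f) f) sums cnj g"
    unfolding adj using \<open>(\<lambda>k. cinner (S k f) f) sums g\<close> by (simp add: sums_cnj)
  moreover have "(\<lambda>k. cinner (adj (S k) f) f) sums cinner ((\<Sum>k. adj (S k)) f) f"
    by (rule bounded_linear.sums[OF bounded_linear_quadratic_form summable_sums[OF sS']])
  ultimately have 2: "cinner ((\<Sum>k. adj (S k)) f) f = cnj g" by (rule sums_unique2[symmetric])
  have 3: "cinner f f = (\<Sum>\<alpha>\<in>F. \<Sum>\<beta>\<in>F. if \<alpha> = \<beta> then cinner (x \<beta>) (x \<alpha>) else 0)"
    unfolding f_def cinner_sum_left cinner_sum_right cinner_tensor_vec cinner_ket_ket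
    by (intro sum.cong refl) auto
  have "cinner (P_rho \<rho> X r f) f = g + \<rho> *\<^sub>R cinner f f + cnj g"
    unfolding P by (simp add: blinfun.add_left blinfun.scaleR_left cinner_add_left cinner_scaleR_left 1 2)
  also have "cnj g = (\<Sum>\<alpha>\<in>F. \<Sum>\<beta>\<in>F. cnj (upper_entry (\<lambda>i. r *\<^sub>R X i) \<beta> \<alpha> (x \<alpha>) (x \<beta>)))"
    unfolding g_def cnj_sum by (rule sum.swap)
  finally show ?thesis
    unfolding 3 g_def using \<rho>
    by (simp add: cinner_mt_kernel cX sum.distrib scaleR_add_right scaleR_sum_right[symmetric] add_ac)
qed

text \<open>A family in \<open>kernel_positive\<close> may repeat words, whereas a vector over the
  Fock space has one coefficient per word; vectors attached to the same word are added up.\<close>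

lemma kernel_sum_group:
  fixes K :: "'n list \<Rightarrow> 'n list \<Rightarrow> ('h :: chilbert_space \<Rightarrow>\<^sub>L 'h)"
  assumes I: "finite I"
  shows "(\<Sum>i\<in>I. \<Sum>j\<in>I. cinner (K (\<sigma> i) (\<sigma> j) (h j)) (h i))
    = (\<Sum>\<alpha>\<in>\<sigma> ` I. \<Sum>\<beta>\<in>\<sigma> ` I. cinner (K \<alpha> \<beta> (\<Sum>j\<in>{j\<in>I. \<sigma> j = \<beta>}. h j)) (\<Sum>i\<in>{i\<in>I. \<sigma> i = \<alpha>}. h i))"
proof -
  have "(\<Sum>i\<in>I. \<Sum>j\<in>I. cinner (K (\<sigma> i) (\<sigma> j) (h j)) (h i))
      = (\<Sum>\<alpha>\<in>\<sigma> ` I. \<Sum>i\<in>{i\<in>I. \<sigma> i = \<alpha>}. \<Sum>j\<in>I. cinner (K (\<sigma> i) (\<sigma> j) (h j)) (h i))"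
    by (rule sum.image_gen[OF I])
  also have "\<dots> = (\<Sum>\<alpha>\<in>\<sigma> ` I. \<Sum>i\<in>{i\<in>I. \<sigma> i = \<alpha>}. \<Sum>\<beta>\<in>\<sigma> ` I. \<Sum>j\<in>{j\<in>I. \<sigma> j = \<beta>}. cinner (K (\<sigma> i) (\<sigma> j) (h j)) (h i))"
    by (intro sum.cong refl sum.image_gen[OF I])
  also have "\<dots> = (\<Sum>\<alpha>\<in>\<sigma> ` I. \<Sum>\<beta>\<in>\<sigma> ` I. \<Sum>i\<in>{i\<in>I. \<sigma> i = \<alpha>}. \<Sum>j\<in>{j\<in>I. \<sigma> j = \<beta>}. cinner (K (\<sigma> i) (\<sigma> j) (h j)) (h i))"
    by (intro sum.cong refl sum.swap)
  also have "\<dots> = (\<Sum>\<alpha>\<in>\<sigma> ` I. \<Sum>\<beta>\<in>\<sigma> ` I. cinner (K \<alpha> \<beta> (\<Sum>j\<in>{j\<in>I. \<sigma> j = \<beta>}. h j)) (\<Sum>i\<in>{i\<in>I. \<sigma> i = \<alpha>}. h i))"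
    unfolding blinfun.sum_right cinner_sum_right unfolding cinner_sum_left by (intro sum.cong refl) auto
  finally show ?thesis .
qed

lemma limit_from_below_nonneg:
  fixes \<phi> :: "real \<Rightarrow> real"
  assumes "isCont \<phi> 1" "\<And>r. 0 \<le> r \<Longrightarrow> r < 1 \<Longrightarrow> 0 \<le> \<phi> r"
  shows "0 \<le> \<phi> 1"
proof (rule tendsto_lowerbound)
  show "(\<phi> \<longlongrightarrow> \<phi> 1) (at_left 1)"
    using assms(1) unfolding isCont_def by (rule filterlim_mono[OF _ order_refl at_le]) simp
  show "\<forall>\<^sub>F r in at_left 1. 0 \<le> \<phi> r"
    using eventually_at_left_real[of 0 1] assms(2) by (auto elim: eventually_mono)
qed simp

context
  fixes \<rho> c C :: real and A B :: "'n :: finite \<Rightarrow> ('h :: chilbert_space \<Rightarrow>\<^sub>L 'h)"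
  assumes \<rho>: "\<rho> > 0" and A: "row_bounded C A" and B: "row_bounded C B"
begin

lemma cbounded_tuples: "cbounded (A i)" "cbounded (B i)"
  using A B by (simp_all add: row_bounded_def)

lemma kernel_diff_scaled:
  "kernel_diff \<rho> c (\<lambda>i. r *\<^sub>R A i) (\<lambda>i. r *\<^sub>R B i) \<alpha> \<beta>
    = r ^ ((length \<beta> - length \<alpha>) + (length \<alpha> - length \<beta>)) *\<^sub>R kernel_diff \<rho> c A B \<alpha> \<beta>"
  by (simp add: kernel_diff_def mt_kernel_scaleR cbounded_tuples scaleR_diff_right mult.commute)

lemma kernel_model:
  assumes "kernel_positive (kernel_diff \<rho> c A B)"
  shows "\<exists>(v :: nat \<Rightarrow> seq_space) (Z :: 'n \<Rightarrow> (seq_space \<Rightarrow>\<^sub>L seq_space)). row_contraction Z \<and>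
    (\<forall>\<alpha> i j. cinner (wprod Z \<alpha> (v j)) (v i) = cinner (kernel_diff \<rho> c A B [] \<alpha> (z j)) (z i)) \<and>
    (\<forall>\<alpha> \<beta> i j. cinner (mt_kernel 1 Z \<alpha> \<beta> (v j)) (v i) = cinner (kernel_diff \<rho> c A B \<alpha> \<beta> (z j)) (z i))"
proof -
  have c: "cbounded (kernel_diff \<rho> c A B \<alpha> \<beta>)" for \<alpha> \<beta> by (rule cbounded_kernel_diff) (rule cbounded_tuples)+
  obtain v :: "nat \<Rightarrow> seq_space" and Z :: "'n \<Rightarrow> (seq_space \<Rightarrow>\<^sub>L seq_space)" where Z: "row_contraction Z"
    and v: "\<And>\<alpha> i j. cinner (wprod Z \<alpha> (v j)) (v i) = cinner (kernel_diff \<rho> c A B [] \<alpha> (z j)) (z i)"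
    using multi_toeplitz_model[OF assms c kernel_diff_Cons, of z] by blast
  have "cinner (mt_kernel 1 Z \<alpha> \<beta> (v j)) (v i) = cinner (kernel_diff \<rho> c A B \<alpha> \<beta> (z j)) (z i)" for \<alpha> \<beta> i j
    by (rule model_kernel[OF Z c _ kernel_diff_Cons v]) (simp add: adj_kernel_diff cbounded_tuples)
  with Z v show ?thesis by blast
qed

text \<open>Scaling the tuples multiplies each entry by a power of \<open>r\<close>. In the model
  the same multiplication arises by passing from \<open>Z\<close> to \<open>r\<close> times
  \<open>Z\<close>, which is again a row contraction and so has a positive kernel.\<close>

lemma kernel_positive_scaled:
  assumes pos: "kernel_positive (kernel_diff \<rho> c A B)" and r: "0 \<le> r" "r < 1"
  shows "kernel_positive (kernel_diff \<rho> c (\<lambda>i. r *\<^sub>R A i) (\<lambda>i. r *\<^sub>R B i))"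
  unfolding kernel_positive_def
proof (intro allI)
  fix N :: nat and \<sigma> :: "nat \<Rightarrow> 'n list" and h :: "nat \<Rightarrow> 'h"
  obtain v :: "nat \<Rightarrow> seq_space" and Z :: "'n \<Rightarrow> (seq_space \<Rightarrow>\<^sub>L seq_space)" where Z: "row_contraction Z"
    and v: "\<And>\<alpha> \<beta> i j. cinner (mt_kernel 1 Z \<alpha> \<beta> (v j)) (v i) = cinner (kernel_diff \<rho> c A B \<alpha> \<beta> (h j)) (h i)"
    using kernel_model[OF pos, of h] by blast
  have cZ: "cbounded (Z i)" for i using Z by (simp add: row_contraction_def)
  have "kernel_positive (mt_kernel 1 (\<lambda>i. r *\<^sub>R Z i))"
    by (rule kernel_positive_row_contraction[OF row_ball_row_contraction[OF row_contraction_row_ball[OF Z r]]])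
  then have "(\<Sum>i<N. \<Sum>j<N. cinner (mt_kernel 1 (\<lambda>i. r *\<^sub>R Z i) (\<sigma> i) (\<sigma> j) (v j)) (v i)) \<in> \<real>\<^sub>\<ge>\<^sub>0"
    by (rule kernel_positiveD) simp
  then show "(\<Sum>i<N. \<Sum>j<N. cinner (kernel_diff \<rho> c (\<lambda>i. r *\<^sub>R A i) (\<lambda>i. r *\<^sub>R B i) (\<sigma> i) (\<sigma> j) (h j)) (h i)) \<in> \<real>\<^sub>\<ge>\<^sub>0"
    by (simp add: kernel_diff_scaled mt_kernel_scaleR cZ blinfun.scaleR_left cinner_scaleR_left v)
qed

lemma P_rho_dominated_iff:
  assumes r: "0 \<le> r" "r < 1"
  shows "op_le_on UNIV (P_rho \<rho> A r) (c\<^sup>2 *\<^sub>R P_rho \<rho> B r)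
    \<longleftrightarrow> kernel_positive (kernel_diff \<rho> c (\<lambda>i. r *\<^sub>R A i) (\<lambda>i. r *\<^sub>R B i))"
proof -
  let ?K = "kernel_diff \<rho> c (\<lambda>i. r *\<^sub>R A i) (\<lambda>i. r *\<^sub>R B i)"
  let ?T = "c\<^sup>2 *\<^sub>R P_rho \<rho> B r - P_rho \<rho> A r"
  have form: "cinner (?T (\<Sum>\<gamma>\<in>F. tensor_vec (x \<gamma>) (ket \<gamma>))) (\<Sum>\<gamma>\<in>F. tensor_vec (x \<gamma>) (ket \<gamma>))
      = complex_of_real \<rho> * (\<Sum>\<alpha>\<in>F. \<Sum>\<beta>\<in>F. cinner (?K \<alpha> \<beta> (x \<beta>)) (x \<alpha>))" if "finite F" for F x
    by (simp add: blinfun.diff_left blinfun.scaleR_left cinner_diff_left cinner_scaleR_left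
        P_rho_form[OF A r that \<rho>] P_rho_form[OF B r that \<rho>] cinner_kernel_diff sum_subtractf
        scaleR_conv_of_real sum_distrib_left[symmetric] right_diff_distrib)
  have \<rho>_iff: "complex_of_real \<rho> * w \<in> \<real>\<^sub>\<ge>\<^sub>0 \<longleftrightarrow> w \<in> \<real>\<^sub>\<ge>\<^sub>0" for w
    using \<rho> by (auto simp: complex_nonneg_Reals_iff zero_le_mult_iff)
  show ?thesis
  proof
    assume le: "op_le_on UNIV (P_rho \<rho> A r) (c\<^sup>2 *\<^sub>R P_rho \<rho> B r)"
    show "kernel_positive ?K"
      unfolding kernel_positive_def
    proof (intro allI)
      fix N :: nat and \<sigma> :: "nat \<Rightarrow> 'n list" and h :: "nat \<Rightarrow> 'h"
      have "complex_of_real \<rho> * (\<Sum>i<N. \<Sum>j<N. cinner (?K (\<sigma> i) (\<sigma> j) (h j)) (h i)) \<in> \<real>\<^sub>\<ge>\<^sub>0"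
        unfolding kernel_sum_group[OF finite_lessThan]
        by (subst form[symmetric]) (use le in \<open>simp_all add: op_le_on_def op_positive_on_def\<close>)
      then show "(\<Sum>i<N. \<Sum>j<N. cinner (?K (\<sigma> i) (\<sigma> j) (h j)) (h i)) \<in> \<real>\<^sub>\<ge>\<^sub>0" by (simp only: \<rho>_iff)
    qed
  next
    assume pos: "kernel_positive ?K"
    have "op_positive_on (ell2_on UNIV) ?T"
      by (rule op_positive_on_denseI) (simp only: form \<rho>_iff kernel_positiveD[OF pos, where \<sigma> = "\<lambda>\<alpha>. \<alpha>"])
    then show "op_le_on UNIV (P_rho \<rho> A r) (c\<^sup>2 *\<^sub>R P_rho \<rho> B r)" by (simp add: op_le_on_def)
  qed
qed

lemma P_rho_dominated_iff_kernel_positive: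
  "(\<forall>r\<in>{0..<1}. op_le_on UNIV (P_rho \<rho> A r) (c\<^sup>2 *\<^sub>R P_rho \<rho> B r)) \<longleftrightarrow> kernel_positive (kernel_diff \<rho> c A B)"
proof
  assume "\<forall>r\<in>{0..<1}. op_le_on UNIV (P_rho \<rho> A r) (c\<^sup>2 *\<^sub>R P_rho \<rho> B r)"
  then have pos: "kernel_positive (kernel_diff \<rho> c (\<lambda>i. r *\<^sub>R A i) (\<lambda>i. r *\<^sub>R B i))" if "0 \<le> r" "r < 1" for r
    using P_rho_dominated_iff[OF that] that by simp
  show "kernel_positive (kernel_diff \<rho> c A B)"
  proof (rule kernel_positiveI)
    fix N :: nat and \<sigma> :: "nat \<Rightarrow> 'n list" and h :: "nat \<Rightarrow> 'h"
    define n where "n i j = (length (\<sigma> j) - length (\<sigma> i)) + (length (\<sigma> i) - length (\<sigma> j))" for i j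
    define \<phi> where "\<phi> r = (\<Sum>i<N. \<Sum>j<N. r ^ n i j * Re (cinner (kernel_diff \<rho> c A B (\<sigma> i) (\<sigma> j) (h j)) (h i)))" for r
    have "0 \<le> \<phi> 1"
    proof (rule limit_from_below_nonneg)
      show "isCont \<phi> 1" unfolding \<phi>_def by (intro continuous_intros)
      fix r :: real assume "0 \<le> r" "r < 1"
      from kernel_positiveD[OF pos[OF this] finite_lessThan, where \<sigma> = \<sigma> and h = h] show "0 \<le> \<phi> r"
        by (simp add: \<phi>_def n_def kernel_diff_scaled blinfun.scaleR_left cinner_scaleR_left complex_nonneg_Reals_iff)
    qed
    then show "0 \<le> Re (\<Sum>i<N. \<Sum>j<N. cinner (kernel_diff \<rho> c A B (\<sigma> i) (\<sigma> j) (h j)) (h i))"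
      by (simp add: \<phi>_def)
  qed (simp_all add: cbounded_kernel_diff adj_kernel_diff cbounded_tuples)
next
  assume "kernel_positive (kernel_diff \<rho> c A B)"
  then show "\<forall>r\<in>{0..<1}. op_le_on UNIV (P_rho \<rho> A r) (c\<^sup>2 *\<^sub>R P_rho \<rho> B r)"
    using P_rho_dominated_iff kernel_positive_scaled by auto
qed

subsection \<open>Positive free pluriharmonic functions\<close>

text \<open>The form of \<open>F\<close> at \<open>r\<close> times the model, in the vector
  \<open>w\<close> built from the model vectors, is nonnegative by hypothesis. Multiplied by \<rho>,
  its real part is the form of the difference to be estimated.\<close>

lemma pluriharmonic_dominated:
  assumes pos: "kernel_positive (kernel_diff \<rho> c A B)" and F: "positive_pluriharmonic J F"
    and r: "0 \<le> r" "r < 1"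
  shows "op_le_on (ell2_on J)
    (pluriharmonic_eval F (\<lambda>i. r *\<^sub>R A i) + (\<rho> - 1) *\<^sub>R pluriharmonic_eval F (\<lambda>_. 0))
    (c\<^sup>2 *\<^sub>R (pluriharmonic_eval F (\<lambda>i. r *\<^sub>R B i) + (\<rho> - 1) *\<^sub>R pluriharmonic_eval F (\<lambda>_. 0)))"
  unfolding op_le_on_def
proof (rule op_positive_on_denseI)
  fix I :: "nat set" and x :: "nat \<Rightarrow> 'h"
  assume I: "finite I" "I \<subseteq> J"
  have F': "free_holomorphic J F" using F by (simp add: positive_pluriharmonic_def)
  define f where "f = (\<Sum>i\<in>I. tensor_vec (x i) (ket i))"
  obtain v :: "nat \<Rightarrow> seq_space" and Z :: "'n \<Rightarrow> (seq_space \<Rightarrow>\<^sub>L seq_space)" where Z: "row_contraction Z"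
    and v: "\<And>\<alpha> i j. cinner (wprod Z \<alpha> (v j)) (v i) = cinner (kernel_diff \<rho> c A B [] \<alpha> (x j)) (x i)"
    using kernel_model[OF pos, of x] by blast
  define w where "w = (\<Sum>i\<in>I. tensor_vec (v i) (ket i))"
  define e where "e = (\<Sum>i\<in>I. \<Sum>j\<in>I. cinner (x j) (x i) * cinner (F [] (ket j)) (ket i))"
  let ?a = "\<lambda>X k. (\<Sum>\<alpha>\<in>words k. \<Sum>i\<in>I. \<Sum>j\<in>I. cinner (wprod X \<alpha> (x j)) (x i) * cinner (F \<alpha> (ket j)) (ket i))"
  let ?m = "\<lambda>k. (\<Sum>\<alpha>\<in>words k. \<Sum>i\<in>I. \<Sum>j\<in>I. cinner (wprod Z \<alpha> (v j)) (v i) * cinner (F \<alpha> (ket j)) (ket i))"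
  define SA where "SA = cinner (holo_eval F (\<lambda>i. r *\<^sub>R A i) f) f"
  define SB where "SB = cinner (holo_eval F (\<lambda>i. r *\<^sub>R B i) f) f"
  define M where "M = cinner (holo_eval F (\<lambda>i. r *\<^sub>R Z i) w) w"
  have SA: "(\<lambda>k. ?a A k * complex_of_real r ^ k) sums SA"
    unfolding SA_def f_def by (rule holo_eval_form(2)[OF F' A r])
  have SB: "(\<lambda>k. ?a B k * complex_of_real r ^ k) sums SB"
    unfolding SB_def f_def by (rule holo_eval_form(2)[OF F' B r])
  have M: "(\<lambda>k. ?m k * complex_of_real r ^ k) sums M"
    unfolding M_def w_def by (rule holo_eval_form(2)[OF F' row_contraction_row_bounded[OF Z] r])
  \<comment> \<open>Only degree 0 needs a correction: there the model contributes
    \<open>\<rho> * (c\<^sup>2 - 1)\<close> and the tuples \<open>c\<^sup>2 - 1\<close>. The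
    difference \<open>(\<rho> - 1) * (c\<^sup>2 - 1)\<close> is the contribution of the terms with
    \<open>u(0)\<close>.\<close>
  have m: "complex_of_real \<rho> * ?m k = complex_of_real (c\<^sup>2) * ?a B k - ?a A k
      + (if k = 0 then complex_of_real ((\<rho> - 1) * (c\<^sup>2 - 1)) * e else 0)" for k
  proof (cases "k = 0")
    case True
    have "cinner (v j) (v i) = cinner (kernel_diff \<rho> c A B [] [] (x j)) (x i)" for i j
      using v[of "[]"] by simp
    then have "cinner (v j) (v i) = complex_of_real (c\<^sup>2 - 1) * cinner (x j) (x i)" for i j
      by (simp add: cinner_kernel_diff mt_kernel_Nil_left scaleR_conv_of_real algebra_simps)
    then have mk: "?m k = complex_of_real (c\<^sup>2 - 1) * e"
      by (simp add: True e_def sum_distrib_left mult.assoc)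
    have ak: "?a A k = e" "?a B k = e" by (simp_all add: True e_def)
    show ?thesis unfolding mk ak using True by (simp add: algebra_simps)
  next
    case False
    have "complex_of_real \<rho> * cinner (wprod Z \<alpha> (v j)) (v i)
        = complex_of_real (c\<^sup>2) * cinner (wprod B \<alpha> (x j)) (x i) - cinner (wprod A \<alpha> (x j)) (x i)"
      if "\<alpha> \<in> words k" for \<alpha> i j
    proof -
      have "\<alpha> \<noteq> []" using that False by (auto simp: words_def)
      then show ?thesis using \<rho>
        by (simp add: v cinner_kernel_diff mt_kernel_Nil_left blinfun.scaleR_left cinner_scaleR_left
            scaleR_conv_of_real field_simps)
    qed
    then have "complex_of_real \<rho> * ?m k = (\<Sum>\<alpha>\<in>words k. \<Sum>i\<in>I. \<Sum>j\<in>I.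
        (complex_of_real (c\<^sup>2) * cinner (wprod B \<alpha> (x j)) (x i) - cinner (wprod A \<alpha> (x j)) (x i))
          * cinner (F \<alpha> (ket j)) (ket i))"
      unfolding sum_distrib_left mult.assoc[symmetric] by (intro sum.cong refl) simp
    then show ?thesis using False
      by (simp add: left_diff_distrib sum_subtractf sum_distrib_left mult.assoc)
  qed
  have "complex_of_real \<rho> * (?m k * complex_of_real r ^ k)
      = complex_of_real (c\<^sup>2) * (?a B k * complex_of_real r ^ k) - ?a A k * complex_of_real r ^ k
      + (if k = 0 then complex_of_real ((\<rho> - 1) * (c\<^sup>2 - 1)) * e else 0)" for k
  proof -
    have "complex_of_real \<rho> * (?m k * complex_of_real r ^ k) = (complex_of_real \<rho> * ?m k) * complex_of_real r ^ k"
      by (rule mult.assoc[symmetric])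
    then show ?thesis by (simp only: m) (simp add: algebra_simps)
  qed
  then have funs: "(\<lambda>k. complex_of_real \<rho> * (?m k * complex_of_real r ^ k))
      = (\<lambda>k. complex_of_real (c\<^sup>2) * (?a B k * complex_of_real r ^ k) - ?a A k * complex_of_real r ^ k
        + (if k = 0 then complex_of_real ((\<rho> - 1) * (c\<^sup>2 - 1)) * e else 0))"
    by (rule ext)
  have lhs: "(\<lambda>k. complex_of_real \<rho> * (?m k * complex_of_real r ^ k)) sums (complex_of_real \<rho> * M)"
    by (rule sums_mult[OF M])
  have rhs: "(\<lambda>k. complex_of_real (c\<^sup>2) * (?a B k * complex_of_real r ^ k) - ?a A k * complex_of_real r ^ k
      + (if k = 0 then complex_of_real ((\<rho> - 1) * (c\<^sup>2 - 1)) * e else 0)) sums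
      (complex_of_real (c\<^sup>2) * SB - SA + complex_of_real ((\<rho> - 1) * (c\<^sup>2 - 1)) * e)"
    by (intro sums_add sums_diff sums_mult SA SB sums_single)
  have eq: "complex_of_real \<rho> * M
      = complex_of_real (c\<^sup>2) * SB - SA + complex_of_real ((\<rho> - 1) * (c\<^sup>2 - 1)) * e"
    by (rule sums_unique2[OF lhs[unfolded funs] rhs])
  have "w \<in> ell2_on J" using I by (auto simp: w_def ell2_on_def ell2_nth_sum ell2_nth_tensor_ket intro!: sum.neutral)
  moreover have "(\<lambda>i. r *\<^sub>R Z i) \<in> row_ball" by (rule row_contraction_row_ball[OF Z r])
  ultimately have "cinner (pluriharmonic_eval F (\<lambda>i. r *\<^sub>R Z i) w) w \<in> \<real>\<^sub>\<ge>\<^sub>0"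
    using F by (simp add: positive_pluriharmonic_def op_positive_on_def)
  then have "Re M \<ge> 0"
    using cinner_re_op[OF holo_eval_form(1)[OF F' row_contraction_row_bounded[OF Z] r], of w]
    by (simp add: pluriharmonic_eval_def M_def complex_nonneg_Reals_iff)
  then have "0 \<le> \<rho> * Re M" using \<rho> by simp
  also have "\<rho> * Re M = c\<^sup>2 * Re SB - Re SA + (\<rho> - 1) * (c\<^sup>2 - 1) * Re e"
    using arg_cong[OF eq, of Re] by (simp del: of_real_mult of_real_power of_real_diff)
  finally have "0 \<le> c\<^sup>2 * (Re SB + (\<rho> - 1) * Re e) - (Re SA + (\<rho> - 1) * Re e)" by (simp add: algebra_simps)
  moreover have uA: "cinner (pluriharmonic_eval F (\<lambda>i. r *\<^sub>R A i) f) f = complex_of_real (Re SA)"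
    using cinner_re_op[OF holo_eval_form(1)[OF F' A r], of f] by (simp add: pluriharmonic_eval_def SA_def)
  moreover have uB: "cinner (pluriharmonic_eval F (\<lambda>i. r *\<^sub>R B i) f) f = complex_of_real (Re SB)"
    using cinner_re_op[OF holo_eval_form(1)[OF F' B r], of f] by (simp add: pluriharmonic_eval_def SB_def)
  moreover have u0: "cinner (pluriharmonic_eval F (\<lambda>_ :: 'n. 0) f) f = complex_of_real (Re e)"
    using cinner_re_op[OF holo_eval_zero_form(1)[OF F' A], of f] holo_eval_zero_form(2)[OF F' A, where I = I and x = x]
    by (simp add: pluriharmonic_eval_def e_def f_def)
  ultimately show "cinner (blinfun_apply (c\<^sup>2 *\<^sub>R (pluriharmonic_eval F (\<lambda>i. r *\<^sub>R B i) + (\<rho> - 1) *\<^sub>R pluriharmonic_eval F (\<lambda>_. 0))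
      - (pluriharmonic_eval F (\<lambda>i. r *\<^sub>R A i) + (\<rho> - 1) *\<^sub>R pluriharmonic_eval F (\<lambda>_. 0)))
      (\<Sum>i\<in>I. tensor_vec (x i) (ket i))) (\<Sum>i\<in>I. tensor_vec (x i) (ket i)) \<in> \<real>\<^sub>\<ge>\<^sub>0"
    unfolding f_def[symmetric]
    by (simp add: blinfun.diff_left blinfun.add_left blinfun.scaleR_left cinner_diff_left cinner_add_left
        cinner_scaleR_left uA uB u0 complex_nonneg_Reals_iff)
qed

end

section \<open>Harnack domination\<close>

lemma opoly_eq_sum:
  assumes "finite S" "{\<alpha>. p \<alpha> \<noteq> 0} \<subseteq> S"
  shows "opoly p X = (\<Sum>\<alpha>\<in>S. tensor_op (wprod X \<alpha>) (p \<alpha>))"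
  unfolding opoly_def by (rule sum.mono_neutral_left) (use assms in auto)

lemma cbounded_opoly: "(\<And>i. cbounded (X i)) \<Longrightarrow> (\<And>\<alpha>. cbounded (p \<alpha>)) \<Longrightarrow> cbounded (opoly p X)"
  unfolding opoly_def by (intro cbounded_sum cbounded_tensor_op cbounded_wprod)

lemma holo_eval_poly:
  assumes p: "is_poly p"
  shows "holo_eval p (X :: 'n :: finite \<Rightarrow> ('h :: chilbert_space \<Rightarrow>\<^sub>L 'h)) = opoly p X"
proof -
  define S where "S = {\<alpha>. p \<alpha> \<noteq> 0}"
  have S: "finite S" using p by (simp add: is_poly_def S_def)
  define M where "M = (\<Sum>\<alpha>\<in>S. length \<alpha>)"
  have len: "length \<alpha> \<le> M" if "\<alpha> \<in> S" for \<alpha> unfolding M_def by (rule member_le_sum) (use that S in auto)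
  have "holo_eval p X = (\<Sum>k\<le>M. \<Sum>\<alpha>\<in>words k. tensor_op (wprod X \<alpha>) (p \<alpha>))"
    unfolding holo_eval_def
  proof (rule suminf_finite)
    fix k assume "k \<notin> {..M}"
    then have "p \<alpha> = 0" if "\<alpha> \<in> words k" for \<alpha> using len[of \<alpha>] that by (auto simp: S_def words_def)
    then show "(\<Sum>\<alpha>\<in>words k. tensor_op (wprod X \<alpha>) (p \<alpha>)) = 0" by simp
  qed simp
  also have "\<dots> = (\<Sum>k\<le>M. \<Sum>\<alpha>\<in>{\<alpha>\<in>S. length \<alpha> = k}. tensor_op (wprod X \<alpha>) (p \<alpha>))"
  proof (rule sum.cong[OF refl])
    fix k
    show "(\<Sum>\<alpha>\<in>words k. tensor_op (wprod X \<alpha>) (p \<alpha>)) = (\<Sum>\<alpha>\<in>{\<alpha>\<in>S. length \<alpha> = k}. tensor_op (wprod X \<alpha>) (p \<alpha>))"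
      by (rule sum.mono_neutral_right[OF finite_words]) (auto simp: words_def S_def)
  qed
  also have "\<dots> = (\<Sum>\<alpha>\<in>S. tensor_op (wprod X \<alpha>) (p \<alpha>))"
    by (rule sum.group) (use S len in auto)
  finally show ?thesis by (simp add: opoly_def S_def)
qed

lemma free_holomorphic_poly:
  assumes p: "is_poly p" and J: "\<And>\<alpha>. p \<alpha> \<in> coeff_ops J"
  shows "free_holomorphic J p"
  unfolding free_holomorphic_def
proof (intro conjI allI J Limsup_bounded)
  define M where "M = (\<Sum>\<alpha> | p \<alpha> \<noteq> 0. length \<alpha>)"
  have len: "length \<alpha> \<le> M" if "p \<alpha> \<noteq> 0" for \<alpha>
    unfolding M_def by (rule member_le_sum) (use that p in \<open>auto simp: is_poly_def\<close>)
  show "\<forall>\<^sub>F k in sequentially. ereal (norm (\<Sum>\<alpha>\<in>words k. adj (p \<alpha>) o\<^sub>L p \<alpha>) powr (1 / (2 * real k))) \<le> 1"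
    using eventually_gt_at_top[of M]
  proof eventually_elim
    case (elim k)
    then have "p \<alpha> = 0" if "\<alpha> \<in> words k" for \<alpha> using len[of \<alpha>] that by (auto simp: words_def)
    then have "(\<Sum>\<alpha>\<in>words k. adj (p \<alpha>) o\<^sub>L p \<alpha>) = 0" by (intro sum.neutral) (auto intro: blinfun_eqI)
    then show ?case by simp
  qed
qed

lemma cinner_opoly_scaleR:
  assumes S: "finite S" "{\<alpha>. p \<alpha> \<noteq> 0} \<subseteq> S" and X: "\<And>i. cbounded (X i)" and p: "\<And>\<alpha>. cbounded (p \<alpha>)"
  shows "cinner (opoly p (\<lambda>i. r *\<^sub>R X i) f) f
    = (\<Sum>\<alpha>\<in>S. r ^ length \<alpha> *\<^sub>R cinner (tensor_op (wprod X \<alpha>) (p \<alpha>) f) f)"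
  by (simp add: opoly_eq_sum[OF S] wprod_scaleR tensor_op_scaleR_left cbounded_wprod X p blinfun.sum_left
      blinfun.scaleR_left cinner_sum_left cinner_scaleR_left)

section \<open>Toeplitz polynomials with matrix coefficients\<close>

definition matrix_unit :: "nat \<Rightarrow> nat \<Rightarrow> (seq_space \<Rightarrow>\<^sub>L seq_space)" where
  "matrix_unit i j = Blinfun (\<lambda>e. ell2_nth e j *\<^sub>C ket i)"

lemma matrix_unit_apply: "matrix_unit i j e = ell2_nth e j *\<^sub>C ket i"
proof -
  have "norm (ell2_nth e j *\<^sub>C ket i :: seq_space) \<le> norm e * norm (ket i :: seq_space)" for e :: seq_space
    unfolding norm_scaleC by (intro mult_right_mono norm_ell2_nth_le) simp
  then have "bounded_linear (\<lambda>e. ell2_nth e j *\<^sub>C ket i :: seq_space)"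
    by (intro bounded_linear_intro[where K = "norm (ket i :: seq_space)"])
      (simp_all add: ell2_nth_add scaleC_add_left scaleR_ell2.rep_eq
        bounded_bilinear.scaleR_left[OF bounded_bilinear_scaleC] del: norm_ell2_nth_le)
  then show ?thesis by (simp add: matrix_unit_def bounded_linear_Blinfun_apply)
qed

lemma cbounded_matrix_unit [simp]: "cbounded (matrix_unit i j)"
  by (simp add: cbounded_def matrix_unit_apply scaleC_ell2.rep_eq scaleC_complex_def scaleC_scaleC)

lemma matrix_unit_coeff_ops: "i < m \<Longrightarrow> j < m \<Longrightarrow> matrix_unit i j \<in> coeff_ops {..<m}"
  by (auto simp: coeff_ops_def matrix_unit_apply ell2_on_def scaleC_ell2.rep_eq ket.rep_eq)

lemma cinner_matrix_unit: "cinner (matrix_unit i j (ket l)) (ket k) = (if i = k \<and> j = l then 1 else 0)"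
  by (simp add: matrix_unit_apply cinner_scaleC_left cinner_ket_ket) (simp add: ket.rep_eq)

text \<open>The real part of \<open>toeplitz_poly N \<sigma>\<close> is the matrix \<open>(K(\<sigma>\<^sub>i, \<sigma>\<^sub>j))\<close> of the kernel with \<open>\<rho> = 1\<close>.\<close>

definition toeplitz_poly :: "nat \<Rightarrow> (nat \<Rightarrow> 'n list) \<Rightarrow> 'n list \<Rightarrow> (seq_space \<Rightarrow>\<^sub>L seq_space)" where
  "toeplitz_poly N \<sigma> \<alpha> = (\<Sum>i<N. \<Sum>j<N.
    (if \<sigma> j = \<sigma> i @ \<alpha> then if \<alpha> = [] then 1 else 2 else 0 :: real) *\<^sub>R matrix_unit i j)"

lemma toeplitz_poly_support:
  "{\<alpha>. toeplitz_poly N \<sigma> \<alpha> \<noteq> 0} \<subseteq> (\<lambda>(i, j). drop (length (\<sigma> i)) (\<sigma> j)) ` ({..<N} \<times> {..<N})"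
proof
  fix \<alpha> assume \<alpha>: "\<alpha> \<in> {\<alpha>. toeplitz_poly N \<sigma> \<alpha> \<noteq> 0}"
  have "\<exists>i<N. \<exists>j<N. \<sigma> j = \<sigma> i @ \<alpha>"
  proof (rule ccontr)
    assume "\<not> ?thesis"
    then have "toeplitz_poly N \<sigma> \<alpha> = 0" unfolding toeplitz_poly_def by (intro sum.neutral ballI) auto
    with \<alpha> show False by simp
  qed
  then obtain i j where "i < N" "j < N" "\<sigma> j = \<sigma> i @ \<alpha>" by blast
  then show "\<alpha> \<in> (\<lambda>(i, j). drop (length (\<sigma> i)) (\<sigma> j)) ` ({..<N} \<times> {..<N})"
    by (intro image_eqI[of _ _ "(i, j)"]) auto
qed

lemma is_poly_toeplitz_poly: "is_poly (toeplitz_poly N \<sigma>)"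
  unfolding is_poly_def by (rule finite_subset[OF toeplitz_poly_support]) simp

lemma coeff_ops_toeplitz_poly: "toeplitz_poly N \<sigma> \<alpha> \<in> coeff_ops {..<N}"
proof -
  have zero: "0 \<in> coeff_ops {..<N}" by (simp add: coeff_ops_def ell2_on_def)
  have add: "S + T \<in> coeff_ops {..<N}" if "S \<in> coeff_ops {..<N}" "T \<in> coeff_ops {..<N}" for S T
    using that by (auto simp: coeff_ops_def blinfun.add_left ell2_on_add)
  have scale: "r *\<^sub>R S \<in> coeff_ops {..<N}" if "S \<in> coeff_ops {..<N}" for r S
    using that by (auto simp: coeff_ops_def blinfun.scaleR_left ell2_on_def scaleR_ell2.rep_eq)
  have sum: "(\<Sum>i\<in>I. f i) \<in> coeff_ops {..<N}" if "\<And>i. i \<in> I \<Longrightarrow> f i \<in> coeff_ops {..<N}" for I and f :: "nat \<Rightarrow> _"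
    using that by (induction I rule: infinite_finite_induct) (simp_all add: zero add)
  show ?thesis unfolding toeplitz_poly_def by (intro sum scale matrix_unit_coeff_ops) auto
qed

text \<open>The coefficient 2 at nonempty words makes up for the factor 1/2 in the real part, where
  an off-diagonal entry appears once directly and once through the adjoint; the constant term gives
  the diagonal and has coefficient 1.\<close>

lemma toeplitz_poly_form:
  fixes X :: "'n :: finite \<Rightarrow> ('h :: chilbert_space \<Rightarrow>\<^sub>L 'h)" and x :: "nat \<Rightarrow> 'h" and N :: nat
  assumes X: "\<And>i. cbounded (X i)"
  defines "f \<equiv> \<Sum>i<N. tensor_vec (x i) (ket i)"
  shows "cinner (opoly (toeplitz_poly N \<sigma>) X f) f = (\<Sum>k<N. \<Sum>l<N.
    (if \<sigma> k = \<sigma> l then cinner (x l) (x k) else 0) + 2 * upper_entry X (\<sigma> k) (\<sigma> l) (x l) (x k))"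
proof -
  let ?S = "(\<lambda>(i, j). drop (length (\<sigma> i)) (\<sigma> j)) ` ({..<N} \<times> {..<N})"
  let ?w = "\<lambda>\<alpha> k l. if \<sigma> l = \<sigma> k @ \<alpha> then if \<alpha> = [] then 1 else 2 else 0 :: real"
  have S: "finite ?S" by simp
  have cp: "cbounded (toeplitz_poly N \<sigma> \<alpha>)" for \<alpha> by (rule cbounded_coeff_ops[OF coeff_ops_toeplitz_poly])
  have entry: "cinner (toeplitz_poly N \<sigma> \<alpha> (ket l)) (ket k) = complex_of_real (?w \<alpha> k l)" if kl: "k < N" "l < N" for \<alpha> k l
  proof -
    have "cinner (toeplitz_poly N \<sigma> \<alpha> (ket l)) (ket k)
        = (\<Sum>i<N. \<Sum>j<N. ?w \<alpha> i j *\<^sub>R (if i = k \<and> j = l then 1 else 0))"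
      unfolding toeplitz_poly_def blinfun.sum_left cinner_sum_left blinfun.scaleR_left cinner_scaleR_left cinner_matrix_unit ..
    also have "\<dots> = (\<Sum>i<N. \<Sum>j<N. if j = l then if i = k then complex_of_real (?w \<alpha> k l) else 0 else 0)"
      by (intro sum.cong refl) (auto simp: scaleR_conv_of_real)
    also have "\<dots> = (\<Sum>i<N. if i = k then complex_of_real (?w \<alpha> k l) else 0)"
      using kl by (simp only: sum.delta finite_lessThan lessThan_iff if_True)
    also have "\<dots> = complex_of_real (?w \<alpha> k l)"
      using kl by (simp only: sum.delta finite_lessThan lessThan_iff if_True)
    finally show ?thesis .
  qed
  have "cinner (opoly (toeplitz_poly N \<sigma>) X f) f
      = (\<Sum>\<alpha>\<in>?S. \<Sum>k<N. \<Sum>l<N. cinner (wprod X \<alpha> (x l)) (x k) * complex_of_real (?w \<alpha> k l))"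
    unfolding opoly_eq_sum[OF S toeplitz_poly_support] blinfun.sum_left cinner_sum_left f_def
      cinner_tensor_op_finite[OF cbounded_wprod[OF X] cp]
    by (intro sum.cong refl) (simp add: entry)
  also have "\<dots> = (\<Sum>k<N. \<Sum>l<N. \<Sum>\<alpha>\<in>?S. cinner (wprod X \<alpha> (x l)) (x k) * complex_of_real (?w \<alpha> k l))"
    by (rule trans[OF sum.swap], rule sum.cong[OF refl], rule sum.swap)
  also have "\<dots> = (\<Sum>k<N. \<Sum>l<N.
    (if \<sigma> k = \<sigma> l then cinner (x l) (x k) else 0) + 2 * upper_entry X (\<sigma> k) (\<sigma> l) (x l) (x k))"
  proof (intro sum.cong refl)
    fix k l assume kl: "k \<in> {..<N}" "l \<in> {..<N}"
    show "(\<Sum>\<alpha>\<in>?S. cinner (wprod X \<alpha> (x l)) (x k) * complex_of_real (?w \<alpha> k l))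
      = (if \<sigma> k = \<sigma> l then cinner (x l) (x k) else 0) + 2 * upper_entry X (\<sigma> k) (\<sigma> l) (x l) (x k)"
    proof (cases "prefix (\<sigma> k) (\<sigma> l)")
      case True
      then obtain \<gamma> where \<gamma>: "\<sigma> l = \<sigma> k @ \<gamma>" by (auto simp: prefix_def)
      have "\<gamma> \<in> ?S" using kl by (intro image_eqI[of _ _ "(k, l)"]) (auto simp: \<gamma>)
      have "(\<Sum>\<alpha>\<in>?S. cinner (wprod X \<alpha> (x l)) (x k) * complex_of_real (?w \<alpha> k l))
          = (\<Sum>\<alpha>\<in>?S. if \<alpha> = \<gamma> then cinner (wprod X \<gamma> (x l)) (x k) * complex_of_real (if \<gamma> = [] then 1 else 2) else 0)"
        by (intro sum.cong refl) (simp add: \<gamma>)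
      also have "\<dots> = cinner (wprod X \<gamma> (x l)) (x k) * complex_of_real (if \<gamma> = [] then 1 else 2)"
        using \<open>\<gamma> \<in> ?S\<close> S by (simp only: sum.delta if_True)
      finally show ?thesis by (cases "\<gamma> = []") (simp_all add: \<gamma> upper_entry_def strict_prefix_def)
    next
      case False
      then have "\<sigma> l \<noteq> \<sigma> k @ \<alpha>" for \<alpha> by (auto simp: prefix_def)
      moreover from False have "\<sigma> k \<noteq> \<sigma> l" by auto
      ultimately show ?thesis using False by (simp add: upper_entry_def strict_prefix_def)
    qed
  qed
  finally show ?thesis .
qed

lemma Re_mt_kernel_sum:
  assumes X: "\<And>i. cbounded (X i)"
  shows "Re (\<Sum>k\<in>I. \<Sum>l\<in>I. cinner (mt_kernel \<rho> X (\<sigma> k) (\<sigma> l) (x l)) (x k))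
    = (1 / \<rho>) * (2 * Re (\<Sum>k\<in>I. \<Sum>l\<in>I. upper_entry X (\<sigma> k) (\<sigma> l) (x l) (x k)))
      + Re (\<Sum>k\<in>I. \<Sum>l\<in>I. if \<sigma> k = \<sigma> l then cinner (x l) (x k) else 0)"
proof -
  define U where "U = (\<Sum>k\<in>I. \<Sum>l\<in>I. upper_entry X (\<sigma> k) (\<sigma> l) (x l) (x k))"
  have lower: "(\<Sum>k\<in>I. \<Sum>l\<in>I. cnj (upper_entry X (\<sigma> l) (\<sigma> k) (x k) (x l))) = cnj U"
    unfolding U_def cnj_sum by (rule sum.swap)
  have "(\<Sum>k\<in>I. \<Sum>l\<in>I. cinner (mt_kernel \<rho> X (\<sigma> k) (\<sigma> l) (x l)) (x k))
      = (1 / \<rho>) *\<^sub>R (U + cnj U) + (\<Sum>k\<in>I. \<Sum>l\<in>I. if \<sigma> k = \<sigma> l then cinner (x l) (x k) else 0)"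
    by (simp only: cinner_mt_kernel[OF X] sum.distrib scaleR_add_right scaleR_sum_right[symmetric] lower
        U_def[symmetric])
  then show ?thesis unfolding U_def[symmetric] by simp
qed

section \<open>From pluriharmonic functions to polynomials and back to the kernel\<close>

context
  fixes \<rho> c C :: real and A B :: "'n :: finite \<Rightarrow> ('h :: chilbert_space \<Rightarrow>\<^sub>L 'h)"
  assumes \<rho>: "\<rho> > 0" and A: "row_bounded C A" and B: "row_bounded C B"
begin

text \<open>A polynomial that is positive on the ball is a positive pluriharmonic function. Its form
  at \<open>r\<close> times a tuple is a polynomial in \<open>r\<close>, so the inequality survives
  the limit to \<open>r = 1\<close>.\<close>

lemma harnack_dominated_if_pluriharmonic_dominated:
  assumes dom: "\<forall>J F. positive_pluriharmonic J F \<longrightarrow> (\<forall>r\<in>{0..<1}.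
        op_le_on (ell2_on J)
          (pluriharmonic_eval F (\<lambda>i. r *\<^sub>R A i) + (\<rho> - 1) *\<^sub>R pluriharmonic_eval F (\<lambda>_. 0))
          (c\<^sup>2 *\<^sub>R (pluriharmonic_eval F (\<lambda>i. r *\<^sub>R B i) + (\<rho> - 1) *\<^sub>R pluriharmonic_eval F (\<lambda>_. 0))))"
  shows "harnack_dominated \<rho> c A B"
  unfolding harnack_dominated_def
proof (intro allI impI, elim conjE)
  fix m :: nat and p :: "'n list \<Rightarrow> (seq_space \<Rightarrow>\<^sub>L seq_space)"
  assume p: "is_poly p" "\<forall>\<alpha>. p \<alpha> \<in> coeff_ops {..<m}"
    and pos: "\<forall>X\<in>row_ball. op_positive_on (ell2_on {..<m}) (re_op (opoly p X))"
  have cp: "cbounded (p \<alpha>)" for \<alpha> using p(2) cbounded_coeff_ops by blast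
  have cA: "cbounded (A i)" and cB: "cbounded (B i)" for i by (rule cbounded_tuples[OF \<rho> A B])+
  have "positive_pluriharmonic {..<m} p"
    using p pos by (simp add: positive_pluriharmonic_def free_holomorphic_poly pluriharmonic_eval_def holo_eval_poly)
  note dom' = dom[rule_format, OF this, unfolded pluriharmonic_eval_def holo_eval_poly[OF p(1)]]
  show "op_le_on (ell2_on {..<m})
     (re_op (opoly p A) + (\<rho> - 1) *\<^sub>R re_op (opoly p (\<lambda>_. 0)))
     (c\<^sup>2 *\<^sub>R (re_op (opoly p B) + (\<rho> - 1) *\<^sub>R re_op (opoly p (\<lambda>_. 0))))"
    unfolding op_le_on_def op_positive_on_def
  proof
    fix f :: "(nat, 'h) ell2" assume f: "f \<in> ell2_on {..<m}"
    define q where "q X = Re (cinner (opoly p X f) f)" for X :: "'n \<Rightarrow> 'h \<Rightarrow>\<^sub>L 'h"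
    have form: "cinner ((c\<^sup>2 *\<^sub>R (re_op (opoly p Y) + (\<rho> - 1) *\<^sub>R re_op (opoly p (\<lambda>_. 0)))
        - (re_op (opoly p X) + (\<rho> - 1) *\<^sub>R re_op (opoly p (\<lambda>_. 0)))) f) f
      = complex_of_real (c\<^sup>2 * (q Y + (\<rho> - 1) * q (\<lambda>_. 0)) - (q X + (\<rho> - 1) * q (\<lambda>_. 0)))"
      if "\<And>i. cbounded (X i)" "\<And>i. cbounded (Y i)" for X Y
      by (simp add: blinfun.diff_left blinfun.add_left blinfun.scaleR_left cinner_diff_left cinner_add_left
          cinner_scaleR_left cinner_re_op cbounded_opoly that cp q_def scaleR_conv_of_real)
    define \<phi> where "\<phi> r = c\<^sup>2 * (q (\<lambda>i. r *\<^sub>R B i) + (\<rho> - 1) * q (\<lambda>_. 0))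
      - (q (\<lambda>i. r *\<^sub>R A i) + (\<rho> - 1) * q (\<lambda>_. 0))" for r
    have S: "finite {\<alpha>. p \<alpha> \<noteq> 0}" using p(1) by (simp add: is_poly_def)
    have "0 \<le> \<phi> 1"
    proof (rule limit_from_below_nonneg)
      have q: "q (\<lambda>i. r *\<^sub>R X i)
          = (\<Sum>\<alpha> | p \<alpha> \<noteq> 0. r ^ length \<alpha> * Re (cinner (tensor_op (wprod X \<alpha>) (p \<alpha>) f) f))"
        if "\<And>i. cbounded (X i)" for r X
        unfolding q_def cinner_opoly_scaleR[OF S order_refl that cp] by simp
      show "isCont \<phi> 1" unfolding \<phi>_def q[OF cA] q[OF cB] by (intro continuous_intros)
      fix r :: real assume "0 \<le> r" "r < 1"
      then have "r \<in> {0..<1}" by simp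
      from bspec[OF dom'[OF this, unfolded op_le_on_def op_positive_on_def] f]
      have "complex_of_real (\<phi> r) \<in> \<real>\<^sub>\<ge>\<^sub>0" unfolding \<phi>_def by (subst (asm) form) (simp_all add: cA cB)
      then show "0 \<le> \<phi> r" by (simp add: complex_nonneg_Reals_iff)
    qed
    then show "cinner ((c\<^sup>2 *\<^sub>R (re_op (opoly p B) + (\<rho> - 1) *\<^sub>R re_op (opoly p (\<lambda>_. 0)))
        - (re_op (opoly p A) + (\<rho> - 1) *\<^sub>R re_op (opoly p (\<lambda>_. 0)))) f) f \<in> \<real>\<^sub>\<ge>\<^sub>0"
      unfolding form[OF cA cB] by (simp add: \<phi>_def complex_nonneg_Reals_iff)
  qed
qed

text \<open>The test polynomial is positive on the ball because row contractions have positive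
  kernels. With \<open>D\<close> the diagonal and \<open>U X\<close> the upper part, its real part
  has the form \<open>D + 2 * U X\<close> at \<open>X\<close> and \<open>D\<close> at 0, so each
  side of the domination involves \<open>2 * U X + \<rho> * D\<close>, which is \<rho> times the
  kernel form.\<close>

lemma kernel_positive_if_harnack_dominated:
  assumes dom: "harnack_dominated \<rho> c A B"
  shows "kernel_positive (kernel_diff \<rho> c A B)"
proof (rule kernel_positiveI)
  fix N :: nat and \<sigma> :: "nat \<Rightarrow> 'n list" and h :: "nat \<Rightarrow> 'h"
  have cA: "cbounded (A i)" and cB: "cbounded (B i)" for i by (rule cbounded_tuples[OF \<rho> A B])+
  let ?p = "toeplitz_poly N \<sigma>"
  have cp: "cbounded (?p \<alpha>)" for \<alpha> by (rule cbounded_coeff_ops[OF coeff_ops_toeplitz_poly])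
  define D where "D = Re (\<Sum>k<N. \<Sum>l<N. if \<sigma> k = \<sigma> l then cinner (h l) (h k) else 0)"
  define U where "U X = Re (\<Sum>k<N. \<Sum>l<N. upper_entry X (\<sigma> k) (\<sigma> l) (h l) (h k))"
    for X :: "'n \<Rightarrow> 'h \<Rightarrow>\<^sub>L 'h"
  have "op_positive_on (ell2_on {..<N}) (re_op (opoly ?p X))" if X: "X \<in> row_ball" for X :: "'n \<Rightarrow> _"
  proof (unfold op_positive_on_def, intro ballI)
    fix f :: "(nat, seq_space) ell2" assume f: "f \<in> ell2_on {..<N}"
    have cX: "cbounded (X i)" for i using X by (simp add: row_ball_def)
    have fx: "f = (\<Sum>i<N. tensor_vec (ell2_nth f i) (ket i))"
      using f by (intro ell2_eqI) (auto simp: ell2_nth_sum ell2_nth_tensor_ket ell2_on_def)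
    have "0 \<le> Re (\<Sum>k<N. \<Sum>l<N. cinner (mt_kernel 1 X (\<sigma> k) (\<sigma> l) (ell2_nth f l)) (ell2_nth f k))"
      using kernel_positiveD[OF kernel_positive_row_contraction[OF row_ball_row_contraction[OF X]] finite_lessThan,
          where \<sigma> = \<sigma> and h = "ell2_nth f"]
      by (simp add: complex_nonneg_Reals_iff)
    also have "\<dots> = Re (cinner (opoly ?p X f) f)"
      unfolding Re_mt_kernel_sum[OF cX]
      by (subst (3) fx, subst (3) fx) (simp only: toeplitz_poly_form[OF cX], simp add: sum.distrib sum_distrib_left)
    finally show "cinner (re_op (opoly ?p X) f) f \<in> \<real>\<^sub>\<ge>\<^sub>0"
      using cX by (subst cinner_re_op) (auto simp: cbounded_opoly cp)
  qed
  then have le: "op_le_on (ell2_on {..<N})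
        (re_op (opoly ?p A) + (\<rho> - 1) *\<^sub>R re_op (opoly ?p (\<lambda>_. 0)))
        (c\<^sup>2 *\<^sub>R (re_op (opoly ?p B) + (\<rho> - 1) *\<^sub>R re_op (opoly ?p (\<lambda>_. 0))))"
    using dom is_poly_toeplitz_poly coeff_ops_toeplitz_poly unfolding harnack_dominated_def by blast
  define f where "f = (\<Sum>i<N. tensor_vec (h i) (ket i))"
  have "f \<in> ell2_on {..<N}" by (auto simp: f_def ell2_on_def ell2_nth_sum ell2_nth_tensor_ket intro!: sum.neutral)
  with le have main: "cinner ((c\<^sup>2 *\<^sub>R (re_op (opoly ?p B) + (\<rho> - 1) *\<^sub>R re_op (opoly ?p (\<lambda>_. 0)))
      - (re_op (opoly ?p A) + (\<rho> - 1) *\<^sub>R re_op (opoly ?p (\<lambda>_. 0)))) f) f \<in> \<real>\<^sub>\<ge>\<^sub>0"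
    unfolding op_le_on_def op_positive_on_def by blast
  have form: "cinner (re_op (opoly ?p X) f) f = complex_of_real (D + 2 * U X)"
    if "\<And>i. cbounded (X i)" for X
    using toeplitz_poly_form[OF that, where N = N and \<sigma> = \<sigma> and x = h] 
    by (subst cinner_re_op) (simp_all add: cbounded_opoly cp that f_def D_def U_def sum.distrib sum_distrib_left)
  have "upper_entry (\<lambda>_. 0) \<alpha> \<beta> x y = 0" for \<alpha> \<beta> :: "'n list" and x y :: 'h
    by (auto simp: upper_entry_def wprod_zero dest: prefix_length_less)
  then have "U (\<lambda>_. 0) = 0" by (simp add: U_def)
  with main have "0 \<le> c\<^sup>2 * (2 * U B + \<rho> * D) - (2 * U A + \<rho> * D)"
    by (simp add: blinfun.diff_left blinfun.add_left blinfun.scaleR_left cinner_diff_left cinner_add_left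
          cinner_scaleR_left form cA cB complex_nonneg_Reals_iff algebra_simps)
  then have "0 \<le> (c\<^sup>2 * (2 * U B + \<rho> * D) - (2 * U A + \<rho> * D)) / \<rho>" using \<rho> by simp
  also have "\<dots> = c\<^sup>2 * (1 / \<rho> * (2 * U B) + D) - (1 / \<rho> * (2 * U A) + D)" using \<rho> by (simp add: field_simps)
  also have "\<dots> = Re (\<Sum>k<N. \<Sum>l<N. cinner (kernel_diff \<rho> c A B (\<sigma> k) (\<sigma> l) (h l)) (h k))"
    unfolding U_def D_def Re_mt_kernel_sum[OF cA, symmetric] Re_mt_kernel_sum[OF cB, symmetric] cinner_kernel_diff
    by (simp add: sum_subtractf sum_distrib_left)
  finally show "0 \<le> Re (\<Sum>i<N. \<Sum>j<N. cinner (kernel_diff \<rho> c A B (\<sigma> i) (\<sigma> j) (h j)) (h i))" .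
qed (simp_all add: cbounded_kernel_diff adj_kernel_diff cbounded_tuples[OF \<rho> A B])

end

section \<open>Intertwining operators between minimal dilations\<close>

lemma word_map_linear:
  assumes "isometric_dilation \<rho> T G J V"
  shows "word_map V \<alpha> (J (c *\<^sub>C h)) = c *\<^sub>C word_map V \<alpha> (J h)" "word_map V \<alpha> (J h) \<in> G"
proof -
  have J: "J (c *\<^sub>C h) = c *\<^sub>C J h" "\<And>h. J h \<in> G"
    and V: "\<And>i x. x \<in> G \<Longrightarrow> V i x \<in> G" "\<And>i x. x \<in> G \<Longrightarrow> V i (c *\<^sub>C x) = c *\<^sub>C V i x"
    using assms by (auto simp: isometric_dilation_def clinear_on_def image_subset_iff)
  show G: "word_map V \<alpha> (J h) \<in> G" for \<alpha> h by (induction \<alpha>) (simp_all add: J V)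
  show "word_map V \<alpha> (J (c *\<^sub>C h)) = c *\<^sub>C word_map V \<alpha> (J h)" by (induction \<alpha>) (simp_all add: J V G)
qed

lemma clinear_on_sum:
  assumes L: "clinear_on M L" and M: "csubspace M" and x: "\<And>i. i \<in> I \<Longrightarrow> x i \<in> M"
  shows "L (\<Sum>i\<in>I. x i) = (\<Sum>i\<in>I. L (x i))"
  using x
proof (induction I rule: infinite_finite_induct)
  case (insert i I)
  then show ?case using L csubspace_sum[OF M, of I x] by (simp add: clinear_on_def)
next
  case empty
  have "0 \<in> M" using M by (simp add: csubspace_def)
  then have "L (0 *\<^sub>C 0) = 0 *\<^sub>C L 0" using L by (simp only: clinear_on_def)
  then show ?case by simp
next
  case (infinite I)
  have "0 \<in> M" using M by (simp add: csubspace_def)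
  then have "L (0 *\<^sub>C 0) = 0 *\<^sub>C L 0" using L by (simp only: clinear_on_def)
  then show ?case using infinite by simp
qed

lemma clinear_on_diff:
  assumes L: "clinear_on M L" and M: "csubspace M" and x: "x \<in> M" "y \<in> M"
  shows "L (x - y) = L x - L y"
proof -
  have "L ((x - y) + y) = L (x - y) + L y"
    using L csubspace_diff[OF M x] x unfolding clinear_on_def by blast
  then show ?thesis by simp
qed

context
  fixes \<rho> c :: real and A B :: "'n :: finite \<Rightarrow> ('h :: chilbert_space \<Rightarrow>\<^sub>L 'h)"
    and KA :: "'ga :: chilbert_space set" and JA V and KB :: "'gb :: chilbert_space set" and JB W
  assumes \<rho>: "\<rho> > 0" and c: "c > 0" and cA: "\<And>i. cbounded (A i)" and cB: "\<And>i. cbounded (B i)"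
    and mA: "minimal_isometric_dilation \<rho> A KA JA V" and mB: "minimal_isometric_dilation \<rho> B KB JB W"
begin

lemma dilations: "isometric_dilation \<rho> A KA JA V" "isometric_dilation \<rho> B KB JB W"
  using mA mB unfolding minimal_isometric_dilation_def by blast+

text \<open>Positivity of the difference kernel thus says precisely that the correspondence between
  \<open>word_map W \<sigma> (JB h)\<close> and \<open>word_map V \<sigma> (JA h)\<close> is bounded
  by \<open>c\<close> on finite sums.\<close>

lemma kernel_diff_dilation_sum:
  "(\<Sum>i\<in>I. \<Sum>j\<in>I. cinner (kernel_diff \<rho> c A B (\<sigma> i) (\<sigma> j) (h j)) (h i))
    = complex_of_real (c\<^sup>2 * (norm (\<Sum>i\<in>I. word_map W (\<sigma> i) (JB (h i))))\<^sup>2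
        - (norm (\<Sum>i\<in>I. word_map V (\<sigma> i) (JA (h i))))\<^sup>2)"
  unfolding of_real_diff of_real_mult dilation_sum[OF \<rho> cA dilations(1), symmetric]
    dilation_sum[OF \<rho> cB dilations(2), symmetric]
  by (simp add: cinner_kernel_diff sum_subtractf sum_distrib_left scaleR_conv_of_real)

lemma kernel_positive_if_intertwiner:
  assumes L: "clinear_on KB L" "\<And>x. x \<in> KB \<Longrightarrow> norm (L x) \<le> c * norm x" "\<And>h. L (JB h) = JA h"
    "\<And>i x. x \<in> KB \<Longrightarrow> L (W i x) = V i (L x)"
  shows "kernel_positive (kernel_diff \<rho> c A B)"
  unfolding kernel_positive_def
proof (intro allI)
  fix N :: nat and \<sigma> and h :: "nat \<Rightarrow> 'h"
  have KB: "csubspace KB" using dilations(2) by (simp add: isometric_dilation_def)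
  note inKB = word_map_linear(2)[OF dilations(2)]
  have Lw: "L (word_map W \<alpha> (JB h)) = word_map V \<alpha> (JA h)" for \<alpha> h
    by (induction \<alpha>) (simp_all add: L inKB)
  have "L (\<Sum>i<N. word_map W (\<sigma> i) (JB (h i))) = (\<Sum>i<N. word_map V (\<sigma> i) (JA (h i)))"
    by (simp add: clinear_on_sum[OF L(1) KB] inKB Lw)
  moreover have "(\<Sum>i<N. word_map W (\<sigma> i) (JB (h i))) \<in> KB" by (intro csubspace_sum[OF KB] inKB)
  ultimately have "norm (\<Sum>i<N. word_map V (\<sigma> i) (JA (h i))) \<le> c * norm (\<Sum>i<N. word_map W (\<sigma> i) (JB (h i)))"
    using L(2) by metis
  then have "(norm (\<Sum>i<N. word_map V (\<sigma> i) (JA (h i))))\<^sup>2 \<le> (c * norm (\<Sum>i<N. word_map W (\<sigma> i) (JB (h i))))\<^sup>2"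
    by (intro power_mono norm_ge_zero)
  then show "(\<Sum>i<N. \<Sum>j<N. cinner (kernel_diff \<rho> c A B (\<sigma> i) (\<sigma> j) (h j)) (h i)) \<in> \<real>\<^sub>\<ge>\<^sub>0"
    unfolding kernel_diff_dilation_sum by (simp add: complex_nonneg_Reals_iff power_mult_distrib)
qed

lemma intertwiner_if_kernel_positive:
  assumes pos: "kernel_positive (kernel_diff \<rho> c A B)"
  shows "\<exists>L :: 'gb \<Rightarrow> 'ga. clinear_on KB L \<and> L ` KB \<subseteq> KA \<and>
    (\<forall>x\<in>KB. norm (L x) \<le> c * norm x) \<and> (\<forall>h. L (JB h) = JA h) \<and> (\<forall>i. \<forall>x\<in>KB. L (W i x) = V i (L x))"
proof -
  define x where "x p = word_map W (fst p) (JB (snd p))" for p :: "'n list \<times> 'h"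
  define y where "y p = word_map V (fst p) (JA (snd p))" for p :: "'n list \<times> 'h"
  have KA: "KA = closed_cspan (range y)"
    using mA unfolding minimal_isometric_dilation_def y_def
    by (auto intro!: arg_cong[where f = closed_cspan] simp: image_def)
  have KB: "KB = closed_cspan (range x)"
    using mB unfolding minimal_isometric_dilation_def x_def
    by (auto intro!: arg_cong[where f = closed_cspan] simp: image_def)
  have KBc: "csubspace KB" "closed KB" using dilations(2) by (simp_all add: isometric_dilation_def)
  have KAc: "csubspace KA" "closed KA" using dilations(1) by (simp_all add: isometric_dilation_def)
  have W: "clinear_on KB (W i)" "\<And>x. x \<in> KB \<Longrightarrow> W i x \<in> KB" "\<And>x. x \<in> KB \<Longrightarrow> norm (W i x) = norm x" for i
    using dilations(2) by (auto simp: isometric_dilation_def image_subset_iff)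
  have V: "clinear_on KA (V i)" "\<And>x. x \<in> KA \<Longrightarrow> V i x \<in> KA" "\<And>x. x \<in> KA \<Longrightarrow> norm (V i x) = norm x" for i
    using dilations(1) by (auto simp: isometric_dilation_def image_subset_iff)
  have "norm (\<Sum>p\<in>F. a p *\<^sub>C y p) \<le> c * norm (\<Sum>p\<in>F. a p *\<^sub>C x p)" if F: "finite F" for F and a :: "'n list \<times> 'h \<Rightarrow> complex"
  proof (rule power2_le_imp_le)
    \<comment> \<open>The scalar coefficients are absorbed into the vectors of \<open>'h\<close>, on
      which the word maps depend linearly.\<close>
    have "(\<Sum>p\<in>F. \<Sum>q\<in>F. cinner (kernel_diff \<rho> c A B (fst p) (fst q) (a q *\<^sub>C snd q)) (a p *\<^sub>C snd p)) \<in> \<real>\<^sub>\<ge>\<^sub>0"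
      by (rule kernel_positiveD[OF pos F])
    then have "0 \<le> c\<^sup>2 * (norm (\<Sum>p\<in>F. word_map W (fst p) (JB (a p *\<^sub>C snd p))))\<^sup>2
        - (norm (\<Sum>p\<in>F. word_map V (fst p) (JA (a p *\<^sub>C snd p))))\<^sup>2"
      unfolding kernel_diff_dilation_sum complex_nonneg_Reals_iff by simp
    then show "(norm (\<Sum>p\<in>F. a p *\<^sub>C y p))\<^sup>2 \<le> (c * norm (\<Sum>p\<in>F. a p *\<^sub>C x p))\<^sup>2"
      by (simp add: word_map_linear(1)[OF dilations(1)] word_map_linear(1)[OF dilations(2)] x_def y_def power_mult_distrib)
  qed (use c in simp)
  from ext_family[OF this] obtain T :: "'gb \<Rightarrow>\<^sub>L 'ga" where T: "cbounded T" "\<And>p. T (x p) = y p"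
    "\<And>z. norm (T z) \<le> c * norm z" "\<And>z. T z \<in> KA"
    using c unfolding KA by (meson less_imp_le)
  have TJ: "T (JB h) = JA h" for h using T(2)[of "([], h)"] by (simp add: x_def y_def)
  have "T (W i z) = V i (T z)" if z: "z \<in> KB" for i z
  proof -
    \<comment> \<open>The two sides agree on the generators, so it suffices that \<open>M\<close> is
      a closed subspace. \<open>V i\<close> and \<open>W i\<close> are plain functions controlled
      only on \<open>KA\<close> and \<open>KB\<close>; their continuity there comes from the
      isometry property applied to differences.\<close>
    define M where "M = {z\<in>KB. T (W i z) = V i (T z)}"
    have "csubspace M"
      using KBc(1) W(1)[of i] V(1)[of i] T(1,4) clinear_on_sum[OF W(1) KBc(1), of "{}" undefined i]
        clinear_on_sum[OF V(1) KAc(1), of "{}" undefined i]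
      by (auto simp: csubspace_def M_def clinear_on_def blinfun.add_right cbounded_scaleC)
    moreover have "closed M"
      unfolding closed_sequential_limits
    proof (intro allI impI, elim conjE)
      fix s l assume s: "\<forall>n. s n \<in> M" "s \<longlonglongrightarrow> l"
      have sB: "s n \<in> KB" for n using s(1) by (simp add: M_def)
      then have l: "l \<in> KB" using closed_sequentially[OF KBc(2) _ s(2)] by blast
      have "(\<lambda>n. norm (s n - l)) \<longlonglongrightarrow> 0" using s(2) by (simp add: LIM_zero_iff tendsto_norm_zero_iff)
      then have "(\<lambda>n. norm (W i (s n) - W i l)) \<longlonglongrightarrow> 0"
        using W(3)[OF csubspace_diff[OF KBc(1) sB l]] by (simp add: clinear_on_diff[OF W(1) KBc(1) sB l])
      then have 1: "(\<lambda>n. W i (s n)) \<longlonglongrightarrow> W i l" by (simp add: LIM_zero_iff tendsto_norm_zero_iff)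
      have Tl: "(\<lambda>n. T (s n)) \<longlonglongrightarrow> T l" by (rule bounded_linear.tendsto[OF blinfun.bounded_linear_right s(2)])
      then have "(\<lambda>n. norm (T (s n) - T l)) \<longlonglongrightarrow> 0" by (simp add: LIM_zero_iff tendsto_norm_zero_iff)
      then have "(\<lambda>n. norm (V i (T (s n)) - V i (T l))) \<longlonglongrightarrow> 0"
        using V(3)[OF csubspace_diff[OF KAc(1) T(4) T(4)]] by (simp add: clinear_on_diff[OF V(1) KAc(1) T(4) T(4)])
      then have 2: "(\<lambda>n. V i (T (s n))) \<longlonglongrightarrow> V i (T l)" by (simp add: LIM_zero_iff tendsto_norm_zero_iff)
      have "(\<lambda>n. T (W i (s n))) \<longlonglongrightarrow> T (W i l)"
        by (rule bounded_linear.tendsto[OF blinfun.bounded_linear_right 1])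
      then have "(\<lambda>n. V i (T (s n))) \<longlonglongrightarrow> T (W i l)" using s(1) by (simp add: M_def)
      then show "l \<in> M" using 2 LIMSEQ_unique l unfolding M_def by blast
    qed
    moreover have "range x \<subseteq> M"
    proof
      fix z assume "z \<in> range x"
      then obtain p where p: "z = x p" by blast
      have "W i z = x (i # fst p, snd p)" "V i (y p) = y (i # fst p, snd p)"
        by (simp_all add: p x_def y_def)
      moreover have "z \<in> KB" unfolding p KB by (rule subsetD[OF closed_cspan_superset]) simp
      ultimately show "z \<in> M" using p by (simp add: M_def T(2))
    qed
    ultimately have "KB \<subseteq> M" unfolding KB by (intro closed_cspan_least)
    then show ?thesis using z by (auto simp: M_def)
  qed
  then show ?thesis
    using T TJ by (intro exI[of _ "blinfun_apply T"]) (auto simp: clinear_on_def blinfun.add_right cbounded_scaleC)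
qed

end

section \<open>Positivity on the noncommutative disc algebra\<close>

text \<open>Evaluation at an arbitrary family \<open>Y\<close> indexed by words. Products of a tuple
  are one case; the other is the first row of a kernel, which is not multiplicative.\<close>

definition poly_value :: "('n list \<Rightarrow> complex) \<Rightarrow> ('n list \<Rightarrow> ('h :: chilbert_space \<Rightarrow>\<^sub>L 'h)) \<Rightarrow> ('h \<Rightarrow>\<^sub>L 'h)" where
  "poly_value p Y = (\<Sum>\<alpha> | p \<alpha> \<noteq> 0. scalar_op (p \<alpha>) o\<^sub>L Y \<alpha>)"

lemma poly_op_eq_value: "poly_op p T = poly_value p (wprod T)"
  by (simp add: poly_op_def poly_value_def)

lemma cinner_poly_value:
  assumes "finite S" "{\<alpha>. p \<alpha> \<noteq> 0} \<subseteq> S"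
  shows "cinner (poly_value p Y x) y = (\<Sum>\<alpha>\<in>S. p \<alpha> * cinner (Y \<alpha> x) y)"
proof -
  have "cinner (poly_value p Y x) y = (\<Sum>\<alpha> | p \<alpha> \<noteq> 0. p \<alpha> * cinner (Y \<alpha> x) y)"
    by (simp add: poly_value_def blinfun.sum_left cinner_sum_left scalar_op.rep_eq cinner_scaleC_left)
  also have "\<dots> = (\<Sum>\<alpha>\<in>S. p \<alpha> * cinner (Y \<alpha> x) y)"
    by (rule sum.mono_neutral_left) (use assms in auto)
  finally show ?thesis .
qed

lemma cbounded_poly_value: "(\<And>\<alpha>. cbounded (Y \<alpha>)) \<Longrightarrow> cbounded (poly_value p Y)"
  by (simp add: poly_value_def)

lemma is_poly_add: "is_poly p \<Longrightarrow> is_poly q \<Longrightarrow> is_poly (\<lambda>\<alpha>. p \<alpha> + q \<alpha> :: complex)"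
  unfolding is_poly_def by (rule finite_subset[of _ "{\<alpha>. p \<alpha> \<noteq> 0} \<union> {\<alpha>. q \<alpha> \<noteq> 0}"]) auto

lemma is_poly_scale: "is_poly p \<Longrightarrow> is_poly (\<lambda>\<alpha>. c * p \<alpha> :: complex)"
  unfolding is_poly_def by (rule finite_subset[of _ "{\<alpha>. p \<alpha> \<noteq> 0}"]) auto

lemma is_poly_single: "is_poly (\<lambda>\<gamma>. if \<gamma> = \<delta> then c else 0)"
  unfolding is_poly_def by (rule finite_subset[of _ "{\<delta>}"]) auto

lemma is_poly_zero: "is_poly (\<lambda>_. 0)"
  by (simp add: is_poly_def)

lemma poly_value_add:
  assumes "is_poly p" "is_poly q"
  shows "poly_value (\<lambda>\<alpha>. p \<alpha> + q \<alpha>) Y = poly_value p Y + poly_value q Y"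
proof (rule blinfun_eqI, rule cinner_ext)
  fix x y
  let ?S = "{\<alpha>. p \<alpha> \<noteq> 0} \<union> {\<alpha>. q \<alpha> \<noteq> 0}"
  have S: "finite ?S" using assms by (simp add: is_poly_def)
  show "cinner (poly_value (\<lambda>\<alpha>. p \<alpha> + q \<alpha>) Y x) y = cinner ((poly_value p Y + poly_value q Y) x) y"
    unfolding blinfun.add_left cinner_add_left
    by (subst (1 2 3) cinner_poly_value[OF S]) (auto simp: sum.distrib distrib_right)
qed

lemma poly_value_scale:
  assumes "is_poly p"
  shows "poly_value (\<lambda>\<alpha>. c * p \<alpha>) Y = scalar_op c o\<^sub>L poly_value p Y"
proof (rule blinfun_eqI, rule cinner_ext)
  fix x y
  have S: "finite {\<alpha>. p \<alpha> \<noteq> 0}" using assms by (simp add: is_poly_def)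
  have "cinner (poly_value (\<lambda>\<alpha>. c * p \<alpha>) Y x) y = c * cinner (poly_value p Y x) y"
    by (subst (1 2) cinner_poly_value[OF S]) (auto simp: sum_distrib_left mult.assoc)
  then show "cinner (poly_value (\<lambda>\<alpha>. c * p \<alpha>) Y x) y = cinner ((scalar_op c o\<^sub>L poly_value p Y) x) y"
    by (simp add: scalar_op.rep_eq cinner_scaleC_left)
qed

lemma poly_value_single: "poly_value (\<lambda>\<gamma>. if \<gamma> = \<delta> then c else 0) Y = scalar_op c o\<^sub>L Y \<delta>"
proof (rule blinfun_eqI, rule cinner_ext)
  fix x y
  show "cinner (poly_value (\<lambda>\<gamma>. if \<gamma> = \<delta> then c else 0) Y x) y = cinner ((scalar_op c o\<^sub>L Y \<delta>) x) y"
    by (subst cinner_poly_value[of "{\<delta>}"]) (auto simp: scalar_op.rep_eq cinner_scaleC_left)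
qed

lemma poly_value_zero: "poly_value (\<lambda>_. 0) Y = 0"
  by (simp add: poly_value_def)

lemma scalar_op_one [simp]: "scalar_op 1 = id_blinfun"
  by (rule blinfun_eqI) (simp add: scalar_op.rep_eq)

subsection \<open>The Poisson transform\<close>

lemma gram_sum:
  "(\<Sum>i\<in>I. \<Sum>j\<in>I. c i * cnj (c j) * cinner (z i) (z j)) = complex_of_real ((norm (\<Sum>i\<in>I. c i *\<^sub>C z i))\<^sup>2)"
  unfolding norm_sum_square
  by (subst sum.swap) (simp add: cinner_scaleC_left cinner_scaleC_right ac_simps)

lemma sum_words_snoc:
  "(\<Sum>\<gamma>\<in>words (Suc n). f \<gamma>) = (\<Sum>l\<in>UNIV. \<Sum>\<gamma>\<in>words n. f (\<gamma> @ [l :: 'n :: finite]))"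
proof -
  have "(\<Sum>\<gamma>\<in>words (Suc n). f \<gamma>) = (\<Sum>\<gamma>\<in>words (Suc n). f (rev \<gamma>))" by (rule sum_words_rev[symmetric])
  also have "\<dots> = (\<Sum>l\<in>UNIV. \<Sum>\<gamma>\<in>words n. f (rev \<gamma> @ [l]))" by (simp add: sum_words_Suc)
  also have "\<dots> = (\<Sum>l\<in>UNIV. \<Sum>\<gamma>\<in>words n. f (\<gamma> @ [l]))"
    by (rule sum.cong[OF refl]) (rule sum_words_rev)
  finally show ?thesis .
qed

lemma row_ball_column_words:
  assumes X: "X \<in> row_ball"
  shows "(\<Sum>\<gamma>\<in>words n. (norm (adj (wprod X \<gamma>) e))\<^sup>2) \<le> norm (\<Sum>i\<in>UNIV. X i o\<^sub>L adj (X i)) ^ n * (norm e)\<^sup>2"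
proof (induction n arbitrary: e)
  case (Suc n)
  have cb: "cbounded (X i)" for i using X by (simp add: row_ball_def)
  let ?s = "norm (\<Sum>i\<in>UNIV. X i o\<^sub>L adj (X i))"
  have "(\<Sum>\<gamma>\<in>words (Suc n). (norm (adj (wprod X \<gamma>) e))\<^sup>2)
      = (\<Sum>i\<in>UNIV. \<Sum>\<gamma>\<in>words n. (norm (adj (wprod X \<gamma>) (adj (X i) e)))\<^sup>2)"
    by (simp add: sum_words_Suc adj_compose cb cbounded_wprod)
  also have "\<dots> \<le> (\<Sum>i\<in>UNIV. ?s ^ n * (norm (adj (X i) e))\<^sup>2)" by (intro sum_mono Suc.IH)
  also have "\<dots> = ?s ^ n * (\<Sum>i\<in>UNIV. (norm (adj (X i) e))\<^sup>2)" by (simp add: sum_distrib_left)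
  also have "\<dots> \<le> ?s ^ n * (?s * (norm e)\<^sup>2)" by (intro mult_left_mono row_ball_column[OF X]) simp
  finally show ?case by (simp add: ac_simps)
qed simp

lemma sum_shorter_words:
  "(\<Sum>\<gamma>\<in>{\<gamma>. length \<gamma> < N}. f \<gamma>) = (\<Sum>n<N. \<Sum>\<gamma>\<in>words n. f (\<gamma> :: 'n :: finite list))"
  "finite {\<gamma> :: 'n list. length \<gamma> < N}"
proof -
  have "{\<gamma> :: 'n list. length \<gamma> < N} = (\<Union>n<N. words n)" by (auto simp: words_def)
  then show fin: "finite {\<gamma> :: 'n list. length \<gamma> < N}" by simp
  have "(\<Sum>n<N. \<Sum>\<gamma>\<in>{\<gamma>\<in>{\<gamma>. length \<gamma> < N}. length \<gamma> = n}. f \<gamma>) = (\<Sum>\<gamma>\<in>{\<gamma>. length \<gamma> < N}. f \<gamma>)"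
    by (rule sum.group[OF fin]) auto
  moreover have "{\<gamma>\<in>{\<gamma> :: 'n list. length \<gamma> < N}. length \<gamma> = n} = words n" if "n < N" for n
    using that by (auto simp: words_def)
  ultimately show "(\<Sum>\<gamma>\<in>{\<gamma>. length \<gamma> < N}. f \<gamma>) = (\<Sum>n<N. \<Sum>\<gamma>\<in>words n. f \<gamma>)" by simp
qed

text \<open>The compression of \<open>P\<^sub>i\<^sub>j(S)\<close> to words shorter than \<open>N\<close>, paired with a kernel \<open>G\<close>.\<close>

lemma truncated_pairing:
  fixes P :: "nat \<Rightarrow> nat \<Rightarrow> 'n :: finite list \<Rightarrow> complex"
    and G :: "'n list \<times> nat \<Rightarrow> 'n list \<times> nat \<Rightarrow> complex"
  shows "(\<Sum>a\<in>{\<gamma>. length \<gamma> < N} \<times> {..<m}. \<Sum>b\<in>{\<gamma>. length \<gamma> < N} \<times> {..<m}.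
      (\<Sum>\<alpha>\<in>S. if fst a = \<alpha> @ fst b then P (snd a) (snd b) \<alpha> else 0) * G b a)
    = (\<Sum>i<m. \<Sum>j<m. \<Sum>\<alpha>\<in>S. P i j \<alpha> * (\<Sum>\<gamma>\<in>{\<gamma>. length \<gamma> < N - length \<alpha>}. G (\<gamma>, j) (\<alpha> @ \<gamma>, i)))"
proof -
  let ?W = "{\<gamma> :: 'n list. length \<gamma> < N}"
  have W: "finite ?W" by (rule sum_shorter_words(2))
  have inner: "(\<Sum>\<delta>\<in>?W. if \<delta> = \<alpha> @ \<gamma> then P i j \<alpha> * G (\<gamma>, j) (\<delta>, i) else 0)
      = (if length \<gamma> < N - length \<alpha> then P i j \<alpha> * G (\<gamma>, j) (\<alpha> @ \<gamma>, i) else 0)" for \<alpha> \<gamma> i j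
  proof -
    have "(\<Sum>\<delta>\<in>?W. if \<delta> = \<alpha> @ \<gamma> then P i j \<alpha> * G (\<gamma>, j) (\<delta>, i) else 0)
        = (\<Sum>\<delta>\<in>?W. if \<delta> = \<alpha> @ \<gamma> then P i j \<alpha> * G (\<gamma>, j) (\<alpha> @ \<gamma>, i) else 0)"
      by (intro sum.cong refl) simp
    also have "\<dots> = (if \<alpha> @ \<gamma> \<in> ?W then P i j \<alpha> * G (\<gamma>, j) (\<alpha> @ \<gamma>, i) else 0)"
      using W by (simp only: sum.delta)
    finally show ?thesis by (auto simp: less_diff_conv add.commute)
  qed
  have "(\<Sum>a\<in>?W \<times> {..<m}. \<Sum>b\<in>?W \<times> {..<m}.
      (\<Sum>\<alpha>\<in>S. if fst a = \<alpha> @ fst b then P (snd a) (snd b) \<alpha> else 0) * G b a)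
    = (\<Sum>\<delta>\<in>?W. \<Sum>i<m. \<Sum>\<gamma>\<in>?W. \<Sum>j<m. \<Sum>\<alpha>\<in>S. if \<delta> = \<alpha> @ \<gamma> then P i j \<alpha> * G (\<gamma>, j) (\<delta>, i) else 0)"
    by (simp add: sum.cartesian_product' sum_distrib_right if_distrib[where f = "\<lambda>x. x * _"] cong: if_cong)
  also have "\<dots> = (\<Sum>i<m. \<Sum>\<delta>\<in>?W. \<Sum>\<gamma>\<in>?W. \<Sum>j<m. \<Sum>\<alpha>\<in>S. if \<delta> = \<alpha> @ \<gamma> then P i j \<alpha> * G (\<gamma>, j) (\<delta>, i) else 0)"
    by (rule sum.swap)
  also have "\<dots> = (\<Sum>i<m. \<Sum>\<delta>\<in>?W. \<Sum>j<m. \<Sum>\<gamma>\<in>?W. \<Sum>\<alpha>\<in>S. if \<delta> = \<alpha> @ \<gamma> then P i j \<alpha> * G (\<gamma>, j) (\<delta>, i) else 0)"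
    by (rule sum.cong[OF refl], rule sum.cong[OF refl], rule sum.swap)
  also have "\<dots> = (\<Sum>i<m. \<Sum>j<m. \<Sum>\<delta>\<in>?W. \<Sum>\<gamma>\<in>?W. \<Sum>\<alpha>\<in>S. if \<delta> = \<alpha> @ \<gamma> then P i j \<alpha> * G (\<gamma>, j) (\<delta>, i) else 0)"
    by (rule sum.cong[OF refl], rule sum.swap)
  also have "\<dots> = (\<Sum>i<m. \<Sum>j<m. \<Sum>\<delta>\<in>?W. \<Sum>\<alpha>\<in>S. \<Sum>\<gamma>\<in>?W. if \<delta> = \<alpha> @ \<gamma> then P i j \<alpha> * G (\<gamma>, j) (\<delta>, i) else 0)"
    by (rule sum.cong[OF refl], rule sum.cong[OF refl], rule sum.cong[OF refl], rule sum.swap)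
  also have "\<dots> = (\<Sum>i<m. \<Sum>j<m. \<Sum>\<alpha>\<in>S. \<Sum>\<delta>\<in>?W. \<Sum>\<gamma>\<in>?W. if \<delta> = \<alpha> @ \<gamma> then P i j \<alpha> * G (\<gamma>, j) (\<delta>, i) else 0)"
    by (rule sum.cong[OF refl], rule sum.cong[OF refl], rule sum.swap)
  also have "\<dots> = (\<Sum>i<m. \<Sum>j<m. \<Sum>\<alpha>\<in>S. \<Sum>\<gamma>\<in>?W. \<Sum>\<delta>\<in>?W. if \<delta> = \<alpha> @ \<gamma> then P i j \<alpha> * G (\<gamma>, j) (\<delta>, i) else 0)"
    by (rule sum.cong[OF refl], rule sum.cong[OF refl], rule sum.cong[OF refl], rule sum.swap)
  also have "\<dots> = (\<Sum>i<m. \<Sum>j<m. \<Sum>\<alpha>\<in>S. \<Sum>\<gamma>\<in>?W.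
      if length \<gamma> < N - length \<alpha> then P i j \<alpha> * G (\<gamma>, j) (\<alpha> @ \<gamma>, i) else 0)"
    unfolding inner ..
  also have "\<dots> = (\<Sum>i<m. \<Sum>j<m. \<Sum>\<alpha>\<in>S. P i j \<alpha> * (\<Sum>\<gamma>\<in>{\<gamma>. length \<gamma> < N - length \<alpha>}. G (\<gamma>, j) (\<alpha> @ \<gamma>, i)))"
  proof (intro sum.cong refl)
    fix i j \<alpha>
    have "(\<Sum>\<gamma>\<in>?W. if length \<gamma> < N - length \<alpha> then P i j \<alpha> * G (\<gamma>, j) (\<alpha> @ \<gamma>, i) else 0)
        = (\<Sum>\<gamma>\<in>{\<gamma>. length \<gamma> < N - length \<alpha>}. P i j \<alpha> * G (\<gamma>, j) (\<alpha> @ \<gamma>, i))"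
      using W by (intro sum.mono_neutral_cong_right) auto
    then show "(\<Sum>\<gamma>\<in>?W. if length \<gamma> < N - length \<alpha> then P i j \<alpha> * G (\<gamma>, j) (\<alpha> @ \<gamma>, i) else 0)
        = P i j \<alpha> * (\<Sum>\<gamma>\<in>{\<gamma>. length \<gamma> < N - length \<alpha>}. G (\<gamma>, j) (\<alpha> @ \<gamma>, i))"
      by (simp add: sum_distrib_left)
  qed
  finally show ?thesis .
qed

text \<open>The compression of \<open>P\<^sub>i\<^sub>j(S)\<close> to short words is paired with the
  kernel \<open>\<langle>(1 - \<Sum>\<^sub>i X\<^sub>i X\<^sub>i\<^sup>*) X\<^sub>\<gamma>\<^sup>* x\<^sub>j, X\<^sub>\<delta>\<^sup>* x\<^sub>i\<rangle>\<close>, and the sum over \<open>\<gamma>\<close> telescopes.\<close>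

lemma poisson_transform_positive:
  fixes X :: "'n :: finite \<Rightarrow> (seq_space \<Rightarrow>\<^sub>L seq_space)" and P :: "nat \<Rightarrow> nat \<Rightarrow> 'n list \<Rightarrow> complex"
  assumes X: "X \<in> row_ball" and S: "finite S" "\<And>i j. {\<alpha>. P i j \<alpha> \<noteq> 0} \<subseteq> S"
    and pos: "\<And>f :: nat \<Rightarrow> 'n fock. 0 \<le> Re (\<Sum>i<m. \<Sum>j<m. cinner (poly_op (P i j) left_creation (f j)) (f i))"
  shows "0 \<le> Re (\<Sum>i<m. \<Sum>j<m. \<Sum>\<alpha>\<in>S. P i j \<alpha> * cinner (wprod X \<alpha> (x j)) (x i))"
proof -
  have cb: "cbounded (X i)" for i using X by (simp add: row_ball_def)
  have cw: "cbounded (wprod X \<gamma>)" for \<gamma> by (rule cbounded_wprod[OF cb])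
  define s where "s = norm (\<Sum>i\<in>UNIV. X i o\<^sub>L adj (X i))"
  have s: "0 \<le> s" "s < 1" using X by (simp_all add: s_def row_ball_def)
  define y where "y a = adj (wprod X (fst a)) (x (snd a))" for a
  \<comment> \<open>The defect \<open>I - \<Sum>X_i X_i^*\<close> enters through this scalar kernel
    alone, so no square root of an operator has to be taken.\<close>
  define k where "k a b = cinner (y a) (y b) - (\<Sum>l\<in>UNIV. cinner (adj (X l) (y a)) (adj (X l) (y b)))" for a b
  have psd: "psd_kernel k"
    unfolding psd_kernel_def
  proof (intro allI)
    fix M :: nat and \<sigma> and c :: "nat \<Rightarrow> complex"
    define w where "w = (\<Sum>i<M. c i *\<^sub>C y (\<sigma> i))"
    have adjw: "adj (X l) w = (\<Sum>i<M. c i *\<^sub>C adj (X l) (y (\<sigma> i)))" for l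
      by (simp add: w_def blinfun.sum_right cbounded_scaleC[OF cbounded_adj[OF cb]])
    have "(\<Sum>i<M. \<Sum>j<M. c i * cnj (c j) * k (\<sigma> i) (\<sigma> j))
        = (\<Sum>i<M. \<Sum>j<M. c i * cnj (c j) * cinner (y (\<sigma> i)) (y (\<sigma> j)))
          - (\<Sum>i<M. \<Sum>j<M. \<Sum>l\<in>UNIV. c i * cnj (c j) * cinner (adj (X l) (y (\<sigma> i))) (adj (X l) (y (\<sigma> j))))"
      by (simp add: k_def right_diff_distrib sum_subtractf sum_distrib_left)
    also have "(\<Sum>i<M. \<Sum>j<M. \<Sum>l\<in>UNIV. c i * cnj (c j) * cinner (adj (X l) (y (\<sigma> i))) (adj (X l) (y (\<sigma> j))))
        = (\<Sum>i<M. \<Sum>l\<in>UNIV. \<Sum>j<M. c i * cnj (c j) * cinner (adj (X l) (y (\<sigma> i))) (adj (X l) (y (\<sigma> j))))"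
      by (rule sum.cong[OF refl], rule sum.swap)
    also have "\<dots> = (\<Sum>l\<in>UNIV. \<Sum>i<M. \<Sum>j<M. c i * cnj (c j) * cinner (adj (X l) (y (\<sigma> i))) (adj (X l) (y (\<sigma> j))))"
      by (rule sum.swap)
    also have "\<dots> = (\<Sum>l\<in>UNIV. complex_of_real ((norm (adj (X l) w))\<^sup>2))"
      unfolding gram_sum adjw ..
    also have "(\<Sum>i<M. \<Sum>j<M. c i * cnj (c j) * cinner (y (\<sigma> i)) (y (\<sigma> j))) = complex_of_real ((norm w)\<^sup>2)"
      unfolding gram_sum w_def ..
    finally have "(\<Sum>i<M. \<Sum>j<M. c i * cnj (c j) * k (\<sigma> i) (\<sigma> j))
        = complex_of_real ((norm w)\<^sup>2 - (\<Sum>l\<in>UNIV. (norm (adj (X l) w))\<^sup>2))" by simp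
    moreover have "(\<Sum>l\<in>UNIV. (norm (adj (X l) w))\<^sup>2) \<le> (norm w)\<^sup>2"
      using row_ball_column[OF X, of w] s mult_right_mono[of s 1 "(norm w)\<^sup>2"] by (simp add: s_def)
    ultimately show "(\<Sum>i<M. \<Sum>j<M. c i * cnj (c j) * k (\<sigma> i) (\<sigma> j)) \<in> \<real>\<^sub>\<ge>\<^sub>0"
      by (simp only: complex_nonneg_Reals_iff Re_complex_of_real Im_complex_of_real) simp
  qed
  \<comment> \<open>The form of the n-th iterate of the map
    \<open>Y \<mapsto> \<Sum>X_i Y X_i^*\<close> at the identity.\<close>
  define E where "E n u z = (\<Sum>\<gamma>\<in>words n. cinner (adj (wprod X \<gamma>) u) (adj (wprod X \<gamma>) z))" for n u z
  \<comment> \<open>Both \<open>\<gamma>\<close> and \<open>\<alpha> @ \<gamma>\<close> must be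
    shorter than \<open>N\<close>, hence the index \<open>N - length \<alpha>\<close> of the
    remainder.\<close>
  define t where "t N = (\<Sum>i<m. \<Sum>j<m. \<Sum>\<alpha>\<in>S. P i j \<alpha> *
      (cinner (x j) (adj (wprod X \<alpha>) (x i)) - E (N - length \<alpha>) (x j) (adj (wprod X \<alpha>) (x i))))" for N
  have "0 \<le> Re (t N)" for N
  proof -
    let ?W = "{\<gamma> :: 'n list. length \<gamma> < N}"
    let ?M = "\<lambda>a b :: 'n list \<times> nat. \<Sum>\<alpha>\<in>S. if fst a = \<alpha> @ fst b then P (snd a) (snd b) \<alpha> else 0"
    have fin: "finite (?W \<times> {..<m})" using sum_shorter_words(2) by blast
    have "0 \<le> Re (\<Sum>a\<in>?W \<times> {..<m}. \<Sum>b\<in>?W \<times> {..<m}. ?M a b * k b a)"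
    proof (rule psd_pairing[OF fin _ psd])
      fix c :: "'n list \<times> nat \<Rightarrow> complex"
      \<comment> \<open>Scalars indexed by words and rows are read as Fock space vectors; the form
        of the compressed matrix at these scalars is the form of the given matrix of polynomials in
        the left creation operators.\<close>
      define f where "f j = (\<Sum>\<gamma>\<in>?W. c (\<gamma>, j) *\<^sub>C ket \<gamma>)" for j
      have "cinner (wprod left_creation \<alpha> (f j)) (f i)
          = (\<Sum>\<gamma>\<in>{\<gamma>. length \<gamma> < N - length \<alpha>}. c (\<gamma>, j) * cnj (c (\<alpha> @ \<gamma>, i)))" for \<alpha> i j
      proof -
        have W: "wprod left_creation \<alpha> (f j) = (\<Sum>\<gamma>\<in>?W. c (\<gamma>, j) *\<^sub>C ket (\<alpha> @ \<gamma>))"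
          by (simp add: f_def blinfun.sum_right cbounded_scaleC[OF cbounded_wprod] wprod_left_creation_ket)
        have "cinner (wprod left_creation \<alpha> (f j)) (f i)
            = (\<Sum>\<delta>\<in>?W. \<Sum>\<gamma>\<in>?W. if \<alpha> @ \<gamma> = \<delta> then c (\<gamma>, j) * cnj (c (\<delta>, i)) else 0)"
          unfolding W unfolding f_def cinner_sum_right cinner_scaleC_right cinner_sum_left cinner_scaleC_left
            cinner_ket_ket sum_distrib_left
          by (intro sum.cong refl) auto
        also have "\<dots> = (\<Sum>\<gamma>\<in>?W. \<Sum>\<delta>\<in>?W. if \<alpha> @ \<gamma> = \<delta> then c (\<gamma>, j) * cnj (c (\<delta>, i)) else 0)"
          by (rule sum.swap)
        also have "\<dots> = (\<Sum>\<gamma>\<in>?W. if \<alpha> @ \<gamma> \<in> ?W then c (\<gamma>, j) * cnj (c (\<alpha> @ \<gamma>, i)) else 0)"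
          by (rule sum.cong[OF refl]) (rule sum.delta'[OF sum_shorter_words(2)])
        also have "\<dots> = (\<Sum>\<gamma>\<in>{\<gamma>. length \<gamma> < N - length \<alpha>}. c (\<gamma>, j) * cnj (c (\<alpha> @ \<gamma>, i)))"
          using sum_shorter_words(2)[of N]
          by (intro sum.mono_neutral_cong_right) (auto simp: less_diff_conv add.commute)
        finally show ?thesis .
      qed
      then have "(\<Sum>i<m. \<Sum>j<m. cinner (poly_op (P i j) left_creation (f j)) (f i))
          = (\<Sum>i<m. \<Sum>j<m. \<Sum>\<alpha>\<in>S. P i j \<alpha> * (\<Sum>\<gamma>\<in>{\<gamma>. length \<gamma> < N - length \<alpha>}. c (\<gamma>, j) * cnj (c (\<alpha> @ \<gamma>, i))))"
        unfolding poly_op_eq_value cinner_poly_value[OF S] by simp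
      also have "\<dots> = (\<Sum>a\<in>?W \<times> {..<m}. \<Sum>b\<in>?W \<times> {..<m}. ?M a b * (c b * cnj (c a)))"
        by (rule truncated_pairing[where G = "\<lambda>b a. c b * cnj (c a)", symmetric])
      finally show "0 \<le> Re (\<Sum>a\<in>?W \<times> {..<m}. \<Sum>b\<in>?W \<times> {..<m}. ?M a b * c b * cnj (c a))"
        using pos[of f] by (simp only: mult.assoc)
    qed
    also have "(\<Sum>a\<in>?W \<times> {..<m}. \<Sum>b\<in>?W \<times> {..<m}. ?M a b * k b a) = t N"
      unfolding truncated_pairing t_def
    proof (intro sum.cong refl arg_cong2[where f = "(*)"])
      fix i j \<alpha>
      define z where "z = adj (wprod X \<alpha>) (x i)"
      \<comment> \<open>Since the adjoint reverses products, the letters of the defect are appended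
        at the end of \<gamma>, and the subtracted part of \<open>k\<close> at level
        \<open>n\<close> is level \<open>Suc n\<close> of \<open>E\<close>.\<close>
      have "(\<Sum>\<gamma>\<in>words n. k (\<gamma>, j) (\<alpha> @ \<gamma>, i)) = E n (x j) z - E (Suc n) (x j) z" for n
      proof -
        have "E (Suc n) (x j) z = (\<Sum>\<gamma>\<in>words n. \<Sum>l\<in>UNIV.
            cinner (adj (X l) (adj (wprod X \<gamma>) (x j))) (adj (X l) (adj (wprod X \<gamma>) z)))"
          unfolding E_def sum_words_snoc
          by (subst sum.swap) (simp add: wprod_append adj_compose cw cb)
        moreover have "y (\<alpha> @ \<gamma>, i) = adj (wprod X \<gamma>) z" for \<gamma>
          by (simp add: y_def z_def wprod_append adj_compose cw)
        ultimately show ?thesis by (simp add: k_def E_def y_def sum_subtractf)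
      qed
      then have "(\<Sum>\<gamma>\<in>{\<gamma>. length \<gamma> < N - length \<alpha>}. k (\<gamma>, j) (\<alpha> @ \<gamma>, i)) = E 0 (x j) z - E (N - length \<alpha>) (x j) z"
        using sum_lessThan_telescope'[of "\<lambda>n. E n (x j) z" "N - length \<alpha>"]
        by (simp only: sum_shorter_words(1))
      also have "E 0 (x j) z = cinner (x j) z" by (simp add: E_def)
      finally show "(\<Sum>\<gamma>\<in>{\<gamma>. length \<gamma> < N - length \<alpha>}. k (\<gamma>, j) (\<alpha> @ \<gamma>, i))
          = cinner (x j) (adj (wprod X \<alpha>) (x i)) - E (N - length \<alpha>) (x j) (adj (wprod X \<alpha>) (x i))"
        by (simp add: z_def)
    qed
    finally show ?thesis .
  qed
  \<comment> \<open>The remainder is of order \<open>s ^ n\<close>, and \<open>s < 1\<close> because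
    \<open>X\<close> lies in the open ball.\<close>
  moreover have "t \<longlonglongrightarrow> (\<Sum>i<m. \<Sum>j<m. \<Sum>\<alpha>\<in>S. P i j \<alpha> * (cinner (x j) (adj (wprod X \<alpha>) (x i)) - 0))"
    unfolding t_def
  proof (intro tendsto_sum tendsto_mult tendsto_diff tendsto_const)
    fix j i and \<alpha> :: "'n list"
    have "(\<lambda>n. E n u z) \<longlonglongrightarrow> 0" for u z
    proof (rule Lim_null_comparison)
      have "norm (E n u z) \<le> s ^ n * ((norm u)\<^sup>2 + (norm z)\<^sup>2)" for n
      proof -
        have "norm (E n u z) \<le> (\<Sum>\<gamma>\<in>words n. (norm (adj (wprod X \<gamma>) u))\<^sup>2 + (norm (adj (wprod X \<gamma>) z))\<^sup>2)"
          unfolding E_def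
        proof (rule sum_norm_le)
          fix \<gamma>
          let ?a = "norm (adj (wprod X \<gamma>) u)" and ?b = "norm (adj (wprod X \<gamma>) z)"
          have "cmod (cinner (adj (wprod X \<gamma>) u) (adj (wprod X \<gamma>) z)) \<le> ?a * ?b" by (rule norm_cinner_le)
          also have "\<dots> \<le> ?a\<^sup>2 + ?b\<^sup>2"
            using sum_squares_bound[of ?a ?b] mult_nonneg_nonneg[of ?a ?b] by (simp del: mult_nonneg_nonneg)
          finally show "cmod (cinner (adj (wprod X \<gamma>) u) (adj (wprod X \<gamma>) z)) \<le> ?a\<^sup>2 + ?b\<^sup>2" .
        qed
        also have "\<dots> \<le> s ^ n * (norm u)\<^sup>2 + s ^ n * (norm z)\<^sup>2"
          unfolding sum.distrib s_def by (intro add_mono row_ball_column_words X)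
        finally show ?thesis by (simp add: distrib_left)
      qed
      then show "\<forall>\<^sub>F n in sequentially. norm (E n u z) \<le> s ^ n * ((norm u)\<^sup>2 + (norm z)\<^sup>2)" by simp
      show "(\<lambda>n. s ^ n * ((norm u)\<^sup>2 + (norm z)\<^sup>2)) \<longlonglongrightarrow> 0"
        using s by (intro tendsto_mult_left_zero LIMSEQ_realpow_zero)
    qed
    then show "(\<lambda>N. E (N - length \<alpha>) (x j) (adj (wprod X \<alpha>) (x i))) \<longlonglongrightarrow> 0"
      by (rule filterlim_compose[OF _ filterlim_minus_const_nat_at_top])
  qed
  ultimately have "0 \<le> Re (\<Sum>i<m. \<Sum>j<m. \<Sum>\<alpha>\<in>S. P i j \<alpha> * (cinner (x j) (adj (wprod X \<alpha>) (x i)) - 0))"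
    by (intro tendsto_lowerbound[OF tendsto_Re]) (auto intro: always_eventually)
  then show ?thesis by (simp only: diff_zero cinner_adj[OF cw])
qed

subsection \<open>Positive multi-Toeplitz kernels act completely positively\<close>

text \<open>On the vectors \<open>h j\<close> the kernel is realised by a row contraction
  \<open>Z\<close>. The Poisson transform gives the claim for \<open>t\<close> times
  \<open>Z\<close> with \<open>t < 1\<close>, and the expression is a polynomial in
  \<open>t\<close>.\<close>

lemma multi_toeplitz_value_positive:
  fixes K :: "'n :: finite list \<Rightarrow> 'n list \<Rightarrow> ('h :: chilbert_space \<Rightarrow>\<^sub>L 'h)" and P :: "nat \<Rightarrow> nat \<Rightarrow> 'n list \<Rightarrow> complex"
  assumes K: "kernel_positive K" "\<And>\<alpha> \<beta>. cbounded (K \<alpha> \<beta>)"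
      "\<And>i j \<alpha> \<beta>. K (i # \<alpha>) (j # \<beta>) = (if i = j then K \<alpha> \<beta> else 0)"
    and P: "\<And>i j. is_poly (P i j)"
    and pos: "\<And>f :: nat \<Rightarrow> 'n fock. 0 \<le> Re (\<Sum>i<m. \<Sum>j<m. cinner (poly_op (P i j) left_creation (f j)) (f i))"
  shows "0 \<le> Re (\<Sum>i<m. \<Sum>j<m. cinner (poly_value (P i j) (K []) (h j)) (h i))"
proof -
  \<comment> \<open>Setting the entries outside the matrix to zero provides one finite set
    \<open>S\<close> that supports all of them.\<close>
  define P' where "P' i j = (if i < m \<and> j < m then P i j else (\<lambda>_. 0))" for i j
  define S where "S = (\<Union>i<m. \<Union>j<m. {\<alpha>. P i j \<alpha> \<noteq> 0})"
  have S: "finite S" "\<And>i j. {\<alpha>. P' i j \<alpha> \<noteq> 0} \<subseteq> S" using P by (auto simp: S_def is_poly_def P'_def)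
  obtain v :: "nat \<Rightarrow> seq_space" and Z :: "'n \<Rightarrow> (seq_space \<Rightarrow>\<^sub>L seq_space)" where Z: "row_contraction Z"
    and v: "\<And>\<alpha> i j. cinner (wprod Z \<alpha> (v j)) (v i) = cinner (K [] \<alpha> (h j)) (h i)"
    using multi_toeplitz_model[OF K, of h] by blast
  define \<phi> where "\<phi> t = (\<Sum>i<m. \<Sum>j<m. \<Sum>\<alpha>\<in>S. t ^ length \<alpha> * Re (P' i j \<alpha> * cinner (K [] \<alpha> (h j)) (h i)))" for t
  have "0 \<le> \<phi> 1"
  proof (rule limit_from_below_nonneg)
    show "isCont \<phi> 1" unfolding \<phi>_def by (intro continuous_intros)
    fix t :: real assume t: "0 \<le> t" "t < 1"
    have "0 \<le> Re (\<Sum>i<m. \<Sum>j<m. \<Sum>\<alpha>\<in>S. P' i j \<alpha> * cinner (wprod (\<lambda>i. t *\<^sub>R Z i) \<alpha> (v j)) (v i))"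
      using pos by (intro poisson_transform_positive[OF row_contraction_row_ball[OF Z t] S]) (simp add: P'_def)
    also have "\<dots> = \<phi> t"
      by (simp add: \<phi>_def wprod_scaleR blinfun.scaleR_left cinner_scaleR_left v scaleR_conv_of_real
          algebra_simps sum_distrib_left)
    finally show "0 \<le> \<phi> t" .
  qed
  also have "\<phi> 1 = Re (\<Sum>i<m. \<Sum>j<m. cinner (poly_value (P' i j) (K []) (h j)) (h i))"
    unfolding cinner_poly_value[OF S] by (simp add: \<phi>_def)
  also have "\<dots> = Re (\<Sum>i<m. \<Sum>j<m. cinner (poly_value (P i j) (K []) (h j)) (h i))"
    by (simp add: P'_def)
  finally show ?thesis .
qed

text \<open>The adjoint of the entry \<open>(i, j)\<close> has the same real part in the form as the
  analytic entry put at \<open>(j, i)\<close>. This reduces matrices over the operator space to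
  matrices of analytic polynomials.\<close>

lemma Re_symmetrized_form:
  assumes Y: "\<And>\<alpha>. cbounded (Y \<alpha>)" and pq: "\<And>i j. is_poly (p i j)" "\<And>i j. is_poly (q i j)"
  shows "Re (\<Sum>i<m. \<Sum>j<m. cinner ((adj (poly_value (q i j) Y) + poly_value (p i j) Y) (f j)) (f i))
    = Re (\<Sum>i<m. \<Sum>j<m. cinner (poly_value (\<lambda>\<alpha>. p i j \<alpha> + q j i \<alpha>) Y (f j)) (f i))"
proof -
  have "(\<Sum>i<m. \<Sum>j<m. Re (cinner (adj (poly_value (q i j) Y) (f j)) (f i)))
      = (\<Sum>i<m. \<Sum>j<m. Re (cinner (poly_value (q i j) Y (f i)) (f j)))"
  proof (intro sum.cong refl)
    fix i j
    have "cinner (adj (poly_value (q i j) Y) (f j)) (f i) = cnj (cinner (poly_value (q i j) Y (f i)) (f j))"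
      by (subst cinner_adj'[OF cbounded_poly_value[OF Y]]) (rule cinner_commute)
    then show "Re (cinner (adj (poly_value (q i j) Y) (f j)) (f i)) = Re (cinner (poly_value (q i j) Y (f i)) (f j))"
      by simp
  qed
  also have "\<dots> = (\<Sum>i<m. \<Sum>j<m. Re (cinner (poly_value (q j i) Y (f j)) (f i)))" by (rule sum.swap)
  finally show ?thesis
    by (simp add: poly_value_add pq blinfun.add_left cinner_add_left sum.distrib)
qed

context
  fixes K :: "'n :: finite list \<Rightarrow> 'n list \<Rightarrow> ('h :: chilbert_space \<Rightarrow>\<^sub>L 'h)"
  assumes K: "kernel_positive K" "\<And>\<alpha> \<beta>. cbounded (K \<alpha> \<beta>)"
      "\<And>i j \<alpha> \<beta>. K (i # \<alpha>) (j # \<beta>) = (if i = j then K \<alpha> \<beta> else 0)"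
begin

lemma multi_toeplitz_value_positive':
  fixes p q :: "nat \<Rightarrow> nat \<Rightarrow> 'n list \<Rightarrow> complex"
  assumes pq: "\<And>i j. is_poly (p i j)" "\<And>i j. is_poly (q i j)"
    and pos: "\<And>f :: nat \<Rightarrow> 'n fock. 0 \<le> Re (\<Sum>i<m. \<Sum>j<m.
      cinner ((adj (poly_op (q i j) left_creation) + poly_op (p i j) left_creation) (f j)) (f i))"
  shows "0 \<le> Re (\<Sum>i<m. \<Sum>j<m. cinner ((adj (poly_value (q i j) (K [])) + poly_value (p i j) (K [])) (h j)) (h i))"
proof -
  have cS: "cbounded (wprod left_creation \<alpha>)" for \<alpha> :: "'n list" by (simp add: cbounded_wprod)
  have "0 \<le> Re (\<Sum>i<m. \<Sum>j<m. cinner (poly_op (\<lambda>\<alpha>. p i j \<alpha> + q j i \<alpha>) left_creation (f j)) (f i))"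
    for f :: "nat \<Rightarrow> 'n fock"
    using pos[of f] unfolding poly_op_eq_value Re_symmetrized_form[OF cS pq] .
  then show ?thesis
    unfolding Re_symmetrized_form[OF K(2) pq]
    by (rule multi_toeplitz_value_positive[OF K is_poly_add[OF pq]])
qed

text \<open>The matrix with rows \<open>(t, -2g)\<close> and \<open>(0, t)\<close>, where \<open>t = \<parallel>g\<parallel>\<close>, has positive real part.\<close>

lemma multi_toeplitz_value_contractive:
  assumes K1: "K [] [] = id_blinfun" and pq: "is_poly p" "is_poly q"
  shows "norm (adj (poly_value q (K [])) + poly_value p (K []))
    \<le> norm (adj (poly_op q left_creation) + poly_op p left_creation)"
proof -
  define g where "g = adj (poly_op q left_creation) + poly_op p left_creation"
  define u where "u = adj (poly_value q (K [])) + poly_value p (K [])"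
  define t where "t = norm g"
  have t: "t \<ge> 0" by (simp add: t_def)
  define d where "d = (\<lambda>\<gamma> :: 'n list. if \<gamma> = [] then complex_of_real t else 0)"
  define p2 where "p2 = (\<lambda>\<alpha>. - 2 * p \<alpha>)"
  define q2 where "q2 = (\<lambda>\<alpha>. - 2 * q \<alpha>)"
  \<comment> \<open>The entries as pairs of polynomials: \<open>pp\<close> holds the analytic part
    and \<open>qq\<close> the part whose adjoint is taken.\<close>
  define pp where "pp i j = (if i = j then d else if i = (0 :: nat) then p2 else (\<lambda>_. 0))" for i j :: nat
  define qq where "qq i j = (if i = j then (\<lambda>_. 0) else if i = (0 :: nat) then q2 else (\<lambda>_. 0))" for i j :: nat
  have "is_poly p2" "is_poly q2" unfolding p2_def q2_def by (rule is_poly_scale[OF pq(1)] is_poly_scale[OF pq(2)])+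
  then have polys: "is_poly (pp i j)" "is_poly (qq i j)" for i j
    by (auto simp: pp_def qq_def d_def intro: is_poly_single is_poly_zero)
  have form: "Re (\<Sum>i<2. \<Sum>j<2. cinner ((adj (poly_value (qq i j) Y) + poly_value (pp i j) Y) (f j)) (f i))
      = t * (norm (f 0))\<^sup>2 + t * (norm (f 1))\<^sup>2 - 2 * Re (cinner ((adj (poly_value q Y) + poly_value p Y) (f 1)) (f 0))"
    if Y: "\<And>\<alpha>. cbounded (Y \<alpha>)" "Y [] = id_blinfun" for Y :: "'n list \<Rightarrow> ('b :: chilbert_space \<Rightarrow>\<^sub>L 'b)" and f
  proof -
    have "poly_value p2 Y = - (2 *\<^sub>R poly_value p Y)"
      "adj (poly_value q2 Y) = - (2 *\<^sub>R adj (poly_value q Y))"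
      unfolding p2_def q2_def using poly_value_scale[OF pq(1), of "-2" Y] poly_value_scale[OF pq(2), of "-2" Y]
      by (simp_all add: adj_compose cbounded_poly_value Y adj_scalar_op)
        (auto intro!: blinfun_eqI simp: scalar_op.rep_eq blinfun.minus_left blinfun.minus_right blinfun.scaleR_left scaleR_scaleC
          scaleC_minus_left cbounded_scaleC[OF cbounded_adj[OF cbounded_poly_value[OF Y(1)]]])
    moreover have "poly_value d Y = t *\<^sub>R id_blinfun"
      unfolding d_def poly_value_single Y(2)
      by (rule blinfun_eqI) (simp add: scalar_op.rep_eq blinfun.scaleR_left scaleR_scaleC)
    ultimately show ?thesis
      by (simp add: numeral_2_eq_2 pp_def qq_def poly_value_zero blinfun.add_left blinfun.minus_left
          blinfun.scaleR_left cinner_add_left cinner_minus_left cinner_scaleR_left cinner_self)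
  qed
  have cS: "cbounded (wprod left_creation \<alpha>)" for \<alpha> :: "'n list" by (simp add: cbounded_wprod)
  have main: "2 * Re (cinner (u y) x) \<le> t * ((norm x)\<^sup>2 + (norm y)\<^sup>2)" for x y
  proof -
    have "0 \<le> Re (\<Sum>i<2. \<Sum>j<2. cinner ((adj (poly_value (qq i j) (K [])) + poly_value (pp i j) (K []))
        (if j = 0 then x else y)) (if i = 0 then x else y))"
    proof (rule multi_toeplitz_value_positive'[OF polys])
      fix f :: "nat \<Rightarrow> 'n fock"
      have "Re (cinner (g (f 1)) (f 0)) \<le> norm (g (f 1)) * norm (f 0)"
        using norm_cinner_le complex_Re_le_cmod order_trans by blast
      also have "\<dots> \<le> (t * norm (f 1)) * norm (f 0)" unfolding t_def by (intro mult_right_mono norm_blinfun) simp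
      finally have "2 * Re (cinner (g (f 1)) (f 0)) \<le> t * (2 * norm (f 1) * norm (f 0))" by simp
      also have "\<dots> \<le> t * ((norm (f 1))\<^sup>2 + (norm (f 0))\<^sup>2)"
        by (intro mult_left_mono sum_squares_bound t)
      finally show "0 \<le> Re (\<Sum>i<2. \<Sum>j<2.
          cinner ((adj (poly_op (qq i j) left_creation) + poly_op (pp i j) left_creation) (f j)) (f i))"
        unfolding poly_op_eq_value by (subst form) (simp_all add: cS g_def poly_op_eq_value algebra_simps)
    qed
    then show ?thesis by (subst (asm) form) (simp_all add: K K1 u_def algebra_simps)
  qed
  have "norm u \<le> t"
  proof (rule norm_blinfun_bound[OF t])
    fix y
    show "norm (u y) \<le> t * norm y"
    proof (cases "t = 0")
      case True
      then have "(norm (u y))\<^sup>2 \<le> 0" using main[of y "u y"] by (simp add: cinner_self)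
      then show ?thesis using True by simp
    next
      case False
      then have tp: "t > 0" using t by simp
      \<comment> \<open>For fixed \<open>y\<close> the best test vector is \<open>u y\<close>
        divided by \<open>t\<close>; for \<open>t = 0\<close>, treated above, \<open>u y\<close>
        itself suffices.\<close>
      have "2 * (norm (u y))\<^sup>2 / t \<le> t * ((norm (u y))\<^sup>2 / t\<^sup>2 + (norm y)\<^sup>2)"
        using main[of y "(1 / t) *\<^sub>R u y"] tp
        by (simp add: cinner_scaleR_right cinner_self power_divide)
      moreover have "t * ((norm (u y))\<^sup>2 / t\<^sup>2 + (norm y)\<^sup>2) = (norm (u y))\<^sup>2 / t + t * (norm y)\<^sup>2"
        using tp by (simp add: power2_eq_square distrib_left)
      ultimately have "(norm (u y))\<^sup>2 / t \<le> t * (norm y)\<^sup>2" by simp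
      then have "(norm (u y))\<^sup>2 \<le> t * (norm y)\<^sup>2 * t" using tp by (simp add: pos_divide_le_eq)
      then have "(norm (u y))\<^sup>2 \<le> (t * norm y)\<^sup>2" by (simp add: power2_eq_square ac_simps)
      then show ?thesis by (rule power2_le_imp_le) (simp add: t)
    qed
  qed
  then show ?thesis by (simp add: u_def t_def g_def)
qed

end

subsection \<open>The maps \<open>\<phi>\<^sub>T\<close>\<close>

definition poly_sum :: "('n list \<Rightarrow> complex) \<Rightarrow> ('n list \<Rightarrow> complex) \<Rightarrow> ('n list \<Rightarrow> ('h :: chilbert_space \<Rightarrow>\<^sub>L 'h))
    \<Rightarrow> ('h \<Rightarrow>\<^sub>L 'h)" where
  "poly_sum q p Y = adj (poly_value q Y) + poly_value p Y"

definition disc_polys :: "('n fock \<Rightarrow>\<^sub>L 'n fock) set" where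
  "disc_polys = {poly_sum q p (wprod left_creation) | q p. is_poly q \<and> is_poly p}"

lemma is_poly_diff: "is_poly p \<Longrightarrow> is_poly q \<Longrightarrow> is_poly (\<lambda>\<alpha>. p \<alpha> - q \<alpha> :: complex)"
  unfolding is_poly_def by (rule finite_subset[of _ "{\<alpha>. p \<alpha> \<noteq> 0} \<union> {\<alpha>. q \<alpha> \<noteq> 0}"]) auto

lemma poly_value_diff:
  assumes "is_poly p" "is_poly q"
  shows "poly_value (\<lambda>\<alpha>. p \<alpha> - q \<alpha>) Y = poly_value p Y - poly_value q Y"
  using poly_value_add[OF is_poly_diff[OF assms] assms(2), of Y] by simp

lemma poly_sum_add:
  assumes "\<And>\<alpha>. cbounded (Y \<alpha>)" "is_poly q" "is_poly p" "is_poly q'" "is_poly p'"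
  shows "poly_sum (\<lambda>\<alpha>. q \<alpha> + q' \<alpha>) (\<lambda>\<alpha>. p \<alpha> + p' \<alpha>) Y = poly_sum q p Y + poly_sum q' p' Y"
  using assms by (simp add: poly_sum_def poly_value_add adj_add cbounded_poly_value)

lemma poly_sum_diff:
  assumes "\<And>\<alpha>. cbounded (Y \<alpha>)" "is_poly q" "is_poly p" "is_poly q'" "is_poly p'"
  shows "poly_sum (\<lambda>\<alpha>. q \<alpha> - q' \<alpha>) (\<lambda>\<alpha>. p \<alpha> - p' \<alpha>) Y = poly_sum q p Y - poly_sum q' p' Y"
  using assms by (simp add: poly_sum_def poly_value_diff adj_diff cbounded_poly_value)

lemma poly_sum_scale:
  assumes Y: "\<And>\<alpha>. cbounded (Y \<alpha>)" and "is_poly q" "is_poly p"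
  shows "poly_sum (\<lambda>\<alpha>. cnj a * q \<alpha>) (\<lambda>\<alpha>. a * p \<alpha>) Y = scalar_op a o\<^sub>L poly_sum q p Y"
proof -
  have "adj (poly_value q Y) o\<^sub>L scalar_op a = scalar_op a o\<^sub>L adj (poly_value q Y)"
    by (rule blinfun_eqI) (simp add: scalar_op.rep_eq cbounded_scaleC[OF cbounded_adj[OF cbounded_poly_value[OF Y]]])
  then show ?thesis
    using assms by (simp add: poly_sum_def poly_value_scale adj_compose cbounded_poly_value adj_scalar_op)
      (rule blinfun_eqI, simp add: blinfun.add_left blinfun.add_right)
qed

lemma cbounded_wprod_left_creation [simp]: "cbounded (wprod left_creation \<alpha>)"
  by (simp add: cbounded_wprod)

text \<open>The definition takes closures twice. Taking adjoints does not increase the norm, so sums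
  of polynomials and adjoints of polynomials are already dense. The limit \<open>f\<close> must
  first be seen to be complex linear, since only then does \<open>adj f\<close> mean the
  adjoint.\<close>

lemma disc_opspace_eq_closure: "disc_opspace = closure (disc_polys :: ('n fock \<Rightarrow>\<^sub>L 'n fock) set)"
proof
  show "closure disc_polys \<subseteq> (disc_opspace :: ('n fock \<Rightarrow>\<^sub>L 'n fock) set)"
    unfolding disc_opspace_def
  proof (rule closure_mono, rule subsetI)
    fix g :: "'n fock \<Rightarrow>\<^sub>L 'n fock" assume "g \<in> disc_polys"
    then obtain q p :: "'n list \<Rightarrow> complex" where g: "g = adj (poly_op q left_creation) + poly_op p left_creation" "is_poly q" "is_poly p"
      by (auto simp: disc_polys_def poly_sum_def poly_op_eq_value)
    have "poly_op q left_creation \<in> disc_algebra" "poly_op p left_creation \<in> disc_algebra"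
      unfolding disc_algebra_def by (rule subsetD[OF closure_subset]; use g(2,3) in blast)+
    with g(1) show "g \<in> {adj f + g | f g. f \<in> disc_algebra \<and> g \<in> disc_algebra}" by blast
  qed
  show "disc_opspace \<subseteq> closure (disc_polys :: ('n fock \<Rightarrow>\<^sub>L 'n fock) set)"
    unfolding disc_opspace_def
  proof (rule closure_minimal[OF _ closed_closure], rule subsetI)
    fix u :: "'n fock \<Rightarrow>\<^sub>L 'n fock" assume "u \<in> {adj f + g | f g. f \<in> disc_algebra \<and> g \<in> disc_algebra}"
    then obtain f g where u: "u = adj f + g" "f \<in> disc_algebra" "g \<in> disc_algebra" by blast
    obtain s where s: "\<forall>n. s n \<in> {poly_op p left_creation | p. is_poly p}" "s \<longlonglongrightarrow> f"
      using u(2) unfolding disc_algebra_def closure_sequential by blast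
    obtain t where t: "\<forall>n. t n \<in> {poly_op p left_creation | p. is_poly p}" "t \<longlonglongrightarrow> g"
      using u(3) unfolding disc_algebra_def closure_sequential by blast
    have cs: "cbounded (s n)" for n
      using s(1)[rule_format, of n] by (auto simp: poly_op_eq_value cbounded_poly_value)
    then have cf: "cbounded f" by (rule cbounded_limit[OF _ s(2)])
    have "(\<lambda>n. adj (s n) - adj f) \<longlonglongrightarrow> 0"
    proof (rule Lim_null_comparison)
      show "\<forall>\<^sub>F n in sequentially. norm (adj (s n) - adj f) \<le> norm (s n - f)"
        using norm_adj_le[of "s _ - f"] cs cf by (simp add: adj_diff)
      show "(\<lambda>n. norm (s n - f)) \<longlonglongrightarrow> 0" using s(2) by (simp add: LIM_zero_iff tendsto_norm_zero_iff)
    qed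
    then have "(\<lambda>n. adj (s n) + t n) \<longlonglongrightarrow> adj f + g" by (intro tendsto_add t(2)) (simp add: LIM_zero_iff)
    moreover have "adj (s n) + t n \<in> disc_polys" for n
    proof -
      obtain q p where qp: "s n = poly_op q left_creation" "is_poly q" "t n = poly_op p left_creation" "is_poly p"
        using s(1)[rule_format, of n] t(1)[rule_format, of n] by blast
      have "adj (s n) + t n = poly_sum q p (wprod left_creation)"
        by (simp add: qp poly_sum_def poly_op_eq_value)
      then show ?thesis using qp(2,4) unfolding disc_polys_def by blast
    qed
    ultimately show "u \<in> closure disc_polys" unfolding u(1) closure_sequential
      by (intro exI[of _ "\<lambda>n. adj (s n) + t n"]) blast
  qed
qed

text \<open>On polynomials the map attached to \<open>T\<close> is evaluation against the first row
  of the kernel. The correction term arises because the entry at the empty word is the identity and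
  not \<open>1 / \<rho>\<close> times it.\<close>

lemma poly_value_mt_kernel:
  assumes p: "is_poly p"
  shows "poly_value p (mt_kernel \<rho> T []) = (1 / \<rho>) *\<^sub>R poly_op p T + (1 - 1 / \<rho>) *\<^sub>R scalar_op (p [])"
proof (rule blinfun_eqI, rule cinner_ext)
  fix x y
  let ?S = "insert [] {\<alpha>. p \<alpha> \<noteq> 0}"
  have S: "finite ?S" "{\<alpha>. p \<alpha> \<noteq> 0} \<subseteq> ?S" using p by (auto simp: is_poly_def)
  have "cinner (poly_value p (mt_kernel \<rho> T []) x) y = (\<Sum>\<alpha>\<in>?S. p \<alpha> * cinner (mt_kernel \<rho> T [] \<alpha> x) y)"
    by (rule cinner_poly_value[OF S])
  also have "\<dots> = (\<Sum>\<alpha>\<in>?S. (1 / \<rho>) *\<^sub>R (p \<alpha> * cinner (wprod T \<alpha> x) y)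
      + (if \<alpha> = [] then (1 - 1 / \<rho>) *\<^sub>R (p [] * cinner x y) else 0))"
    by (intro sum.cong refl)
      (auto simp: mt_kernel_Nil_left blinfun.scaleR_left cinner_scaleR_left scaleR_diff_left)
  also have "\<dots> = (1 / \<rho>) *\<^sub>R (\<Sum>\<alpha>\<in>?S. p \<alpha> * cinner (wprod T \<alpha> x) y) + (1 - 1 / \<rho>) *\<^sub>R (p [] * cinner x y)"
    unfolding sum.distrib scaleR_sum_right[symmetric] using S(1) by (simp only: sum.delta insertI1 if_True)
  also have "\<dots> = cinner (((1 / \<rho>) *\<^sub>R poly_op p T + (1 - 1 / \<rho>) *\<^sub>R scalar_op (p [])) x) y"
    unfolding poly_op_eq_value cinner_poly_value[OF S, symmetric]
    by (simp add: blinfun.add_left blinfun.scaleR_left cinner_add_left cinner_scaleR_left scalar_op.rep_eq cinner_scaleC_left)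
  finally show "cinner (poly_value p (mt_kernel \<rho> T []) x) y
    = cinner (((1 / \<rho>) *\<^sub>R poly_op p T + (1 - 1 / \<rho>) *\<^sub>R scalar_op (p [])) x) y" .
qed

lemma scalar_op_add: "scalar_op (a + b) = scalar_op a + scalar_op b"
  by (rule blinfun_eqI) (simp add: scalar_op.rep_eq blinfun.add_left scaleC_add_left)

lemma poly_sum_mt_kernel:
  assumes T: "\<And>i. cbounded (T i)" and "is_poly q" "is_poly p"
  shows "poly_sum q p (mt_kernel \<rho> T []) = (1 / \<rho>) *\<^sub>R (adj (poly_op q T) + poly_op p T)
    + (1 - 1 / \<rho>) *\<^sub>R scalar_op (cnj (q []) + p [])"
proof -
  have "cbounded (poly_op q T)" by (simp add: poly_op_eq_value cbounded_poly_value cbounded_wprod T)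
  then show ?thesis
    using assms(2,3)
    by (simp add: poly_sum_def poly_value_mt_kernel adj_add adj_scaleR adj_scalar_op scalar_op_add scaleR_add_right)
qed

text \<open>The map is a definite description, so existence and uniqueness have to be established.
  Representations by \<open>q\<close> and \<open>p\<close> are not unique, as constants can be
  shifted between them; contractivity applied to differences makes the values independent of the
  choice and Lipschitz, hence extendable to the closure. Density gives uniqueness.\<close>

lemma phi_map_properties:
  fixes T :: "'n :: finite \<Rightarrow> ('h :: chilbert_space \<Rightarrow>\<^sub>L 'h)"
  assumes T: "\<And>i. cbounded (T i)" and pos: "kernel_positive (mt_kernel \<rho> T)"
  shows phi_map_continuous: "continuous_on disc_opspace (phi_map \<rho> T)"
    and phi_map_poly: "is_poly q \<Longrightarrow> is_poly p \<Longrightarrow>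
      phi_map \<rho> T (poly_sum q p (wprod left_creation)) = poly_sum q p (mt_kernel \<rho> T [])"
proof -
  let ?U = "\<lambda>q p. poly_sum q p (wprod left_creation) :: 'n fock \<Rightarrow>\<^sub>L 'n fock"
  let ?V = "\<lambda>q p. poly_sum q p (mt_kernel \<rho> T [])"
  have cK: "cbounded (mt_kernel \<rho> T \<alpha> \<beta>)" for \<alpha> \<beta> by (rule cbounded_mt_kernel[OF T])
  have lip: "norm (?V q p - ?V q' p') \<le> norm (?U q p - ?U q' p')"
    if "is_poly q" "is_poly p" "is_poly q'" "is_poly p'" for q p q' p'
  proof -
    have "norm (?V (\<lambda>\<alpha>. q \<alpha> - q' \<alpha>) (\<lambda>\<alpha>. p \<alpha> - p' \<alpha>)) \<le> norm (?U (\<lambda>\<alpha>. q \<alpha> - q' \<alpha>) (\<lambda>\<alpha>. p \<alpha> - p' \<alpha>))"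
      unfolding poly_sum_def poly_op_eq_value[symmetric]
      by (rule multi_toeplitz_value_contractive[OF pos cK mt_kernel_Cons])
        (simp_all add: mt_kernel_Nil_left is_poly_diff that)
    then show ?thesis using that by (simp add: poly_sum_diff cK)
  qed
  define f where "f g = (SOME v. \<exists>q p. is_poly q \<and> is_poly p \<and> g = ?U q p \<and> v = ?V q p)" for g
  have f: "f (?U q p) = ?V q p" if "is_poly q" "is_poly p" for q p
  proof -
    have "\<exists>v q' p'. is_poly q' \<and> is_poly p' \<and> ?U q p = ?U q' p' \<and> v = ?V q' p'" using that by blast
    from someI_ex[OF this] obtain q' p' where qp: "is_poly q'" "is_poly p'" "?U q p = ?U q' p'" "f (?U q p) = ?V q' p'"
      unfolding f_def by blast
    then show ?thesis using lip[OF that qp(1,2)] by simp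
  qed
  have "1-lipschitz_on disc_polys f"
  proof (rule lipschitz_onI)
    fix x y :: "'n fock \<Rightarrow>\<^sub>L 'n fock" assume "x \<in> disc_polys" "y \<in> disc_polys"
    then obtain q p q' p' where "x = ?U q p" "is_poly q" "is_poly p" "y = ?U q' p'" "is_poly q'" "is_poly p'"
      by (auto simp: disc_polys_def)
    then show "dist (f x) (f y) \<le> 1 * dist x y" using lip by (simp add: f dist_norm)
  qed simp
  then obtain g where g: "1-lipschitz_on disc_opspace g" "\<And>x. x \<in> disc_polys \<Longrightarrow> g x = f x"
    using lipschitz_extend_closure unfolding disc_opspace_eq_closure by blast
  have sub: "(disc_polys :: ('n fock \<Rightarrow>\<^sub>L 'n fock) set) \<subseteq> disc_opspace"
    unfolding disc_opspace_eq_closure by (rule closure_subset)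
  define \<phi> where "\<phi> x = (if x \<in> disc_opspace then g x else 0)" for x
  define Q where "Q \<phi> \<longleftrightarrow> continuous_on disc_opspace \<phi> \<and>
    (\<forall>p q. is_poly p \<longrightarrow> is_poly q \<longrightarrow>
      \<phi> (adj (poly_op q left_creation) + poly_op p left_creation) =
        (1 / \<rho>) *\<^sub>R (adj (poly_op q T) + poly_op p T) +
        (1 - 1 / \<rho>) *\<^sub>R scalar_op (cnj (q []) + p [])) \<and>
    (\<forall>g. g \<notin> disc_opspace \<longrightarrow> \<phi> g = 0)" for \<phi> :: "('n fock \<Rightarrow>\<^sub>L 'n fock) \<Rightarrow> ('h \<Rightarrow>\<^sub>L 'h)"
  have Uin: "?U q p \<in> disc_polys" if "is_poly q" "is_poly p" for q p using that by (auto simp: disc_polys_def)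
  have val: "\<phi>' (?U q p) = ?V q p" if "Q \<phi>'" "is_poly q" "is_poly p" for \<phi>' q p
    using that unfolding Q_def by (simp add: poly_sum_mt_kernel[OF T] poly_sum_def[of _ _ "wprod left_creation"] poly_op_eq_value[symmetric])
  have "Q \<phi>"
    unfolding Q_def
  proof (intro conjI allI impI)
    have "continuous_on disc_opspace g" by (rule lipschitz_on_continuous_on[OF g(1)])
    then show "continuous_on disc_opspace \<phi>" by (rule continuous_on_eq) (simp add: \<phi>_def)
    show "\<phi> x = 0" if "x \<notin> disc_opspace" for x using that by (simp add: \<phi>_def)
    fix p q :: "'n list \<Rightarrow> complex" assume pq: "is_poly p" "is_poly q"
    have "\<phi> (?U q p) = ?V q p" using Uin[OF pq(2,1)] sub g(2) f pq by (auto simp: \<phi>_def)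
    then show "\<phi> (adj (poly_op q left_creation) + poly_op p left_creation) =
        (1 / \<rho>) *\<^sub>R (adj (poly_op q T) + poly_op p T) + (1 - 1 / \<rho>) *\<^sub>R scalar_op (cnj (q []) + p [])"
      using pq by (simp add: poly_sum_mt_kernel[OF T] poly_sum_def[of _ _ "wprod left_creation"] poly_op_eq_value[symmetric])
  qed
  moreover have "\<phi>' = \<phi>" if Q': "Q \<phi>'" for \<phi>'
  proof
    fix x
    show "\<phi>' x = \<phi> x"
    proof (cases "x \<in> disc_opspace")
      case True
      then obtain s where s: "\<forall>n. s n \<in> disc_polys" "s \<longlonglongrightarrow> x"
        unfolding disc_opspace_eq_closure closure_sequential by blast
      have eq: "\<phi>' (s n) = \<phi> (s n)" for n
        using s(1)[rule_format, of n] val[OF Q'] val[OF \<open>Q \<phi>\<close>] by (auto simp: disc_polys_def)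
      have "(\<lambda>n. \<psi> (s n)) \<longlonglongrightarrow> \<psi> x" if "Q \<psi>" for \<psi>
      proof (rule continuous_on_tendsto_compose[of disc_opspace \<psi> s x, OF _ s(2) True])
        show "continuous_on disc_opspace \<psi>" using that by (simp add: Q_def)
        show "\<forall>\<^sub>F n in sequentially. s n \<in> disc_opspace" using s(1) sub by (intro always_eventually) blast
      qed
      from this[OF Q'] this[OF \<open>Q \<phi>\<close>] show ?thesis unfolding eq by (rule LIMSEQ_unique)
    next
      case False
      then show ?thesis using Q' \<open>Q \<phi>\<close> by (simp add: Q_def)
    qed
  qed
  ultimately have "Q (phi_map \<rho> T)"
    unfolding phi_map_def Q_def[symmetric] by (rule theI)
  then show "continuous_on disc_opspace (phi_map \<rho> T)"
    "is_poly q \<Longrightarrow> is_poly p \<Longrightarrow> phi_map \<rho> T (?U q p) = ?V q p"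
    using val by (simp_all add: Q_def)
qed

subsection \<open>Complete positivity\<close>

context
  fixes \<rho> c :: real and A B :: "'n :: finite \<Rightarrow> ('h :: chilbert_space \<Rightarrow>\<^sub>L 'h)"
  assumes cA: "\<And>i. cbounded (A i)" and cB: "\<And>i. cbounded (B i)"
    and posA: "kernel_positive (mt_kernel \<rho> A)" and posB: "kernel_positive (mt_kernel \<rho> B)"
begin

definition phi_diff :: "('n fock \<Rightarrow>\<^sub>L 'n fock) \<Rightarrow> ('h \<Rightarrow>\<^sub>L 'h)" where
  "phi_diff g = c\<^sup>2 *\<^sub>R phi_map \<rho> B g - phi_map \<rho> A g"

lemma cbounded_KD: "cbounded (kernel_diff \<rho> c A B \<alpha> \<beta>)"
  by (rule cbounded_kernel_diff[OF cA cB])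

lemma phi_diff_continuous: "continuous_on disc_opspace phi_diff"
  unfolding phi_diff_def
  by (intro continuous_intros phi_map_continuous[OF cA posA] phi_map_continuous[OF cB posB])

lemma phi_diff_poly:
  assumes qp: "is_poly q" "is_poly p"
  shows "phi_diff (poly_sum q p (wprod left_creation)) = poly_sum q p (kernel_diff \<rho> c A B [])"
proof -
  have val: "poly_value p (kernel_diff \<rho> c A B [])
      = c\<^sup>2 *\<^sub>R poly_value p (mt_kernel \<rho> B []) - poly_value p (mt_kernel \<rho> A [])" if p: "is_poly p" for p
  proof (rule blinfun_eqI, rule cinner_ext)
    fix x y
    have S: "finite {\<alpha>. p \<alpha> \<noteq> 0}" using p by (simp add: is_poly_def)
    show "cinner (poly_value p (kernel_diff \<rho> c A B []) x) y
        = cinner ((c\<^sup>2 *\<^sub>R poly_value p (mt_kernel \<rho> B []) - poly_value p (mt_kernel \<rho> A [])) x) y"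
      unfolding blinfun.diff_left blinfun.scaleR_left cinner_diff_left cinner_scaleR_left
        cinner_poly_value[OF S order_refl] cinner_kernel_diff
      by (simp add: right_diff_distrib sum_subtractf scaleR_sum_right)
  qed
  have "phi_diff (poly_sum q p (wprod left_creation))
      = c\<^sup>2 *\<^sub>R poly_sum q p (mt_kernel \<rho> B []) - poly_sum q p (mt_kernel \<rho> A [])"
    by (simp only: phi_diff_def phi_map_poly[OF cA posA qp] phi_map_poly[OF cB posB qp])
  then show ?thesis
    using qp by (simp add: poly_sum_def val adj_diff adj_scaleR cbounded_poly_value cbounded_mt_kernel cA cB scaleR_add_right)
qed

lemma phi_diff_approx:
  assumes "g \<in> disc_opspace"
  shows "\<exists>q p. (\<forall>n :: nat. is_poly (q n) \<and> is_poly (p n)) \<and>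
    (\<lambda>n. poly_sum (q n) (p n) (wprod left_creation)) \<longlonglongrightarrow> g \<and>
    (\<lambda>n. poly_sum (q n) (p n) (kernel_diff \<rho> c A B [])) \<longlonglongrightarrow> phi_diff g"
proof -
  obtain s where s: "\<forall>n. s n \<in> disc_polys" "s \<longlonglongrightarrow> g"
    using assms unfolding disc_opspace_eq_closure closure_sequential by blast
  have "\<forall>n. \<exists>q p. is_poly q \<and> is_poly p \<and> s n = poly_sum q p (wprod left_creation)"
    using s(1) unfolding disc_polys_def by blast
  then obtain q p where qp: "\<And>n. is_poly (q n)" "\<And>n. is_poly (p n)"
    "\<And>n. s n = poly_sum (q n) (p n) (wprod left_creation)" by metis
  have "(\<lambda>n. phi_diff (s n)) \<longlonglongrightarrow> phi_diff g"
  proof (rule continuous_on_tendsto_compose[OF phi_diff_continuous s(2) assms])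
    show "\<forall>\<^sub>F n in sequentially. s n \<in> disc_opspace"
      using s(1) closure_subset unfolding disc_opspace_eq_closure by (intro always_eventually) blast
  qed
  then have "(\<lambda>n. poly_sum (q n) (p n) (kernel_diff \<rho> c A B [])) \<longlonglongrightarrow> phi_diff g"
    by (simp add: qp phi_diff_poly)
  moreover have "(\<lambda>n. poly_sum (q n) (p n) (wprod left_creation)) \<longlonglongrightarrow> g" using s(2) by (simp add: qp(3)[symmetric])
  ultimately show ?thesis using qp by blast
qed

lemma phi_diff_limitI:
  assumes "\<And>n :: nat. is_poly (q n)" "\<And>n. is_poly (p n)" "(\<lambda>n. poly_sum (q n) (p n) (wprod left_creation)) \<longlonglongrightarrow> g"
    "(\<lambda>n. poly_sum (q n) (p n) (kernel_diff \<rho> c A B [])) \<longlonglongrightarrow> u"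
  shows "g \<in> disc_opspace" "phi_diff g = u"
proof -
  have s: "poly_sum (q n) (p n) (wprod left_creation) \<in> disc_polys" for n using assms by (auto simp: disc_polys_def)
  then show g: "g \<in> disc_opspace" unfolding disc_opspace_eq_closure closure_sequential
    using assms(3) by (intro exI[of _ "\<lambda>n. poly_sum (q n) (p n) (wprod left_creation)"]) blast
  have "(\<lambda>n. phi_diff (poly_sum (q n) (p n) (wprod left_creation))) \<longlonglongrightarrow> phi_diff g"
  proof (rule continuous_on_tendsto_compose[OF phi_diff_continuous assms(3) g])
    show "\<forall>\<^sub>F n in sequentially. poly_sum (q n) (p n) (wprod left_creation) \<in> disc_opspace"
      using s closure_subset unfolding disc_opspace_eq_closure by (intro always_eventually) blast
  qed
  then show "phi_diff g = u" using assms(4) by (simp add: phi_diff_poly assms(1,2) LIMSEQ_unique)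
qed

lemma phi_diff_add:
  assumes "f \<in> disc_opspace" "g \<in> disc_opspace"
  shows "phi_diff (f + g) = phi_diff f + phi_diff g"
proof -
  obtain q p where f: "\<And>n. is_poly (q n)" "\<And>n :: nat. is_poly (p n)"
    "(\<lambda>n. poly_sum (q n) (p n) (wprod left_creation)) \<longlonglongrightarrow> f"
    "(\<lambda>n. poly_sum (q n) (p n) (kernel_diff \<rho> c A B [])) \<longlonglongrightarrow> phi_diff f"
    using phi_diff_approx[OF assms(1)] by blast
  obtain q' p' where g: "\<And>n. is_poly (q' n)" "\<And>n :: nat. is_poly (p' n)"
    "(\<lambda>n. poly_sum (q' n) (p' n) (wprod left_creation)) \<longlonglongrightarrow> g"
    "(\<lambda>n. poly_sum (q' n) (p' n) (kernel_diff \<rho> c A B [])) \<longlonglongrightarrow> phi_diff g"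
    using phi_diff_approx[OF assms(2)] by blast
  show ?thesis
    by (rule phi_diff_limitI(2)[of "\<lambda>n \<alpha>. q n \<alpha> + q' n \<alpha>" "\<lambda>n \<alpha>. p n \<alpha> + p' n \<alpha>"])
      (simp_all add: is_poly_add f g poly_sum_add cbounded_KD tendsto_add)
qed

lemma phi_diff_scale:
  assumes "f \<in> disc_opspace"
  shows "scalar_op a o\<^sub>L f \<in> disc_opspace" "phi_diff (scalar_op a o\<^sub>L f) = scalar_op a o\<^sub>L phi_diff f"
proof -
  obtain q p where f: "\<And>n. is_poly (q n)" "\<And>n :: nat. is_poly (p n)"
    "(\<lambda>n. poly_sum (q n) (p n) (wprod left_creation)) \<longlonglongrightarrow> f"
    "(\<lambda>n. poly_sum (q n) (p n) (kernel_diff \<rho> c A B [])) \<longlonglongrightarrow> phi_diff f"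
    using phi_diff_approx[OF assms(1)] by blast
  note t = bounded_bilinear.tendsto[OF bounded_bilinear_blinfun_compose tendsto_const]
  note r = phi_diff_limitI[where q = "\<lambda>n \<alpha>. cnj a * q n \<alpha>" and p = "\<lambda>n \<alpha>. a * p n \<alpha>"
      and u = "scalar_op a o\<^sub>L phi_diff f"]
  show "scalar_op a o\<^sub>L f \<in> disc_opspace"
    by (rule r(1)) (simp_all add: is_poly_scale f poly_sum_scale cbounded_KD t)
  show "phi_diff (scalar_op a o\<^sub>L f) = scalar_op a o\<^sub>L phi_diff f"
    by (rule r(2)) (simp_all add: is_poly_scale f poly_sum_scale cbounded_KD t)
qed

text \<open>Polynomial approximants of a positive matrix need not be positive. Adding the
  approximation error times the identity restores positivity of the real part, and the added term
  disappears in the limit.\<close>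

lemma phi_diff_Re_positive:
  fixes m :: nat
  assumes KD: "kernel_positive (kernel_diff \<rho> c A B)"
    and G: "\<And>i j. i < m \<Longrightarrow> j < m \<Longrightarrow> G i j \<in> disc_opspace"
    and pos: "\<And>f. 0 \<le> Re (\<Sum>i<m. \<Sum>j<m. cinner (G i j (f j)) (f i))"
  shows "0 \<le> Re (\<Sum>i<m. \<Sum>j<m. cinner (phi_diff (G i j) (h j)) (h i))"
proof -
  let ?K = "kernel_diff \<rho> c A B"
  \<comment> \<open>For indices outside the matrix nothing but polynomials is asked for, because the
    positivity lemma takes polynomials at all indices.\<close>
  define R where "R i j qp \<longleftrightarrow> (\<forall>n :: nat. is_poly (fst qp n) \<and> is_poly (snd qp n)) \<and>
    (i < m \<longrightarrow> j < m \<longrightarrow> (\<lambda>n. poly_sum (fst qp n) (snd qp n) (wprod left_creation)) \<longlonglongrightarrow> G i j \<and>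
    (\<lambda>n. poly_sum (fst qp n) (snd qp n) (?K [])) \<longlonglongrightarrow> phi_diff (G i j))" for i j qp
  have "\<exists>qp. R i j qp" for i j
  proof (cases "i < m \<and> j < m")
    case True
    then obtain q p where "\<And>n. is_poly (q n)" "\<And>n. is_poly (p n)"
      "(\<lambda>n. poly_sum (q n) (p n) (wprod left_creation)) \<longlonglongrightarrow> G i j"
      "(\<lambda>n. poly_sum (q n) (p n) (?K [])) \<longlonglongrightarrow> phi_diff (G i j)"
      using phi_diff_approx[OF G[of i j]] by blast
    then show ?thesis unfolding R_def by (intro exI[of _ "(q, p)"]) simp
  next
    case False
    then show ?thesis unfolding R_def by (intro exI[of _ "(\<lambda>_ _. 0, \<lambda>_ _. 0)"]) (auto simp: is_poly_zero)
  qed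
  then obtain qp where R: "\<And>i j. R i j (qp i j)" by metis
  define q where "q i j = fst (qp i j)" for i j
  define p where "p i j = snd (qp i j)" for i j
  have qp: "is_poly (q i j n)" "is_poly (p i j n)" for i j n
    using R unfolding R_def q_def p_def by blast+
  have lim: "(\<lambda>n. poly_sum (q i j n) (p i j n) (wprod left_creation)) \<longlonglongrightarrow> G i j"
    "(\<lambda>n. poly_sum (q i j n) (p i j n) (?K [])) \<longlonglongrightarrow> phi_diff (G i j)" if "i < m" "j < m" for i j
    using R that unfolding R_def q_def p_def by blast+
  \<comment> \<open>The sum of the entrywise errors dominates the error of the matrix form, since
    the product of the norms of \<open>f i\<close> and \<open>f j\<close> is at most the sum
    \<open>F\<close> of all squared norms.\<close>
  define e where "e n = (\<Sum>i<m. \<Sum>j<m. norm (poly_sum (q i j n) (p i j n) (wprod left_creation) - G i j))" for n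
  have e: "e \<longlonglongrightarrow> 0"
  proof -
    have "e \<longlonglongrightarrow> (\<Sum>i<m. \<Sum>j<m. norm (G i j - G i j))"
      unfolding e_def by (intro tendsto_sum tendsto_norm tendsto_diff tendsto_const lim) auto
    then show ?thesis by simp
  qed
  define \<delta> where "\<delta> i j n = (\<lambda>\<gamma> :: 'n list. if i = j then if \<gamma> = [] then complex_of_real (e n) else 0 else 0)" for i j :: nat and n
  have \<delta>: "is_poly (\<delta> i j n)" for i j n by (cases "i = j") (simp_all add: \<delta>_def is_poly_single is_poly_zero)
  have form: "Re (\<Sum>i<m. \<Sum>j<m. cinner ((adj (poly_value (q i j n) Y) + poly_value (\<lambda>\<alpha>. p i j n \<alpha> + \<delta> i j n \<alpha>) Y) (f j)) (f i))
      = Re (\<Sum>i<m. \<Sum>j<m. cinner (poly_sum (q i j n) (p i j n) Y (f j)) (f i)) + e n * (\<Sum>i<m. Re (cinner (Y [] (f i)) (f i)))"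
    for n and Y :: "'n list \<Rightarrow> ('b :: chilbert_space \<Rightarrow>\<^sub>L 'b)" and f
  proof -
    have "cinner ((adj (poly_value (q i j n) Y) + poly_value (\<lambda>\<alpha>. p i j n \<alpha> + \<delta> i j n \<alpha>) Y) (f j)) (f i)
        = cinner (poly_sum (q i j n) (p i j n) Y (f j)) (f i)
          + (if i = j then complex_of_real (e n) * cinner (Y [] (f i)) (f i) else 0)" for i j
    proof -
      have "poly_value (\<delta> i j n) Y = (if i = j then scalar_op (complex_of_real (e n)) o\<^sub>L Y [] else 0)"
        by (cases "i = j") (simp_all add: \<delta>_def poly_value_single poly_value_zero)
      then show ?thesis
        by (simp add: poly_sum_def poly_value_add qp \<delta> blinfun.add_left cinner_add_left scalar_op.rep_eq cinner_scaleC_left)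
    qed
    then show ?thesis by (simp add: sum.distrib sum_distrib_left)
  qed
  have "0 \<le> Re (\<Sum>i<m. \<Sum>j<m. cinner (poly_sum (q i j n) (p i j n) (?K []) (h j)) (h i))
      + e n * (\<Sum>i<m. Re (cinner (?K [] [] (h i)) (h i)))" for n
    unfolding form[symmetric]
  proof (rule multi_toeplitz_value_positive'[OF KD cbounded_KD kernel_diff_Cons is_poly_add[OF qp(2) \<delta>] qp(1)])
    fix f :: "nat \<Rightarrow> 'n fock"
    define F where "F = (\<Sum>i<m. (norm (f i))\<^sup>2)"
    have "Re (cinner ((G i j - poly_sum (q i j n) (p i j n) (wprod left_creation)) (f j)) (f i))
        \<le> norm (poly_sum (q i j n) (p i j n) (wprod left_creation) - G i j) * F" if ij: "i < m" "j < m" for i j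
    proof -
      let ?D = "G i j - poly_sum (q i j n) (p i j n) (wprod left_creation)"
      have "Re (cinner (?D (f j)) (f i)) \<le> norm (?D (f j)) * norm (f i)"
        using norm_cinner_le complex_Re_le_cmod order_trans by blast
      also have "\<dots> \<le> (norm ?D * norm (f j)) * norm (f i)" by (intro mult_right_mono norm_blinfun) simp
      also have "\<dots> = norm ?D * (norm (f j) * norm (f i))" by (rule mult.assoc)
      also have "\<dots> \<le> norm ?D * F"
      proof (intro mult_left_mono norm_ge_zero)
        have "(norm (f i))\<^sup>2 \<le> F" "(norm (f j))\<^sup>2 \<le> F"
          unfolding F_def using ij by (auto intro!: member_le_sum)
        then show "norm (f j) * norm (f i) \<le> F" using sum_squares_bound[of "norm (f j)" "norm (f i)"] by simp
      qed
      finally show ?thesis by (simp add: norm_minus_commute)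
    qed
    then have "(\<Sum>i<m. \<Sum>j<m. Re (cinner ((G i j - poly_sum (q i j n) (p i j n) (wprod left_creation)) (f j)) (f i))) \<le> e n * F"
      unfolding e_def sum_distrib_right by (intro sum_mono) auto
    then have "Re (\<Sum>i<m. \<Sum>j<m. cinner (G i j (f j)) (f i))
        \<le> Re (\<Sum>i<m. \<Sum>j<m. cinner (poly_sum (q i j n) (p i j n) (wprod left_creation) (f j)) (f i)) + e n * F"
      by (simp add: blinfun.diff_left cinner_diff_left sum_subtractf)
    moreover have F: "(\<Sum>i<m. Re (cinner (wprod left_creation [] (f i)) (f i))) = F" by (simp add: F_def cinner_self)
    ultimately show "0 \<le> Re (\<Sum>i<m. \<Sum>j<m. cinner ((adj (poly_op (q i j n) left_creation)
        + poly_op (\<lambda>\<alpha>. p i j n \<alpha> + \<delta> i j n \<alpha>) left_creation) (f j)) (f i))"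
      using pos[of f] unfolding poly_op_eq_value form F by linarith
  qed
  moreover have "(\<lambda>n. Re (\<Sum>i<m. \<Sum>j<m. cinner (poly_sum (q i j n) (p i j n) (?K []) (h j)) (h i))
      + e n * (\<Sum>i<m. Re (cinner (?K [] [] (h i)) (h i))))
    \<longlonglongrightarrow> Re (\<Sum>i<m. \<Sum>j<m. cinner (phi_diff (G i j) (h j)) (h i)) + 0 * (\<Sum>i<m. Re (cinner (?K [] [] (h i)) (h i)))"
    by (intro tendsto_add tendsto_mult tendsto_Re tendsto_sum tendsto_cinner tendsto_const e tendsto_blinfun_apply lim) auto
  ultimately show ?thesis
    using tendsto_lowerbound[OF _ always_eventually trivial_limit_sequentially] by force
qed

lemma completely_positive_if_kernel_positive:
  assumes KD: "kernel_positive (kernel_diff \<rho> c A B)"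
  shows "completely_positive_on disc_opspace phi_diff"
  unfolding completely_positive_on_def
proof (intro conjI ballI allI impI)
  fix m :: nat and G :: "nat \<Rightarrow> nat \<Rightarrow> ('n fock \<Rightarrow>\<^sub>L 'n fock)"
  assume G: "\<forall>i<m. \<forall>j<m. G i j \<in> disc_opspace" and pos: "op_matrix_positive m G"
  have pos': "(\<Sum>i<m. \<Sum>j<m. cinner (G i j (f j)) (f i)) \<in> \<real>\<^sub>\<ge>\<^sub>0" for f
    using pos by (simp add: op_matrix_positive_def)
  \<comment> \<open>The previous lemma controls real parts only. As the form of \<open>G\<close> is
    real and nonnegative, it applies to \<open>a\<close> times \<open>G\<close> for \<open>a\<close>
    equal to 1, \<i> and -\<i>, which gives a nonnegative real part and a vanishing imaginary
    part.\<close>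
  have ge: "0 \<le> Re (a * (\<Sum>i<m. \<Sum>j<m. cinner (phi_diff (G i j) (h j)) (h i)))"
    if a: "\<And>r. 0 \<le> r \<Longrightarrow> 0 \<le> Re (a * complex_of_real r)" for a h
  proof -
    have "0 \<le> Re (\<Sum>i<m. \<Sum>j<m. cinner (phi_diff (scalar_op a o\<^sub>L G i j) (h j)) (h i))"
    proof (rule phi_diff_Re_positive[OF KD])
      fix f :: "nat \<Rightarrow> 'n fock"
      define z where "z = (\<Sum>i<m. \<Sum>j<m. cinner (G i j (f j)) (f i))"
      have "z = complex_of_real (Re z)" "0 \<le> Re z"
        using pos'[of f] by (auto simp: z_def complex_nonneg_Reals_iff complex_eq_iff)
      then have "0 \<le> Re (a * z)" using a[of "Re z"] by simp
      then show "0 \<le> Re (\<Sum>i<m. \<Sum>j<m. cinner ((scalar_op a o\<^sub>L G i j) (f j)) (f i))"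
        unfolding z_def sum_distrib_left by (simp add: scalar_op.rep_eq cinner_scaleC_left)
    qed (use G phi_diff_scale in blast)
    also have "(\<Sum>i<m. \<Sum>j<m. cinner (phi_diff (scalar_op a o\<^sub>L G i j) (h j)) (h i))
        = (\<Sum>i<m. \<Sum>j<m. a * cinner (phi_diff (G i j) (h j)) (h i))"
      using G by (intro sum.cong refl) (simp add: phi_diff_scale scalar_op.rep_eq cinner_scaleC_left)
    finally show ?thesis by (simp only: sum_distrib_left)
  qed
  show "op_matrix_positive m (\<lambda>i j. phi_diff (G i j))"
    unfolding op_matrix_positive_def complex_nonneg_Reals_iff
  proof
    fix h
    let ?w = "\<Sum>i<m. \<Sum>j<m. cinner (phi_diff (G i j) (h j)) (h i)"
    have "0 \<le> Re (1 * ?w)" "0 \<le> Re (\<i> * ?w)" "0 \<le> Re (- \<i> * ?w)" by (rule ge, simp)+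
    then show "0 \<le> Re ?w \<and> Im ?w = 0" by (simp del: Re_sum Im_sum)
  qed
qed (simp_all add: phi_diff_add phi_diff_scale)

text \<open>The kernel matrix of the left creation operators, with parameter 1, is a positive matrix
  over the operator space, and \<open>phi_diff\<close> carries it entry by entry to the matrix of
  the difference kernel.\<close>

lemma kernel_positive_if_completely_positive:
  assumes cp: "completely_positive_on disc_opspace phi_diff"
  shows "kernel_positive (kernel_diff \<rho> c A B)"
proof -
  define pk where "pk \<alpha> \<beta> = (\<lambda>\<gamma>. if \<beta> = \<alpha> @ \<gamma> then 1 else 0 :: complex)" for \<alpha> \<beta> :: "'n list"
  \<comment> \<open>The condition \<open>\<gamma> \<noteq> []\<close> keeps a diagonal entry from
    being counted in both polynomials.\<close>
  define qk where "qk \<alpha> \<beta> = (\<lambda>\<gamma>. if \<gamma> \<noteq> [] \<and> \<alpha> = \<beta> @ \<gamma> then 1 else 0 :: complex)" for \<alpha> \<beta> :: "'n list"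
  have poly: "is_poly (pk \<alpha> \<beta>)" "is_poly (qk \<alpha> \<beta>)" for \<alpha> \<beta>
    unfolding is_poly_def pk_def qk_def
    by (rule finite_subset[of _ "{drop (length \<alpha>) \<beta>, drop (length \<beta>) \<alpha>}"]; auto)+
  \<comment> \<open>The polynomials depend on the words only, so the same pair recovers the entry of
    every Hermitian kernel with the shift relation from its first row; it is used for the left
    creation operators and for the difference kernel.\<close>
  have rep: "poly_sum (qk \<alpha> \<beta>) (pk \<alpha> \<beta>) (K []) = K \<alpha> \<beta>"
    if K: "\<And>\<alpha> \<beta>. cbounded (K \<alpha> \<beta>)" "\<And>\<alpha> \<beta>. adj (K \<alpha> \<beta>) = K \<beta> \<alpha>"
      "\<And>i j \<alpha> \<beta>. K (i # \<alpha>) (j # \<beta>) = (if i = j then K \<alpha> \<beta> else 0)"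
    for K :: "'n list \<Rightarrow> 'n list \<Rightarrow> ('b :: chilbert_space \<Rightarrow>\<^sub>L 'b)" and \<alpha> \<beta>
  proof (induction \<alpha> arbitrary: \<beta>)
    case Nil
    have "pk [] \<beta> = (\<lambda>\<gamma>. if \<gamma> = \<beta> then 1 else 0)" "qk [] \<beta> = (\<lambda>_. 0)" by (auto simp: pk_def qk_def)
    then show ?case by (simp add: poly_sum_def poly_value_single poly_value_zero) (rule blinfun_eqI, simp)
  next
    case (Cons i \<alpha>)
    show ?case
    proof (cases \<beta>)
      case Nil
      have "pk (i # \<alpha>) [] = (\<lambda>_. 0)" "qk (i # \<alpha>) [] = (\<lambda>\<gamma>. if \<gamma> = i # \<alpha> then 1 else 0)"
        by (auto simp: pk_def qk_def)
      moreover have "id_blinfun o\<^sub>L K [] (i # \<alpha>) = K [] (i # \<alpha>)" by (rule blinfun_eqI) simp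
      ultimately show ?thesis by (simp add: Nil poly_sum_def poly_value_single poly_value_zero K)
    next
      case (Cons j \<beta>')
      have "pk (i # \<alpha>) (j # \<beta>') = (if i = j then pk \<alpha> \<beta>' else (\<lambda>_. 0))"
        "qk (i # \<alpha>) (j # \<beta>') = (if i = j then qk \<alpha> \<beta>' else (\<lambda>_. 0))"
        by (auto simp: pk_def qk_def)
      then show ?thesis using Cons.IH[of \<beta>'] by (simp add: Cons poly_sum_def poly_value_zero K)
    qed
  qed
  have SK: "mt_kernel 1 left_creation [] = wprod (left_creation :: 'n \<Rightarrow> _)"
    by (rule ext) (simp add: mt_kernel_Nil_left)
  have S: "poly_sum (qk \<alpha> \<beta>) (pk \<alpha> \<beta>) (wprod left_creation) = mt_kernel 1 left_creation \<alpha> \<beta>" for \<alpha> \<beta>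
    unfolding SK[symmetric] by (rule rep) (simp_all add: cbounded_mt_kernel adj_mt_kernel mt_kernel_Cons)
  have KD: "poly_sum (qk \<alpha> \<beta>) (pk \<alpha> \<beta>) (kernel_diff \<rho> c A B []) = kernel_diff \<rho> c A B \<alpha> \<beta>" for \<alpha> \<beta>
    by (rule rep) (simp_all add: cbounded_KD adj_kernel_diff cA cB kernel_diff_Cons)
  show ?thesis
    unfolding kernel_positive_def
  proof (intro allI)
    fix N :: nat and \<sigma> :: "nat \<Rightarrow> 'n list" and h :: "nat \<Rightarrow> 'h"
    define G where "G i j = (mt_kernel 1 left_creation (\<sigma> i) (\<sigma> j) :: 'n fock \<Rightarrow>\<^sub>L 'n fock)" for i j
    have "G i j \<in> disc_polys" for i j
      unfolding G_def S[symmetric] disc_polys_def using poly by blast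
    then have "G i j \<in> disc_opspace" for i j unfolding disc_opspace_eq_closure using closure_subset by blast
    moreover have "op_matrix_positive N G"
      unfolding op_matrix_positive_def G_def
      by (intro allI kernel_positiveD[OF kernel_positive_row_contraction[OF row_contraction_left_creation]]) simp
    ultimately have "op_matrix_positive N (\<lambda>i j. phi_diff (G i j))"
      using cp unfolding completely_positive_on_def by blast
    moreover have "phi_diff (G i j) = kernel_diff \<rho> c A B (\<sigma> i) (\<sigma> j)" for i j
      unfolding G_def S[symmetric] by (simp only: phi_diff_poly[OF poly(2,1)] KD)
    ultimately show "(\<Sum>i<N. \<Sum>j<N. cinner (kernel_diff \<rho> c A B (\<sigma> i) (\<sigma> j) (h j)) (h i)) \<in> \<real>\<^sub>\<ge>\<^sub>0"
      by (simp add: op_matrix_positive_def)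
  qed
qed

end

section \<open>The equivalence theorem\<close>

theorem theorem2p2:
  fixes A B :: "'n :: finite \<Rightarrow> ('h :: chilbert_space \<Rightarrow>\<^sub>L 'h)"
    and \<rho> c :: real
    and KA :: "'ga :: chilbert_space set" and JA :: "'h \<Rightarrow> 'ga" and V :: "'n \<Rightarrow> 'ga \<Rightarrow> 'ga"
    and KB :: "'gb :: chilbert_space set" and JB :: "'h \<Rightarrow> 'gb" and W :: "'n \<Rightarrow> 'gb \<Rightarrow> 'gb"
  assumes "\<rho> > 0" and "c > 0"
    and "class_C \<rho> A" and "class_C \<rho> B"
    and "minimal_isometric_dilation \<rho> A KA JA V"
    and "minimal_isometric_dilation \<rho> B KB JB W"
  shows "(harnack_dominated \<rho> c A B \<longleftrightarrow>
      (\<forall>r\<in>{0..<1}. op_le_on UNIV (P_rho \<rho> A r) (c\<^sup>2 *\<^sub>R P_rho \<rho> B r)))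
    \<and> (harnack_dominated \<rho> c A B \<longleftrightarrow>
      (\<forall>J F. positive_pluriharmonic J F \<longrightarrow> (\<forall>r\<in>{0..<1}.
        op_le_on (ell2_on J)
          (pluriharmonic_eval F (\<lambda>i. r *\<^sub>R A i) + (\<rho> - 1) *\<^sub>R pluriharmonic_eval F (\<lambda>_. 0))
          (c\<^sup>2 *\<^sub>R (pluriharmonic_eval F (\<lambda>i. r *\<^sub>R B i)
                    + (\<rho> - 1) *\<^sub>R pluriharmonic_eval F (\<lambda>_. 0))))))
    \<and> (harnack_dominated \<rho> c A B \<longleftrightarrow>
      kernel_positive (\<lambda>\<alpha> \<beta>. c\<^sup>2 *\<^sub>R mt_kernel \<rho> B \<alpha> \<beta> - mt_kernel \<rho> A \<alpha> \<beta>))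
    \<and> (harnack_dominated \<rho> c A B \<longleftrightarrow>
      completely_positive_on disc_opspace (\<lambda>g. c\<^sup>2 *\<^sub>R phi_map \<rho> B g - phi_map \<rho> A g))
    \<and> (harnack_dominated \<rho> c A B \<longleftrightarrow>
      (\<exists>L :: 'gb \<Rightarrow> 'ga. clinear_on KB L \<and> L ` KB \<subseteq> KA \<and>
        (\<forall>x\<in>KB. norm (L x) \<le> c * norm x) \<and>
        (\<forall>h. L (JB h) = JA h) \<and>
        (\<forall>i. \<forall>x\<in>KB. L (W i x) = V i (L x))))"
proof -
  note \<rho> = assms(1) and c = assms(2) and mA = assms(5) and mB = assms(6)
  have cA: "cbounded (A i)" and cB: "cbounded (B i)" for i
    using assms(3,4) unfolding class_C_def by blast+
  have dA: "isometric_dilation \<rho> A KA JA V" and dB: "isometric_dilation \<rho> B KB JB W"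
    using mA mB unfolding minimal_isometric_dilation_def by blast+
  have rA: "row_bounded (1 + \<rho>\<^sup>2) A" and rB: "row_bounded (1 + \<rho>\<^sup>2) B"
    unfolding row_bounded_def
    using dilation_row_bound[OF \<rho> cA dA] dilation_row_bound[OF \<rho> cB dB] cA cB by simp_all
  have pA: "kernel_positive (mt_kernel \<rho> A)" and pB: "kernel_positive (mt_kernel \<rho> B)"
    by (rule dilation_kernel_positive[OF \<rho> cA dA] dilation_kernel_positive[OF \<rho> cB dB])+
  let ?iii = "\<forall>J F. positive_pluriharmonic J F \<longrightarrow> (\<forall>r\<in>{0..<1}.
        op_le_on (ell2_on J)
          (pluriharmonic_eval F (\<lambda>i. r *\<^sub>R A i) + (\<rho> - 1) *\<^sub>R pluriharmonic_eval F (\<lambda>_. 0))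
          (c\<^sup>2 *\<^sub>R (pluriharmonic_eval F (\<lambda>i. r *\<^sub>R B i)
                    + (\<rho> - 1) *\<^sub>R pluriharmonic_eval F (\<lambda>_. 0))))"
  let ?iv = "kernel_positive (kernel_diff \<rho> c A B)"
  have kd: "kernel_diff \<rho> c A B = (\<lambda>\<alpha> \<beta>. c\<^sup>2 *\<^sub>R mt_kernel \<rho> B \<alpha> \<beta> - mt_kernel \<rho> A \<alpha> \<beta>)"
    by (intro ext) (rule kernel_diff_def)
  have iii: "?iii" if ?iv using pluriharmonic_dominated[OF \<rho> rA rB that] by simp
  have i: "harnack_dominated \<rho> c A B" if ?iii
    by (rule harnack_dominated_if_pluriharmonic_dominated[OF \<rho> rA rB that])
  have iv: ?iv if "harnack_dominated \<rho> c A B"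
    by (rule kernel_positive_if_harnack_dominated[OF \<rho> rA rB that])
  have ii: "(\<forall>r\<in>{0..<1}. op_le_on UNIV (P_rho \<rho> A r) (c\<^sup>2 *\<^sub>R P_rho \<rho> B r)) \<longleftrightarrow> ?iv"
    by (rule P_rho_dominated_iff_kernel_positive[OF \<rho> rA rB])
  have pd: "phi_diff \<rho> c A B = (\<lambda>g. c\<^sup>2 *\<^sub>R phi_map \<rho> B g - phi_map \<rho> A g)"
    by (rule ext) (rule phi_diff_def[OF cA cB pA pB])
  have v: "completely_positive_on disc_opspace (\<lambda>g. c\<^sup>2 *\<^sub>R phi_map \<rho> B g - phi_map \<rho> A g) \<longleftrightarrow> ?iv"
    using completely_positive_if_kernel_positive[OF cA cB pA pB, of c]
      kernel_positive_if_completely_positive[OF cA cB pA pB, of c] unfolding pd by blast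
  have vi: "(\<exists>L :: 'gb \<Rightarrow> 'ga. clinear_on KB L \<and> L ` KB \<subseteq> KA \<and>
        (\<forall>x\<in>KB. norm (L x) \<le> c * norm x) \<and>
        (\<forall>h. L (JB h) = JA h) \<and>
        (\<forall>i. \<forall>x\<in>KB. L (W i x) = V i (L x))) \<longleftrightarrow> ?iv" (is "?L \<longleftrightarrow> _")
  proof
    assume ?L
    then obtain L :: "'gb \<Rightarrow> 'ga" where "clinear_on KB L" "\<And>x. x \<in> KB \<Longrightarrow> norm (L x) \<le> c * norm x"
      "\<And>h. L (JB h) = JA h" "\<And>i x. x \<in> KB \<Longrightarrow> L (W i x) = V i (L x)" by blast
    then show ?iv by (rule kernel_positive_if_intertwiner[OF \<rho> c cA cB mA mB])
  qed (rule intertwiner_if_kernel_positive[OF \<rho> c cA cB mA mB])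
  \<comment> \<open>Conditions (ii), (v) and (vi) have been rewritten to (iv), and the rest is the
    cycle from (iv) to (iii), from (iii) to (i) and from (i) to (iv).\<close>
  show ?thesis unfolding kd[symmetric] ii v vi using i iii iv by blast
qed

end
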